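(* Let $k>2$ and let $g$ be an adapted metric on $(M;\mathcal D_1,\ldots,\mathcal D_k)$ such that all $\mathcal D_\mu$ are one-dimensional, pairwise mixed totally geodesic and pairwise mixed integrable. Then a pair $(g,\mathfrak T)$, where $\mathfrak T$ is the contorsion tensor of a statistical connection, is critical for the action $\bar J_{\mathcal D}$ with respect to adapted variations of $g$ preserving the volume of $(M,g)$ and all variations of $\mathfrak T$ if and only if $\mathfrak T=0$ and there exists a constant $\lambda$ such that for all $1\le\mu\le k$ $${\rm Ric}|_{\mathcal D_\mu\times\mathcal D_\mu}=-\frac{2\lambda}{k-2}\,g|_{\mathcal D_\mu\times\mathcal D_\mu}.$$
   Context: Setting. $M$ is a connected smooth manifold with $TM=\mathcal D_1+\ldots+\mathcal D_k$ a direct sum of subbundles (distributions). A pseudo-Riemannian metric $g=\langle\cdot,\cdot\rangle$ is adapted if all $\mathcal D_\mu$ are non-degenerate and pairwise orthogonal. $\{E_{\mu,a}\}$ are local orthonormal frames of $\mathcal D_\mu$; $\varepsilon=\pm1$ is the square of the corresponding frame vector. $\nabla$ is the Levi-Civita connection, ${\rm Ric}$ the Ricci tensor of $g$, $\bar\nabla=\nabla+\mathfrak T$ with contorsion $(1,2)$-tensor $\mathfrak T$. $\bar\nabla$ is statistical if $\langle\mathfrak T_XY,Z\rangle$ is totally symmetric. Mixed scalar curvature: with $\bar R_{X,Y}=[\bar\nabla_Y,\bar\nabla_X]+\bar\nabla_{[X,Y]}$, $\overline{\rm S}_{\mathcal D_1,\ldots,\mathcal D_k}=\frac12\sum_{\nu<\mu}\sum_{a,b}\varepsilon_a\varepsilon_b(\langle\bar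 R_{E_{\nu,a},E_{\mu,b}}E_{\nu,a},E_{\mu,b}\rangle+\langle\bar R_{E_{\mu,b},E_{\nu,a}}E_{\mu,b},E_{\nu,a}\rangle)$. The action is $\bar J_{\mathcal D}(g,\mathfrak T)=\int_M\overline{\rm S}_{\mathcal D_1,\ldots,\mathcal D_k}\,{\rm d\,vol}_g$ (over a relatively compact domain $\Omega$ containing the supports of variations if $M$ is non-compact; volume-preserving then refers to $\Omega$). Adapted variation: smooth family $g_t$ of adapted metrics, $g_0=g$, $\partial_tg_t$ supported in $\Omega$. Variation of $\mathfrak T$: smooth family of $(1,2)$-tensors $\mathfrak T_t$, $\mathfrak T_0=\mathfrak T$, $\partial_t\mathfrak T_t$ supported in $\Omega$. The pair is critical if the derivative of the action at $t=0$ vanishes for all (volume-preserving) adapted variations of $g$ with $\mathfrak T$ fixed and for all variations of $\mathfrak T$ with $g$ fixed. A pair $(\mathcal D_\mu,\mathcal D_\nu)$, $\mu\ne\nu$, is mixed totally geodesic (resp. mixed integrable) if the orthogonal projection of $\nabla_XY+\nabla_YX$ (resp. $[X,Y]$) onto $(\mathcal D_\mu\oplus\mathcal D_\nu)^\bot$ vanishes for all $X\in\mathcal D_\mu$, $Y\in\mathcal D_\nu$. *)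

theory Defs
  imports "HOL-Analysis.Analysis"
begin

section \<open>Smooth maps between Euclidean spaces\<close>

text \<open>All uses are on open sets \<open>S\<close>, where \<open>at x\<close> and \<open>at x within S\<close> agree.\<close>

primrec Ck_on :: "nat \<Rightarrow> ('a::real_normed_vector \<Rightarrow> 'b::real_normed_vector) \<Rightarrow> 'a set \<Rightarrow> bool" where
  "Ck_on 0 f S \<longleftrightarrow> continuous_on S f"
| "Ck_on (Suc m) f S \<longleftrightarrow>
     f differentiable_on S \<and> (\<forall>v. Ck_on m (\<lambda>x. frechet_derivative f (at x) v) S)"

definition smooth_on :: "('a::real_normed_vector \<Rightarrow> 'b::real_normed_vector) \<Rightarrow> 'a set \<Rightarrow> bool" where
  "smooth_on f S \<longleftrightarrow> (\<forall>m. Ck_on m f S)"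


section \<open>Smooth manifolds\<close>

text \<open>
  The manifold is the whole type \<open>'m\<close>; its smooth structure is the one generated by an atlas
  \<open>A\<close> of charts (domain, coordinate map) with values in \<open>real^'n\<close>, so its dimension
  is \<open>CARD('n)\<close>.
\<close>

type_synonym ('m, 'n) chart = "'m set \<times> ('m \<Rightarrow> real^'n)"

definition chart_inv :: "('m, 'n::finite) chart \<Rightarrow> real^'n \<Rightarrow> 'm" where
  "chart_inv c = inv_into (fst c) (snd c)"

definition smooth_atlas :: "('m::topological_space, 'n::finite) chart set \<Rightarrow> bool" where
  "smooth_atlas A \<longleftrightarrow>
     (\<forall>c\<in>A. open (fst c) \<and> open (snd c ` fst c) \<and>
        homeomorphism (fst c) (snd c ` fst c) (snd c) (chart_inv c)) \<and>
     (\<Union>c\<in>A. fst c) = UNIV \<and>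
     (\<forall>c\<in>A. \<forall>d\<in>A. smooth_on (snd d \<circ> chart_inv c) (snd c ` (fst c \<inter> fst d)))"

definition connected_smooth_manifold ::
    "('m::{t2_space,second_countable_topology}, 'n::finite) chart set \<Rightarrow> bool" where
  "connected_smooth_manifold A \<longleftrightarrow> smooth_atlas A \<and> connected (UNIV :: 'm set)"

definition smooth_fun_on ::
    "('m, 'n::finite) chart set \<Rightarrow> 'm set \<Rightarrow> ('m \<Rightarrow> real) \<Rightarrow> bool" where
  "smooth_fun_on A W f \<longleftrightarrow> (\<forall>c\<in>A. smooth_on (f \<circ> chart_inv c) (snd c ` (fst c \<inter> W)))"


section \<open>Tangent vectors and vector fields\<close>

text \<open>
  Every tangent space is modelled on \<open>real^'n\<close>: a tangent vector at \<open>p\<close> is given by its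
  coordinates in a chart \<open>chart_at A p\<close> that is chosen once and for all for each \<open>p\<close>.
  The map \<open>to_coord A c p\<close> converts a tangent vector at \<open>p\<close> to its coordinates in
  the chart \<open>c\<close>, and \<open>of_coord A c p\<close> converts back.
\<close>

definition chart_at :: "('m, 'n::finite) chart set \<Rightarrow> 'm \<Rightarrow> ('m, 'n) chart" where
  "chart_at A p = (SOME c. c \<in> A \<and> p \<in> fst c)"

definition to_coord ::
    "('m, 'n::finite) chart set \<Rightarrow> ('m, 'n) chart \<Rightarrow> 'm \<Rightarrow> real^'n \<Rightarrow> real^'n" where
  "to_coord A c p =
     frechet_derivative (snd c \<circ> chart_inv (chart_at A p)) (at (snd (chart_at A p) p))"

definition of_coord ::
    "('m, 'n::finite) chart set \<Rightarrow> ('m, 'n) chart \<Rightarrow> 'm \<Rightarrow> real^'n \<Rightarrow> real^'n" where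
  "of_coord A c p = frechet_derivative (snd (chart_at A p) \<circ> chart_inv c) (at (snd c p))"

definition coord_field ::
    "('m, 'n::finite) chart set \<Rightarrow> ('m, 'n) chart \<Rightarrow> 'n \<Rightarrow> 'm \<Rightarrow> real^'n" where
  "coord_field A c i p = of_coord A c p (axis i 1)"

type_synonym ('m, 'n) vfield = "'m \<Rightarrow> real^'n"

definition vf_rep ::
    "('m, 'n::finite) chart set \<Rightarrow> ('m, 'n) chart \<Rightarrow> ('m, 'n) vfield \<Rightarrow> real^'n \<Rightarrow> real^'n" where
  "vf_rep A c X x = to_coord A c (chart_inv c x) (X (chart_inv c x))"

definition smooth_vf_on ::
    "('m, 'n::finite) chart set \<Rightarrow> 'm set \<Rightarrow> ('m, 'n) vfield \<Rightarrow> bool" where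
  "smooth_vf_on A W X \<longleftrightarrow> (\<forall>c\<in>A. smooth_on (vf_rep A c X) (snd c ` (fst c \<inter> W)))"

definition vf_apply ::
    "('m, 'n::finite) chart set \<Rightarrow> ('m, 'n) vfield \<Rightarrow> ('m \<Rightarrow> real) \<Rightarrow> 'm \<Rightarrow> real" where
  "vf_apply A X f p =
     frechet_derivative (f \<circ> chart_inv (chart_at A p)) (at (snd (chart_at A p) p)) (X p)"

definition lie_bracket ::
    "('m, 'n::finite) chart set \<Rightarrow> ('m, 'n) vfield \<Rightarrow> ('m, 'n) vfield \<Rightarrow> ('m, 'n) vfield" where
  "lie_bracket A X Y p =
     (let c = chart_at A p; x = snd c p in
        frechet_derivative (vf_rep A c Y) (at x) (X p) -
        frechet_derivative (vf_rep A c X) (at x) (Y p))"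


section \<open>Tensor fields\<close>

type_synonym ('m, 'n) bilin_field = "'m \<Rightarrow> real^'n \<Rightarrow> real^'n \<Rightarrow> real"
type_synonym ('m, 'n) tensor12_field = "'m \<Rightarrow> real^'n \<Rightarrow> real^'n \<Rightarrow> real^'n"

definition bilin_comp ::
    "('m, 'n::finite) chart set \<Rightarrow> ('m, 'n) chart \<Rightarrow> ('m, 'n) bilin_field \<Rightarrow> real^'n \<Rightarrow> real^'n^'n" where
  "bilin_comp A c g x =
     (let p = chart_inv c x in \<chi> i j. g p (coord_field A c i p) (coord_field A c j p))"

definition tensor12_comp ::
    "('m, 'n::finite) chart set \<Rightarrow> ('m, 'n) chart \<Rightarrow> ('m, 'n) tensor12_field \<Rightarrow>
      real^'n \<Rightarrow> 'n \<Rightarrow> 'n \<Rightarrow> real^'n" where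
  "tensor12_comp A c T x i j =
     (let p = chart_inv c x in
        to_coord A c p (T p (coord_field A c i p) (coord_field A c j p)))"

definition pseudo_riemannian_metric ::
    "('m, 'n::finite) chart set \<Rightarrow> ('m, 'n) bilin_field \<Rightarrow> bool" where
  "pseudo_riemannian_metric A g \<longleftrightarrow>
     (\<forall>p. bilinear (g p) \<and> (\<forall>u v. g p u v = g p v u) \<and>
          (\<forall>u. (\<forall>v. g p u v = 0) \<longrightarrow> u = 0)) \<and>
     (\<forall>c\<in>A. smooth_on (bilin_comp A c g) (snd c ` fst c))"

definition smooth_tensor12 ::
    "('m, 'n::finite) chart set \<Rightarrow> ('m, 'n) tensor12_field \<Rightarrow> bool" where
  "smooth_tensor12 A T \<longleftrightarrow>
     (\<forall>p. bilinear (T p)) \<and>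
     (\<forall>c\<in>A. \<forall>i j. smooth_on (\<lambda>x. tensor12_comp A c T x i j) (snd c ` fst c))"


section \<open>Connections and curvature\<close>

type_synonym ('m, 'n) connection = "('m, 'n) vfield \<Rightarrow> ('m, 'n) vfield \<Rightarrow> ('m, 'n) vfield"

text \<open>
  A connection acts on vector fields that are smooth on some open set \<open>W\<close>; only its values
  on \<open>W\<close> are constrained. Locality needs no separate axiom: a field vanishing on \<open>W\<close> equals
  \<open>f\<close> times itself, for \<open>f\<close> the indicator function of the complement of \<open>W\<close>, which
  is smooth on \<open>W\<close>.
\<close>

definition affine_connection ::
    "('m::topological_space, 'n::finite) chart set \<Rightarrow> ('m, 'n) connection \<Rightarrow> bool" where
  "affine_connection A N \<longleftrightarrow>
     (\<forall>W X X' Y Y' f. open W \<and> smooth_vf_on A W X \<and> smooth_vf_on A W X' \<and>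
        smooth_vf_on A W Y \<and> smooth_vf_on A W Y' \<and> smooth_fun_on A W f \<longrightarrow>
        smooth_vf_on A W (N X Y) \<and>
        (\<forall>p\<in>W.
          N (\<lambda>q. X q + X' q) Y p = N X Y p + N X' Y p \<and>
          N (\<lambda>q. f q *\<^sub>R X q) Y p = f p *\<^sub>R N X Y p \<and>
          N X (\<lambda>q. Y q + Y' q) p = N X Y p + N X Y' p \<and>
          N X (\<lambda>q. f q *\<^sub>R Y q) p = vf_apply A X f p *\<^sub>R Y p + f p *\<^sub>R N X Y p))"

definition torsion_free ::
    "('m::topological_space, 'n::finite) chart set \<Rightarrow> ('m, 'n) connection \<Rightarrow> bool" where
  "torsion_free A N \<longleftrightarrow>
     (\<forall>W X Y. open W \<and> smooth_vf_on A W X \<and> smooth_vf_on A W Y \<longrightarrow>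
        (\<forall>p\<in>W. N X Y p - N Y X p = lie_bracket A X Y p))"

definition metric_connection ::
    "('m::topological_space, 'n::finite) chart set \<Rightarrow> ('m, 'n) bilin_field \<Rightarrow>
      ('m, 'n) connection \<Rightarrow> bool" where
  "metric_connection A g N \<longleftrightarrow>
     (\<forall>W X Y Z. open W \<and> smooth_vf_on A W X \<and> smooth_vf_on A W Y \<and> smooth_vf_on A W Z \<longrightarrow>
        (\<forall>p\<in>W. vf_apply A X (\<lambda>q. g q (Y q) (Z q)) p =
           g p (N X Y p) (Z p) + g p (Y p) (N X Z p)))"

text \<open>
  \<open>SOME\<close> rather than \<open>THE\<close>: uniqueness holds only for the values on smooth fields, and
  nothing below depends on the other values.
\<close>

definition levi_civita ::
    "('m::topological_space, 'n::finite) chart set \<Rightarrow> ('m, 'n) bilin_field \<Rightarrow> ('m, 'n) connection" where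
  "levi_civita A g =
     (SOME N. affine_connection A N \<and> torsion_free A N \<and> metric_connection A g N)"

definition contorted_connection ::
    "('m::topological_space, 'n::finite) chart set \<Rightarrow> ('m, 'n) bilin_field \<Rightarrow>
      ('m, 'n) tensor12_field \<Rightarrow> ('m, 'n) connection" where
  "contorted_connection A g T X Y p = levi_civita A g X Y p + T p (X p) (Y p)"

definition statistical ::
    "('m, 'n::finite) bilin_field \<Rightarrow> ('m, 'n) tensor12_field \<Rightarrow> bool" where
  "statistical g T \<longleftrightarrow>
     (\<forall>p x y z. g p (T p x y) z = g p (T p y x) z \<and> g p (T p x y) z = g p (T p x z) y)"

text \<open>Sign convention: \<open>R\<^bsub>X,Y\<^esub> = [\<nabla>\<^sub>Y, \<nabla>\<^sub>X] + \<nabla>\<^bsub>[X,Y]\<^esub>\<close>.\<close>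

definition curvature ::
    "('m, 'n::finite) chart set \<Rightarrow> ('m, 'n) connection \<Rightarrow>
      ('m, 'n) vfield \<Rightarrow> ('m, 'n) vfield \<Rightarrow> ('m, 'n) vfield \<Rightarrow> ('m, 'n) vfield" where
  "curvature A N X Y Z p =
     N Y (N X Z) p - N X (N Y Z) p + N (lie_bracket A X Y) Z p"

text \<open>
  The Ricci tensor is the trace of \<open>z \<mapsto> R\<^bsub>u,z\<^esub> v\<close>; with the above sign of \<open>R\<close> it is positive
  on round spheres. Tangent vectors at \<open>p\<close> are extended to vector fields with
  constant coordinates in \<open>chart_at A p\<close>, which is harmless since \<open>R\<close> is tensorial.
\<close>

definition extend_vec ::
    "('m, 'n::finite) chart set \<Rightarrow> 'm \<Rightarrow> real^'n \<Rightarrow> ('m, 'n) vfield" where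
  "extend_vec A p u q = of_coord A (chart_at A p) q u"

definition ricci ::
    "('m::topological_space, 'n::finite) chart set \<Rightarrow> ('m, 'n) bilin_field \<Rightarrow> ('m, 'n) bilin_field" where
  "ricci A g p u v =
     (\<Sum>i\<in>UNIV. curvature A (levi_civita A g)
        (extend_vec A p u) (extend_vec A p (axis i 1)) (extend_vec A p v) p $ i)"


section \<open>Almost product structures\<close>

type_synonym ('m, 'n) distrib = "'m \<Rightarrow> (real^'n) set"

definition distribution ::
    "('m::topological_space, 'n::finite) chart set \<Rightarrow> ('m, 'n) distrib \<Rightarrow> bool" where
  "distribution A D \<longleftrightarrow>
     (\<exists>r::nat. \<forall>p. \<exists>W X. open W \<and> p \<in> W \<and> (\<forall>a\<in>{1..r}. smooth_vf_on A W (X a)) \<and>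
        (\<forall>q\<in>W. D q = span ((\<lambda>a. X a q) ` {1..r}) \<and> dim (D q) = r))"

definition almost_product ::
    "('m::topological_space, 'n::finite) chart set \<Rightarrow> nat \<Rightarrow> (nat \<Rightarrow> ('m, 'n) distrib) \<Rightarrow> bool" where
  "almost_product A k D \<longleftrightarrow>
     (\<forall>\<mu>\<in>{1..k}. distribution A (D \<mu>)) \<and>
     (\<forall>p v. \<exists>!w. w \<in> (\<Pi>\<^sub>E \<mu>\<in>{1..k}. D \<mu> p) \<and> v = (\<Sum>\<mu>\<in>{1..k}. w \<mu>))"

definition adapted_metric ::
    "('m, 'n::finite) chart set \<Rightarrow> nat \<Rightarrow> (nat \<Rightarrow> ('m, 'n) distrib) \<Rightarrow> ('m, 'n) bilin_field \<Rightarrow> bool" where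
  "adapted_metric A k D g \<longleftrightarrow> pseudo_riemannian_metric A g \<and>
     (\<forall>p. \<forall>\<mu>\<in>{1..k}. \<forall>u\<in>D \<mu> p. (\<forall>v\<in>D \<mu> p. g p u v = 0) \<longrightarrow> u = 0) \<and>
     (\<forall>p. \<forall>\<mu>\<in>{1..k}. \<forall>\<nu>\<in>{1..k}. \<mu> \<noteq> \<nu> \<longrightarrow> (\<forall>u\<in>D \<mu> p. \<forall>v\<in>D \<nu> p. g p u v = 0))"

definition orth_complement :: "(real^'n \<Rightarrow> real^'n \<Rightarrow> real) \<Rightarrow> (real^'n) set \<Rightarrow> (real^'n) set" where
  "orth_complement b S = {w. \<forall>s\<in>S. b w s = 0}"

text \<open>Well-defined only if \<open>b\<close> is non-degenerate on the subspace \<open>S\<close>.\<close>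

definition orth_proj :: "(real^'n \<Rightarrow> real^'n \<Rightarrow> real) \<Rightarrow> (real^'n) set \<Rightarrow> real^'n \<Rightarrow> real^'n" where
  "orth_proj b S v = (THE w. w \<in> S \<and> (\<forall>s\<in>S. b (v - w) s = 0))"

definition section_on ::
    "('m, 'n::finite) chart set \<Rightarrow> 'm set \<Rightarrow> ('m, 'n) distrib \<Rightarrow> ('m, 'n) vfield \<Rightarrow> bool" where
  "section_on A W D X \<longleftrightarrow> smooth_vf_on A W X \<and> (\<forall>q\<in>W. X q \<in> D q)"

definition mixed_totally_geodesic ::
    "('m::topological_space, 'n::finite) chart set \<Rightarrow> ('m, 'n) bilin_field \<Rightarrow>
      ('m, 'n) distrib \<Rightarrow> ('m, 'n) distrib \<Rightarrow> bool" where
  "mixed_totally_geodesic A g D1 D2 \<longleftrightarrow>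
     (\<forall>W X Y. open W \<and> section_on A W D1 X \<and> section_on A W D2 Y \<longrightarrow>
        (\<forall>p\<in>W. orth_proj (g p) (orth_complement (g p) {u + v | u v. u \<in> D1 p \<and> v \<in> D2 p})
           (levi_civita A g X Y p + levi_civita A g Y X p) = 0))"

definition mixed_integrable ::
    "('m::topological_space, 'n::finite) chart set \<Rightarrow> ('m, 'n) bilin_field \<Rightarrow>
      ('m, 'n) distrib \<Rightarrow> ('m, 'n) distrib \<Rightarrow> bool" where
  "mixed_integrable A g D1 D2 \<longleftrightarrow>
     (\<forall>W X Y. open W \<and> section_on A W D1 X \<and> section_on A W D2 Y \<longrightarrow>
        (\<forall>p\<in>W. orth_proj (g p) (orth_complement (g p) {u + v | u v. u \<in> D1 p \<and> v \<in> D2 p})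
           (lie_bracket A X Y p) = 0))"


section \<open>Mixed scalar curvature\<close>

definition adapted_frame ::
    "('m::topological_space, 'n::finite) chart set \<Rightarrow> nat \<Rightarrow> (nat \<Rightarrow> ('m, 'n) distrib) \<Rightarrow>
      ('m, 'n) bilin_field \<Rightarrow> 'm \<Rightarrow> (nat \<Rightarrow> nat \<Rightarrow> ('m, 'n) vfield) \<Rightarrow> bool" where
  "adapted_frame A k D g p E \<longleftrightarrow>
     (\<exists>W. open W \<and> p \<in> W \<and>
        (\<forall>\<mu>\<in>{1..k}. \<forall>a\<in>{1..dim (D \<mu> p)}. section_on A W (D \<mu>) (E \<mu> a) \<and>
           (\<forall>q\<in>W. g q (E \<mu> a q) (E \<mu> a q) \<in> {1, -1} \<and>
              (\<forall>b\<in>{1..dim (D \<mu> p)}. a \<noteq> b \<longrightarrow> g q (E \<mu> a q) (E \<mu> b q) = 0))))"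

text \<open>The value does not depend on the chosen local adapted orthonormal frame.\<close>

definition mixed_scalar_curvature ::
    "('m::topological_space, 'n::finite) chart set \<Rightarrow> nat \<Rightarrow> (nat \<Rightarrow> ('m, 'n) distrib) \<Rightarrow>
      ('m, 'n) bilin_field \<Rightarrow> ('m, 'n) tensor12_field \<Rightarrow> 'm \<Rightarrow> real" where
  "mixed_scalar_curvature A k D g T p =
     (let E = (SOME E. adapted_frame A k D g p E);
          \<epsilon> = (\<lambda>\<mu> a. g p (E \<mu> a p) (E \<mu> a p));
          R = curvature A (contorted_connection A g T)
      in 1/2 * (\<Sum>\<mu>\<in>{1..k}. \<Sum>\<nu>\<in>{1..<\<mu>}. \<Sum>a\<in>{1..dim (D \<nu> p)}. \<Sum>b\<in>{1..dim (D \<mu> p)}.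
           \<epsilon> \<nu> a * \<epsilon> \<mu> b *
             (g p (R (E \<nu> a) (E \<mu> b) (E \<nu> a) p) (E \<mu> b p) +
              g p (R (E \<mu> b) (E \<nu> a) (E \<mu> b) p) (E \<nu> a p))))"


section \<open>Volume and the action\<close>

definition volume_measure ::
    "('m::topological_space, 'n::finite) chart set \<Rightarrow> ('m, 'n) bilin_field \<Rightarrow> 'm measure" where
  "volume_measure A g =
     (THE V. sets V = sets borel \<and>
        (\<forall>c\<in>A. \<forall>B\<in>sets borel. B \<subseteq> fst c \<longrightarrow>
           emeasure V B = (\<integral>\<^sup>+x\<in>snd c ` B. ennreal (sqrt \<bar>det (bilin_comp A c g x)\<bar>) \<partial>lborel)))"

definition action ::
    "('m::topological_space, 'n::finite) chart set \<Rightarrow> nat \<Rightarrow> (nat \<Rightarrow> ('m, 'n) distrib) \<Rightarrow>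
      'm set \<Rightarrow> ('m, 'n) bilin_field \<Rightarrow> ('m, 'n) tensor12_field \<Rightarrow> real" where
  "action A k D \<Omega> g T =
     (LINT p:\<Omega>|volume_measure A g. mixed_scalar_curvature A k D g T p)"

text \<open>
  On a compact manifold the action is taken over the whole manifold, otherwise over a
  relatively compact domain.
\<close>

definition action_domain :: "'m::topological_space set \<Rightarrow> bool" where
  "action_domain \<Omega> \<longleftrightarrow>
     (if compact (UNIV :: 'm set) then \<Omega> = UNIV
      else open \<Omega> \<and> connected \<Omega> \<and> compact (closure \<Omega>))"


section \<open>Variations and critical pairs\<close>

definition adapted_variation ::
    "('m::topological_space, 'n::finite) chart set \<Rightarrow> nat \<Rightarrow> (nat \<Rightarrow> ('m, 'n) distrib) \<Rightarrow>
      'm set \<Rightarrow> ('m, 'n) bilin_field \<Rightarrow> real \<Rightarrow> (real \<Rightarrow> ('m, 'n) bilin_field) \<Rightarrow> bool" where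
  "adapted_variation A k D \<Omega> g \<delta> G \<longleftrightarrow>
     0 < \<delta> \<and> G 0 = g \<and> (\<forall>t\<in>{-\<delta><..<\<delta>}. adapted_metric A k D (G t)) \<and>
     (\<forall>c\<in>A. smooth_on (\<lambda>(t, x). bilin_comp A c (G t) x) ({-\<delta><..<\<delta>} \<times> snd c ` fst c)) \<and>
     (\<forall>t\<in>{-\<delta><..<\<delta>}. closure {p. \<exists>u v. deriv (\<lambda>s. G s p u v) t \<noteq> 0} \<subseteq> \<Omega>)"

definition volume_preserving ::
    "('m::topological_space, 'n::finite) chart set \<Rightarrow> 'm set \<Rightarrow> real \<Rightarrow>
      (real \<Rightarrow> ('m, 'n) bilin_field) \<Rightarrow> bool" where
  "volume_preserving A \<Omega> \<delta> G \<longleftrightarrow>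
     (\<forall>t\<in>{-\<delta><..<\<delta>}. emeasure (volume_measure A (G t)) \<Omega> = emeasure (volume_measure A (G 0)) \<Omega>)"

definition contorsion_variation ::
    "('m::topological_space, 'n::finite) chart set \<Rightarrow> 'm set \<Rightarrow> ('m, 'n) tensor12_field \<Rightarrow>
      real \<Rightarrow> (real \<Rightarrow> ('m, 'n) tensor12_field) \<Rightarrow> bool" where
  "contorsion_variation A \<Omega> T \<delta> H \<longleftrightarrow>
     0 < \<delta> \<and> H 0 = T \<and> (\<forall>t\<in>{-\<delta><..<\<delta>}. smooth_tensor12 A (H t)) \<and>
     (\<forall>c\<in>A. \<forall>i j. smooth_on (\<lambda>(t, x). tensor12_comp A c (H t) x i j)
        ({-\<delta><..<\<delta>} \<times> snd c ` fst c)) \<and>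
     (\<forall>t\<in>{-\<delta><..<\<delta>}.
        closure {p. \<exists>u v. vector_derivative (\<lambda>s. H s p u v) (at t) \<noteq> 0} \<subseteq> \<Omega>)"

definition critical_pair ::
    "('m::topological_space, 'n::finite) chart set \<Rightarrow> nat \<Rightarrow> (nat \<Rightarrow> ('m, 'n) distrib) \<Rightarrow>
      ('m, 'n) bilin_field \<Rightarrow> ('m, 'n) tensor12_field \<Rightarrow> bool" where
  "critical_pair A k D g T \<longleftrightarrow>
     (\<forall>\<Omega>. action_domain \<Omega> \<longrightarrow>
        (\<forall>\<delta> G. adapted_variation A k D \<Omega> g \<delta> G \<and> volume_preserving A \<Omega> \<delta> G \<longrightarrow>
           ((\<lambda>t. action A k D \<Omega> (G t) T) has_real_derivative 0) (at 0)) \<and>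
        (\<forall>\<delta> H. contorsion_variation A \<Omega> T \<delta> H \<longrightarrow>
           ((\<lambda>t. action A k D \<Omega> g (H t)) has_real_derivative 0) (at 0)))"

end

theory Submission
 imports Defs
begin

text \<open>
 As all \<open>D \<mu>\<close> are lines, the mixed scalar curvature is half the full contraction of the Ricci tensor
 of the contorted connection, hence half of the scalar curvature plus a divergence plus terms quadratic in the
 contorsion tensor. The derivative along a variation of \<open>T\<close> is therefore a quadratic expression, whose
 polarisation at a statistical \<open>T\<close> forces \<open>T = 0\<close>. For \<open>T = 0\<close> the Palatini identity
 shows that the derivative along an adapted variation is, up to a constant factor, the integral of
 \<open>\<Sum>\<mu>. \<eta>\<^sub>\<mu> (Scal / 2 - Ric\<^sub>\<mu>)\<close>, where \<open>\<eta>\<^sub>\<mu>\<close> is the relative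
 velocity of the metric along \<open>D \<mu>\<close> and \<open>Ric\<^sub>\<mu>\<close> is the value of Ric on a unit vector of this line.
 Rescaling the metric along two lines only, with prescribed volume form, shows that all \<open>Scal / 2 - Ric\<^sub>\<mu>\<close>
 are equal to one constant; summation over \<open>\<mu>\<close> determines \<open>Scal\<close> and, as \<open>k > 2\<close>, the Ricci
 curvatures of the lines.
\<close>

text \<open>The obstacle is that every object is given pointwise in an arbitrarily chosen chart,
  while the linear term of a variation disappears only after integration over the manifold. That
  term is therefore isolated without coordinates, as the odd part of the mixed scalar curvature in
  the contorsion (\<open>mixed_linear\<close>). It is additive, so a partition of unity reduces its
  integral to one chart, where it is the divergence of a field of compact support. The same
  functional serves both kinds of variation, because the velocity of the Christoffel symbols is
  itself a (1,2)-tensor. What remains of the derivative is tensorial in the velocity: a test field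
  may be multiplied by the very function whose vanishing is claimed, and the integrand becomes a
  square. For the contorsion, test tensors of rank one give
  \<open>2 <T(c,a),b> = <a,c> t(b) + <a,b> t(c)\<close> on frame vectors, with \<open>t\<close> the
  trace of \<open>T\<close>, and two distinct lines suffice to conclude \<open>t = 0\<close>. For
  the metric, preservation of volume is demanded at every parameter and not only to first order;
  this is why the volume of a rescaled metric is computed exactly, through a differential equation
  in the parameter.\<close>

section \<open>Calculus of smooth maps\<close>

notation frechet_derivative ("\<D>")

abbreviation sum_UNIV :: "('i::finite => 'b::comm_monoid_add) => 'b" (binder "\<Sum>*" 10) where
 "sum_UNIV f \<equiv> sum f UNIV"

type_synonym 'n coefficients = "real^'n => real^'n => real^'n => real^'n"

named_theorems smooth_intros

lemma frechet_derivativeI: "(f has_derivative f') (at x) ==> \<D> f (at x) = f'"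
 by (metis frechet_derivative_at)

lemma frechet_derivative_cong_open:
 assumes "open S" "x \<in> S" "\<And>y. y \<in> S ==> f y = g y"
 shows "\<D> f (at x) = \<D> g (at x)"
proof -
 have "(f has_derivative f') (at x) \<longleftrightarrow> (g has_derivative f') (at x)" for f'
  using assms has_derivative_transform_within_open[of _ _ x UNIV S] by metis
 thus ?thesis by (simp add: frechet_derivative_def)
qed

lemma differentiable_on_openD:
 "f differentiable_on S ==> open S ==> x \<in> S ==>
   (f has_derivative \<D> f (at x)) (at x)"
 using differentiable_on_eq_differentiable_at frechet_derivative_works by blast

section \<open>Closure properties of the classes \<open>Ck_on\<close>\<close>

lemma Ck_on_cong:
 assumes "open S" "\<And>x. x \<in> S ==> f x = g x"
 shows "Ck_on m f S \<longleftrightarrow> Ck_on m g S"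
 using assms(2)
proof (induction m arbitrary: f g)
 case 0
 then show ?case by (simp cong: continuous_on_cong)
next
 case (Suc m)
 have "f differentiable_on S \<longleftrightarrow> g differentiable_on S"
  unfolding differentiable_on_def using Suc.prems differentiable_transform_within[of _ _ S]
  by (metis zero_less_one)
 moreover have "Ck_on m (\<lambda>x. \<D> f (at x) v) S
   \<longleftrightarrow> Ck_on m (\<lambda>x. \<D> g (at x) v) S" for v
  by (rule Suc.IH) (use frechet_derivative_cong_open[OF assms(1)] Suc.prems in metis)
 ultimately show ?case by simp
qed

lemma Ck_on_SucD: "Ck_on (Suc m) f S ==> Ck_on m f S"
proof (induction m arbitrary: f)
 case 0
 then show ?case using differentiable_imp_continuous_on by auto
next
 case (Suc m)
 then show ?case by (metis Ck_on.simps(2))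
qed

lemma Ck_on_subset: "Ck_on m f S ==> S' \<subseteq> S ==> Ck_on m f S'"
 by (induction m arbitrary: f)
   (auto intro: continuous_on_subset differentiable_on_subset)

text \<open>The derivative may be any family \<open>f'\<close> given by a formula, so that
  inductions on \<open>m\<close> need not unfold \<open>frechet_derivative\<close>.\<close>

lemma Ck_on_SucI:
 assumes "open S" "\<And>x. x \<in> S ==> (f has_derivative f' x) (at x)"
  and "\<And>v. Ck_on m (\<lambda>x. f' x v) S"
 shows "Ck_on (Suc m) f S"
proof -
 have "f differentiable_on S"
  using assms(2) differentiable_at_imp_differentiable_on differentiableI by blast
 moreover have "Ck_on m (\<lambda>x. \<D> f (at x) v) S" for v
  using Ck_on_cong[OF assms(1), of "\<lambda>x. \<D> f (at x) v" "\<lambda>x. f' x v" m]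
   assms(3) frechet_derivativeI[OF assms(2)] by simp
 ultimately show ?thesis by simp
qed

lemma Ck_on_SucE:
 assumes "Ck_on (Suc m) f S" "open S"
 shows "\<And>x. x \<in> S ==> (f has_derivative \<D> f (at x)) (at x)"
  and "\<And>v. Ck_on m (\<lambda>x. \<D> f (at x) v) S"
 using assms differentiable_on_openD by auto

lemma Ck_on_const: "open S ==> Ck_on m (\<lambda>x. c) S"
proof (induction m arbitrary: c)
 case (Suc m)
 then show ?case by (intro Ck_on_SucI[where f' = "\<lambda>x v. 0"]) auto
qed simp

lemma Ck_on_linear:
 assumes "bounded_linear f" "open S"
 shows "Ck_on m f S"
proof (cases m)
 case 0
 then show ?thesis using assms linear_continuous_on by auto
next
 case (Suc m')
 show ?thesis
  unfolding Suc
  by (intro Ck_on_SucI[where f' = "\<lambda>x. f"] assms bounded_linear_imp_has_derivative Ck_on_const)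
qed

lemma Ck_on_add:
 assumes "open S" "Ck_on m f S" "Ck_on m g S"
 shows "Ck_on m (\<lambda>x. f x + g x) S"
 using assms(2,3)
proof (induction m arbitrary: f g)
 case 0
 then show ?case by (simp add: continuous_on_add)
next
 case (Suc m)
 show ?case
  by (rule Ck_on_SucI[OF assms(1) has_derivative_add])
    (use Ck_on_SucE[OF Suc.prems(1) assms(1)] Ck_on_SucE[OF Suc.prems(2) assms(1)] Suc.IH in auto)
qed

lemma Ck_on_sum:
 assumes "open S" "\<And>i. i \<in> I ==> Ck_on m (f i) S"
 shows "Ck_on m (\<lambda>x. \<Sum>i\<in>I. f i x) S"
 using assms(2)
 by (induction I rule: infinite_finite_induct) (auto intro: Ck_on_const Ck_on_add assms(1))

lemma Ck_on_bounded_linear_compose: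
 assumes "open S" "bounded_linear L" "Ck_on m f S"
 shows "Ck_on m (\<lambda>x. L (f x)) S"
 using assms(3)
proof (induction m arbitrary: f)
 case 0
 then show ?case using assms(2) by (simp add: bounded_linear.continuous_on)
next
 case (Suc m)
 show ?case
  by (rule Ck_on_SucI[OF assms(1) bounded_linear.has_derivative[OF assms(2)]])
    (use Ck_on_SucE[OF Suc.prems(1) assms(1)] Suc.IH in auto)
qed

lemma Ck_on_bilinear:
 assumes "open S" "bounded_bilinear P" "Ck_on m f S" "Ck_on m g S"
 shows "Ck_on m (\<lambda>x. P (f x) (g x)) S"
 using assms(3,4)
proof (induction m arbitrary: f g)
 case 0
 then show ?case using assms(2) by (simp add: bounded_bilinear.continuous_on)
next
 case (Suc m)
 note fd = Ck_on_SucE[OF Suc.prems(1) assms(1)] and gd = Ck_on_SucE[OF Suc.prems(2) assms(1)]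
 show ?case
  by (rule Ck_on_SucI[OF assms(1) bounded_bilinear.FDERIV[OF assms(2) fd(1) gd(1)]],
    assumption, assumption)
    (intro Ck_on_add assms(1) Suc.IH fd(2) gd(2) Suc.prems[THEN Ck_on_SucD])
qed

text \<open>\<open>Ck_on\<close> controls the derivative of \<open>f\<close> only in constant
  directions, whereas the chain rule applies it to the varying vector
  \<open>\<D> g (at x) v\<close>. Expanding that vector in \<open>Basis\<close> turns the derivative
  into a finite sum of products, to which the induction hypothesis applies; this is why the middle
  space is Euclidean.\<close>

lemma Ck_on_compose:
 fixes f :: "'b::euclidean_space => 'c::real_normed_vector" and g :: "'a::real_normed_vector => 'b"
 assumes "open S" "open T" "g ` S \<subseteq> T" "Ck_on m f T" "Ck_on m g S"
 shows "Ck_on m (\<lambda>x. f (g x)) S"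
 using assms(4,5)
proof (induction m arbitrary: f)
 case 0
 then show ?case using assms(3) by (simp add: continuous_on_compose2)
next
 case (Suc m)
 note gd = Ck_on_SucE[OF Suc.prems(2) assms(1)] and fd = Ck_on_SucE[OF Suc.prems(1) assms(2)]
 show ?case
 proof (rule Ck_on_SucI[OF assms(1)])
  fix x assume x: "x \<in> S"
  have "((\<lambda>x. f (g x)) has_derivative (\<lambda>v. \<D> f (at (g x)) (\<D> g (at x) v))) (at x)"
   using has_derivative_compose[OF gd(1)[OF x] fd(1)[of "g x"]] x assms(3) by auto
  moreover have "\<D> f (at (g x)) w
     = (\<Sum>b\<in>Basis. (w \<bullet> b) *\<^sub>R \<D> f (at (g x)) b)" for w
  proof -
   have "linear (\<D> f (at (g x)))"
    using fd(1)[of "g x"] x assms(3) has_derivative_linear by blast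
   hence "\<D> f (at (g x)) (\<Sum>b\<in>Basis. (w \<bullet> b) *\<^sub>R b)
     = (\<Sum>b\<in>Basis. (w \<bullet> b) *\<^sub>R \<D> f (at (g x)) b)"
    by (simp add: linear_sum linear_scale)
   thus ?thesis by (simp add: euclidean_representation)
  qed
  ultimately show "((\<lambda>x. f (g x)) has_derivative
    (\<lambda>v. \<Sum>b\<in>Basis. (\<D> g (at x) v \<bullet> b) *\<^sub>R \<D> f (at (g x)) b)) (at x)"
   by (metis (no_types, lifting) ext)
 next
  fix v
  show "Ck_on m (\<lambda>x. \<Sum>b\<in>Basis. (\<D> g (at x) v \<bullet> b) *\<^sub>R \<D> f (at (g x)) b) S"
   by (intro Ck_on_sum Ck_on_bilinear[OF _ bounded_bilinear_scaleR] assms(1)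
     Ck_on_bounded_linear_compose[OF _ bounded_linear_inner_left] gd(2)
     Suc.IH[OF fd(2) Ck_on_SucD[OF Suc.prems(2)]])
 qed
qed

lemma Ck_on_local:
 assumes "\<And>x. x \<in> S ==> \<exists>U. open U \<and> x \<in> U \<and> Ck_on m f U"
 shows "Ck_on m f S"
 using assms
proof (induction m arbitrary: f)
 case 0
 have "isCont f x" if "x \<in> S" for x
  using 0[OF that] continuous_on_eq_continuous_at by auto
 then show ?case by (simp add: continuous_at_imp_continuous_on)
next
 case (Suc m)
 have "f differentiable (at x)" if "x \<in> S" for x
  using Suc.prems[OF that] differentiable_on_eq_differentiable_at by auto
 moreover have "Ck_on m (\<lambda>x. \<D> f (at x) v) S" for v
  by (rule Suc.IH) (use Suc.prems in fastforce)
 ultimately show ?case by (simp add: differentiable_at_imp_differentiable_on)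
qed

section \<open>Closure properties of smooth maps\<close>

lemma smooth_on_cong:
 assumes "open S" "\<And>x. x \<in> S ==> f x = g x"
 shows "smooth_on f S \<longleftrightarrow> smooth_on g S"
 using Ck_on_cong[OF assms] by (simp add: smooth_on_def)

lemma smooth_on_subset: "smooth_on f S ==> S' \<subseteq> S ==> smooth_on f S'"
 using Ck_on_subset unfolding smooth_on_def by blast

lemma smooth_on_local:
 "(\<And>x. x \<in> S ==> \<exists>U. open U \<and> x \<in> U \<and> smooth_on f U) ==> smooth_on f S"
 unfolding smooth_on_def using Ck_on_local by metis

lemma smooth_on_has_derivative:
 "smooth_on f S ==> open S ==> x \<in> S ==> (f has_derivative \<D> f (at x)) (at x)"
 using Ck_on_SucE(1) unfolding smooth_on_def by blast

lemma smooth_on_differentiable: "smooth_on f S ==> open S ==> x \<in> S ==> f differentiable (at x)"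
 using smooth_on_has_derivative differentiableI by blast

lemma smooth_on_continuous_on: "smooth_on f S ==> continuous_on S f"
 unfolding smooth_on_def by (metis Ck_on.simps(1))

lemma smooth_on_frechet:
 "smooth_on f S ==> smooth_on (\<lambda>x. \<D> f (at x) v) S"
 unfolding smooth_on_def using Ck_on.simps(2) by blast

lemma smooth_on_const [smooth_intros]: "open S ==> smooth_on (\<lambda>x. c) S"
 by (simp add: smooth_on_def Ck_on_const)

lemma smooth_on_linear: "bounded_linear f ==> open S ==> smooth_on f S"
 by (simp add: smooth_on_def Ck_on_linear)

lemma smooth_on_ident [smooth_intros]: "open S ==> smooth_on (\<lambda>x. x) S"
 by (simp add: smooth_on_linear bounded_linear_ident)

lemma smooth_on_add [smooth_intros]:
 "open S ==> smooth_on f S ==> smooth_on g S ==> smooth_on (\<lambda>x. f x + g x) S"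
 by (simp add: smooth_on_def Ck_on_add)

lemma smooth_on_sum [smooth_intros]:
 "open S ==> (\<And>i. i \<in> I ==> smooth_on (f i) S) ==> smooth_on (\<lambda>x. \<Sum>i\<in>I. f i x) S"
 by (simp add: smooth_on_def Ck_on_sum)

lemma smooth_on_linear_compose:
 "bounded_linear L ==> open S ==> smooth_on f S ==> smooth_on (\<lambda>x. L (f x)) S"
 by (simp add: smooth_on_def Ck_on_bounded_linear_compose)

lemma smooth_on_bilinear:
 "bounded_bilinear P ==> open S ==> smooth_on f S ==> smooth_on g S ==>
   smooth_on (\<lambda>x. P (f x) (g x)) S"
 by (simp add: smooth_on_def Ck_on_bilinear)

lemma smooth_on_compose:
 fixes f :: "'b::euclidean_space => 'c::real_normed_vector" and g :: "'a::real_normed_vector => 'b"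
 shows "smooth_on f T ==> smooth_on g S ==> open S ==> open T ==> (\<And>x. x \<in> S ==> g x \<in> T) ==>
   smooth_on (\<lambda>x. f (g x)) S"
 unfolding smooth_on_def using Ck_on_compose[of S T g _ f] by (simp add: image_subset_iff)

lemmas smooth_on_scaleR [smooth_intros] = smooth_on_bilinear[OF bounded_bilinear_scaleR]
lemmas smooth_on_mult [smooth_intros] = smooth_on_bilinear[OF bounded_bilinear_mult]
lemmas smooth_on_inner [smooth_intros] = smooth_on_bilinear[OF bounded_bilinear_inner]
lemmas smooth_on_minus [smooth_intros] =
 smooth_on_linear_compose[OF bounded_linear_minus[OF bounded_linear_ident]]
lemmas smooth_on_fst [smooth_intros] = smooth_on_linear_compose[OF bounded_linear_fst]
lemmas smooth_on_snd [smooth_intros] = smooth_on_linear_compose[OF bounded_linear_snd]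
lemmas smooth_on_nth [smooth_intros] = smooth_on_linear_compose[OF bounded_linear_vec_nth]

lemma smooth_on_diff [smooth_intros]:
 "open S ==> smooth_on f S ==> smooth_on g S ==> smooth_on (\<lambda>x. f x - g x) S"
 using smooth_on_add[of S f "\<lambda>x. - g x"] smooth_on_minus[of S g] by simp

lemma smooth_on_Pair [smooth_intros]:
 assumes "open S" "smooth_on f S" "smooth_on g S"
 shows "smooth_on (\<lambda>x. (f x, g x)) S"
proof -
 have "bounded_linear (\<lambda>x::'b. (x, 0::'c))" "bounded_linear (\<lambda>x::'c. (0::'b, x))"
  by (intro bounded_linear_Pair bounded_linear_ident bounded_linear_zero)+
 then have "smooth_on (\<lambda>x. (f x, 0) + (0, g x)) S"
  using assms by (intro smooth_on_add smooth_on_linear_compose[of "\<lambda>x. (x, 0)"]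
    smooth_on_linear_compose[of "\<lambda>x. (0, x)"])
 then show ?thesis by simp
qed

lemma vec_lambda_eq_sum: "(\<chi> i. f i) = (\<Sum>*i. (\<Sum>b\<in>Basis. (f i \<bullet> b) *\<^sub>R axis i b))"
 for f :: "'n::finite => 'b::euclidean_space"
proof -
 have "(\<Sum>b\<in>Basis. (f i \<bullet> b) *\<^sub>R axis i b) = axis i (f i)" for i
 proof -
  have "(\<Sum>b\<in>Basis. (f i \<bullet> b) *\<^sub>R axis i b) = axis i (\<Sum>b\<in>Basis. (f i \<bullet> b) *\<^sub>R b)"
   by (auto simp: vec_eq_iff axis_def)
  then show ?thesis by (simp add: euclidean_representation)
 qed
 then show ?thesis by (simp add: vec_eq_iff axis_def sum.delta if_distrib[of "\<lambda>x. x $ _"] cong: if_cong)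
qed

lemma smooth_on_vec_lambda [smooth_intros]:
 fixes f :: "'a::real_normed_vector => 'n::finite => 'b::euclidean_space"
 assumes "open S" "\<And>i. smooth_on (\<lambda>x. f x i) S"
 shows "smooth_on (\<lambda>x. \<chi> i. f x i) S"
 unfolding vec_lambda_eq_sum
 by (intro smooth_intros assms)

lemma smooth_on_vec_iff:
 fixes f :: "'a::real_normed_vector => 'b::euclidean_space ^ 'n::finite"
 assumes "open S"
 shows "smooth_on f S \<longleftrightarrow> (\<forall>i. smooth_on (\<lambda>x. f x $ i) S)"
 using smooth_on_vec_lambda[OF assms, of "\<lambda>x i. f x $ i"] smooth_on_nth[OF assms] by auto

lemma smooth_on_prod [smooth_intros]:
 fixes f :: "'i => 'a::real_normed_vector => real"
 assumes "open S" "\<And>i. i \<in> I ==> smooth_on (f i) S"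
 shows "smooth_on (\<lambda>x. \<Prod>i\<in>I. f i x) S"
 using assms(2)
 by (induction I rule: infinite_finite_induct) (auto intro: smooth_intros assms(1))

lemma smooth_on_power [smooth_intros]:
 fixes f :: "'a::real_normed_vector => real"
 assumes "open S" "smooth_on f S"
 shows "smooth_on (\<lambda>x. f x ^ n) S"
 by (induction n) (auto intro: smooth_intros assms)

text \<open>The derivative of \<open>inverse\<close> is a polynomial in \<open>inverse\<close>, so
  each order of differentiability yields the next.\<close>

lemma Ck_on_inverse_real: "Ck_on m (inverse :: real => real) (- {0})"
proof (induction m)
 case 0
 then show ?case by (auto intro: continuous_intros)
next
 case (Suc m)
 have o: "open (- {0::real})" by auto
 have "Ck_on m (\<lambda>x::real. - (inverse x * v * inverse x)) (- {0})" for v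
  using Suc o
  by (intro Ck_on_bounded_linear_compose[OF o bounded_linear_minus[OF bounded_linear_ident]]
    Ck_on_bilinear[OF o bounded_bilinear_mult] Ck_on_const)
 then show ?case
  by (intro Ck_on_SucI[OF o has_derivative_inverse']) auto
qed

lemma smooth_on_inverse [smooth_intros]:
 fixes f :: "'a::real_normed_vector => real"
 assumes "open S" "smooth_on f S" "\<And>x. x \<in> S ==> f x \<noteq> 0"
 shows "smooth_on (\<lambda>x. inverse (f x)) S"
 by (rule smooth_on_compose[where T = "- {0}"])
   (use assms Ck_on_inverse_real in "auto simp: smooth_on_def")

lemma smooth_on_divide [smooth_intros]:
 fixes f :: "'a::real_normed_vector => real"
 assumes "open S" "smooth_on f S" "smooth_on g S" "\<And>x. x \<in> S ==> g x \<noteq> 0"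
 shows "smooth_on (\<lambda>x. f x / g x) S"
 unfolding divide_inverse by (intro smooth_intros assms)

lemma Ck_on_sqrt: "Ck_on m sqrt {0<..}"
proof (induction m)
 case 0
 then show ?case by (auto intro: continuous_intros)
next
 case (Suc m)
 have inv: "Ck_on m (\<lambda>x. inverse (sqrt x)) {0<..}"
  by (rule Ck_on_compose[OF _ _ _ Ck_on_inverse_real Suc]) auto
 have "Ck_on m (\<lambda>x. (v / 2) * inverse (sqrt x)) {0<..}" for v
  by (rule Ck_on_bilinear[OF _ bounded_bilinear_mult Ck_on_const inv]) auto
 then show ?case
  by (intro Ck_on_SucI[where f' = "\<lambda>x v. (v / 2) * inverse (sqrt x)"])
    (auto intro!: derivative_eq_intros simp: field_simps)
qed

lemma smooth_on_sqrt [smooth_intros]: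
 fixes f :: "'a::real_normed_vector => real"
 assumes "open S" "smooth_on f S" "\<And>x. x \<in> S ==> 0 < f x"
 shows "smooth_on (\<lambda>x. sqrt (f x)) S"
 by (rule smooth_on_compose[where T = "{0<..}"])
   (use assms Ck_on_sqrt in "auto simp: smooth_on_def")

text \<open>Where \<open>f\<close> has no zero its sign is locally constant, so that near each point
  the absolute value is \<open>f\<close> times a constant.\<close>

lemma smooth_on_abs:
 fixes f :: "'a::real_normed_vector => real"
 assumes "open S" "smooth_on f S" "\<And>x. x \<in> S ==> f x \<noteq> 0"
 shows "smooth_on (\<lambda>x. \<bar>f x\<bar>) S"
proof (rule smooth_on_local)
 fix x assume x: "x \<in> S"
 define U where "U = {y\<in>S. 0 < f y * sgn (f x)}"
 have U: "open U" unfolding U_def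
  using continuous_open_preimage[OF continuous_on_mult[OF smooth_on_continuous_on[OF assms(2)]
    continuous_on_const[of _ "sgn (f x)"]] assms(1) open_greaterThan[of 0]]
  by (simp add: vimage_def Collect_conj_eq)
 have "smooth_on (\<lambda>y. sgn (f x) * f y) U"
  by (intro smooth_intros smooth_on_subset[OF assms(2)] U) (auto simp: U_def)
 moreover have "\<bar>f y\<bar> = sgn (f x) * f y" if "y \<in> U" for y
  using that assms(3) x by (auto simp: U_def sgn_if split: if_splits)
 ultimately have "smooth_on (\<lambda>y. \<bar>f y\<bar>) U" using smooth_on_cong[OF U] by metis
 moreover have "x \<in> U" using x assms(3)[OF x] by (auto simp: U_def sgn_if)
 ultimately show "\<exists>U. open U \<and> x \<in> U \<and> smooth_on (\<lambda>y. \<bar>f y\<bar>) U" using U by blast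
qed

lemma smooth_on_det [smooth_intros]:
 fixes M :: "'a::real_normed_vector => real^'n^'n"
 assumes "open S" "smooth_on M S"
 shows "smooth_on (\<lambda>x. det (M x)) S"
 unfolding det_def by (intro smooth_intros assms)

lemma smooth_on_matrix_vector_mult [smooth_intros]:
 fixes M :: "'a::real_normed_vector => real^'n^'m" and v :: "'a => real^'n"
 assumes "open S" "smooth_on M S" "smooth_on v S"
 shows "smooth_on (\<lambda>x. M x *v v x) S"
 unfolding matrix_vector_mult_def by (intro smooth_intros assms)

lemma matrix_inv_right:
 fixes M :: "real^'n^'n"
 assumes "det M \<noteq> 0"
 shows "M ** matrix_inv M = mat 1"
 using someI_ex[of "\<lambda>A'. M ** A' = mat 1 \<and> A' ** M = mat 1"] assms
 unfolding matrix_inv_def by (metis invertible_def invertible_det_nz)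

lemma matrix_inv_left:
 fixes M :: "real^'n^'n"
 assumes "det M \<noteq> 0"
 shows "matrix_inv M ** M = mat 1"
 using matrix_inv_right[OF assms] matrix_left_right_inverse by blast

text \<open>Cramer's rule for the columns of the inverse. It makes the entries quotients of
  polynomials in the entries of \<open>M\<close>, whence smoothness of the inverse.\<close>

lemma matrix_inv_entry:
 fixes M :: "real^'n^'n"
 assumes "det M \<noteq> 0"
 shows "matrix_inv M $ k $ j = det (\<chi> i l. if l = k then axis j 1 $ i else M $ i $ l) / det M"
proof -
 have "M *v (matrix_inv M *v axis j 1) = axis j 1"
  using assms by (simp add: matrix_vector_mul_assoc matrix_inv_right invertible_det_nz)
 then have "matrix_inv M *v axis j 1 = (\<chi> k. det (\<chi> i l. if l = k then axis j 1 $ i else M $ i $ l) / det M)"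
  using cramer[OF assms] by blast
 then show ?thesis
  by (metis (no_types, lifting) column_def matrix_vector_mul_component matrix_vector_mult_basis vec_lambda_beta)
qed

lemma smooth_on_matrix_inv [smooth_intros]:
 fixes M :: "'a::real_normed_vector => real^'n^'n"
 assumes "open S" "smooth_on M S" "\<And>x. x \<in> S ==> det (M x) \<noteq> 0"
 shows "smooth_on (\<lambda>x. matrix_inv (M x)) S"
proof -
 have s: "smooth_on (\<lambda>x. det (\<chi> i l. if l = k then axis j 1 $ i else M x $ i $ l) / det (M x)) S" for k j
 proof (intro smooth_on_divide smooth_on_det smooth_on_vec_lambda assms)
  fix i l show "smooth_on (\<lambda>x. if l = k then axis j 1 $ i else M x $ i $ l) S"
   by (cases "l = k") (auto intro!: smooth_intros assms)
 qed
 have "smooth_on (\<lambda>x. matrix_inv (M x) $ k $ j) S" for k j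
  using s[of k j] smooth_on_cong[OF assms(1)] matrix_inv_entry[OF assms(3)]
  by (metis (no_types, lifting))
 then show ?thesis by (simp add: smooth_on_vec_iff[OF assms(1)])
qed

section \<open>Symmetry of second derivatives\<close>

lemma second_difference_mean_value:
 fixes f :: "'a::real_normed_vector => real"
 assumes S: "open S" and f: "smooth_on f S" and h: "h > 0"
  and seg: "\<And>s r. s \<in> {0..h} ==> r \<in> {0..h} ==> x + s *\<^sub>R u + r *\<^sub>R w \<in> S"
 obtains s r where "s \<in> {0..h}" "r \<in> {0..h}"
  "f (x + h *\<^sub>R u + h *\<^sub>R w) - f (x + h *\<^sub>R u) - (f (x + h *\<^sub>R w) - f x) =
   h * (h * \<D> (\<lambda>y. \<D> f (at y) u) (at (x + s *\<^sub>R u + r *\<^sub>R w)) w)"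
proof -
 define A where "A = (\<lambda>y. \<D> f (at y) u)"
 have A: "smooth_on A S" unfolding A_def using smooth_on_frechet[OF f] .
 have d1: "((\<lambda>s. f (x + s *\<^sub>R u + r *\<^sub>R w)) has_real_derivative A (x + s *\<^sub>R u + r *\<^sub>R w)) (at s)"
  if "s \<in> {0..h}" "r \<in> {0..h}" for s r
 proof -
  have "((\<lambda>s. x + s *\<^sub>R u + r *\<^sub>R w) has_derivative (\<lambda>s. s *\<^sub>R u)) (at s)"
   by (auto intro!: derivative_eq_intros)
  from has_derivative_compose[OF this smooth_on_has_derivative[OF f S seg[OF that]]]
  show ?thesis
   unfolding has_real_derivative_iff_has_vector_derivative has_vector_derivative_def A_def
   using linear_scale[OF has_derivative_linear[OF smooth_on_has_derivative[OF f S seg[OF that]]]]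
   by simp
 qed
 have d2: "((\<lambda>r. A (x + s *\<^sub>R u + r *\<^sub>R w)) has_real_derivative
   \<D> A (at (x + s *\<^sub>R u + r *\<^sub>R w)) w) (at r)"
  if "s \<in> {0..h}" "r \<in> {0..h}" for s r
 proof -
  have "((\<lambda>r. x + s *\<^sub>R u + r *\<^sub>R w) has_derivative (\<lambda>r. r *\<^sub>R w)) (at r)"
   by (auto intro!: derivative_eq_intros)
  from has_derivative_compose[OF this smooth_on_has_derivative[OF A S seg[OF that]]]
  show ?thesis
   unfolding has_real_derivative_iff_has_vector_derivative has_vector_derivative_def
   using linear_scale[OF has_derivative_linear[OF smooth_on_has_derivative[OF A S seg[OF that]]]]
   by simp
 qed
 \<comment> \<open>The increment in direction \<open>w\<close> is regarded as a function of the step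
   \<open>s\<close> along \<open>u\<close>; the second use of the mean value theorem then acts along
   \<open>w\<close>.\<close>
 have "\<exists>s>0. s < h \<and> (f (x + h *\<^sub>R u + h *\<^sub>R w) - f (x + h *\<^sub>R u + 0 *\<^sub>R w)) -
   (f (x + 0 *\<^sub>R u + h *\<^sub>R w) - f (x + 0 *\<^sub>R u + 0 *\<^sub>R w)) =
   (h - 0) * (A (x + s *\<^sub>R u + h *\<^sub>R w) - A (x + s *\<^sub>R u + 0 *\<^sub>R w))"
  using MVT2[OF h, of "\<lambda>s. f (x + s *\<^sub>R u + h *\<^sub>R w) - f (x + s *\<^sub>R u + 0 *\<^sub>R w)"
    "\<lambda>s. A (x + s *\<^sub>R u + h *\<^sub>R w) - A (x + s *\<^sub>R u + 0 *\<^sub>R w)"]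
   d1 h by (force intro!: DERIV_diff)
 then obtain s where s: "0 < s" "s < h" "f (x + h *\<^sub>R u + h *\<^sub>R w) - f (x + h *\<^sub>R u) -
   (f (x + h *\<^sub>R w) - f x) = h * (A (x + s *\<^sub>R u + h *\<^sub>R w) - A (x + s *\<^sub>R u + 0 *\<^sub>R w))"
  by auto
 have "\<exists>r>0. r < h \<and> A (x + s *\<^sub>R u + h *\<^sub>R w) - A (x + s *\<^sub>R u + 0 *\<^sub>R w) =
   (h - 0) * \<D> A (at (x + s *\<^sub>R u + r *\<^sub>R w)) w"
  using MVT2[OF h, of "\<lambda>r. A (x + s *\<^sub>R u + r *\<^sub>R w)"
    "\<lambda>r. \<D> A (at (x + s *\<^sub>R u + r *\<^sub>R w)) w"] d2 s by force
 then obtain r where r: "0 < r" "r < h" "A (x + s *\<^sub>R u + h *\<^sub>R w) - A (x + s *\<^sub>R u + 0 *\<^sub>R w) =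
   (h - 0) * \<D> A (at (x + s *\<^sub>R u + r *\<^sub>R w)) w"
  by blast
 show thesis
  by (rule that[of s r]) (use s r in "auto simp: A_def")
qed

text \<open>The second difference over a parallelogram does not see the order of \<open>u\<close>
  and \<open>w\<close>, while the mean value theorem writes it as \<open>h * h\<close> times either
  mixed derivative at some point of the parallelogram. Both points tend to \<open>x\<close>, where
  the mixed derivatives are continuous.\<close>

lemma second_derivative_symmetric_real:
 fixes f :: "'a::real_normed_vector => real"
 assumes S: "open S" and x: "x \<in> S" and f: "smooth_on f S"
 shows "\<D> (\<lambda>y. \<D> f (at y) u) (at x) w =
     \<D> (\<lambda>y. \<D> f (at y) w) (at x) u"
proof -
 define B where "B = (\<lambda>u w x. \<D> (\<lambda>y. \<D> f (at y) u) (at x) w)"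
 have B: "isCont (B u w) x" for u w
  using smooth_on_continuous_on[OF smooth_on_frechet[OF smooth_on_frechet[OF f]]] S x
  unfolding B_def by (simp add: continuous_on_eq_continuous_at)
 have "\<bar>B u w x - B w u x\<bar> \<le> e" if e: "e > 0" for e
 proof -
  have "\<forall>\<^sub>F y in nhds x. y \<in> S \<and> dist (B u w y) (B u w x) < e / 2 \<and> dist (B w u y) (B w u x) < e / 2"
   using B[of u w] B[of w u] e S x
   by (intro eventually_conj)
     (auto simp: isCont_def eventually_nhds_in_open tendsto_at_iff_tendsto_nhds dest: tendstoD[where e = "e / 2"])
  then obtain d where d: "d > 0"
   "\<And>y. dist y x < d ==> y \<in> S \<and> dist (B u w y) (B u w x) < e / 2 \<and> dist (B w u y) (B w u x) < e / 2"
   unfolding eventually_nhds_metric by blast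
  \<comment> \<open>With this step all points reached by multiples up to \<open>h\<close> of the two
    vectors are within \<open>d / 2\<close> of \<open>x\<close>; the summand 1 avoids a division by
    zero if both vectors vanish.\<close>
  define h where "h = d / (2 * (norm u + norm w + 1))"
  have np: "norm u + norm w + 1 > 0" by (smt (verit) norm_ge_zero)
  have h: "h > 0" unfolding h_def using d np by (auto intro!: divide_pos_pos)
  have near: "dist (x + s *\<^sub>R u' + r *\<^sub>R w') x < d"
   if "s \<in> {0..h}" "r \<in> {0..h}" "norm u' + norm w' = norm u + norm w" for s r u' w'
  proof -
   have "dist (x + s *\<^sub>R u' + r *\<^sub>R w') x = norm (s *\<^sub>R u' + r *\<^sub>R w')"
    by (simp add: dist_norm algebra_simps)
   also have "\<dots> \<le> s * norm u' + r * norm w'"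
    using norm_triangle_ineq[of "s *\<^sub>R u'" "r *\<^sub>R w'"] that by simp
   also have "\<dots> \<le> h * norm u' + h * norm w'"
    using that by (intro add_mono mult_right_mono) auto
   also have "\<dots> = h * (norm u + norm w)" using that(3) by (metis distrib_left)
   also have "\<dots> \<le> h * (norm u + norm w + 1)" using h by simp
   also have "\<dots> = d / 2" unfolding h_def using np by (simp add: field_simps)
   finally show ?thesis using d(1) by simp
  qed
  obtain s r where sr: "s \<in> {0..h}" "r \<in> {0..h}"
   "f (x + h *\<^sub>R u + h *\<^sub>R w) - f (x + h *\<^sub>R u) - (f (x + h *\<^sub>R w) - f x) = h * (h * B u w (x + s *\<^sub>R u + r *\<^sub>R w))"
   using second_difference_mean_value[OF S f h, of x u w] d(2)[OF near] unfolding B_def by metis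
  obtain s' r' where sr': "s' \<in> {0..h}" "r' \<in> {0..h}"
   "f (x + h *\<^sub>R w + h *\<^sub>R u) - f (x + h *\<^sub>R w) - (f (x + h *\<^sub>R u) - f x) = h * (h * B w u (x + s' *\<^sub>R w + r' *\<^sub>R u))"
   using second_difference_mean_value[OF S f h, of x w u] d(2)[OF near] unfolding B_def
   by (metis add.commute)
  have swap: "x + h *\<^sub>R w + h *\<^sub>R u = x + h *\<^sub>R u + h *\<^sub>R w" by (simp add: algebra_simps)
  have "h * (h * B u w (x + s *\<^sub>R u + r *\<^sub>R w)) = h * (h * B w u (x + s' *\<^sub>R w + r' *\<^sub>R u))"
   using sr(3) sr'(3)[unfolded swap] by linarith
  then have "B u w (x + s *\<^sub>R u + r *\<^sub>R w) = B w u (x + s' *\<^sub>R w + r' *\<^sub>R u)" using h by simp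
  moreover have "dist (B u w (x + s *\<^sub>R u + r *\<^sub>R w)) (B u w x) < e / 2"
   using d(2)[OF near[OF sr(1,2)]] by simp
  moreover have "dist (B w u (x + s' *\<^sub>R w + r' *\<^sub>R u)) (B w u x) < e / 2"
   using d(2)[OF near[OF sr'(1,2)]] by (simp add: add.commute)
  ultimately show ?thesis unfolding dist_real_def by linarith
 qed
 then have "\<bar>B u w x - B w u x\<bar> \<le> 0" by (rule field_le_epsilon) auto
 then show ?thesis by (simp add: B_def)
qed

lemma second_derivative_symmetric:
 fixes f :: "'a::real_normed_vector => 'b::euclidean_space"
 assumes S: "open S" and x: "x \<in> S" and f: "smooth_on f S"
 shows "\<D> (\<lambda>y. \<D> f (at y) u) (at x) w =
     \<D> (\<lambda>y. \<D> f (at y) w) (at x) u"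
proof (rule euclidean_eqI)
 fix b :: 'b
 have fb: "smooth_on (\<lambda>y. f y \<bullet> b) S" by (intro smooth_intros S f)
 have inner: "\<D> (\<lambda>y. g y \<bullet> b) (at y) v = \<D> g (at y) v \<bullet> b"
  if "smooth_on g S" "y \<in> S" for g :: "'a => 'b" and y v
  using frechet_derivativeI[OF bounded_linear.has_derivative[OF bounded_linear_inner_left
     smooth_on_has_derivative[OF that(1) S that(2)]]] by simp
 have "\<D> (\<lambda>y. \<D> f (at y) u) (at x) w \<bullet> b
   = \<D> (\<lambda>y. \<D> (\<lambda>y. f y \<bullet> b) (at y) u) (at x) w" for u w
 proof -
  have "\<D> (\<lambda>y. \<D> (\<lambda>y. f y \<bullet> b) (at y) u) (at x) =
    \<D> (\<lambda>y. \<D> f (at y) u \<bullet> b) (at x)"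
   by (intro frechet_derivative_cong_open[OF S x] inner f)
  then show ?thesis using inner[OF smooth_on_frechet[OF f] x] by simp
 qed
 then show "\<D> (\<lambda>y. \<D> f (at y) u) (at x) w \<bullet> b =
    \<D> (\<lambda>y. \<D> f (at y) w) (at x) u \<bullet> b"
  using second_derivative_symmetric_real[OF S x fb] by simp
qed

subsection \<open>Smooth one-parameter families\<close>

lemma smooth_family_slice:
 fixes f :: "real => 'a::real_normed_vector => 'b::real_normed_vector"
 assumes "smooth_on (\<lambda>(t, x). f t x) (I \<times> U)" "open I" "open U" "t \<in> I"
 shows family_derivative_space:
   "\<And>x. x \<in> U ==> (f t has_derivative (\<lambda>v. \<D> (\<lambda>(t, x). f t x) (at (t, x)) (0, v))) (at x)"
  and family_derivative_time:
   "\<And>x. x \<in> U ==> ((\<lambda>s. f s x) has_vector_derivative \<D> (\<lambda>(t, x). f t x) (at (t, x)) (1, 0)) (at t)"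
proof -
 fix x assume x: "x \<in> U"
 have op: "open (I \<times> U)" using assms by (simp add: open_Times)
 have tx: "(t, x) \<in> I \<times> U" using assms x by auto
 note D = smooth_on_has_derivative[OF assms(1) op tx]
 show "(f t has_derivative (\<lambda>v. \<D> (\<lambda>(t, x). f t x) (at (t, x)) (0, v))) (at x)"
  using has_derivative_compose[OF has_derivative_Pair[OF has_derivative_const has_derivative_ident] D]
  by (simp add: case_prod_beta)
 have *: "((\<lambda>s. f s x) has_derivative (\<lambda>s. \<D> (\<lambda>(t, x). f t x) (at (t, x)) (s, 0))) (at t)"
  using has_derivative_compose[OF has_derivative_Pair[OF has_derivative_ident has_derivative_const] D]
  by (simp add: case_prod_beta)
 have "(\<lambda>s. \<D> (\<lambda>(t, x). f t x) (at (t, x)) (s, 0)) =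
   (\<lambda>s. s *\<^sub>R \<D> (\<lambda>(t, x). f t x) (at (t, x)) (1, 0))"
 proof
  fix s show "\<D> (\<lambda>(t, x). f t x) (at (t, x)) (s, 0) =
   s *\<^sub>R \<D> (\<lambda>(t, x). f t x) (at (t, x)) (1, 0)"
   using linear_scale[OF has_derivative_linear[OF D], of s "(1, 0)"] by simp
 qed
 from *[unfolded this]
 show "((\<lambda>s. f s x) has_vector_derivative \<D> (\<lambda>(t, x). f t x) (at (t, x)) (1, 0)) (at t)"
  unfolding has_vector_derivative_def .
qed

lemma smooth_family_frechet:
 fixes f :: "real => 'a::real_normed_vector => 'b::real_normed_vector"
 assumes "smooth_on (\<lambda>(t, x). f t x) (I \<times> U)" "open I" "open U"
 shows "smooth_on (\<lambda>(t, x). \<D> (f t) (at x) v) (I \<times> U)"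
proof -
 have "\<D> (f t) (at x) v = \<D> (\<lambda>(t, x). f t x) (at (t, x)) (0, v)"
  if "(t, x) \<in> I \<times> U" for t x
  using frechet_derivativeI[OF family_derivative_space[OF assms]] that by auto
 then show ?thesis
  using smooth_on_frechet[OF assms(1), of "(0, v)"]
   smooth_on_cong[OF open_Times[OF assms(2,3)], of "\<lambda>(t, x). \<D> (f t) (at x) v"
    "\<lambda>z. \<D> (\<lambda>(t, x). f t x) (at z) (0, v)"] by auto
qed

lemma smooth_family_vector_derivative:
 fixes f :: "real => 'a::real_normed_vector => 'b::real_normed_vector"
 assumes "smooth_on (\<lambda>(t, x). f t x) (I \<times> U)" "open I" "open U"
 shows "smooth_on (\<lambda>(t, x). vector_derivative (\<lambda>s. f s x) (at t)) (I \<times> U)"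
proof -
 have "vector_derivative (\<lambda>s. f s x) (at t) = \<D> (\<lambda>(t, x). f t x) (at (t, x)) (1, 0)"
  if "(t, x) \<in> I \<times> U" for t x
  using vector_derivative_at[OF family_derivative_time[OF assms]] that by auto
 then show ?thesis
  using smooth_on_frechet[OF assms(1), of "(1, 0)"]
   smooth_on_cong[OF open_Times[OF assms(2,3)], of "\<lambda>(t, x). vector_derivative (\<lambda>s. f s x) (at t)"
    "\<lambda>z. \<D> (\<lambda>(t, x). f t x) (at z) (1, 0)"] by auto
qed

lemma smooth_family_at:
 fixes f :: "real => 'a::euclidean_space => 'b::real_normed_vector"
 assumes "smooth_on (\<lambda>(t, x). f t x) (I \<times> U)" "open I" "open U" "t \<in> I"
 shows "smooth_on (f t) U"
 using smooth_on_compose[OF assms(1) smooth_on_Pair[OF assms(3) smooth_on_const[OF assms(3)]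
    smooth_on_ident[OF assms(3)]], of t] assms(2-4)
 by (simp add: open_Times)

lemma smooth_on_times_snd:
 fixes f :: "'a::euclidean_space => 'b::real_normed_vector"
 assumes "smooth_on f U" "open I" "open U"
 shows "smooth_on (\<lambda>(t::real, x). f x) (I \<times> U)"
 using smooth_on_compose[OF assms(1) smooth_on_linear[OF bounded_linear_snd], of "I \<times> U"] assms(2,3)
 by (simp add: open_Times case_prod_beta' mem_Times_iff)

text \<open>Parameter and position are treated as one variable in the product space: the claim is
  the symmetry of the second derivative in the directions \<open>(0, v)\<close> and
  \<open>(1, 0)\<close>.\<close>

lemma family_derivative_commute:
 fixes f :: "real => 'a::real_normed_vector => 'b::euclidean_space"
 assumes f: "smooth_on (\<lambda>(t, x). f t x) (I \<times> U)" "open I" "open U" and "t \<in> I" "x \<in> U"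
 shows "((\<lambda>s. \<D> (f s) (at x) v) has_vector_derivative
   \<D> (\<lambda>y. vector_derivative (\<lambda>s. f s y) (at t)) (at x) v) (at t)"
proof -
 let ?F = "\<lambda>(t, x). f t x"
 have op: "open (I \<times> U)" using assms by (simp add: open_Times)
 have tx: "(t, x) \<in> I \<times> U" using assms by auto
 have "((\<lambda>s. \<D> (f s) (at x) v) has_vector_derivative
   \<D> (\<lambda>(t, x). \<D> (f t) (at x) v) (at (t, x)) (1, 0)) (at t)"
  using family_derivative_time[OF smooth_family_frechet[OF f] assms(2,3,4,5)] .
 also have "\<D> (\<lambda>(t, x). \<D> (f t) (at x) v) (at (t, x)) =
   \<D> (\<lambda>z. \<D> ?F (at z) (0, v)) (at (t, x))"
  using frechet_derivativeI[OF family_derivative_space[OF f]]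
  by (intro frechet_derivative_cong_open[OF op tx]) auto
 also have "\<dots> (1, 0) = \<D> (\<lambda>z. \<D> ?F (at z) (1, 0)) (at (t, x)) (0, v)"
  using second_derivative_symmetric[OF op tx f(1)] .
 also have "\<D> (\<lambda>z. \<D> ?F (at z) (1, 0)) (at (t, x)) =
   \<D> (\<lambda>(t, x). vector_derivative (\<lambda>s. f s x) (at t)) (at (t, x))"
  using vector_derivative_at[OF family_derivative_time[OF f]]
  by (intro frechet_derivative_cong_open[OF op tx]) auto
 also have "\<dots> (0, v) = \<D> (\<lambda>y. vector_derivative (\<lambda>s. f s y) (at t)) (at x) v"
  using frechet_derivativeI[OF family_derivative_space[OF smooth_family_vector_derivative[OF f] assms(2,3,4,5)]]
  by simp
 finally show ?thesis .
qed

subsection \<open>A smooth cut-off function\<close>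

text \<open>The powers of \<open>inverse x\<close> make the family closed under differentiation, so
  that one induction proves smoothness of all members; only \<open>flat_exp 0\<close> serves as a
  cut-off.\<close>

definition flat_exp :: "nat => real => real" where
 "flat_exp n x = (if x > 0 then exp (- inverse x) * inverse x ^ n else 0)"

lemma flat_exp_has_derivative:
 "(flat_exp n has_real_derivative (flat_exp (n + 2) x - real n * flat_exp (n + 1) x)) (at x)"
proof -
 consider "x > 0" | "x < 0" | "x = 0" by linarith
 then show ?thesis
 proof cases
  case 1
  have "((\<lambda>x. exp (- inverse x) * inverse x ^ n) has_real_derivative
    (flat_exp (n + 2) x - real n * flat_exp (n + 1) x)) (at x)"
  proof -
   have *: "real n * inverse x ^ (n - Suc 0) = real n * inverse x ^ n * x"
    using 1 by (cases n) auto
   have "exp (- inverse x) * (inverse x * inverse x) * inverse x ^ n +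
     (real n * inverse x ^ (n - Suc 0)) * (- (inverse x * inverse x)) * exp (- inverse x) =
     flat_exp (n + 2) x - real n * flat_exp (n + 1) x"
    unfolding * using 1 by (simp add: flat_exp_def)
   then show ?thesis
    using DERIV_mult[OF DERIV_chain2[OF DERIV_exp DERIV_minus[OF DERIV_inverse]] DERIV_power[OF DERIV_inverse], of x n] 1
    by (simp add: power2_eq_square mult_ac)
  qed
  then show ?thesis
   by (rule has_field_derivative_transform_within_open[of _ _ _ "{0<..}"]) (use 1 in "auto simp: flat_exp_def")
 next
  case 2
  have "((\<lambda>x. 0) has_real_derivative 0) (at x)" by simp
  then have "(flat_exp n has_real_derivative 0) (at x)"
   by (rule has_field_derivative_transform_within_open[of _ _ _ "{..<0}"]) (use 2 in "auto simp: flat_exp_def")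
  then show ?thesis using 2 by (simp add: flat_exp_def)
 next
  case 3
  \<comment> \<open>The difference quotient at 0 is this expression in the reciprocal variable, and
    the exponential beats every power.\<close>
  have "((\<lambda>y. y ^ Suc n / exp y) \<longlongrightarrow> 0) (at_top :: real filter)"
   using tendsto_power_div_exp_0 .
  then have "((\<lambda>y. inverse y ^ Suc n / exp (inverse y)) \<longlongrightarrow> 0) (at_right (0::real))"
   using filterlim_inverse_at_top_right by (rule filterlim_compose)
  then have "((\<lambda>y. flat_exp n y / y) \<longlongrightarrow> 0) (at_right 0)"
   by (rule Lim_transform_eventually)
     (auto simp: flat_exp_def eventually_at_filter exp_minus field_simps)
  moreover have "((\<lambda>y. flat_exp n y / y) \<longlongrightarrow> 0) (at_left 0)"
   by (rule tendsto_eventually) (auto simp: flat_exp_def eventually_at_filter)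
  ultimately have "((\<lambda>y. flat_exp n y / y) \<longlongrightarrow> 0) (at 0)" by (simp add: filterlim_split_at)
  then show ?thesis using 3 by (simp add: has_field_derivative_iff flat_exp_def)
 qed
qed

lemma smooth_on_flat_exp: "smooth_on (flat_exp n) UNIV"
proof -
 have "Ck_on m (flat_exp n) UNIV" for m n
 proof (induction m arbitrary: n)
  case 0
  show ?case
   using DERIV_continuous_on[OF has_field_derivative_at_within[OF flat_exp_has_derivative]] by simp
 next
  case (Suc m)
  have "Ck_on m (\<lambda>x. v *\<^sub>R flat_exp (n + 2) x + (- v * real n) *\<^sub>R flat_exp (n + 1) x) UNIV" for v :: real
   using Suc by (intro Ck_on_add Ck_on_bounded_linear_compose[OF _ bounded_linear_scaleR_right]) auto
  then show ?case
   by (intro Ck_on_SucI[where f' = "\<lambda>x v. v *\<^sub>R flat_exp (n + 2) x + (- v * real n) *\<^sub>R flat_exp (n + 1) x"])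
     (use flat_exp_has_derivative[unfolded has_real_derivative_iff_has_vector_derivative
       has_vector_derivative_def, of n] in "auto simp: algebra_simps")
 qed
 then show ?thesis by (simp add: smooth_on_def)
qed

subsection \<open>Derivative of the determinant\<close>

lemma permutes_moves_two:
 assumes "p permutes (UNIV :: 'n::finite set)" "p \<noteq> id"
 obtains i j where "i \<noteq> j" "p i \<noteq> i" "p j \<noteq> j"
proof -
 obtain i where "p i \<noteq> i" using assms(2) by (auto simp: fun_eq_iff)
 moreover have "p (p i) \<noteq> p i" using \<open>p i \<noteq> i\<close> permutes_inj[OF assms(1)] by (auto dest: injD)
 ultimately show thesis using that[of i "p i"] by metis
qed

text \<open>In the Leibniz expansion at the identity matrix a permutation other than
  \<open>id\<close> has at least two off-diagonal factors. Differentiating one of them leaves a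
  zero, so only the diagonal product contributes, and its derivative is the trace.\<close>

lemma has_real_derivative_det_one:
 fixes N :: "real => real^'n^'n"
 assumes N: "\<And>i j. ((\<lambda>t. N t $ i $ j) has_real_derivative N' $ i $ j) (at t)" and one: "N t = mat 1"
 shows "((\<lambda>t. det (N t)) has_real_derivative trace N') (at t)"
proof -
 let ?P = "{p. p permutes (UNIV :: 'n set)}"
 have fin: "finite ?P" by (simp add: finite_permutations)
 have D: "((\<lambda>t. \<Prod>i\<in>UNIV. N t $ i $ p i) has_real_derivative
   (\<Sum>*i. N' $ i $ p i * (\<Prod>j\<in>UNIV - {i}. N t $ j $ p j))) (at t)" for p
  using has_field_derivative_prod[of UNIV "\<lambda>i t. N t $ i $ p i" "\<lambda>i. N' $ i $ p i" t] N by simp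
 have z: "(\<Sum>*i. N' $ i $ p i * (\<Prod>j\<in>UNIV - {i}. N t $ j $ p j)) = (if p = id then trace N' else 0)"
  if p: "p \<in> ?P" for p
 proof (cases "p = id")
  case True
  then show ?thesis by (simp add: trace_def one mat_def)
 next
  case False
  then obtain a b where ab: "a \<noteq> b" "p a \<noteq> a" "p b \<noteq> b"
   using permutes_moves_two p by blast
  have "(\<Prod>j\<in>UNIV - {i}. N t $ j $ p j) = 0" for i
  proof -
   obtain c where "c \<noteq> i" "p c \<noteq> c" using ab by metis
   then show ?thesis by (intro prod_zero) (auto simp: one mat_def intro!: bexI[of _ c])
  qed
  then show ?thesis using False by (simp del: prod_zero_iff)
 qed
 have "((\<lambda>t. \<Sum>p\<in>?P. of_int (sign p) * (\<Prod>i\<in>UNIV. N t $ i $ p i)) has_real_derivative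
   (\<Sum>p\<in>?P. of_int (sign p) * (if p = id then trace N' else 0))) (at t)"
 proof (intro DERIV_sum DERIV_cmult)
  fix p assume "p \<in> ?P"
  from D[of p, unfolded z[OF this]]
  show "((\<lambda>t. \<Prod>i\<in>UNIV. N t $ i $ p i) has_real_derivative (if p = id then trace N' else 0)) (at t)" .
 qed
 also have "(\<Sum>p\<in>?P. of_int (sign p) * (if p = id then trace N' else 0)) = trace N'"
  using fin by (simp add: if_distrib[of "\<lambda>x. _ * x"] sum.delta sign_id permutes_id cong: if_cong)
 finally show ?thesis by (simp add: det_def)
qed

text \<open>Jacobi's formula. Multiplication by the constant matrix \<open>matrix_inv (M t)\<close>
  moves the base point to the identity.\<close>

lemma has_real_derivative_det:
 fixes M :: "real => real^'n^'n"
 assumes M: "(M has_vector_derivative M') (at t)" and nz: "det (M t) \<noteq> 0"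
 shows "((\<lambda>t. det (M t)) has_real_derivative det (M t) * trace (matrix_inv (M t) ** M')) (at t)"
proof -
 let ?B = "matrix_inv (M t)"
 have "((\<lambda>t. M t $ i $ j) has_real_derivative M' $ i $ j) (at t)" for i j
  using bounded_linear.has_vector_derivative[OF bounded_linear_compose[OF bounded_linear_vec_nth bounded_linear_vec_nth] M]
  by (simp add: has_real_derivative_iff_has_vector_derivative)
 then have "((\<lambda>t. (?B ** M t) $ i $ j) has_real_derivative (?B ** M') $ i $ j) (at t)" for i j
  unfolding matrix_matrix_mult_def by (auto intro!: DERIV_sum DERIV_cmult)
 then have "((\<lambda>t. det (?B ** M t)) has_real_derivative trace (?B ** M')) (at t)"
  by (rule has_real_derivative_det_one) (use matrix_inv_left[OF nz] in simp)
 from DERIV_cmult[OF this, of "det (M t)"]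
 show ?thesis
  using matrix_inv_right[OF nz] by (simp add: det_mul[symmetric] matrix_mul_assoc matrix_mul_lid)
qed

lemma has_vector_derivative_matrix_inv:
 fixes M :: "real => real^'n^'n"
 assumes M: "(M has_vector_derivative M') (at t)"
  and Mi: "((\<lambda>t. matrix_inv (M t)) has_vector_derivative Mi') (at t)"
  and T: "open T" "t \<in> T" "\<And>s. s \<in> T ==> det (M s) \<noteq> 0"
 shows "Mi' = - (matrix_inv (M t) ** M' ** matrix_inv (M t))"
proof -
 have bil: "bounded_bilinear ((**) :: real^'n^'n => real^'n^'n => real^'n^'n)"
 proof -
  have "bilinear ((**) :: real^'n^'n => real^'n^'n => real^'n^'n)"
   by (auto simp: bilinear_def linear_iff vec_eq_iff matrix_matrix_mult_def sum.distrib
     algebra_simps sum_distrib_left)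
  then show ?thesis by (simp add: bilinear_conv_bounded_bilinear)
 qed
 have "((\<lambda>s. matrix_inv (M s) ** M s) has_vector_derivative (matrix_inv (M t) ** M' + Mi' ** M t)) (at t)"
  using bounded_bilinear.has_vector_derivative[OF bil Mi M] .
 moreover have "((\<lambda>s. matrix_inv (M s) ** M s) has_vector_derivative 0) (at t)"
  by (rule has_vector_derivative_transform_within_open[of "\<lambda>_. mat 1" _ _ T])
    (simp_all add: T matrix_inv_left)
 ultimately have "matrix_inv (M t) ** M' + Mi' ** M t = 0" by (rule vector_derivative_unique_at)
 then have "Mi' ** M t = - (matrix_inv (M t) ** M')" by (simp add: eq_neg_iff_add_eq_0 add.commute)
 then have "Mi' ** M t ** matrix_inv (M t) = - (matrix_inv (M t) ** M') ** matrix_inv (M t)" by simp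
 moreover have "- A ** B = - (A ** B)" for A B :: "real^'n^'n"
  by (simp add: vec_eq_iff matrix_matrix_mult_def sum_negf)
 ultimately show ?thesis
  using matrix_inv_right[OF T(3)[OF T(2)]] by (simp add: matrix_mul_assoc[symmetric])
qed

subsection \<open>Differentiation under the integral sign\<close>

text \<open>The bound on \<open>f'\<close> also bounds the difference quotients at 0, and constants
  are integrable on a finite measure space; dominated convergence then applies along every sequence
  tending to 0.\<close>

lemma has_real_derivative_integral:
 fixes f :: "real => 'a => real"
 assumes "finite_measure M" and \<delta>: "\<delta> > 0"
  and meas: "\<And>t. \<bar>t\<bar> < \<delta> ==> f t \<in> borel_measurable M"
  and der: "\<And>t p. \<bar>t\<bar> < \<delta> ==> p \<in> space M ==> ((\<lambda>s. f s p) has_real_derivative f' t p) (at t)"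
  and bd: "\<And>t p. \<bar>t\<bar> < \<delta> ==> p \<in> space M ==> \<bar>f' t p\<bar> \<le> C"
  and bd0: "\<And>p. p \<in> space M ==> \<bar>f 0 p\<bar> \<le> C0"
 shows "((\<lambda>t. integral\<^sup>L M (f t)) has_real_derivative integral\<^sup>L M (f' 0)) (at 0)"
proof -
 interpret finite_measure M by fact
 have lip: "\<bar>f t p - f 0 p\<bar> \<le> C * \<bar>t\<bar>" if "\<bar>t\<bar> < \<delta>" "p \<in> space M" for t p
 proof -
  have "norm (f t p - f 0 p) \<le> C * norm (t - 0)"
  proof (rule field_differentiable_bound[of "{-\<delta><..<\<delta>}" "\<lambda>s. f s p" "\<lambda>s. f' s p"])
   fix s assume "s \<in> {-\<delta><..<\<delta>}"
   then have "\<bar>s\<bar> < \<delta>" by auto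
   then show "((\<lambda>s. f s p) has_real_derivative f' s p) (at s within {-\<delta><..<\<delta>})" "norm (f' s p) \<le> C"
    using der bd that(2) by (auto intro: has_field_derivative_at_within)
  qed (use that \<delta> in auto)
  then show ?thesis by simp
 qed
 have int0: "integrable M (f t)" if t: "\<bar>t\<bar> < \<delta>" for t
 proof (rule integrable_const_bound[of _ "C0 + \<bar>C\<bar> * \<delta>"])
  have "\<bar>f t p\<bar> \<le> C0 + \<bar>C\<bar> * \<delta>" if p: "p \<in> space M" for p
  proof -
   have "C * \<bar>t\<bar> \<le> \<bar>C\<bar> * \<delta>" using \<open>\<bar>t\<bar> < \<delta>\<close> by (intro mult_mono) auto
   then show ?thesis using lip[OF t p] bd0[OF p] by linarith
  qed
  then show "AE p in M. norm (f t p) \<le> C0 + \<bar>C\<bar> * \<delta>" by simp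
 qed (use meas that in auto)
 have "(\<lambda>n. (integral\<^sup>L M (f (X n)) - integral\<^sup>L M (f 0)) / X n) \<longlonglongrightarrow> integral\<^sup>L M (f' 0)"
  if X: "\<And>n. X n \<noteq> 0" "X \<longlonglongrightarrow> 0" for X
 proof -
  \<comment> \<open>The quotient is replaced by 0 as long as \<open>X n\<close> lies outside the
    interval, so that every member of the sequence is measurable and bounded; this changes finitely
    many terms only.\<close>
  define s where "s = (\<lambda>n p. if \<bar>X n\<bar> < \<delta> then (f (X n) p - f 0 p) / X n else 0)"
  have ev: "\<forall>\<^sub>F n in sequentially. \<bar>X n\<bar> < \<delta>"
   using tendstoD[OF X(2) \<delta>] by (simp add: dist_real_def)
  have sm: "s n \<in> borel_measurable M" for n
   unfolding s_def using meas[of "X n"] meas[of 0] \<delta> by (cases "\<bar>X n\<bar> < \<delta>") simp_all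
  have lim: "(\<lambda>n. s n p) \<longlonglongrightarrow> f' 0 p" if "p \<in> space M" for p
  proof -
   have "((\<lambda>h. (f (0 + h) p - f 0 p) / h) \<longlongrightarrow> f' 0 p) (at 0)"
    using der[of 0 p] \<delta> that by (simp add: DERIV_def)
   then have "(\<lambda>n. (f (X n) p - f 0 p) / X n) \<longlonglongrightarrow> f' 0 p"
    using X by (auto simp: tendsto_at_iff_sequentially o_def)
   then show ?thesis
    by (rule Lim_transform_eventually) (use ev in "auto simp: s_def elim: eventually_mono")
  qed
  have m': "f' 0 \<in> borel_measurable M" by (rule borel_measurable_LIMSEQ_real[OF lim sm])
  have sb: "norm (s n p) \<le> \<bar>C\<bar>" if "p \<in> space M" for n p
  proof (cases "\<bar>X n\<bar> < \<delta>")
   case True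
   have "C * \<bar>X n\<bar> \<le> \<bar>C\<bar> * \<bar>X n\<bar>" by (intro mult_right_mono) auto
   with lip[OF True that] have "\<bar>f (X n) p - f 0 p\<bar> \<le> \<bar>C\<bar> * \<bar>X n\<bar>" by linarith
   then show ?thesis using X(1)[of n] True
    by (simp add: s_def abs_divide divide_le_eq)
  qed (simp add: s_def)
  have "(\<lambda>n. integral\<^sup>L M (s n)) \<longlonglongrightarrow> integral\<^sup>L M (f' 0)"
   by (rule integral_dominated_convergence[where w = "\<lambda>_. \<bar>C\<bar>"]) (use m' sm sb lim in auto)
  moreover have "\<forall>\<^sub>F n in sequentially. integral\<^sup>L M (s n) = (integral\<^sup>L M (f (X n)) - integral\<^sup>L M (f 0)) / X n"
   using ev by eventually_elim (use int0 \<delta> in "simp add: s_def")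
  ultimately show ?thesis by (rule Lim_transform_eventually)
 qed
 then show ?thesis unfolding DERIV_def tendsto_at_iff_sequentially by (auto simp: o_def)
qed

lemma compact_continuous_bounded:
 fixes f :: "'a::topological_space => real"
 assumes "compact K" "continuous_on K f"
 obtains C where "\<And>x. x \<in> K ==> \<bar>f x\<bar> \<le> C"
proof -
 have "bounded (f ` K)" using assms by (intro compact_imp_bounded compact_continuous_image)
 then show thesis using that unfolding bounded_iff by auto
qed

text \<open>The divergence theorem for compact support, from Fubini and translation invariance
  alone. Integrating the derivative along the segment from \<open>x\<close> to \<open>x + e\<close>
  gives \<open>F (x + e) - F x\<close>, whose integral over \<open>x\<close> is 0; integrating over
  \<open>x\<close> first gives the wanted integral at every point of the segment.\<close>

lemma integral_directional_derivative_eq_0: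
 fixes F :: "'a::euclidean_space => real"
 assumes der: "\<And>x. (F has_derivative F' x) (at x)"
  and cont: "continuous_on UNIV (\<lambda>x. F' x e)"
  and K: "compact K" "\<And>x. x \<notin> K ==> F x = 0"
 shows "integral\<^sup>L lborel (\<lambda>x. F' x e) = 0"
proof -
 \<comment> \<open>The points from which the segment in direction \<open>e\<close> meets
   \<open>K\<close>. The integrand \<open>h\<close> vanishes when its first argument is outside this
   compact set, which gives joint integrability.\<close>
 let ?L = "(\<lambda>(x, t). x - t *\<^sub>R e) ` (K \<times> {0..1::real})"
 define h where "h = (\<lambda>(x, t). F' (x + t *\<^sub>R e) e * indicator {0..1::real} t)"
 have zero: "F' x e = 0" if "x \<notin> K" for x
 proof -
  have "open (- K)" using K(1) compact_imp_closed by blast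
  then have "(F has_derivative (\<lambda>_. 0)) (at x)"
   using has_derivative_transform_within_open[of "\<lambda>_. 0" "\<lambda>_. 0" x UNIV "- K" F] K(2) that by auto
  from has_derivative_unique[OF der this] show ?thesis by simp
 qed
 have cF: "continuous_on UNIV F"
  by (rule continuous_at_imp_continuous_on) (simp add: has_derivative_continuous[OF der])
 have "continuous_on (?L \<times> {0..1}) (\<lambda>(x, t). F' (x + t *\<^sub>R e) e)"
  unfolding case_prod_beta' by (intro continuous_on_compose2[OF cont] continuous_intros) auto
 moreover have "compact (?L \<times> {0..1::real})"
  unfolding case_prod_beta' by (intro compact_Times compact_continuous_image continuous_intros K(1)) auto
 ultimately have "integrable lborel (\<lambda>z. indicator (?L \<times> {0..1}) z *\<^sub>R (\<lambda>(x, t). F' (x + t *\<^sub>R e) e) z)"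
  by (intro borel_integrable_compact)
 moreover have "indicator (?L \<times> {0..1}) z *\<^sub>R (\<lambda>(x, t). F' (x + t *\<^sub>R e) e) z = h z" for z
 proof (cases "fst z + snd z *\<^sub>R e \<in> K")
  case True
  then have "snd z \<in> {0..1} ==> fst z \<in> ?L" by (intro image_eqI[of _ _ "(fst z + snd z *\<^sub>R e, snd z)"]) auto
  then show ?thesis by (auto simp: h_def indicator_def split: prod.split)
 qed (auto simp: h_def zero split: prod.split)
 ultimately have "integrable (lborel \<Otimes>\<^sub>M lborel) h" by (simp add: lborel_prod)
 from lborel_pair.Fubini_integral[of "\<lambda>x t. h (x, t)"] this
 have fub: "(\<integral>t. (\<integral>x. h (x, t) \<partial>lborel) \<partial>lborel) = (\<integral>x. (\<integral>t. h (x, t) \<partial>lborel) \<partial>lborel)" by simp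
 have tr: "(\<integral>x. f (x + a) \<partial>lborel) = integral\<^sup>L lborel f" if "continuous_on UNIV f" for f :: "'a => real" and a
  using integral_distr[of "(+) a" lborel borel f] borel_measurable_continuous_onI[OF that]
  by (simp add: lborel_distr_plus add.commute[of a])
 have d: "((\<lambda>s. F (x + s *\<^sub>R e)) has_real_derivative F' (x + t *\<^sub>R e) e) (at t)" for x t
 proof -
  have "((\<lambda>s. x + s *\<^sub>R e) has_derivative (\<lambda>s. s *\<^sub>R e)) (at t)"
   by (auto intro!: derivative_eq_intros)
  from has_derivative_compose[OF this der] linear_scale[OF has_derivative_linear[OF der]]
  show ?thesis
   unfolding has_real_derivative_iff_has_vector_derivative has_vector_derivative_def by simp
 qed
 have "(\<lambda>x. indicator K x *\<^sub>R F x) = F" using K(2) by (auto simp: fun_eq_iff indicator_def)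
 then have iF: "integrable lborel F"
  using borel_integrable_compact[OF K(1) continuous_on_subset[OF cF subset_UNIV]] by simp
 have "(\<integral>t. h (x, t) \<partial>lborel) = F (x + e) - F x" for x
  using integral_FTC_Icc_real[of 0 1 "\<lambda>s. F (x + s *\<^sub>R e)" "\<lambda>t. F' (x + t *\<^sub>R e) e"] d
   continuous_on_compose2[OF cont, of UNIV "\<lambda>t. x + t *\<^sub>R e"]
  by (simp add: h_def continuous_intros continuous_on_eq_continuous_at)
 moreover have "(\<integral>x. h (x, t) \<partial>lborel) = indicator {0..1} t * integral\<^sup>L lborel (\<lambda>x. F' x e)" for t
  using tr[OF cont, of "t *\<^sub>R e"] by (simp add: h_def mult.commute)
 moreover have "integrable lborel (\<lambda>x. F (x + e))"
  using integrable_distr[of "(+) e" lborel borel F] iF by (simp add: lborel_distr_plus add.commute)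
 ultimately show ?thesis using fub tr[OF cF, of e] iF by (simp add: mult.commute)
qed

lemma smooth_on_transform:
 assumes "smooth_on g S" "open S" "\<And>x. x \<in> S ==> f x = g x"
 shows "smooth_on f S"
 using smooth_on_cong[OF assms(2,3)] assms(1) by simp

lemma has_derivative_cong_open:
 assumes "(f has_derivative f') (at x)" "open S" "x \<in> S" "\<And>y. y \<in> S ==> f y = g y"
 shows "(g has_derivative f') (at x)"
 using has_derivative_transform_within_open[OF assms(1-3)] assms(4) by simp

subsection \<open>Fields of linear and bilinear maps\<close>

lemma linear_euclidean_expansion:
 fixes L :: "'b::euclidean_space => 'c::real_vector"
 assumes "linear L"
 shows "L w = (\<Sum>b\<in>Basis. (w \<bullet> b) *\<^sub>R L b)"
proof -
 have "L (\<Sum>b\<in>Basis. (w \<bullet> b) *\<^sub>R b) = (\<Sum>b\<in>Basis. (w \<bullet> b) *\<^sub>R L b)"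
  using assms by (simp add: linear_sum linear_scale)
 thus ?thesis by (simp add: euclidean_representation)
qed

text \<open>The product rule for a linear map that depends on the point. Only its values on fixed
  vectors are differentiated, so no norm on a space of linear maps is involved.\<close>

lemma has_derivative_linear_field:
 fixes L :: "'a::real_normed_vector => 'b::euclidean_space => 'c::real_normed_vector"
 assumes S: "open S" "x \<in> S" and lin: "\<And>y. y \<in> S ==> linear (L y)"
  and L': "\<And>w. ((\<lambda>y. L y w) has_derivative L' w) (at x)"
  and Z: "(Z has_derivative Z') (at x)"
 shows "((\<lambda>y. L y (Z y)) has_derivative (\<lambda>v. L' (Z x) v + L x (Z' v))) (at x)"
proof -
 have "((\<lambda>y. \<Sum>b\<in>Basis. (Z y \<bullet> b) *\<^sub>R L y b) has_derivative
   (\<lambda>v. \<Sum>b\<in>Basis. (Z x \<bullet> b) *\<^sub>R L' b v + (Z' v \<bullet> b) *\<^sub>R L x b)) (at x)"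
  by (intro derivative_intros L' Z bounded_linear.has_derivative[OF bounded_linear_inner_left Z])
 moreover have "(\<Sum>b\<in>Basis. (Z y \<bullet> b) *\<^sub>R L y b) = L y (Z y)" if "y \<in> S" for y
  using linear_euclidean_expansion[OF lin[OF that], of "Z y"] by simp
 ultimately have *: "((\<lambda>y. L y (Z y)) has_derivative
   (\<lambda>v. \<Sum>b\<in>Basis. (Z x \<bullet> b) *\<^sub>R L' b v + (Z' v \<bullet> b) *\<^sub>R L x b)) (at x)"
  by (rule has_derivative_cong_open[OF _ S])
 have "((\<lambda>y. \<Sum>b\<in>Basis. (Z x \<bullet> b) *\<^sub>R L y b) has_derivative
   (\<lambda>v. \<Sum>b\<in>Basis. (Z x \<bullet> b) *\<^sub>R L' b v)) (at x)"
  by (intro derivative_intros L')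
 moreover have "(\<Sum>b\<in>Basis. (Z x \<bullet> b) *\<^sub>R L y b) = L y (Z x)" if "y \<in> S" for y
  using linear_euclidean_expansion[OF lin[OF that], of "Z x"] by simp
 ultimately have "((\<lambda>y. L y (Z x)) has_derivative
   (\<lambda>v. \<Sum>b\<in>Basis. (Z x \<bullet> b) *\<^sub>R L' b v)) (at x)"
  by (rule has_derivative_cong_open[OF _ S])
 \<comment> \<open>\<open>L'\<close> is given for each vector separately; its linear dependence on
   the vector follows from uniqueness of derivatives.\<close>
 then have "L' (Z x) = (\<lambda>v. \<Sum>b\<in>Basis. (Z x \<bullet> b) *\<^sub>R L' b v)"
  using has_derivative_unique[OF L'] by blast
 moreover have "(\<Sum>b\<in>Basis. (Z' v \<bullet> b) *\<^sub>R L x b) = L x (Z' v)" for v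
  using linear_euclidean_expansion[OF lin[OF S(2)], of "Z' v"] by simp
 ultimately show ?thesis using * by (simp add: sum.distrib)
qed

lemma has_derivative_bilinear_field:
 fixes C :: "'a::real_normed_vector => 'b::euclidean_space => 'd::euclidean_space => 'c::real_normed_vector"
 assumes S: "open S" "x \<in> S" and bil: "\<And>y. y \<in> S ==> bilinear (C y)"
  and C': "\<And>u w. ((\<lambda>y. C y u w) has_derivative C' u w) (at x)"
  and X: "(X has_derivative X') (at x)" and Y: "(Y has_derivative Y') (at x)"
 shows "((\<lambda>y. C y (X y) (Y y)) has_derivative
   (\<lambda>v. C' (X x) (Y x) v + C x (X' v) (Y x) + C x (X x) (Y' v))) (at x)"
proof -
 have "((\<lambda>y. C y (X y) w) has_derivative (\<lambda>v. C' (X x) w v + C x (X' v) w)) (at x)" for w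
  using bil by (intro has_derivative_linear_field[OF S, of "\<lambda>y u. C y u w"] C' X) (simp add: bilinear_def)
 from has_derivative_linear_field[OF S, of "\<lambda>y. C y (X y)", OF _ this Y] bil
 show ?thesis by (simp add: bilinear_def)
qed

lemma smooth_on_linear_field:
 fixes L :: "'a::real_normed_vector => 'b::euclidean_space => 'c::real_normed_vector"
 assumes S: "open S" and lin: "\<And>y. y \<in> S ==> linear (L y)"
  and L: "\<And>w. smooth_on (\<lambda>y. L y w) S" and Z: "smooth_on Z S"
 shows "smooth_on (\<lambda>y. L y (Z y)) S"
proof -
 have "smooth_on (\<lambda>y. \<Sum>b\<in>Basis. (Z y \<bullet> b) *\<^sub>R L y b) S"
  by (intro smooth_intros S L Z)
 moreover have "L y (Z y) = (\<Sum>b\<in>Basis. (Z y \<bullet> b) *\<^sub>R L y b)" if "y \<in> S" for y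
  using linear_euclidean_expansion[OF lin[OF that], of "Z y"] .
 ultimately show ?thesis using smooth_on_cong[OF S, of "\<lambda>y. L y (Z y)"] by simp
qed

lemma smooth_on_bilinear_field:
 fixes C :: "'a::real_normed_vector => 'b::euclidean_space => 'd::euclidean_space => 'c::real_normed_vector"
 assumes S: "open S" and bil: "\<And>y. y \<in> S ==> bilinear (C y)"
  and C: "\<And>u w. smooth_on (\<lambda>y. C y u w) S" and X: "smooth_on X S" and Y: "smooth_on Y S"
 shows "smooth_on (\<lambda>y. C y (X y) (Y y)) S"
proof -
 have "smooth_on (\<lambda>y. C y (X y) w) S" for w
  by (rule smooth_on_linear_field[OF S, of "\<lambda>y u. C y u w", OF _ C X]) (use bil in "simp add: bilinear_def")
 from smooth_on_linear_field[OF S, of "\<lambda>y. C y (X y)", OF _ this Y] bil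
 show ?thesis by (simp add: bilinear_def)
qed

lemma smooth_on_frechet_apply:
 fixes f :: "'a::euclidean_space => 'c::real_normed_vector"
 assumes "open S" "smooth_on f S" "smooth_on Z S"
 shows "smooth_on (\<lambda>x. \<D> f (at x) (Z x)) S"
 by (rule smooth_on_linear_field[OF assms(1), of "\<lambda>x. \<D> f (at x)"])
   (use assms in "auto intro: smooth_on_frechet smooth_on_differentiable linear_frechet_derivative")

section \<open>Charts\<close>

text \<open>The Jacobian of the coordinate change at \<open>p\<close>. \<open>to_coord\<close> and
  \<open>of_coord\<close> are the cases in which one of the charts is the chosen chart at
  \<open>p\<close>, so that their inversion rules are instances of the cocycle rule
  \<open>transition_comp\<close>.\<close>

definition transition_derivative ::
  "('m, 'n::finite) chart => ('m, 'n) chart => 'm => real^'n => real^'n" where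
 "transition_derivative c d p = \<D> (snd d \<circ> chart_inv c) (at (snd c p))"

lemma to_coord_eq: "to_coord A c p = transition_derivative (chart_at A p) c p"
 by (simp add: to_coord_def transition_derivative_def)

lemma of_coord_eq: "of_coord A c p = transition_derivative c (chart_at A p) p"
 by (simp add: of_coord_def transition_derivative_def)

locale manifold =
 fixes A :: "('m::{t2_space,second_countable_topology}, 'n::finite) chart set"
 assumes atlas: "smooth_atlas A"
begin

lemma open_chart: "c \<in> A ==> open (fst c)" "c \<in> A ==> open (snd c ` fst c)"
 using atlas by (auto simp: smooth_atlas_def)

lemma chart_homeomorphism:
 "c \<in> A ==> homeomorphism (fst c) (snd c ` fst c) (snd c) (chart_inv c)"
 using atlas by (auto simp: smooth_atlas_def)

lemma chart_inv_chart [simp]: "c \<in> A ==> p \<in> fst c ==> chart_inv c (snd c p) = p"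
 using chart_homeomorphism unfolding homeomorphism_def by blast

lemma chart_at: "chart_at A p \<in> A" "p \<in> fst (chart_at A p)"
proof -
 have "\<exists>c. c \<in> A \<and> p \<in> fst c" using atlas unfolding smooth_atlas_def by blast
 then show "chart_at A p \<in> A" "p \<in> fst (chart_at A p)"
  unfolding chart_at_def by (metis (mono_tags, lifting) someI_ex)+
qed

lemma ex_chart: obtains c where "c \<in> A" "p \<in> fst c"
 using chart_at by blast

lemma continuous_on_chart: "c \<in> A ==> continuous_on (fst c) (snd c)"
 and continuous_on_chart_inv: "c \<in> A ==> continuous_on (snd c ` fst c) (chart_inv c)"
 using chart_homeomorphism unfolding homeomorphism_def by blast+

lemma chart_image_Int: "c \<in> A ==> snd c ` (fst c \<inter> W) = {x \<in> snd c ` fst c. chart_inv c x \<in> W}"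
 by auto

lemma open_chart_image: "c \<in> A ==> open W ==> open (snd c ` (fst c \<inter> W))"
 using continuous_open_preimage[OF continuous_on_chart_inv open_chart(2), of c W]
 unfolding chart_image_Int by (simp add: vimage_def Int_def)

lemma open_chart_preimage:
 assumes "c \<in> A" "open V"
 shows "open {p \<in> fst c. snd c p \<in> V}"
 using continuous_open_preimage[OF continuous_on_chart[OF assms(1)] open_chart(1)[OF assms(1)] assms(2)]
 by (simp add: vimage_def Int_def)

lemma smooth_transition:
 "c \<in> A ==> d \<in> A ==> smooth_on (snd d \<circ> chart_inv c) (snd c ` (fst c \<inter> fst d))"
 using atlas by (auto simp: smooth_atlas_def)

lemma has_derivative_transition:
 assumes "c \<in> A" "d \<in> A" "p \<in> fst c" "p \<in> fst d"
 shows "(snd d \<circ> chart_inv c has_derivative transition_derivative c d p) (at (snd c p))"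
 unfolding transition_derivative_def
 by (rule smooth_on_has_derivative[OF smooth_transition open_chart_image])
   (use assms open_chart in auto)

lemma linear_transition:
 assumes "c \<in> A" "d \<in> A" "p \<in> fst c" "p \<in> fst d"
 shows "linear (transition_derivative c d p)"
 using has_derivative_transition[OF assms] has_derivative_linear by blast

lemma chart_change_has_derivative:
 assumes "c \<in> A" "d \<in> A" "p \<in> fst c" "p \<in> fst d"
  and f: "(f \<circ> chart_inv d has_derivative f') (at (snd d p))"
 shows "(f \<circ> chart_inv c has_derivative f' \<circ> transition_derivative c d p) (at (snd c p))"
proof -
 have "((\<lambda>x. (f \<circ> chart_inv d) ((snd d \<circ> chart_inv c) x)) has_derivative
   (\<lambda>v. f' (transition_derivative c d p v))) (at (snd c p))"
  by (rule has_derivative_compose[OF has_derivative_transition[OF assms(1-4)]])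
    (simp only: o_apply chart_inv_chart[OF assms(1,3)] f[unfolded o_def])
 then have "(f \<circ> chart_inv c has_derivative (\<lambda>v. f' (transition_derivative c d p v))) (at (snd c p))"
  by (rule has_derivative_transform_within_open[OF _ open_chart_image[OF assms(1) open_chart(1)[OF assms(2)]]])
    (use assms in auto)
 then show ?thesis by (simp add: o_def)
qed

lemma transition_comp:
 assumes "c \<in> A" "d \<in> A" "e \<in> A" "p \<in> fst c" "p \<in> fst d" "p \<in> fst e"
 shows "transition_derivative d e p (transition_derivative c d p v) = transition_derivative c e p v"
proof -
 have "(snd e \<circ> chart_inv c has_derivative transition_derivative d e p \<circ> transition_derivative c d p) (at (snd c p))"
  by (rule chart_change_has_derivative) (use assms has_derivative_transition in auto)
 then have "transition_derivative c e p = transition_derivative d e p \<circ> transition_derivative c d p"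
  unfolding transition_derivative_def[of c e] by (rule frechet_derivativeI)
 then show ?thesis by simp
qed

lemma transition_self:
 assumes "c \<in> A" "p \<in> fst c"
 shows "transition_derivative c c p v = v"
proof -
 have "(snd c \<circ> chart_inv c has_derivative (\<lambda>x. x)) (at (snd c p))"
  by (rule has_derivative_transform_within_open[OF has_derivative_ident open_chart(2)[OF assms(1)]])
    (use assms in auto)
 then have "transition_derivative c c p = (\<lambda>x. x)"
  unfolding transition_derivative_def by (rule frechet_derivativeI)
 then show ?thesis by simp
qed

lemma to_coord_of_coord [simp]: "c \<in> A ==> p \<in> fst c ==> to_coord A c p (of_coord A c p v) = v"
 and of_coord_to_coord [simp]: "c \<in> A ==> p \<in> fst c ==> of_coord A c p (to_coord A c p v) = v"
 and to_coord_chart_at [simp]: "to_coord A (chart_at A p) p v = v"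
 and of_coord_chart_at [simp]: "of_coord A (chart_at A p) p v = v"
 using chart_at by (simp_all add: to_coord_eq of_coord_eq transition_comp transition_self)

lemma transition_to_coord:
 "c \<in> A ==> d \<in> A ==> p \<in> fst c ==> p \<in> fst d ==>
  transition_derivative c d p (to_coord A c p v) = to_coord A d p v"
 using chart_at by (simp add: to_coord_eq transition_comp)

lemma to_coord_of_coord':
 "c \<in> A ==> d \<in> A ==> p \<in> fst c ==> p \<in> fst d ==>
  to_coord A d p (of_coord A c p v) = transition_derivative c d p v"
 using chart_at by (simp add: to_coord_eq of_coord_eq transition_comp)

lemma linear_to_coord: "c \<in> A ==> p \<in> fst c ==> linear (to_coord A c p)"
 and linear_of_coord: "c \<in> A ==> p \<in> fst c ==> linear (of_coord A c p)"
 using linear_transition chart_at by (auto simp: to_coord_eq of_coord_eq)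

lemma vf_rep_at [simp]: "c \<in> A ==> p \<in> fst c ==> vf_rep A c X (snd c p) = to_coord A c p (X p)"
 by (simp add: vf_rep_def)

lemma smooth_vf_rep: "smooth_vf_on A W X ==> c \<in> A ==> smooth_on (vf_rep A c X) (snd c ` (fst c \<inter> W))"
 by (simp add: smooth_vf_on_def)

lemma smooth_fun_rep: "smooth_fun_on A W f ==> c \<in> A ==> smooth_on (f \<circ> chart_inv c) (snd c ` (fst c \<inter> W))"
 by (simp add: smooth_fun_on_def)

lemma vf_rep_has_derivative:
 assumes "smooth_vf_on A W X" "open W" "c \<in> A" "p \<in> fst c" "p \<in> W"
 shows "(vf_rep A c X has_derivative \<D> (vf_rep A c X) (at (snd c p))) (at (snd c p))"
 by (rule smooth_on_has_derivative[OF smooth_vf_rep open_chart_image]) (use assms in auto)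

lemma fun_rep_has_derivative:
 assumes "smooth_fun_on A W f" "open W" "c \<in> A" "p \<in> fst c" "p \<in> W"
 shows "(f \<circ> chart_inv c has_derivative \<D> (f \<circ> chart_inv c) (at (snd c p))) (at (snd c p))"
 by (rule smooth_on_has_derivative[OF smooth_fun_rep open_chart_image]) (use assms in auto)

section \<open>Derivations and brackets in an arbitrary chart\<close>

lemma vf_apply_chart:
 assumes "smooth_fun_on A W f" "open W" "c \<in> A" "p \<in> fst c" "p \<in> W"
 shows "vf_apply A X f p = \<D> (f \<circ> chart_inv c) (at (snd c p)) (to_coord A c p (X p))"
proof -
 have "(f \<circ> chart_inv (chart_at A p) has_derivative
   \<D> (f \<circ> chart_inv c) (at (snd c p)) \<circ> transition_derivative (chart_at A p) c p)
   (at (snd (chart_at A p) p))"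
  using assms chart_at by (intro chart_change_has_derivative fun_rep_has_derivative)
 then show ?thesis unfolding vf_apply_def by (simp add: frechet_derivativeI to_coord_eq)
qed

text \<open>The bracket is defined in the chosen chart of the point. Passing to the chart
  \<open>c\<close> adds to each of its two terms the second derivative of the transition map in the
  directions \<open>X p\<close> and \<open>Y p\<close>; being symmetric, it cancels in the
  difference.\<close>

lemma lie_bracket_chart:
 assumes X: "smooth_vf_on A W X" and Y: "smooth_vf_on A W Y" and W: "open W" "p \<in> W"
  and c: "c \<in> A" "p \<in> fst c"
 shows "to_coord A c p (lie_bracket A X Y p) =
   \<D> (vf_rep A c Y) (at (snd c p)) (to_coord A c p (X p)) -
   \<D> (vf_rep A c X) (at (snd c p)) (to_coord A c p (Y p))"
proof -
 define d where "d = chart_at A p"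
 have d: "d \<in> A" "p \<in> fst d" using chart_at by (auto simp: d_def)
 define \<tau> where "\<tau> = snd c \<circ> chart_inv d"
 define V where "V = snd d ` (fst d \<inter> (fst c \<inter> W))"
 define y where "y = snd d p"
 have V: "open V" "y \<in> V"
  unfolding V_def y_def using open_chart_image[OF d(1)] open_chart(1)[OF c(1)] W d c by auto
 have \<tau>: "smooth_on \<tau> V" unfolding \<tau>_def V_def
  by (rule smooth_on_subset[OF smooth_transition]) (use c d in auto)
 let ?D = "\<lambda>u w. \<D> (\<lambda>z. \<D> \<tau> (at z) u) (at y) w"
 \<comment> \<open>The chain rule for one field read in both charts; \<open>?D\<close> is the
   non-tensorial term.\<close>
 have key: "\<D> (vf_rep A c Z) (at (snd c p)) (transition_derivative d c p v) =
   ?D (Z p) v + transition_derivative d c p (\<D> (vf_rep A d Z) (at y) v)"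
  if Z: "smooth_vf_on A W Z" for Z v
 proof -
  have "((\<lambda>z. \<D> \<tau> (at z) (vf_rep A d Z z)) has_derivative
   (\<lambda>v. \<D> (\<lambda>z. \<D> \<tau> (at z) (vf_rep A d Z y)) (at y) v +
      \<D> \<tau> (at y) (\<D> (vf_rep A d Z) (at y) v))) (at y)"
  proof (rule has_derivative_linear_field[OF V, of "\<lambda>z. \<D> \<tau> (at z)"])
   show "\<And>z. z \<in> V ==> linear (\<D> \<tau> (at z))"
    using smooth_on_differentiable[OF \<tau> V(1)] linear_frechet_derivative by blast
   show "\<And>w. ((\<lambda>z. \<D> \<tau> (at z) w) has_derivative
     \<D> (\<lambda>z. \<D> \<tau> (at z) w) (at y)) (at y)"
    using smooth_on_has_derivative[OF smooth_on_frechet[OF \<tau>] V] .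
   show "(vf_rep A d Z has_derivative \<D> (vf_rep A d Z) (at y)) (at y)"
    unfolding y_def using vf_rep_has_derivative[OF Z W(1) d W(2)] .
  qed
  moreover have "\<D> \<tau> (at z) (vf_rep A d Z z) = vf_rep A c Z (\<tau> z)" if z: "z \<in> V" for z
  proof -
   obtain q where q: "q \<in> fst d" "q \<in> fst c" "z = snd d q" using z by (auto simp: V_def)
   then show ?thesis
    using transition_to_coord[OF d(1) c(1) q(1,2)] d c
    by (simp add: \<tau>_def transition_derivative_def)
  qed
  ultimately have "((\<lambda>z. vf_rep A c Z (\<tau> z)) has_derivative
   (\<lambda>v. \<D> (\<lambda>z. \<D> \<tau> (at z) (vf_rep A d Z y)) (at y) v +
      \<D> \<tau> (at y) (\<D> (vf_rep A d Z) (at y) v))) (at y)"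
   by (rule has_derivative_cong_open[OF _ V])
  moreover have "((\<lambda>z. vf_rep A c Z (\<tau> z)) has_derivative
   (\<lambda>v. \<D> (vf_rep A c Z) (at (snd c p)) (transition_derivative d c p v))) (at y)"
   unfolding y_def \<tau>_def
   by (rule has_derivative_compose[OF has_derivative_transition])
     (use vf_rep_has_derivative[OF Z W(1) c W(2)] d c in auto)
  ultimately have "(\<lambda>v. \<D> (vf_rep A c Z) (at (snd c p)) (transition_derivative d c p v)) =
   (\<lambda>v. \<D> (\<lambda>z. \<D> \<tau> (at z) (vf_rep A d Z y)) (at y) v +
      \<D> \<tau> (at y) (\<D> (vf_rep A d Z) (at y) v))"
   using has_derivative_unique by blast
  from fun_cong[OF this, of v] show ?thesis
   using d by (simp add: y_def \<tau>_def transition_derivative_def) (simp add: d_def)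
 qed
 have sym: "?D u w = ?D w u" for u w using second_derivative_symmetric[OF V \<tau>] .
 have "to_coord A c p (lie_bracket A X Y p) = transition_derivative d c p
   (\<D> (vf_rep A d Y) (at y) (X p) - \<D> (vf_rep A d X) (at y) (Y p))"
  by (simp add: lie_bracket_def Let_def to_coord_eq d_def y_def)
 also have "\<dots> = transition_derivative d c p (\<D> (vf_rep A d Y) (at y) (X p)) -
   transition_derivative d c p (\<D> (vf_rep A d X) (at y) (Y p))"
  using linear_diff[OF linear_transition[OF d(1) c(1) d(2) c(2)]] .
 also have "\<dots> = \<D> (vf_rep A c Y) (at (snd c p)) (transition_derivative d c p (X p)) -
   \<D> (vf_rep A c X) (at (snd c p)) (transition_derivative d c p (Y p))"
  using key[OF X, of "Y p"] key[OF Y, of "X p"] sym[of "X p" "Y p"] by simp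
 finally show ?thesis by (simp add: to_coord_eq d_def)
qed

lemma smooth_vf_on_subset: "smooth_vf_on A W X ==> W' \<subseteq> W ==> smooth_vf_on A W' X"
 unfolding smooth_vf_on_def by (meson smooth_on_subset image_mono Int_mono order_refl)

text \<open>Fields with constant coordinates in a chart extend a given tangent vector; they are the
  test fields in the arguments on chart independence and uniqueness.\<close>

lemma smooth_of_coord:
 assumes "c \<in> A"
 shows "smooth_vf_on A (fst c) (\<lambda>q. of_coord A c q u)"
 unfolding smooth_vf_on_def
proof
 fix d assume d: "d \<in> A"
 let ?V = "snd d ` (fst d \<inter> fst c)"
 have V: "open ?V" using open_chart_image[OF d open_chart(1)[OF assms]] .
 have "smooth_on (\<lambda>x. \<D> (snd d \<circ> chart_inv c) (at ((snd c \<circ> chart_inv d) x)) u) ?V"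
  by (rule smooth_on_compose[OF smooth_on_frechet[OF smooth_transition[OF assms d]]
     smooth_transition[OF d assms] V open_chart_image[OF assms open_chart(1)[OF d]]])
    (use assms d in auto)
 moreover have "vf_rep A d (\<lambda>q. of_coord A c q u) x =
   \<D> (snd d \<circ> chart_inv c) (at ((snd c \<circ> chart_inv d) x)) u" if x: "x \<in> ?V" for x
  using x assms d to_coord_of_coord'[OF assms d] by (auto simp: vf_rep_def transition_derivative_def)
 ultimately show "smooth_on (vf_rep A d (\<lambda>q. of_coord A c q u)) ?V"
  by (rule smooth_on_transform[OF _ V])
qed

end

section \<open>Levi-Civita connection\<close>

subsection \<open>Christoffel symbols\<close>

definition metric_matrix_on :: "(real^'n => real^'n^'n) => (real^'n) set => bool" where
 "metric_matrix_on G S \<longleftrightarrow> open S \<and> smooth_on G S \<and> (\<forall>x\<in>S. transpose (G x) = G x \<and> det (G x) \<noteq> 0)"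

text \<open>The Christoffel symbols as a bilinear map of vectors: the lowered vector is given by the
  Koszul formula for constant fields. No manifold occurs, so that families of metrics can be
  differentiated on a fixed open set of coordinates.\<close>

definition christoffel ::
  "(real^'n => real^'n^'n) => real^'n => real^'n => real^'n => real^'n" where
 "christoffel G x u v = matrix_inv (G x) *v
   (\<chi> l. (v \<bullet> (\<D> G (at x) u *v axis l 1) + u \<bullet> (\<D> G (at x) v *v axis l 1)
      - u \<bullet> (\<D> G (at x) (axis l 1) *v v)) / 2)"

lemma vec_eq_sum_axis: "(w :: real^'n) = (\<Sum>*l. w $ l *\<^sub>R axis l 1)"
 using basis_expansion[of w] by (simp add: scalar_mult_eq_scaleR)

lemma symmetric_matrix_inner:
 fixes M :: "real^'n^'n"
 assumes "transpose M = M"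
 shows "u \<bullet> (M *v w) = w \<bullet> (M *v u)"
 using dot_lmul_matrix[of u M w] assms by (metis inner_commute vector_transpose_matrix)

lemma linear_matrix_arg: "linear (\<lambda>M::real^'n^'m. M *v v)"
 by (auto simp: linear_iff matrix_vector_mult_def vec_eq_iff sum.distrib algebra_simps sum_distrib_left)

context
 fixes G :: "real^'n => real^'n^'n" and S x
 assumes G: "metric_matrix_on G S" and x: "x \<in> S"
begin

lemma metric_matrix_derivative: "(G has_derivative \<D> G (at x)) (at x)"
 using G x smooth_on_has_derivative unfolding metric_matrix_on_def by blast

lemma metric_matrix_linear: "linear (\<D> G (at x))"
 using metric_matrix_derivative has_derivative_linear by blast

lemma metric_matrix_symmetric: "transpose (G x) = G x" and metric_matrix_det: "det (G x) \<noteq> 0"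
 using G x by (auto simp: metric_matrix_on_def)

lemma metric_matrix_derivative_symmetric:
 "transpose (\<D> G (at x) u) = \<D> G (at x) u"
proof -
 have "((\<lambda>y. transpose (G y)) has_derivative (\<lambda>u. transpose (\<D> G (at x) u))) (at x)"
  by (rule bounded_linear.has_derivative[OF _ metric_matrix_derivative])
    (auto simp: linear_conv_bounded_linear[symmetric] linear_iff transpose_def vec_eq_iff)
 then have "(G has_derivative (\<lambda>u. transpose (\<D> G (at x) u))) (at x)"
  by (rule has_derivative_cong_open[of _ _ _ S]) (use G x in "auto simp: metric_matrix_on_def")
 then have "(\<lambda>u. transpose (\<D> G (at x) u)) = \<D> G (at x)"
  using metric_matrix_derivative has_derivative_unique by blast
 then show ?thesis by metis
qed

lemmas metric_matrix_derivative_inner = symmetric_matrix_inner[OF metric_matrix_derivative_symmetric]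
lemmas metric_matrix_inner = symmetric_matrix_inner[OF metric_matrix_symmetric]

text \<open>The definition prescribes the pairing with basis vectors, and both sides are linear in
  \<open>w\<close>. The algebraic properties of \<open>christoffel\<close> follow from this formula
  and nondegeneracy.\<close>

lemma christoffel_inner:
 "2 * (christoffel G x u v \<bullet> (G x *v w)) =
   v \<bullet> (\<D> G (at x) u *v w) + u \<bullet> (\<D> G (at x) v *v w)
   - u \<bullet> (\<D> G (at x) w *v v)"
proof -
 let ?D = "\<D> G (at x)"
 define k where "k = (\<lambda>w. (v \<bullet> (?D u *v w) + u \<bullet> (?D v *v w) - u \<bullet> (?D w *v v)) / 2)"
 have lin: "linear k"
  using metric_matrix_linear unfolding k_def
  by (intro linearI) (auto simp: linear_add linear_scale matrix_vector_right_distrib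
    matrix_vector_mult_scaleR inner_right_distrib matrix_vector_mult_add_rdistrib algebra_simps
    diff_divide_distrib add_divide_distrib scaleR_matrix_vector_assoc[symmetric])
 have "christoffel G x u v \<bullet> (G x *v w) = w \<bullet> (G x *v christoffel G x u v)"
  by (rule metric_matrix_inner)
 also have "G x *v christoffel G x u v = (\<chi> l. k (axis l 1))"
  unfolding christoffel_def k_def
  by (simp add: matrix_vector_mul_assoc matrix_inv_right[OF metric_matrix_det])
 also have "w \<bullet> (\<chi> l. k (axis l 1)) = (\<Sum>*l. w $ l * k (axis l 1))"
  by (simp add: inner_vec_def)
 also have "\<dots> = k (\<Sum>*l. w $ l *\<^sub>R axis l 1)"
  by (simp add: linear_sum[OF lin] linear_scale[OF lin])
 also have "\<dots> = k w" using vec_eq_sum_axis[of w] by simp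
 finally show ?thesis by (simp add: k_def)
qed

lemma metric_matrix_nondegenerate:
 assumes "\<And>w. u \<bullet> (G x *v w) = v \<bullet> (G x *v w)"
 shows "u = v"
proof -
 have "(u - v) \<bullet> (G x *v w) = 0" for w using assms by (simp add: inner_diff_left)
 then have "(u - v) \<bullet> (G x *v (matrix_inv (G x) *v (u - v))) = 0" by blast
 then show ?thesis
  by (simp add: matrix_vector_mul_assoc matrix_inv_right[OF metric_matrix_det])
qed

lemma christoffel_symmetric: "christoffel G x u v = christoffel G x v u"
proof (rule metric_matrix_nondegenerate)
 fix w show "christoffel G x u v \<bullet> (G x *v w) = christoffel G x v u \<bullet> (G x *v w)"
  using christoffel_inner[of u v w] christoffel_inner[of v u w]
   metric_matrix_derivative_inner[of u w v] by linarith
qed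

lemma bilinear_christoffel: "bilinear (christoffel G x)"
proof -
 let ?D = "\<D> G (at x)"
 note [simp] = linear_add[OF metric_matrix_linear] linear_scale[OF metric_matrix_linear]
 have "christoffel G x (u + u') v = christoffel G x u v + christoffel G x u' v" for u u' v
 proof (rule metric_matrix_nondegenerate)
  fix w
  show "christoffel G x (u + u') v \<bullet> (G x *v w) = (christoffel G x u v + christoffel G x u' v) \<bullet> (G x *v w)"
   using christoffel_inner[of "u + u'" v w] christoffel_inner[of u v w] christoffel_inner[of u' v w]
   by (simp add: matrix_vector_mult_add_rdistrib inner_add_left inner_add_right)
 qed
 moreover have "christoffel G x (r *\<^sub>R u) v = r *\<^sub>R christoffel G x u v" for u v r
 proof (rule metric_matrix_nondegenerate)
  fix w
  have "2 * (christoffel G x (r *\<^sub>R u) v \<bullet> (G x *v w)) = r * (2 * (christoffel G x u v \<bullet> (G x *v w)))"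
   unfolding christoffel_inner
   by (simp add: scaleR_matrix_vector_assoc[symmetric] algebra_simps)
  then show "christoffel G x (r *\<^sub>R u) v \<bullet> (G x *v w) = (r *\<^sub>R christoffel G x u v) \<bullet> (G x *v w)"
   by simp
 qed
 ultimately have "linear (\<lambda>u. christoffel G x u v)" for v by (intro linearI)
 moreover from this have "linear (christoffel G x u)" for u
  by (subst christoffel_symmetric[abs_def]) simp
 ultimately show ?thesis by (simp add: bilinear_def)
qed

lemma christoffel_metric:
 "v \<bullet> (\<D> G (at x) u *v w) =
   christoffel G x u v \<bullet> (G x *v w) + christoffel G x u w \<bullet> (G x *v v)"
 using christoffel_inner[of u v w] christoffel_inner[of u w v]
  metric_matrix_derivative_inner[of v u w]
  metric_matrix_derivative_inner[of u w v] metric_matrix_derivative_inner[of u v w] by linarith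

end

lemma smooth_on_christoffel:
 assumes "metric_matrix_on G S"
 shows "smooth_on (\<lambda>x. christoffel G x u v) S"
 using assms unfolding christoffel_def metric_matrix_on_def
 by (intro smooth_intros smooth_on_frechet) auto

lemma smooth_family_christoffel:
 fixes G :: "real => real^'n => real^'n^'n"
 assumes G: "smooth_on (\<lambda>(t, x). G t x) (I \<times> U)" and I: "open I" "open U"
  and det: "\<And>t x. t \<in> I ==> x \<in> U ==> det (G t x) \<noteq> 0"
 shows "smooth_on (\<lambda>(t, x). christoffel (G t) x u v) (I \<times> U)"
proof -
 have op: "open (I \<times> U)" using I by (simp add: open_Times)
 have D: "smooth_on (\<lambda>z. \<D> (G (fst z)) (at (snd z)) w) (I \<times> U)" for w
  using smooth_family_frechet[OF G I] by (simp add: case_prod_beta')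
 have G': "smooth_on (\<lambda>z. G (fst z) (snd z)) (I \<times> U)" using G by (simp add: case_prod_beta')
 show ?thesis
  unfolding christoffel_def case_prod_beta'
  by (intro smooth_intros op D G') (use det in auto)
qed

subsection \<open>The metric in a chart\<close>

context manifold
begin

context
 fixes g :: "('m, 'n) bilin_field"
 assumes g: "pseudo_riemannian_metric A g"
begin

lemma bilinear_metric: "bilinear (g p)" and metric_symmetric: "g p u v = g p v u"
 and smooth_metric: "c \<in> A ==> smooth_on (bilin_comp A c g) (snd c ` fst c)"
 using g unfolding pseudo_riemannian_metric_def by blast+

lemma metric_nondegenerate: "(\<And>v. g p u v = 0) ==> u = 0"
 using g unfolding pseudo_riemannian_metric_def by blast

lemma metric_simps:
 "g p (u + u') v = g p u v + g p u' v" "g p v (u + u') = g p v u + g p v u'"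
 "g p (r *\<^sub>R u) v = r * g p u v" "g p v (r *\<^sub>R u) = r * g p v u"
 "g p (u - u') v = g p u v - g p u' v" "g p v (u - u') = g p v u - g p v u'"
 "g p 0 v = 0" "g p v 0 = 0"
 using bilinear_metric
 by (simp_all add: bilinear_ladd bilinear_radd bilinear_lmul bilinear_rmul bilinear_lsub bilinear_rsub
   bilinear_lzero bilinear_rzero)

lemma metric_chart:
 assumes "c \<in> A" "p \<in> fst c"
 shows "g p u v = to_coord A c p u \<bullet> (bilin_comp A c g (snd c p) *v to_coord A c p v)"
proof -
 have e: "w = (\<Sum>*i. to_coord A c p w $ i *\<^sub>R coord_field A c i p)" for w
 proof -
  have "w = of_coord A c p (\<Sum>*i. to_coord A c p w $ i *\<^sub>R axis i 1)"
   using assms by (simp add: vec_eq_sum_axis[symmetric])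
  also have "\<dots> = (\<Sum>*i. to_coord A c p w $ i *\<^sub>R coord_field A c i p)"
   using linear_of_coord[OF assms] by (simp add: linear_sum linear_scale coord_field_def)
  finally show ?thesis .
 qed
 have "g p u v = g p (\<Sum>*i. to_coord A c p u $ i *\<^sub>R coord_field A c i p)
   (\<Sum>*j. to_coord A c p v $ j *\<^sub>R coord_field A c j p)"
  using e[of u] e[of v] by simp
 also have "\<dots> = (\<Sum>(i, j)\<in>UNIV \<times> UNIV. g p (to_coord A c p u $ i *\<^sub>R coord_field A c i p)
   (to_coord A c p v $ j *\<^sub>R coord_field A c j p))"
  by (rule bilinear_sum[OF bilinear_metric])
 also have "\<dots> = (\<Sum>*i j. to_coord A c p u $ i * (to_coord A c p v $ j *
   g p (coord_field A c i p) (coord_field A c j p)))"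
  by (simp add: sum.cartesian_product metric_simps mult_ac)
 also have "\<dots> = to_coord A c p u \<bullet> (bilin_comp A c g (snd c p) *v to_coord A c p v)"
  using assms by (simp add: inner_vec_def matrix_vector_mult_def bilin_comp_def Let_def sum_distrib_left mult_ac)
 finally show ?thesis .
qed

lemma metric_matrix_chart:
 assumes c: "c \<in> A"
 shows "metric_matrix_on (bilin_comp A c g) (snd c ` fst c)"
 unfolding metric_matrix_on_def
proof (intro conjI ballI open_chart(2)[OF c] smooth_metric[OF c])
 fix x assume "x \<in> snd c ` fst c"
 then obtain p where p: "p \<in> fst c" "x = snd c p" by auto
 show "transpose (bilin_comp A c g x) = bilin_comp A c g x"
  by (simp add: transpose_def bilin_comp_def Let_def metric_symmetric vec_eq_iff)
 have "inj ((*v) (bilin_comp A c g x))"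
 proof (rule linear_injective_0[THEN iffD2, rule_format])
  fix v assume "bilin_comp A c g x *v v = 0"
  then have "g p u (of_coord A c p v) = 0" for u
   using metric_chart[OF c p(1), of u "of_coord A c p v"] c p by simp
  then have "of_coord A c p v = 0" using metric_nondegenerate metric_symmetric by metis
  then have "to_coord A c p (of_coord A c p v) = 0"
   using linear_to_coord[OF c p(1)] linear_0 by metis
  then show "v = 0" using c p by simp
 qed simp
 then show "det (bilin_comp A c g x) \<noteq> 0"
  by (metis invertible_left_inverse matrix_left_invertible_injective invertible_det_nz)
qed

lemma metric_rep:
 assumes "c \<in> A" "x \<in> snd c ` fst c"
 shows "((\<lambda>q. g q (Y q) (Z q)) \<circ> chart_inv c) x = vf_rep A c Y x \<bullet> (bilin_comp A c g x *v vf_rep A c Z x)"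
 using assms by (auto simp: metric_chart)

lemma smooth_metric_apply:
 assumes "open W" "smooth_vf_on A W Y" "smooth_vf_on A W Z"
 shows "smooth_fun_on A W (\<lambda>q. g q (Y q) (Z q))"
 unfolding smooth_fun_on_def
proof
 fix c assume c: "c \<in> A"
 show "smooth_on ((\<lambda>q. g q (Y q) (Z q)) \<circ> chart_inv c) (snd c ` (fst c \<inter> W))"
 proof (rule smooth_on_transform)
  show "smooth_on (\<lambda>x. vf_rep A c Y x \<bullet> (bilin_comp A c g x *v vf_rep A c Z x)) (snd c ` (fst c \<inter> W))"
   by (intro smooth_intros open_chart_image c assms smooth_vf_rep
     smooth_on_subset[OF smooth_metric[OF c]]) auto
 qed (use metric_rep[OF c] c assms open_chart_image in auto)
qed

lemma metric_vf_apply: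
 assumes W: "open W" "p \<in> W" and Y: "smooth_vf_on A W Y" and Z: "smooth_vf_on A W Z"
  and c: "c \<in> A" "p \<in> fst c"
 defines "x \<equiv> snd c p"
 shows "vf_apply A X (\<lambda>q. g q (Y q) (Z q)) p =
  \<D> (vf_rep A c Y) (at x) (to_coord A c p (X p)) \<bullet> (bilin_comp A c g x *v to_coord A c p (Z p))
  + to_coord A c p (Y p) \<bullet> (\<D> (bilin_comp A c g) (at x) (to_coord A c p (X p)) *v to_coord A c p (Z p))
  + to_coord A c p (Y p) \<bullet> (bilin_comp A c g x *v \<D> (vf_rep A c Z) (at x) (to_coord A c p (X p)))"
proof -
 note x = x_def
 have xs: "x \<in> snd c ` fst c" using c by (auto simp: x)
 have bl: "bounded_bilinear ((*v) :: real^'n^'n => real^'n => real^'n)"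
 proof -
  have "bilinear ((*v) :: real^'n^'n => real^'n => real^'n)"
   by (auto simp: bilinear_def linear_matrix_arg)
  then show ?thesis by (simp add: bilinear_conv_bounded_bilinear)
 qed
 have Yd: "(vf_rep A c Y has_derivative \<D> (vf_rep A c Y) (at x)) (at x)"
  and Zd: "(vf_rep A c Z has_derivative \<D> (vf_rep A c Z) (at x)) (at x)"
  unfolding x using vf_rep_has_derivative[OF _ W(1) c W(2)] Y Z by blast+
 have "((\<lambda>x. vf_rep A c Y x \<bullet> (bilin_comp A c g x *v vf_rep A c Z x)) has_derivative
   (\<lambda>v. vf_rep A c Y x \<bullet> (bilin_comp A c g x *v \<D> (vf_rep A c Z) (at x) v +
     \<D> (bilin_comp A c g) (at x) v *v vf_rep A c Z x) +
     \<D> (vf_rep A c Y) (at x) v \<bullet> (bilin_comp A c g x *v vf_rep A c Z x))) (at x)"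
  by (intro has_derivative_inner bounded_bilinear.FDERIV[OF bl] Yd Zd
    metric_matrix_derivative[OF metric_matrix_chart[OF c(1)] xs])
 then have "((\<lambda>q. g q (Y q) (Z q)) \<circ> chart_inv c has_derivative
   (\<lambda>v. vf_rep A c Y x \<bullet> (bilin_comp A c g x *v \<D> (vf_rep A c Z) (at x) v +
     \<D> (bilin_comp A c g) (at x) v *v vf_rep A c Z x) +
     \<D> (vf_rep A c Y) (at x) v \<bullet> (bilin_comp A c g x *v vf_rep A c Z x))) (at x)"
  by (rule has_derivative_cong_open[OF _ open_chart(2)[OF c(1)] xs]) (rule metric_rep[OF c(1), symmetric])
 then show ?thesis
  using vf_apply_chart[OF smooth_metric_apply[OF W(1) Y Z] W(1) c W(2), of X] c
  by (simp add: frechet_derivativeI x inner_add_right)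
qed

text \<open>The right-hand side of the Koszul formula. It is built from derivations, brackets and
  the metric, hence free of charts; it ties the coordinate formula to any torsion-free metric
  connection and so carries both chart independence and uniqueness.\<close>

definition koszul :: "('m, 'n) vfield => ('m, 'n) vfield => ('m, 'n) vfield => 'm => real" where
 "koszul X Y Z p = vf_apply A X (\<lambda>q. g q (Y q) (Z q)) p + vf_apply A Y (\<lambda>q. g q (X q) (Z q)) p
   - vf_apply A Z (\<lambda>q. g q (X q) (Y q)) p + g p (lie_bracket A X Y p) (Z p)
   - g p (lie_bracket A X Z p) (Y p) - g p (lie_bracket A Y Z p) (X p)"

definition covariant_rep ::
  "('m, 'n) chart => ('m, 'n) vfield => ('m, 'n) vfield => 'm => real^'n" where
 "covariant_rep c X Y p = \<D> (vf_rep A c Y) (at (snd c p)) (to_coord A c p (X p)) +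
   christoffel (bilin_comp A c g) (snd c p) (to_coord A c p (X p)) (to_coord A c p (Y p))"

lemma koszul_chart:
 assumes W: "open W" "p \<in> W" and X: "smooth_vf_on A W X" and Y: "smooth_vf_on A W Y"
  and Z: "smooth_vf_on A W Z" and c: "c \<in> A" "p \<in> fst c"
 shows "koszul X Y Z p = 2 * (covariant_rep c X Y p \<bullet> (bilin_comp A c g (snd c p) *v to_coord A c p (Z p)))"
proof -
 define x where "x = snd c p"
 have xs: "x \<in> snd c ` fst c" using c by (auto simp: x_def)
 note G = metric_matrix_chart[OF c(1)]
 note ap = metric_vf_apply[OF W _ _ c, folded x_def]
 note lb = lie_bracket_chart[OF _ _ W c, folded x_def]
 note mi = metric_matrix_inner[OF G xs]
 show ?thesis
  unfolding koszul_def metric_chart[OF c] lb[OF X Y] lb[OF X Z] lb[OF Y Z] ap[OF Y Z] ap[OF X Z] ap[OF X Y]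
   covariant_rep_def inner_add_left inner_diff_left distrib_left x_def[symmetric]
   christoffel_inner[OF G xs]
  using mi[of "to_coord A c p (Y p)" "\<D> (vf_rep A c Z) (at x) (to_coord A c p (X p))"]
   mi[of "to_coord A c p (X p)" "\<D> (vf_rep A c Z) (at x) (to_coord A c p (Y p))"]
   mi[of "to_coord A c p (X p)" "\<D> (vf_rep A c Y) (at x) (to_coord A c p (Z p))"]
   mi[of "to_coord A c p (Y p)" "\<D> (vf_rep A c X) (at x) (to_coord A c p (Z p))"]
  by (simp add: inner_add_left inner_diff_left)
qed

lemma koszul_unique:
 assumes N: "torsion_free A N" "metric_connection A g N"
  and W: "open W" "p \<in> W" and X: "smooth_vf_on A W X" and Y: "smooth_vf_on A W Y" and Z: "smooth_vf_on A W Z"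
 shows "koszul X Y Z p = 2 * g p (N X Y p) (Z p)"
proof -
 have t: "lie_bracket A X' Y' p = N X' Y' p - N Y' X' p" if "smooth_vf_on A W X'" "smooth_vf_on A W Y'" for X' Y'
  using N(1) that W unfolding torsion_free_def by metis
 have m: "vf_apply A X' (\<lambda>q. g q (Y' q) (Z' q)) p = g p (N X' Y' p) (Z' p) + g p (Y' p) (N X' Z' p)"
  if "smooth_vf_on A W X'" "smooth_vf_on A W Y'" "smooth_vf_on A W Z'" for X' Y' Z'
  using N(2) that W unfolding metric_connection_def by metis
 show ?thesis
  unfolding koszul_def t[OF X Y] t[OF X Z] t[OF Y Z] m[OF X Y Z] m[OF Y X Z] m[OF Z X Y] metric_simps
  using metric_symmetric[of p "X p"] metric_symmetric[of p "Y p"] by simp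
qed

definition covariant :: "('m, 'n) connection" where
 "covariant X Y p = covariant_rep (chart_at A p) X Y p"

text \<open>In every chart the pairing of \<open>covariant_rep\<close> with a vector is half of the
  Koszul expression, which knows no chart; nondegeneracy of the metric does the rest.\<close>

lemma covariant_chart:
 assumes W: "open W" "p \<in> W" and X: "smooth_vf_on A W X" and Y: "smooth_vf_on A W Y"
  and c: "c \<in> A" "p \<in> fst c"
 shows "to_coord A c p (covariant X Y p) = covariant_rep c X Y p"
proof -
 define x where "x = snd c p"
 have xs: "x \<in> snd c ` fst c" using c by (auto simp: x_def)
 let ?d = "chart_at A p"
 have d: "?d \<in> A" "p \<in> fst ?d" using chart_at by auto
 show ?thesis
 proof (rule metric_matrix_nondegenerate[OF metric_matrix_chart[OF c(1)] xs])
  fix w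
  define Z where "Z = (\<lambda>q. of_coord A c q w)"
  have Z: "smooth_vf_on A (W \<inter> fst c) Z"
   unfolding Z_def using smooth_vf_on_subset[OF smooth_of_coord[OF c(1)]] by blast
  have W': "open (W \<inter> fst c)" "p \<in> W \<inter> fst c" using W c open_chart(1)[OF c(1)] by auto
  have XY: "smooth_vf_on A (W \<inter> fst c) X" "smooth_vf_on A (W \<inter> fst c) Y"
   using smooth_vf_on_subset X Y by blast+
  have Zp: "to_coord A c p (Z p) = w" using c by (simp add: Z_def)
  have "to_coord A c p (covariant X Y p) \<bullet> (bilin_comp A c g x *v w) = g p (covariant X Y p) (Z p)"
   by (simp add: metric_chart[OF c] Zp x_def)
  also have "2 * \<dots> = koszul X Y Z p"
   using koszul_chart[OF W' XY Z d] by (simp add: metric_chart[OF d] covariant_def)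
  also have "\<dots> = 2 * (covariant_rep c X Y p \<bullet> (bilin_comp A c g x *v w))"
   using koszul_chart[OF W' XY Z c] by (simp add: Zp x_def)
  finally show "to_coord A c p (covariant X Y p) \<bullet> (bilin_comp A c g x *v w) =
    covariant_rep c X Y p \<bullet> (bilin_comp A c g x *v w)" by simp
 qed
qed

lemma smooth_covariant:
 assumes W: "open W" and X: "smooth_vf_on A W X" and Y: "smooth_vf_on A W Y"
 shows "smooth_vf_on A W (covariant X Y)"
 unfolding smooth_vf_on_def
proof
 fix c assume c: "c \<in> A"
 let ?S = "snd c ` (fst c \<inter> W)"
 have S: "open ?S" using open_chart_image c W by blast
 note G = metric_matrix_chart[OF c]
 show "smooth_on (vf_rep A c (covariant X Y)) ?S"
 proof (rule smooth_on_transform[OF _ S])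
  show "smooth_on (\<lambda>x. \<D> (vf_rep A c Y) (at x) (vf_rep A c X x) +
    christoffel (bilin_comp A c g) x (vf_rep A c X x) (vf_rep A c Y x)) ?S"
  proof (rule smooth_on_add[OF S smooth_on_frechet_apply[OF S smooth_vf_rep[OF Y c] smooth_vf_rep[OF X c]]])
   show "smooth_on (\<lambda>x. christoffel (bilin_comp A c g) x (vf_rep A c X x) (vf_rep A c Y x)) ?S"
    by (rule smooth_on_bilinear_field[OF S, of "christoffel (bilin_comp A c g)", OF _ _
       smooth_vf_rep[OF X c] smooth_vf_rep[OF Y c]])
      (auto intro: bilinear_christoffel[OF G] smooth_on_subset[OF smooth_on_christoffel[OF G]])
  qed
  show "vf_rep A c (covariant X Y) x = \<D> (vf_rep A c Y) (at x) (vf_rep A c X x) +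
    christoffel (bilin_comp A c g) x (vf_rep A c X x) (vf_rep A c Y x)" if "x \<in> ?S" for x
   using that c covariant_chart[OF W _ X Y c] by (auto simp: covariant_rep_def)
 qed
qed

end

end

section \<open>Existence and uniqueness of the Levi-Civita connection\<close>

context manifold
begin

lemma smooth_lie_bracket:
 assumes W: "open W" and X: "smooth_vf_on A W X" and Y: "smooth_vf_on A W Y"
 shows "smooth_vf_on A W (lie_bracket A X Y)"
 unfolding smooth_vf_on_def
proof
 fix c assume c: "c \<in> A"
 let ?S = "snd c ` (fst c \<inter> W)"
 have S: "open ?S" using open_chart_image c W by blast
 show "smooth_on (vf_rep A c (lie_bracket A X Y)) ?S"
 proof (rule smooth_on_transform[OF _ S])
  show "smooth_on (\<lambda>x. \<D> (vf_rep A c Y) (at x) (vf_rep A c X x) -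
    \<D> (vf_rep A c X) (at x) (vf_rep A c Y x)) ?S"
   by (intro smooth_on_diff S smooth_on_frechet_apply smooth_vf_rep X Y c)
  show "vf_rep A c (lie_bracket A X Y) x = \<D> (vf_rep A c Y) (at x) (vf_rep A c X x) -
    \<D> (vf_rep A c X) (at x) (vf_rep A c Y x)" if "x \<in> ?S" for x
   using that c lie_bracket_chart[OF X Y W _ c] by auto
 qed
qed

lemma vf_rep_add: "c \<in> A ==> x \<in> snd c ` fst c ==>
  vf_rep A c (\<lambda>q. X q + Y q) x = vf_rep A c X x + vf_rep A c Y x"
 by (auto simp: linear_add[OF linear_to_coord])

lemma vf_rep_scaleR: "c \<in> A ==> x \<in> snd c ` fst c ==>
  vf_rep A c (\<lambda>q. f q *\<^sub>R X q) x = f (chart_inv c x) *\<^sub>R vf_rep A c X x"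
 by (auto simp: linear_scale[OF linear_to_coord])

lemma smooth_vf_add:
 assumes "open W" "smooth_vf_on A W X" "smooth_vf_on A W Y"
 shows "smooth_vf_on A W (\<lambda>q. X q + Y q)"
 unfolding smooth_vf_on_def
proof
 fix c assume c: "c \<in> A"
 show "smooth_on (vf_rep A c (\<lambda>q. X q + Y q)) (snd c ` (fst c \<inter> W))"
  by (rule smooth_on_transform[OF smooth_on_add[OF _ smooth_vf_rep[OF assms(2) c] smooth_vf_rep[OF assms(3) c]]])
    (use open_chart_image[OF c assms(1)] vf_rep_add[OF c] in auto)
qed

lemma smooth_vf_scaleR:
 assumes "open W" "smooth_fun_on A W f" "smooth_vf_on A W X"
 shows "smooth_vf_on A W (\<lambda>q. f q *\<^sub>R X q)"
 unfolding smooth_vf_on_def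
proof
 fix c assume c: "c \<in> A"
 show "smooth_on (vf_rep A c (\<lambda>q. f q *\<^sub>R X q)) (snd c ` (fst c \<inter> W))"
  by (rule smooth_on_transform[OF smooth_on_scaleR[OF _ smooth_fun_rep[OF assms(2) c] smooth_vf_rep[OF assms(3) c]]])
    (use open_chart_image[OF c assms(1)] vf_rep_scaleR[OF c] in auto)
qed

context
 fixes g :: "('m, 'n) bilin_field"
 assumes g: "pseudo_riemannian_metric A g"
begin

lemma covariant_affine: "affine_connection A (covariant g)"
 unfolding affine_connection_def
proof (intro allI impI)
 fix W X X' Y Y' f
 assume *: "open W \<and> smooth_vf_on A W X \<and> smooth_vf_on A W X' \<and>
    smooth_vf_on A W Y \<and> smooth_vf_on A W Y' \<and> smooth_fun_on A W f"
 then have W: "open W" and X: "smooth_vf_on A W X" and X': "smooth_vf_on A W X'"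
  and Y: "smooth_vf_on A W Y" and Y': "smooth_vf_on A W Y'" and f: "smooth_fun_on A W f" by auto
 have "covariant g (\<lambda>q. X q + X' q) Y p = covariant g X Y p + covariant g X' Y p \<and>
   covariant g (\<lambda>q. f q *\<^sub>R X q) Y p = f p *\<^sub>R covariant g X Y p \<and>
   covariant g X (\<lambda>q. Y q + Y' q) p = covariant g X Y p + covariant g X Y' p \<and>
   covariant g X (\<lambda>q. f q *\<^sub>R Y q) p = vf_apply A X f p *\<^sub>R Y p + f p *\<^sub>R covariant g X Y p" if p: "p \<in> W" for p
 proof -
  define c where "c = chart_at A p"
  define x where "x = snd c p"
  have c: "c \<in> A" "p \<in> fst c" using chart_at by (auto simp: c_def)
  have xs: "x \<in> snd c ` fst c" using c by (auto simp: x_def)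
  have S: "open (snd c ` fst c)" using open_chart(2)[OF c(1)] .
  have tc: "to_coord A c p v = v" for v by (simp add: c_def)
  have ci: "chart_inv c x = p" using c by (simp add: x_def)
  have Yx: "vf_rep A c Z x = Z p" for Z using c by (simp add: x_def tc)
  have Yd: "(vf_rep A c Y has_derivative \<D> (vf_rep A c Y) (at x)) (at x)"
   and Yd': "(vf_rep A c Y' has_derivative \<D> (vf_rep A c Y') (at x)) (at x)"
   unfolding x_def using vf_rep_has_derivative[OF _ W c p] Y Y' by blast+
  have fd: "(f \<circ> chart_inv c has_derivative \<D> (f \<circ> chart_inv c) (at x)) (at x)"
   unfolding x_def using fun_rep_has_derivative[OF f W c p] .
  have bil: "bilinear (christoffel (bilin_comp A c g) x)"
   using bilinear_christoffel[OF metric_matrix_chart[OF g c(1)] xs] .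
  have cov: "covariant g Z1 Z2 p = \<D> (vf_rep A c Z2) (at x) (Z1 p) +
    christoffel (bilin_comp A c g) x (Z1 p) (Z2 p)" for Z1 Z2
   by (simp add: covariant_def[OF g] covariant_rep_def[OF g] c_def[symmetric] x_def tc)
  have lin: "linear (\<D> (vf_rep A c Y) (at x))"
   using Yd has_derivative_linear by blast
  have sum: "\<D> (vf_rep A c (\<lambda>q. Y q + Y' q)) (at x) =
    (\<lambda>v. \<D> (vf_rep A c Y) (at x) v + \<D> (vf_rep A c Y') (at x) v)"
   by (rule frechet_derivativeI,
     rule has_derivative_cong_open[OF has_derivative_add[OF Yd Yd'] S xs])
     (rule vf_rep_add[OF c(1), symmetric])
  have "(vf_rep A c (\<lambda>q. f q *\<^sub>R Y q) has_derivative
    (\<lambda>v. (f \<circ> chart_inv c) x *\<^sub>R \<D> (vf_rep A c Y) (at x) v +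
       \<D> (f \<circ> chart_inv c) (at x) v *\<^sub>R vf_rep A c Y x)) (at x)"
   by (rule has_derivative_cong_open[OF has_derivative_scaleR[OF fd Yd] S xs])
     (simp only: vf_rep_scaleR[OF c(1)] o_apply)
  note scale = frechet_derivativeI[OF this]
  have "vf_apply A X f p = \<D> (f \<circ> chart_inv c) (at x) (X p)"
   using vf_apply_chart[OF f W c p] by (simp add: x_def tc)
  then show ?thesis
   unfolding cov sum scale
   by (simp add: ci Yx linear_add[OF lin] linear_scale[OF lin] bilinear_ladd[OF bil] bilinear_radd[OF bil]
     bilinear_lmul[OF bil] bilinear_rmul[OF bil] algebra_simps)
 qed
 then show "smooth_vf_on A W (covariant g X Y) \<and>
    (\<forall>p\<in>W. covariant g (\<lambda>q. X q + X' q) Y p = covariant g X Y p + covariant g X' Y p \<and>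
   covariant g (\<lambda>q. f q *\<^sub>R X q) Y p = f p *\<^sub>R covariant g X Y p \<and>
   covariant g X (\<lambda>q. Y q + Y' q) p = covariant g X Y p + covariant g X Y' p \<and>
   covariant g X (\<lambda>q. f q *\<^sub>R Y q) p = vf_apply A X f p *\<^sub>R Y p + f p *\<^sub>R covariant g X Y p)"
  using smooth_covariant[OF g W X Y] by blast
qed

lemma covariant_torsion_free: "torsion_free A (covariant g)"
 unfolding torsion_free_def
proof (intro allI impI ballI)
 fix W X Y p assume "open W \<and> smooth_vf_on A W X \<and> smooth_vf_on A W Y" "p \<in> W"
 have "snd (chart_at A p) p \<in> snd (chart_at A p) ` fst (chart_at A p)" using chart_at by auto
 note christoffel_symmetric[OF metric_matrix_chart[OF g chart_at(1)] this, of "X p" "Y p"]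
 then show "covariant g X Y p - covariant g Y X p = lie_bracket A X Y p"
  by (simp add: covariant_def[OF g] covariant_rep_def[OF g] lie_bracket_def Let_def)
qed

lemma covariant_metric: "metric_connection A g (covariant g)"
 unfolding metric_connection_def
proof (intro allI impI ballI)
 fix W X Y Z p
 assume "open W \<and> smooth_vf_on A W X \<and> smooth_vf_on A W Y \<and> smooth_vf_on A W Z" and p: "p \<in> W"
 then have W: "open W" and Y: "smooth_vf_on A W Y" and Z: "smooth_vf_on A W Z" by auto
 define c where "c = chart_at A p"
 have c: "c \<in> A" "p \<in> fst c" using chart_at by (auto simp: c_def)
 have tc: "to_coord A c p v = v" for v by (simp add: c_def)
 have xs: "snd c p \<in> snd c ` fst c" using c by auto
 note G = metric_matrix_chart[OF g c(1)]
 have cov: "covariant g Z1 Z2 p = \<D> (vf_rep A c Z2) (at (snd c p)) (Z1 p) +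
   christoffel (bilin_comp A c g) (snd c p) (Z1 p) (Z2 p)" for Z1 Z2
  by (simp add: covariant_def[OF g] covariant_rep_def[OF g] c_def)
 show "vf_apply A X (\<lambda>q. g q (Y q) (Z q)) p = g p (covariant g X Y p) (Z p) + g p (Y p) (covariant g X Z p)"
  unfolding metric_vf_apply[OF g W p Y Z c] metric_chart[OF g c] tc
  using christoffel_metric[OF G xs, of "Y p" "X p" "Z p"]
   metric_matrix_inner[OF G xs, of "Y p" "christoffel (bilin_comp A c g) (snd c p) (X p) (Z p)"]
  by (simp add: cov inner_add_left matrix_vector_right_distrib inner_add_right)
qed

text \<open>\<open>covariant g\<close> is the witness that makes the choice operator
  meaningful.\<close>

lemma levi_civita_props:
 "affine_connection A (levi_civita A g)" "torsion_free A (levi_civita A g)"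
 "metric_connection A g (levi_civita A g)"
 using someI[of "\<lambda>N. affine_connection A N \<and> torsion_free A N \<and> metric_connection A g N" "covariant g"]
  covariant_affine covariant_torsion_free covariant_metric
 unfolding levi_civita_def by auto

text \<open>The chosen connection is arbitrary on non-smooth arguments, but on smooth fields the
  Koszul expression determines its values.\<close>

lemma levi_civita_covariant:
 assumes W: "open W" "p \<in> W" and X: "smooth_vf_on A W X" and Y: "smooth_vf_on A W Y"
 shows "levi_civita A g X Y p = covariant g X Y p"
proof -
 have "g p (levi_civita A g X Y p - covariant g X Y p) u = 0" for u
 proof -
  define c where "c = chart_at A p"
  have c: "c \<in> A" "p \<in> fst c" using chart_at by (auto simp: c_def)
  define Z where "Z = (\<lambda>q. of_coord A c q u)"
  have W': "open (W \<inter> fst c)" "p \<in> W \<inter> fst c" using W c open_chart(1)[OF c(1)] by auto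
  have Z: "smooth_vf_on A (W \<inter> fst c) Z"
   unfolding Z_def using smooth_vf_on_subset[OF smooth_of_coord[OF c(1)]] by blast
  have XY: "smooth_vf_on A (W \<inter> fst c) X" "smooth_vf_on A (W \<inter> fst c) Y"
   using smooth_vf_on_subset X Y by blast+
  have "Z p = u" by (simp add: Z_def c_def)
  then show ?thesis
   using koszul_unique[OF g levi_civita_props(2,3) W' XY Z]
    koszul_unique[OF g covariant_torsion_free covariant_metric W' XY Z]
   by (simp add: metric_simps[OF g])
 qed
 then show ?thesis using metric_nondegenerate[OF g] by (metis eq_iff_diff_eq_0)
qed

lemma levi_civita_chart:
 assumes "open W" "p \<in> W" "smooth_vf_on A W X" "smooth_vf_on A W Y" "c \<in> A" "p \<in> fst c"
 shows "to_coord A c p (levi_civita A g X Y p) =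
   \<D> (vf_rep A c Y) (at (snd c p)) (to_coord A c p (X p)) +
   christoffel (bilin_comp A c g) (snd c p) (to_coord A c p (X p)) (to_coord A c p (Y p))"
 using covariant_chart[OF g assms] levi_civita_covariant[OF assms(1-4)]
 by (simp add: covariant_rep_def[OF g])

lemma smooth_levi_civita:
 assumes "open W" "smooth_vf_on A W X" "smooth_vf_on A W Y"
 shows "smooth_vf_on A W (levi_civita A g X Y)"
proof -
 have "smooth_fun_on A W (\<lambda>_. 0)"
  unfolding smooth_fun_on_def o_def by (auto intro!: smooth_on_const open_chart_image assms)
 then show ?thesis using levi_civita_props(1) assms unfolding affine_connection_def by blast
qed

end

end

section \<open>Curvature in coordinates\<close>

definition coefficients_on :: "'n::finite coefficients => (real^'n) set => bool" where
 "coefficients_on C S \<longleftrightarrow> open S \<and> (\<forall>x\<in>S. bilinear (C x)) \<and> (\<forall>u v. smooth_on (\<lambda>x. C x u v) S)"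

text \<open>Curvature evaluated on fields with constant coordinates, whose brackets vanish. The
  coefficients \<open>C\<close> need not be symmetric, so that the formula covers the Levi-Civita
  connection, contorted connections and families of both.\<close>

definition curvature_rep ::
  "'n::finite coefficients => real^'n => real^'n => real^'n => real^'n => real^'n" where
 "curvature_rep C x u w v = \<D> (\<lambda>y. C y u v) (at x) w - \<D> (\<lambda>y. C y w v) (at x) u
   + C x w (C x u v) - C x u (C x w v)"

definition ricci_rep ::
  "'n::finite coefficients => real^'n => real^'n => real^'n => real" where
 "ricci_rep C x u v = (\<Sum>*j. curvature_rep C x u (axis j 1) v $ j)"

text \<open>Metric and connection coefficients enter separately: \<open>C\<close> need not be the
  Christoffel symbols of \<open>G\<close>, since the contorsion is varied while the metric stays
  fixed.\<close>

definition scalar_rep ::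
  "(real^'n => real^'n^'n) => 'n::finite coefficients => real^'n => real" where
 "scalar_rep G C x = (\<Sum>*i m. matrix_inv (G x) $ i $ m * ricci_rep C x (axis i 1) (axis m 1))"

context
 fixes C :: "'n::finite coefficients" and S x
 assumes C: "coefficients_on C S" and x: "x \<in> S"
begin

lemma coefficients_bilinear: "bilinear (C x)" using C x by (auto simp: coefficients_on_def)

lemma coefficients_derivative:
 "((\<lambda>y. C y u v) has_derivative \<D> (\<lambda>y. C y u v) (at x)) (at x)"
 using C x smooth_on_has_derivative unfolding coefficients_on_def by blast

lemma coefficients_derivative_linear: "linear (\<D> (\<lambda>y. C y u v) (at x))"
 using coefficients_derivative has_derivative_linear by blast

lemma coefficients_derivative_bilinear: "bilinear (\<lambda>u v. \<D> (\<lambda>y. C y u v) (at x) w)"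
proof -
 have S: "open S" using C by (simp add: coefficients_on_def)
 have "\<D> (\<lambda>y. C y (u + u') v) (at x) =
   (\<lambda>w. \<D> (\<lambda>y. C y u v) (at x) w + \<D> (\<lambda>y. C y u' v) (at x) w)" for u u' v
  by (rule frechet_derivativeI,
    rule has_derivative_cong_open[OF has_derivative_add[OF coefficients_derivative coefficients_derivative] S x])
    (use C in "simp add: coefficients_on_def bilinear_ladd")
 moreover have "\<D> (\<lambda>y. C y v (u + u')) (at x) =
   (\<lambda>w. \<D> (\<lambda>y. C y v u) (at x) w + \<D> (\<lambda>y. C y v u') (at x) w)" for u u' v
  by (rule frechet_derivativeI,
    rule has_derivative_cong_open[OF has_derivative_add[OF coefficients_derivative coefficients_derivative] S x])
    (use C in "simp add: coefficients_on_def bilinear_radd")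
 moreover have "\<D> (\<lambda>y. C y (r *\<^sub>R u) v) (at x) =
   (\<lambda>w. r *\<^sub>R \<D> (\<lambda>y. C y u v) (at x) w)" for u v r
  by (rule frechet_derivativeI,
    rule has_derivative_cong_open[OF bounded_linear.has_derivative[OF bounded_linear_scaleR_right coefficients_derivative] S x])
    (use C in "simp add: coefficients_on_def bilinear_lmul")
 moreover have "\<D> (\<lambda>y. C y v (r *\<^sub>R u)) (at x) =
   (\<lambda>w. r *\<^sub>R \<D> (\<lambda>y. C y v u) (at x) w)" for u v r
  by (rule frechet_derivativeI,
    rule has_derivative_cong_open[OF bounded_linear.has_derivative[OF bounded_linear_scaleR_right coefficients_derivative] S x])
    (use C in "simp add: coefficients_on_def bilinear_rmul")
 ultimately show ?thesis by (auto simp: bilinear_def intro!: linearI)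
qed

lemma curvature_rep_linear:
 "linear (\<lambda>u. curvature_rep C x u w v)" "linear (\<lambda>w. curvature_rep C x u w v)"
 "linear (\<lambda>v. curvature_rep C x u w v)"
 unfolding curvature_rep_def
 by (auto intro!: linearI simp: coefficients_derivative_bilinear[THEN bilinear_ladd]
   coefficients_derivative_bilinear[THEN bilinear_radd] coefficients_derivative_bilinear[THEN bilinear_lmul]
   coefficients_derivative_bilinear[THEN bilinear_rmul] coefficients_bilinear[THEN bilinear_ladd]
   coefficients_bilinear[THEN bilinear_radd] coefficients_bilinear[THEN bilinear_lmul]
   coefficients_bilinear[THEN bilinear_rmul] coefficients_derivative_linear[THEN linear_add]
   coefficients_derivative_linear[THEN linear_scale] algebra_simps)

lemma curvature_rep_diagonal: "curvature_rep C x u u v = 0"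
 by (simp add: curvature_rep_def)

lemma ricci_rep_bilinear: "bilinear (ricci_rep C x)"
 by (auto simp: bilinear_def ricci_rep_def curvature_rep_linear[THEN linear_add]
   curvature_rep_linear[THEN linear_scale] sum.distrib sum_distrib_left intro!: linearI)

end

context manifold
begin

definition represents ::
  "('m, 'n) chart => ('m, 'n) connection => 'n::finite coefficients => bool" where
 "represents c N C \<longleftrightarrow> coefficients_on C (snd c ` fst c) \<and>
   (\<forall>W X Y. open W \<and> smooth_vf_on A W X \<and> smooth_vf_on A W Y \<longrightarrow> smooth_vf_on A W (N X Y) \<and>
    (\<forall>p\<in>W \<inter> fst c. to_coord A c p (N X Y p) =
     \<D> (vf_rep A c Y) (at (snd c p)) (to_coord A c p (X p)) +
     C (snd c p) (to_coord A c p (X p)) (to_coord A c p (Y p))))"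

text \<open>The second derivatives of \<open>Z\<close> cancel by symmetry, and the terms with
  derivatives of \<open>X\<close> and \<open>Y\<close> are absorbed by the bracket term. What is
  left depends only on the values of the fields at \<open>p\<close>.\<close>

lemma curvature_chart:
 assumes N: "represents c N C" and W: "open W" "p \<in> W" and c: "c \<in> A" "p \<in> fst c"
  and X: "smooth_vf_on A W X" and Y: "smooth_vf_on A W Y" and Z: "smooth_vf_on A W Z"
 shows "to_coord A c p (curvature A N X Y Z p) =
  curvature_rep C (snd c p) (to_coord A c p (X p)) (to_coord A c p (Y p)) (to_coord A c p (Z p))"
proof -
 define x where "x = snd c p"
 define S where "S = snd c ` (fst c \<inter> W)"
 have S: "open S" "x \<in> S" unfolding S_def x_def using open_chart_image c W by auto
 have C: "coefficients_on C (snd c ` fst c)" using N by (simp add: represents_def)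
 have CS: "coefficients_on C S"
  using C S smooth_on_subset[of _ "snd c ` fst c" S] unfolding coefficients_on_def S_def by blast
 define r where "r = vf_rep A c"
 define D where "D = (\<lambda>U. \<D> (r U) (at x))"
 note bil = coefficients_bilinear[OF CS S(2)]
 have rS: "smooth_on (r U) S" if "smooth_vf_on A W U" for U
  unfolding r_def S_def using smooth_vf_rep[OF that c(1)] .
 have rd: "(r U has_derivative D U) (at x)" if "smooth_vf_on A W U" for U
  unfolding D_def using smooth_on_has_derivative[OF rS[OF that] S] .
 have rx: "r U x = to_coord A c p (U p)" for U using c by (simp add: r_def x_def)
 have NN: "to_coord A c q (N U V q) = \<D> (r V) (at (snd c q)) (to_coord A c q (U q)) +
   C (snd c q) (to_coord A c q (U q)) (to_coord A c q (V q))"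
  if "smooth_vf_on A W U" "smooth_vf_on A W V" "q \<in> W" "q \<in> fst c" for U V q
  using N W that unfolding represents_def r_def by blast
 have NS: "smooth_vf_on A W (N U V)" if "smooth_vf_on A W U" "smooth_vf_on A W V" for U V
  using N W that unfolding represents_def by blast
 have DZ: "D Z = \<D> (r Z) (at x)" by (simp add: D_def)
 \<comment> \<open>All terms of one iterated covariant derivative; exchanging \<open>U\<close> and
   \<open>V\<close> and subtracting gives the curvature up to the bracket term.\<close>
 have key: "to_coord A c p (N V (N U Z) p) =
   \<D> (\<lambda>y. \<D> (r Z) (at y) (r U x)) (at x) (r V x) + D Z (D U (r V x)) +
   (\<D> (\<lambda>y. C y (r U x) (r Z x)) (at x) (r V x) + C x (D U (r V x)) (r Z x) +
    C x (r U x) (D Z (r V x))) + C x (r V x) (D Z (r U x) + C x (r U x) (r Z x))"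
  if U: "smooth_vf_on A W U" and V: "smooth_vf_on A W V" for U V
 proof -
  have rep: "\<D> (r Z) (at y) (r U y) + C y (r U y) (r Z y) = r (N U Z) y" if "y \<in> S" for y
   using that NN[OF U Z] c unfolding S_def r_def by auto
  have d1: "((\<lambda>y. \<D> (r Z) (at y) (r U y)) has_derivative
   (\<lambda>v. \<D> (\<lambda>y. \<D> (r Z) (at y) (r U x)) (at x) v + D Z (D U v))) (at x)"
   unfolding DZ
  proof (rule has_derivative_linear_field[OF S, of "\<lambda>y. \<D> (r Z) (at y)"])
   show "\<And>y. y \<in> S ==> linear (\<D> (r Z) (at y))"
    using smooth_on_differentiable[OF rS[OF Z] S(1)] linear_frechet_derivative by blast
   show "\<And>w. ((\<lambda>y. \<D> (r Z) (at y) w) has_derivative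
     \<D> (\<lambda>y. \<D> (r Z) (at y) w) (at x)) (at x)"
    using smooth_on_has_derivative[OF smooth_on_frechet[OF rS[OF Z]] S] .
  qed (rule rd[OF U])
  have d2: "((\<lambda>y. C y (r U y) (r Z y)) has_derivative
   (\<lambda>v. \<D> (\<lambda>y. C y (r U x) (r Z x)) (at x) v + C x (D U v) (r Z x) + C x (r U x) (D Z v))) (at x)"
   by (rule has_derivative_bilinear_field[OF S, of C])
     (use CS rd[OF U] rd[OF Z] coefficients_derivative[OF CS S(2)] in "auto simp: coefficients_on_def")
  have "(r (N U Z) has_derivative (\<lambda>v. (\<D> (\<lambda>y. \<D> (r Z) (at y) (r U x)) (at x) v + D Z (D U v)) +
    (\<D> (\<lambda>y. C y (r U x) (r Z x)) (at x) v + C x (D U v) (r Z x) + C x (r U x) (D Z v)))) (at x)"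
   by (rule has_derivative_cong_open[OF has_derivative_add[OF d1 d2] S rep])
  note d = frechet_derivativeI[OF this]
  show ?thesis
   using NN[OF V NS[OF U Z] W(2) c(2)] rep[OF S(2)]
   unfolding x_def[symmetric] d rx[symmetric] DZ[symmetric] by simp
 qed
 have sym: "\<D> (\<lambda>y. \<D> (r Z) (at y) u) (at x) v =
   \<D> (\<lambda>y. \<D> (r Z) (at y) v) (at x) u" for u v
  by (rule second_derivative_symmetric[OF S rS[OF Z]])
 have br: "to_coord A c p (lie_bracket A X Y p) = D Y (r X x) - D X (r Y x)"
  using lie_bracket_chart[OF X Y W c] unfolding rx D_def by (simp add: r_def x_def)
 have brN: "to_coord A c p (N (lie_bracket A X Y) Z p) = D Z (D Y (r X x) - D X (r Y x)) +
   C x (D Y (r X x) - D X (r Y x)) (r Z x)"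
  using NN[OF smooth_lie_bracket[OF W(1) X Y] Z W(2) c(2)] unfolding br
  by (simp add: D_def rx x_def[symmetric])
 have linZ: "linear (D Z)" using rd[OF Z] has_derivative_linear by blast
 have "to_coord A c p (curvature A N X Y Z p) = to_coord A c p (N Y (N X Z) p) - to_coord A c p (N X (N Y Z) p) +
   to_coord A c p (N (lie_bracket A X Y) Z p)"
  unfolding curvature_def using linear_to_coord[OF c] by (simp add: linear_add linear_diff)
 also have "\<dots> = curvature_rep C x (r X x) (r Y x) (r Z x)"
  unfolding key[OF X Y] key[OF Y X] brN curvature_rep_def sym[of "r X x" "r Y x"]
  by (simp add: linear_diff[OF linZ] bilinear_lsub[OF bil] bilinear_radd[OF bil])
 finally show ?thesis unfolding x_def[symmetric] rx .
qed

end

section \<open>Contorsion tensors and contorted connections in coordinates\<close>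

definition tensor12_rep ::
  "('m, 'n::finite) chart set => ('m, 'n) chart => ('m, 'n) tensor12_field =>
   real^'n => real^'n => real^'n => real^'n" where
 "tensor12_rep A c T x u v = (let p = chart_inv c x in
   to_coord A c p (T p (of_coord A c p u) (of_coord A c p v)))"

definition contorted_rep ::
  "('m, 'n::finite) chart set => ('m, 'n) chart => ('m, 'n) bilin_field => ('m, 'n) tensor12_field =>
   real^'n => real^'n => real^'n => real^'n" where
 "contorted_rep A c g T x u v = christoffel (bilin_comp A c g) x u v + tensor12_rep A c T x u v"

context manifold
begin

lemma tensor12_rep_chart:
 "c \<in> A ==> p \<in> fst c ==>
  to_coord A c p (T p u v) = tensor12_rep A c T (snd c p) (to_coord A c p u) (to_coord A c p v)"
 by (simp add: tensor12_rep_def Let_def)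

lemma bilinear_tensor12_rep:
 assumes "bilinear (T p)" "c \<in> A" "p \<in> fst c"
 shows "bilinear (tensor12_rep A c T (snd c p))"
 using assms(2,3) linear_to_coord[OF assms(2,3)] linear_of_coord[OF assms(2,3)]
 by (auto simp: bilinear_def tensor12_rep_def Let_def linear_add linear_scale bilinear_ladd[OF assms(1)]
   bilinear_radd[OF assms(1)] bilinear_lmul[OF assms(1)] bilinear_rmul[OF assms(1)] intro!: linearI)

lemma tensor12_rep_expand:
 assumes "bilinear (T p)" "c \<in> A" "p \<in> fst c"
 shows "tensor12_rep A c T (snd c p) u v = (\<Sum>*i j. (u $ i * v $ j) *\<^sub>R tensor12_comp A c T (snd c p) i j)"
proof -
 note bil = bilinear_tensor12_rep[of T p c, OF assms]
 have "tensor12_rep A c T (snd c p) u v = tensor12_rep A c T (snd c p) (\<Sum>*i. u $ i *\<^sub>R axis i 1) (\<Sum>*j. v $ j *\<^sub>R axis j 1)"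
  using vec_eq_sum_axis[of u] vec_eq_sum_axis[of v] by simp
 also have "\<dots> = (\<Sum>(i, j)\<in>UNIV \<times> UNIV. tensor12_rep A c T (snd c p) (u $ i *\<^sub>R axis i 1) (v $ j *\<^sub>R axis j 1))"
  by (rule bilinear_sum[OF bil])
 also have "\<dots> = (\<Sum>*i j. (u $ i * v $ j) *\<^sub>R tensor12_comp A c T (snd c p) i j)"
  using assms by (simp add: sum.cartesian_product bilinear_lmul[OF bil] bilinear_rmul[OF bil])
   (simp add: tensor12_rep_def tensor12_comp_def coord_field_def Let_def mult.commute)
 finally show ?thesis .
qed

lemma coefficients_tensor12_rep:
 assumes T: "smooth_tensor12 A T" and c: "c \<in> A"
 shows "coefficients_on (tensor12_rep A c T) (snd c ` fst c)"
 unfolding coefficients_on_def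
proof (intro conjI allI ballI open_chart(2)[OF c])
 have bil: "bilinear (T p)" for p using T by (simp add: smooth_tensor12_def)
 show "bilinear (tensor12_rep A c T x)" if "x \<in> snd c ` fst c" for x
  using that bilinear_tensor12_rep[OF bil c] by auto
 fix u v
 show "smooth_on (\<lambda>x. tensor12_rep A c T x u v) (snd c ` fst c)"
 proof (rule smooth_on_transform[OF _ open_chart(2)[OF c]])
  show "smooth_on (\<lambda>x. \<Sum>*i j. (u $ i * v $ j) *\<^sub>R tensor12_comp A c T x i j) (snd c ` fst c)"
   using T c by (intro smooth_on_sum smooth_on_scaleR smooth_on_const open_chart(2)) (auto simp: smooth_tensor12_def)
 qed (use tensor12_rep_expand[OF bil c] in auto)
qed

lemma smooth_tensor12_apply:
 assumes W: "open W" and T: "smooth_tensor12 A T" and X: "smooth_vf_on A W X" and Y: "smooth_vf_on A W Y"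
 shows "smooth_vf_on A W (\<lambda>p. T p (X p) (Y p))"
 unfolding smooth_vf_on_def
proof
 fix c assume c: "c \<in> A"
 let ?S = "snd c ` (fst c \<inter> W)"
 have S: "open ?S" using open_chart_image c W by blast
 note C = coefficients_tensor12_rep[OF T c]
 show "smooth_on (vf_rep A c (\<lambda>p. T p (X p) (Y p))) ?S"
 proof (rule smooth_on_transform[OF _ S])
  show "smooth_on (\<lambda>x. tensor12_rep A c T x (vf_rep A c X x) (vf_rep A c Y x)) ?S"
   by (rule smooth_on_bilinear_field[OF S, of "tensor12_rep A c T", OF _ _
       smooth_vf_rep[OF X c] smooth_vf_rep[OF Y c]])
     (use C in "auto simp: coefficients_on_def intro: smooth_on_subset")
 qed (use c tensor12_rep_chart[OF c, of _ T] in auto)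
qed

lemma coefficients_christoffel:
 assumes "pseudo_riemannian_metric A g" "c \<in> A"
 shows "coefficients_on (christoffel (bilin_comp A c g)) (snd c ` fst c)"
 using bilinear_christoffel[OF metric_matrix_chart[OF assms]] smooth_on_christoffel[OF metric_matrix_chart[OF assms]]
  open_chart(2)[OF assms(2)] by (simp add: coefficients_on_def)

lemma represents_levi_civita:
 assumes g: "pseudo_riemannian_metric A g" and c: "c \<in> A"
 shows "represents c (levi_civita A g) (christoffel (bilin_comp A c g))"
 unfolding represents_def
 using coefficients_christoffel[OF g c] smooth_levi_civita[OF g] levi_civita_chart[OF g _ _ _ _ c] by blast

lemma coefficients_add:
 assumes "coefficients_on C S" "coefficients_on C' S"
 shows "coefficients_on (\<lambda>x u v. C x u v + C' x u v) S"
 using assms unfolding coefficients_on_def bilinear_def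
 by (auto intro!: smooth_on_add linear_compose_add)

lemma represents_contorted:
 assumes g: "pseudo_riemannian_metric A g" and T: "smooth_tensor12 A T" and c: "c \<in> A"
 shows "represents c (contorted_connection A g T) (contorted_rep A c g T)"
proof -
 have eq: "contorted_connection A g T X Y = (\<lambda>p. levi_civita A g X Y p + T p (X p) (Y p))" for X Y
  by (simp add: contorted_connection_def fun_eq_iff)
 have eq': "contorted_rep A c g T = (\<lambda>x u v. christoffel (bilin_comp A c g) x u v + tensor12_rep A c T x u v)"
  by (simp add: contorted_rep_def fun_eq_iff)
 show ?thesis
  unfolding represents_def eq eq'
 proof (intro conjI allI impI ballI)
  show "coefficients_on (\<lambda>x u v. christoffel (bilin_comp A c g) x u v + tensor12_rep A c T x u v) (snd c ` fst c)"
   by (intro coefficients_add coefficients_christoffel coefficients_tensor12_rep g T c)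
  fix W X Y assume *: "open W \<and> smooth_vf_on A W X \<and> smooth_vf_on A W Y"
  then show "smooth_vf_on A W (\<lambda>p. levi_civita A g X Y p + T p (X p) (Y p))"
   using smooth_vf_add[OF _ smooth_levi_civita[OF g] smooth_tensor12_apply[OF _ T], of W X Y X Y] by blast
  fix p assume "p \<in> W \<inter> fst c"
  then show "to_coord A c p (levi_civita A g X Y p + T p (X p) (Y p)) =
    \<D> (vf_rep A c Y) (at (snd c p)) (to_coord A c p (X p)) +
    (christoffel (bilin_comp A c g) (snd c p) (to_coord A c p (X p)) (to_coord A c p (Y p)) +
    tensor12_rep A c T (snd c p) (to_coord A c p (X p)) (to_coord A c p (Y p)))"
   using * c levi_civita_chart[OF g, of W p X Y c] tensor12_rep_chart[OF c, of p T]
   by (simp add: linear_add[OF linear_to_coord])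
 qed
qed

end

subsection \<open>Orthogonal frames\<close>

text \<open>The vectors are not normalised: division by \<open>b (E \<mu>) (E \<mu>)\<close> takes
  the place of signs. Hence any nonzero vectors of the lines form such a frame.\<close>

definition orthogonal_frame ::
  "(real^'n => real^'n => real) => 'i set => ('i => real^'n) => bool" where
 "orthogonal_frame b I E \<longleftrightarrow> finite I \<and> bilinear b \<and> (\<forall>\<mu>\<in>I. b (E \<mu>) (E \<mu>) \<noteq> 0) \<and>
   (\<forall>\<mu>\<in>I. \<forall>\<nu>\<in>I. \<mu> \<noteq> \<nu> \<longrightarrow> b (E \<mu>) (E \<nu>) = 0) \<and> (\<forall>v. \<exists>c. v = (\<Sum>\<mu>\<in>I. c \<mu> *\<^sub>R E \<mu>))"

context
 fixes b :: "real^'n => real^'n => real" and I :: "'i set" and E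
 assumes E: "orthogonal_frame b I E"
begin

lemma frame_expansion: "v = (\<Sum>\<mu>\<in>I. (b v (E \<mu>) / b (E \<mu>) (E \<mu>)) *\<^sub>R E \<mu>)"
proof -
 obtain c where c: "v = (\<Sum>\<mu>\<in>I. c \<mu> *\<^sub>R E \<mu>)" using E unfolding orthogonal_frame_def by blast
 have fin: "finite I" and bil: "bilinear b" using E by (auto simp: orthogonal_frame_def)
 have "b v (E \<mu>) / b (E \<mu>) (E \<mu>) = c \<mu>" if \<mu>: "\<mu> \<in> I" for \<mu>
 proof -
  have lin: "linear (\<lambda>u. b u (E \<mu>))" using bil by (simp add: bilinear_def)
  have "b v (E \<mu>) = (\<Sum>\<nu>\<in>I. c \<nu> * b (E \<nu>) (E \<mu>))"
   unfolding c by (simp add: linear_sum[OF lin] linear_scale[OF lin])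
  also have "\<dots> = (\<Sum>\<nu>\<in>I. if \<nu> = \<mu> then c \<mu> * b (E \<mu>) (E \<mu>) else 0)"
   using E \<mu> unfolding orthogonal_frame_def by (intro sum.cong) auto
  finally show ?thesis using fin \<mu> E by (auto simp: orthogonal_frame_def)
 qed
 then show ?thesis using c by (simp cong: sum.cong)
qed

text \<open>Frees the trace in the Ricci tensor from the standard basis, and thereby from the
  chart.\<close>

lemma trace_frame:
 assumes L: "linear L"
 shows "(\<Sum>*j. L (axis j 1) $ j) = (\<Sum>\<mu>\<in>I. b (L (E \<mu>)) (E \<mu>) / b (E \<mu>) (E \<mu>))"
proof -
 have bl: "linear (\<lambda>u. b u w)" for w using E by (simp add: orthogonal_frame_def bilinear_def)
 have "(\<Sum>*j. L (axis j 1) $ j) = (\<Sum>*j. \<Sum>\<mu>\<in>I. b (L (axis j 1)) (E \<mu>) / b (E \<mu>) (E \<mu>) * E \<mu> $ j)"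
  by (subst frame_expansion) simp
 also have "\<dots> = (\<Sum>\<mu>\<in>I. \<Sum>*j. b (L (axis j 1)) (E \<mu>) / b (E \<mu>) (E \<mu>) * E \<mu> $ j)"
  by (rule sum.swap)
 also have "\<dots> = (\<Sum>\<mu>\<in>I. b (L (E \<mu>)) (E \<mu>) / b (E \<mu>) (E \<mu>))"
 proof (rule sum.cong[OF refl])
  fix \<mu>
  have "b (L (E \<mu>)) (E \<mu>) = b (L (\<Sum>*j. E \<mu> $ j *\<^sub>R axis j 1)) (E \<mu>)"
   using vec_eq_sum_axis[of "E \<mu>"] by simp
  also have "\<dots> = (\<Sum>*j. E \<mu> $ j * b (L (axis j 1)) (E \<mu>))"
   by (simp add: linear_sum[OF L] linear_scale[OF L] linear_sum[OF bl] linear_scale[OF bl])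
  finally show "(\<Sum>*j. b (L (axis j 1)) (E \<mu>) / b (E \<mu>) (E \<mu>) * E \<mu> $ j) = b (L (E \<mu>)) (E \<mu>) / b (E \<mu>) (E \<mu>)"
   by (simp add: sum_divide_distrib mult_ac)
 qed
 finally show ?thesis .
qed

text \<open>The completeness relation of the frame: by \<open>frame_expansion\<close> the weighted
  sum of the products of components is a left inverse of \<open>G\<close>.\<close>

lemma matrix_inv_frame:
 assumes b: "\<And>u v. b u v = u \<bullet> (G *v v)" and G: "det G \<noteq> 0" "transpose G = G"
 shows "matrix_inv G $ i $ m = (\<Sum>\<mu>\<in>I. E \<mu> $ i * E \<mu> $ m / b (E \<mu>) (E \<mu>))"
proof -
 define H where "H = (\<chi> i m. \<Sum>\<mu>\<in>I. E \<mu> $ i * E \<mu> $ m / b (E \<mu>) (E \<mu>))"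
 have "H *v (G *v v) = v" for v
 proof -
  have "(H *v (G *v v)) $ i = v $ i" for i
  proof -
   have "(H *v (G *v v)) $ i = (\<Sum>*m. \<Sum>\<mu>\<in>I. E \<mu> $ i * E \<mu> $ m / b (E \<mu>) (E \<mu>) * (G *v v) $ m)"
   proof -
    have "(H *v w) $ i = (\<Sum>*m. H $ i $ m * w $ m)" for w by (simp add: matrix_vector_mult_def)
    then show ?thesis by (simp only:) (simp add: H_def sum_distrib_right)
   qed
   also have "\<dots> = (\<Sum>\<mu>\<in>I. \<Sum>*m. E \<mu> $ i * E \<mu> $ m / b (E \<mu>) (E \<mu>) * (G *v v) $ m)"
    by (rule sum.swap)
   also have "\<dots> = (\<Sum>\<mu>\<in>I. b (E \<mu>) v / b (E \<mu>) (E \<mu>) * E \<mu> $ i)"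
    unfolding b[of _ v] inner_vec_def
    by (simp add: sum_divide_distrib sum_distrib_right sum_distrib_left mult_ac)
   also have "\<dots> = (\<Sum>\<mu>\<in>I. (b v (E \<mu>) / b (E \<mu>) (E \<mu>)) *\<^sub>R E \<mu>) $ i"
    using symmetric_matrix_inner[OF G(2)] by (simp add: b)
   also have "\<dots> = v $ i" using frame_expansion[of v] by simp
   finally show ?thesis .
  qed
  then show ?thesis by (simp add: vec_eq_iff)
 qed
 then have "(H ** G) *v v = mat 1 *v v" for v by (simp add: matrix_vector_mul_assoc)
 then have "H ** G = mat 1" by (simp add: matrix_eq)
 then have "H ** G ** matrix_inv G = matrix_inv G" by simp
 then have "H = matrix_inv G" using matrix_inv_right[OF G(1)] by (simp add: matrix_mul_assoc[symmetric])
 then have "matrix_inv G $ i $ m = H $ i $ m" by simp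
 then show ?thesis by (simp add: H_def)
qed

lemma contraction_frame:
 assumes b: "\<And>u v. b u v = u \<bullet> (G *v v)" and G: "det G \<noteq> 0" "transpose G = G"
  and B: "bilinear (B :: real^'n => real^'n => real)"
 shows "(\<Sum>*i m. matrix_inv G $ i $ m * B (axis i 1) (axis m 1)) =
   (\<Sum>\<mu>\<in>I. B (E \<mu>) (E \<mu>) / b (E \<mu>) (E \<mu>))"
proof -
 have BE: "B u v = (\<Sum>*i m. u $ i * v $ m * B (axis i 1) (axis m 1))" for u v
 proof -
  have "B u v = B (\<Sum>*i. u $ i *\<^sub>R axis i 1) (\<Sum>*j. v $ j *\<^sub>R axis j 1)"
   using vec_eq_sum_axis[of u] vec_eq_sum_axis[of v] by simp
  also have "\<dots> = (\<Sum>(i, j)\<in>UNIV \<times> UNIV. B (u $ i *\<^sub>R axis i 1) (v $ j *\<^sub>R axis j 1))"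
   by (rule bilinear_sum[OF B])
  also have "\<dots> = (\<Sum>*i j. u $ i * v $ j * B (axis i 1) (axis j 1))"
   by (simp add: sum.cartesian_product bilinear_lmul[OF B] bilinear_rmul[OF B] mult_ac)
  finally show ?thesis .
 qed
 have "(\<Sum>*i m. matrix_inv G $ i $ m * B (axis i 1) (axis m 1)) =
   (\<Sum>*i m. \<Sum>\<mu>\<in>I. E \<mu> $ i * E \<mu> $ m / b (E \<mu>) (E \<mu>) * B (axis i 1) (axis m 1))"
  by (simp add: matrix_inv_frame[OF b G] sum_distrib_right)
 also have "\<dots> = (\<Sum>*i. \<Sum>\<mu>\<in>I. \<Sum>*m. E \<mu> $ i * E \<mu> $ m / b (E \<mu>) (E \<mu>) * B (axis i 1) (axis m 1))"
  by (intro sum.cong refl sum.swap)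
 also have "\<dots> = (\<Sum>\<mu>\<in>I. \<Sum>*i m. E \<mu> $ i * E \<mu> $ m / b (E \<mu>) (E \<mu>) * B (axis i 1) (axis m 1))"
  by (rule sum.swap)
 also have "\<dots> = (\<Sum>\<mu>\<in>I. B (E \<mu>) (E \<mu>) / b (E \<mu>) (E \<mu>))"
  by (subst (2) BE) (simp add: sum_divide_distrib mult_ac)
 finally show ?thesis .
qed

end

section \<open>Almost product structures by lines\<close>

lemma sum_pairs_symmetrize:
 fixes K :: "nat => nat => real"
 assumes "\<And>\<mu>. K \<mu> \<mu> = 0"
 shows "(\<Sum>\<mu>\<in>{1..k}. \<Sum>\<nu>\<in>{1..<\<mu>}. K \<nu> \<mu> + K \<mu> \<nu>) = (\<Sum>\<mu>\<in>{1..k}. \<Sum>\<nu>\<in>{1..k}. K \<mu> \<nu>)"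
proof (induction k)
 case (Suc k)
 have "{1..<Suc k} = {1..k}" by auto
 then show ?case using Suc assms by (simp add: sum.distrib)
qed simp

locale line_product = manifold A
 for A :: "('m::{t2_space,second_countable_topology}, 'n::finite) chart set" +
 fixes k :: nat and D :: "nat => ('m, 'n) distrib"
 assumes almost_product: "almost_product A k D"
  and lines: "\<forall>\<mu>\<in>{1..k}. \<forall>p. dim (D \<mu> p) = 1"
begin

lemma local_section:
 assumes "\<mu> \<in> {1..k}"
 obtains W X where "open W" "p \<in> W" "smooth_vf_on A W X" "\<And>q. q \<in> W ==> X q \<noteq> 0 \<and> D \<mu> q = span {X q}"
proof -
 have "distribution A (D \<mu>)" using almost_product assms by (simp add: almost_product_def)
 then obtain r :: nat where r: "\<And>p. \<exists>W X. open W \<and> p \<in> W \<and> (\<forall>a\<in>{1..r}. smooth_vf_on A W (X a)) \<and>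
    (\<forall>q\<in>W. D \<mu> q = span ((\<lambda>a. X a q) ` {1..r}) \<and> dim (D \<mu> q) = r)"
  unfolding distribution_def by blast
 from r[of p] obtain W X where W: "open W" "p \<in> W" "\<forall>a\<in>{1..r}. smooth_vf_on A W (X a)"
  "\<forall>q\<in>W. D \<mu> q = span ((\<lambda>a. X a q) ` {1..r}) \<and> dim (D \<mu> q) = r" by blast
 have r1: "r = 1" using W lines assms by auto
 have sp: "D \<mu> q = span {X 1 q}" if "q \<in> W" for q using W(4) that r1 by auto
 have nz: "X 1 q \<noteq> 0" if "q \<in> W" for q
 proof
  assume "X 1 q = 0"
  then have "dim (D \<mu> q) = 0" using sp[OF that] by simp
  moreover have "dim (D \<mu> q) = 1" using lines assms by blast
  ultimately show False by linarith
 qed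
 show thesis by (rule that[of W "X 1"]) (use W sp nz r1 in auto)
qed

lemma line_span:
 assumes "\<mu> \<in> {1..k}" "u \<in> D \<mu> p" "u \<noteq> 0"
 shows "D \<mu> p = span {u}"
proof -
 obtain W X where "p \<in> W" "\<And>q. q \<in> W ==> X q \<noteq> 0 \<and> D \<mu> q = span {X q}"
  using local_section[OF assms(1), of p] by metis
 then have X: "D \<mu> p = span {X p}" by auto
 then obtain c where c: "u = c *\<^sub>R X p" using assms(2) by (auto simp: span_singleton)
 then have "c \<noteq> 0" using assms(3) by auto
 have "span {u} = span {X p}"
 proof (rule span_eq[THEN iffD2], intro conjI subsetI)
  fix z assume "z \<in> {u}"
  then show "z \<in> span {X p}" using c by (simp add: span_mul span_base)
 next
  fix z assume "z \<in> {X p}"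
  then have "z = (1 / c) *\<^sub>R u" using c \<open>c \<noteq> 0\<close> by simp
  then show "z \<in> span {u}" by (simp add: span_mul span_base)
 qed
 then show ?thesis using X by simp
qed

lemma line_multiple:
 assumes "\<mu> \<in> {1..k}" "u \<in> D \<mu> p" "u \<noteq> 0" "v \<in> D \<mu> p"
 obtains r where "v = r *\<^sub>R u"
 using line_span[OF assms(1-3)] assms(4) by (auto simp: span_singleton)

lemma line_scaleR: "\<mu> \<in> {1..k} ==> u \<in> D \<mu> p ==> r *\<^sub>R u \<in> D \<mu> p"
 using local_section[of \<mu> p] by (metis span_mul)

lemma ex_line_vector: "\<exists>E. \<forall>\<mu>\<in>{1..k}. E \<mu> \<in> D \<mu> p \<and> E \<mu> \<noteq> 0"
proof -
 have "\<exists>u. u \<in> D \<mu> p \<and> u \<noteq> 0" if "\<mu> \<in> {1..k}" for \<mu>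
  using local_section[OF that, of p] by (metis span_base singletonI)
 then show ?thesis by metis
qed

context
 fixes g :: "('m, 'n) bilin_field"
 assumes adapted: "adapted_metric A k D g"
begin

lemma metricD: "pseudo_riemannian_metric A g"
 using adapted by (simp add: adapted_metric_def)

text \<open>On a line, nondegeneracy of the restricted form means that no nonzero vector is
  null.\<close>

lemma line_nonnull:
 assumes "\<mu> \<in> {1..k}" "u \<in> D \<mu> p" "u \<noteq> 0"
 shows "g p u u \<noteq> 0"
proof
 assume z: "g p u u = 0"
 have "g p u v = 0" if v: "v \<in> D \<mu> p" for v
 proof -
  obtain r where "v = r *\<^sub>R u" using line_multiple[OF assms v] .
  then show ?thesis using z metric_simps[OF metricD] by simp
 qed
 then have "u = 0" using adapted assms unfolding adapted_metric_def by blast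
 then show False using assms by simp
qed

lemma frame_lines:
 assumes "\<And>\<mu>. \<mu> \<in> {1..k} ==> E \<mu> \<in> D \<mu> p \<and> E \<mu> \<noteq> 0"
 shows "orthogonal_frame (g p) {1..k} E"
 unfolding orthogonal_frame_def
proof (intro conjI ballI allI impI bilinear_metric[OF metricD])
 show "g p (E \<mu>) (E \<nu>) = 0" if "\<mu> \<in> {1..k}" "\<nu> \<in> {1..k}" "\<mu> \<noteq> \<nu>" for \<mu> \<nu>
  using adapted assms that unfolding adapted_metric_def by blast
 show "g p (E \<mu>) (E \<mu>) \<noteq> 0" if "\<mu> \<in> {1..k}" for \<mu>
  using line_nonnull that assms by blast
 fix v
 obtain w where w: "w \<in> (\<Pi>\<^sub>E \<mu>\<in>{1..k}. D \<mu> p)" "v = (\<Sum>\<mu>\<in>{1..k}. w \<mu>)"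
  using almost_product unfolding almost_product_def by blast
 have "\<exists>r. w \<mu> = r *\<^sub>R E \<mu>" if "\<mu> \<in> {1..k}" for \<mu>
  using line_multiple[OF that, of "E \<mu>" p "w \<mu>"] assms[OF that] w(1) that by (metis PiE_mem)
 then obtain r where r: "\<And>\<mu>. \<mu> \<in> {1..k} ==> w \<mu> = r \<mu> *\<^sub>R E \<mu>" by metis
 then have "v = (\<Sum>\<mu>\<in>{1..k}. r \<mu> *\<^sub>R E \<mu>)" using w(2) by simp
 then show "\<exists>c. v = (\<Sum>\<mu>\<in>{1..k}. c \<mu> *\<^sub>R E \<mu>)" by blast
qed simp

lemma ex_line_frame:
 obtains E where "orthogonal_frame (g p) {1..k} E"
 using ex_line_vector[of p] frame_lines by metis

lemma frame_to_coord:
 assumes E: "orthogonal_frame (g p) I E" and c: "c \<in> A" "p \<in> fst c"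
 shows "orthogonal_frame (\<lambda>u v. u \<bullet> (bilin_comp A c g (snd c p) *v v)) I (\<lambda>\<mu>. to_coord A c p (E \<mu>))"
proof -
 have bil: "bilinear (\<lambda>u v. u \<bullet> (bilin_comp A c g (snd c p) *v v))"
  by (auto simp: bilinear_def linear_iff inner_add_left matrix_vector_right_distrib inner_add_right
    matrix_vector_mult_scaleR)
 have span: "\<exists>r. v = (\<Sum>\<mu>\<in>I. r \<mu> *\<^sub>R to_coord A c p (E \<mu>))" for v
 proof -
  obtain r where "of_coord A c p v = (\<Sum>\<mu>\<in>I. r \<mu> *\<^sub>R E \<mu>)" using E unfolding orthogonal_frame_def by blast
  then have "to_coord A c p (of_coord A c p v) = (\<Sum>\<mu>\<in>I. r \<mu> *\<^sub>R to_coord A c p (E \<mu>))"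
   by (simp only: linear_sum[OF linear_to_coord[OF c]] linear_scale[OF linear_to_coord[OF c]])
  then show ?thesis using c by auto
 qed
 note mc = metric_chart[OF metricD c, symmetric]
 show ?thesis
  unfolding orthogonal_frame_def mc
 proof (intro conjI allI span)
  show "bilinear (\<lambda>u v. u \<bullet> (bilin_comp A c g (snd c p) *v v))" by (rule bil)
 qed (use E in "simp_all add: orthogonal_frame_def")
qed

lemma ex_adapted_frame: "\<exists>E. adapted_frame A k D g p E"
proof -
 have "\<exists>W X. open W \<and> p \<in> W \<and> smooth_vf_on A W X \<and> (\<forall>q\<in>W. X q \<noteq> 0 \<and> D \<mu> q = span {X q})"
  if "\<mu> \<in> {1..k}" for \<mu>
  using local_section[OF that, of p] by metis
 then obtain W X where WX: "\<And>\<mu>. \<mu> \<in> {1..k} ==> open (W \<mu>) \<and> p \<in> W \<mu> \<and> smooth_vf_on A (W \<mu>) (X \<mu>) \<and>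
   (\<forall>q\<in>W \<mu>. X \<mu> q \<noteq> 0 \<and> D \<mu> q = span {X \<mu> q})" by metis
 define V where "V = (\<Inter>\<mu>\<in>{1..k}. W \<mu>)"
 have V: "open V" "p \<in> V" unfolding V_def using WX by (auto intro!: open_INT)
 define E where "E = (\<lambda>\<mu> (a::nat) q. (1 / sqrt \<bar>g q (X \<mu> q) (X \<mu> q)\<bar>) *\<^sub>R X \<mu> q)"
 note pr = metricD
 have nz: "g q (X \<mu> q) (X \<mu> q) \<noteq> 0" if "\<mu> \<in> {1..k}" "q \<in> V" for \<mu> q
  by (rule line_nonnull[OF that(1)]) (use WX that in "auto simp: V_def intro: span_base")
 have smX: "smooth_vf_on A V (X \<mu>)" if "\<mu> \<in> {1..k}" for \<mu>
  by (rule smooth_vf_on_subset[of "W \<mu>"]) (use WX that in "auto simp: V_def")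
 have sf: "smooth_fun_on A V (\<lambda>q. 1 / sqrt \<bar>g q (X \<mu> q) (X \<mu> q)\<bar>)" if \<mu>: "\<mu> \<in> {1..k}" for \<mu>
  unfolding smooth_fun_on_def
 proof
  fix c assume c: "c \<in> A"
  note S = open_chart_image[OF c V(1)]
  have s: "smooth_on (\<lambda>x. g (chart_inv c x) (X \<mu> (chart_inv c x)) (X \<mu> (chart_inv c x))) (snd c ` (fst c \<inter> V))"
   using smooth_fun_rep[OF smooth_metric_apply[OF pr V(1) smX[OF \<mu>] smX[OF \<mu>]] c] by (simp add: o_def)
  have n: "g (chart_inv c x) (X \<mu> (chart_inv c x)) (X \<mu> (chart_inv c x)) \<noteq> 0" if "x \<in> snd c ` (fst c \<inter> V)" for x
   using nz[OF \<mu>] that c by auto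
  show "smooth_on ((\<lambda>q. 1 / sqrt \<bar>g q (X \<mu> q) (X \<mu> q)\<bar>) \<circ> chart_inv c) (snd c ` (fst c \<inter> V))"
   unfolding o_def
   by (rule smooth_on_divide[OF S smooth_on_const[OF S] smooth_on_sqrt[OF S smooth_on_abs[OF S s n]]])
     (use n in auto)
 qed
 have ge: "g q (E \<mu> a q) (E \<nu> b q) = g q (X \<mu> q) (X \<nu> q) /
   (sqrt \<bar>g q (X \<mu> q) (X \<mu> q)\<bar> * sqrt \<bar>g q (X \<nu> q) (X \<nu> q)\<bar>)" for \<mu> \<nu> a b q
  by (simp add: E_def metric_simps[OF pr])
 have "section_on A V (D \<mu>) (E \<mu> a)" if \<mu>: "\<mu> \<in> {1..k}" for \<mu> a
  unfolding section_on_def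
 proof (intro conjI ballI)
  show "smooth_vf_on A V (E \<mu> a)" unfolding E_def using smooth_vf_scaleR[OF V(1) sf[OF \<mu>] smX[OF \<mu>]] .
  show "E \<mu> a q \<in> D \<mu> q" if "q \<in> V" for q
   unfolding E_def by (rule line_scaleR[OF \<mu>]) (use WX[OF \<mu>] that \<mu> in "auto simp: V_def intro: span_base")
 qed
 moreover have "g q (E \<mu> a q) (E \<mu> a q) \<in> {1, -1}" if "\<mu> \<in> {1..k}" "q \<in> V" for \<mu> a q
  using nz[OF that] unfolding ge by (auto simp: abs_if field_simps)
 ultimately have "adapted_frame A k D g p E"
  unfolding adapted_frame_def using V lines by (intro exI[of _ V]) auto
 then show ?thesis by blast
qed

text \<open>For lines every pair of frame vectors is mixed except a vector with itself, and the
  latter contributes no curvature. The sum over pairs is thus a full double sum: over one index it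
  is the trace that defines Ricci, over the other the contraction with the metric.\<close>

theorem mixed_scalar_chart:
 assumes T: "smooth_tensor12 A T" and c: "c \<in> A" "p \<in> fst c"
 shows "mixed_scalar_curvature A k D g T p =
  scalar_rep (bilin_comp A c g) (contorted_rep A c g T) (snd c p) / 2"
proof -
 define x where "x = snd c p"
 define C where "C = contorted_rep A c g T"
 define G where "G = bilin_comp A c g"
 define E where "E = (SOME E. adapted_frame A k D g p E)"
 have "adapted_frame A k D g p E" unfolding E_def using someI_ex[OF ex_adapted_frame] .
 then obtain W where W: "open W" "p \<in> W"
  and sec: "\<And>\<mu>. \<mu> \<in> {1..k} ==> section_on A W (D \<mu>) (E \<mu> 1)"
  and unit: "\<And>\<mu>. \<mu> \<in> {1..k} ==> g p (E \<mu> 1 p) (E \<mu> 1 p) \<in> {1, -1}"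
  unfolding adapted_frame_def using lines by fastforce
 note pr = metricD
 have xs: "x \<in> snd c ` fst c" using c by (auto simp: x_def)
 have rep: "represents c (contorted_connection A g T) C"
  unfolding C_def using represents_contorted[OF pr T c(1)] .
 then have coef: "coefficients_on C (snd c ` fst c)" by (simp add: represents_def)
 have fr: "orthogonal_frame (g p) {1..k} (\<lambda>\<mu>. E \<mu> 1 p)"
 proof (rule frame_lines, intro conjI)
  fix \<mu> assume \<mu>: "\<mu> \<in> {1..k}"
  show "E \<mu> 1 p \<in> D \<mu> p" using sec[OF \<mu>] W by (simp add: section_on_def)
  show "E \<mu> 1 p \<noteq> 0" using unit[OF \<mu>] metric_simps(7)[OF pr] by auto
 qed
 define e where "e = (\<lambda>\<mu>. to_coord A c p (E \<mu> 1 p))"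
 define b where "b = (\<lambda>u v. u \<bullet> (G x *v v))"
 have fe: "orthogonal_frame b {1..k} e" using frame_to_coord[OF fr c] unfolding e_def b_def G_def x_def .
 have gb: "g p u v = b (to_coord A c p u) (to_coord A c p v)" for u v
  using metric_chart[OF pr c] by (simp add: b_def G_def x_def)
 have em: "to_coord A c p (E \<mu> 1 p) = e \<mu>" for \<mu> by (simp add: e_def)
 \<comment> \<open>The frame is unit here, so its signs are their own inverses and multiplication by
   them may be read as the division in the frame formulas.\<close>
 have eps: "b (e \<mu>) (e \<mu>) * t = t / b (e \<mu>) (e \<mu>)" if "\<mu> \<in> {1..k}" for \<mu> t
  using unit[OF that] unfolding gb em by auto
 define K where "K = (\<lambda>\<nu> \<mu>. b (e \<nu>) (e \<nu>) * b (e \<mu>) (e \<mu>) * b (curvature_rep C x (e \<nu>) (e \<mu>) (e \<nu>)) (e \<mu>))"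
 have R: "g p (curvature A (contorted_connection A g T) (E \<nu> 1) (E \<mu> 1) (E \<nu> 1) p) (E \<mu> 1 p) =
   b (curvature_rep C x (e \<nu>) (e \<mu>) (e \<nu>)) (e \<mu>)" if "\<nu> \<in> {1..k}" "\<mu> \<in> {1..k}" for \<nu> \<mu>
  using curvature_chart[OF rep W c, of "E \<nu> 1" "E \<mu> 1" "E \<nu> 1"] sec that
  unfolding gb by (simp add: section_on_def e_def x_def)
 have "mixed_scalar_curvature A k D g T p = 1/2 * (\<Sum>\<mu>\<in>{1..k}. \<Sum>\<nu>\<in>{1..<\<mu>}. K \<nu> \<mu> + K \<mu> \<nu>)"
  unfolding mixed_scalar_curvature_def Let_def E_def[symmetric]
 proof (intro arg_cong[of _ _ "(*) (1/2)"] sum.cong refl)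
  fix \<mu> \<nu> assume "\<mu> \<in> {1..k}" "\<nu> \<in> {1..<\<mu>}"
  then have m: "\<mu> \<in> {1..k}" "\<nu> \<in> {1..k}" by auto
  then have "dim (D \<mu> p) = 1" "dim (D \<nu> p) = 1" using lines by auto
  then show "(\<Sum>a\<in>{1..dim (D \<nu> p)}. \<Sum>b\<in>{1..dim (D \<mu> p)}. g p (E \<nu> a p) (E \<nu> a p) * g p (E \<mu> b p) (E \<mu> b p) *
       (g p (curvature A (contorted_connection A g T) (E \<nu> a) (E \<mu> b) (E \<nu> a) p) (E \<mu> b p) +
       g p (curvature A (contorted_connection A g T) (E \<mu> b) (E \<nu> a) (E \<mu> b) p) (E \<nu> a p))) = K \<nu> \<mu> + K \<mu> \<nu>"
   using R[OF m] R[OF m(2,1)] by (simp add: K_def gb em[simplified] algebra_simps)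
 qed
 also have "\<dots> = 1/2 * (\<Sum>\<nu>\<in>{1..k}. \<Sum>\<mu>\<in>{1..k}. K \<nu> \<mu>)"
  by (subst sum_pairs_symmetrize) (simp_all add: K_def curvature_rep_diagonal[OF coef xs] b_def)
 also have "(\<Sum>\<nu>\<in>{1..k}. \<Sum>\<mu>\<in>{1..k}. K \<nu> \<mu>) = (\<Sum>\<nu>\<in>{1..k}. ricci_rep C x (e \<nu>) (e \<nu>) / b (e \<nu>) (e \<nu>))"
 proof (rule sum.cong[OF refl])
  fix \<nu> assume \<nu>: "\<nu> \<in> {1..k}"
  have "(\<Sum>\<mu>\<in>{1..k}. K \<nu> \<mu>) = b (e \<nu>) (e \<nu>) * (\<Sum>\<mu>\<in>{1..k}. b (curvature_rep C x (e \<nu>) (e \<mu>) (e \<nu>)) (e \<mu>) / b (e \<mu>) (e \<mu>))"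
   unfolding sum_distrib_left
  proof (rule sum.cong[OF refl])
   fix \<mu> assume "\<mu> \<in> {1..k}"
   from eps[OF this] show "K \<nu> \<mu> = b (e \<nu>) (e \<nu>) * (b (curvature_rep C x (e \<nu>) (e \<mu>) (e \<nu>)) (e \<mu>) / b (e \<mu>) (e \<mu>))"
    by (simp only: K_def mult.assoc)
  qed
  also have "(\<Sum>\<mu>\<in>{1..k}. b (curvature_rep C x (e \<nu>) (e \<mu>) (e \<nu>)) (e \<mu>) / b (e \<mu>) (e \<mu>)) = ricci_rep C x (e \<nu>) (e \<nu>)"
   unfolding ricci_rep_def
   by (rule trace_frame[OF fe curvature_rep_linear(2)[OF coef xs], symmetric])
  finally show "(\<Sum>\<mu>\<in>{1..k}. K \<nu> \<mu>) = ricci_rep C x (e \<nu>) (e \<nu>) / b (e \<nu>) (e \<nu>)"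
   using eps[OF \<nu>] by simp
 qed
 also have "\<dots> = scalar_rep G C x"
  unfolding scalar_rep_def
  by (rule contraction_frame[OF fe, symmetric])
    (use metric_matrix_chart[OF pr c(1)] xs ricci_rep_bilinear[OF coef xs] in
     \<open>auto simp: b_def G_def metric_matrix_on_def\<close>)
 finally show ?thesis by (simp add: G_def C_def x_def)
qed

text \<open>\<open>ricci\<close> is a trace in the chosen chart of \<open>p\<close>. This trace and
  the one in \<open>c\<close> equal the same sum over an orthogonal frame of tangent vectors,
  because curvature is tensorial.\<close>

theorem ricci_chart:
 assumes c: "c \<in> A" "p \<in> fst c"
 shows "ricci A g p u v =
  ricci_rep (christoffel (bilin_comp A c g)) (snd c p) (to_coord A c p u) (to_coord A c p v)"
proof -
 note pr = metricD
 obtain E where "\<forall>\<mu>\<in>{1..k}. E \<mu> \<in> D \<mu> p \<and> E \<mu> \<noteq> 0" using ex_line_vector by blast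
 then have fr: "orthogonal_frame (g p) {1..k} E" by (intro frame_lines) auto
 define d where "d = chart_at A p"
 have d: "d \<in> A" "p \<in> fst d" using chart_at by (auto simp: d_def)
 define W where "W = fst d"
 have W: "open W" "p \<in> W" using d open_chart(1)[OF d(1)] by (auto simp: W_def)
 define R where "R = (\<lambda>w. curvature A (levi_civita A g) (extend_vec A p u) (extend_vec A p w) (extend_vec A p v) p)"
 have ex: "smooth_vf_on A W (extend_vec A p w)" "extend_vec A p w p = w" for w
  unfolding W_def extend_vec_def d_def[symmetric] using smooth_of_coord[OF d(1)]
  by (auto simp: d_def)
 have Rc: "to_coord A c' p (R w) = curvature_rep (christoffel (bilin_comp A c' g)) (snd c' p)
   (to_coord A c' p u) (to_coord A c' p w) (to_coord A c' p v)" if "c' \<in> A" "p \<in> fst c'" for c' w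
  using curvature_chart[OF represents_levi_civita[OF pr that(1)] W that ex(1) ex(1) ex(1), of u w v]
  by (simp add: R_def ex(2))
 have tr: "ricci_rep (christoffel (bilin_comp A c' g)) (snd c' p) (to_coord A c' p u) (to_coord A c' p v) =
   (\<Sum>\<mu>\<in>{1..k}. g p (R (E \<mu>)) (E \<mu>) / g p (E \<mu>) (E \<mu>))" if c': "c' \<in> A" "p \<in> fst c'" for c'
 proof -
  have xs: "snd c' p \<in> snd c' ` fst c'" using c' by auto
  show ?thesis
   unfolding ricci_rep_def metric_chart[OF pr c'] Rc[OF c']
   by (rule trace_frame[OF frame_to_coord[OF fr c']
     curvature_rep_linear(2)[OF coefficients_christoffel[OF pr c'(1)] xs]])
 qed
 have "ricci A g p u v = (\<Sum>*i. to_coord A d p (R (axis i 1)) $ i)"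
  by (simp add: ricci_def R_def d_def)
 also have "\<dots> = ricci_rep (christoffel (bilin_comp A d g)) (snd d p) (to_coord A d p u) (to_coord A d p v)"
  unfolding Rc[OF d] ricci_rep_def by (simp add: d_def)
 finally show ?thesis using tr[OF d] tr[OF c] by simp
qed

lemma bilinear_ricci: "bilinear (ricci A g p)"
proof -
 have xs: "snd (chart_at A p) p \<in> snd (chart_at A p) ` fst (chart_at A p)" using chart_at by auto
 have "ricci A g p = ricci_rep (christoffel (bilin_comp A (chart_at A p) g)) (snd (chart_at A p) p)"
  by (intro ext) (simp add: ricci_chart[OF chart_at])
 then show ?thesis
  using ricci_rep_bilinear[OF coefficients_christoffel[OF metricD chart_at(1)] xs] by simp
qed

end

end

section \<open>Change of variables\<close>

text \<open>The library proves the change of variables formula only for well-ordered index types;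
 an arbitrary finite index type is in bijection with the following one.\<close>

typedef ('n::finite) index = "{..<CARD('n)}" by (intro exI[of _ 0]) auto

lemma index_Rep: "bij_betw Rep_index (UNIV :: 'n index set) {..<CARD('n::finite)}"
 by (intro bij_betwI[where g = Abs_index])
   (use Rep_index Abs_index_inverse Rep_index_inverse in auto)

instance index :: (finite) finite
 by standard (use index_Rep bij_betw_finite in blast)

instantiation index :: (finite) wellorder
begin

definition less_eq_index :: "'a index => 'a index => bool" where
 "less_eq_index x y \<longleftrightarrow> Rep_index x \<le> Rep_index y"

definition less_index :: "'a index => 'a index => bool" where
 "less_index x y \<longleftrightarrow> Rep_index x < Rep_index y"

instance
proof
 fix x y z :: "'a index"
 show "x < y \<longleftrightarrow> x \<le> y \<and> \<not> y \<le> x" "x \<le> x" "x \<le> y \<or> y \<le> x"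
  by (auto simp: less_eq_index_def less_index_def)
 show "x \<le> y ==> y \<le> z ==> x \<le> z" by (simp add: less_eq_index_def)
 show "x \<le> y ==> y \<le> x ==> x = y" by (simp add: less_eq_index_def Rep_index_inject)
next
 fix P :: "'a index => bool" and a
 assume step: "\<And>x. (\<And>y. y < x ==> P y) ==> P x"
 show "P a"
 proof (induction "Rep_index a" arbitrary: a rule: less_induct)
  case less
  show ?case by (rule step) (use less in "simp add: less_index_def")
 qed
qed

end

lemma ex_index_bij: "\<exists>e :: 'n::finite => 'n index. bij e"
proof -
 have "card (UNIV :: 'n set) = card (UNIV :: 'n index set)"
  using bij_betw_same_card[OF index_Rep[where 'n = 'n]] by simp
 then show ?thesis using finite_same_card_bij[of "UNIV :: 'n set" "UNIV :: 'n index set"] by auto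
qed

lemma sign_conjugate:
 fixes e :: "'a::finite => 'b::finite"
 assumes e: "bij e" and p: "p permutes UNIV"
 shows "sign (e \<circ> p \<circ> inv e) = sign p"
 using sign_map_permutation[OF bij_is_inj[OF e] p finite] bij_is_surj[OF e]
 by (simp add: map_permutation_def restrict_id_def o_def)

text \<open>Conjugation by \<open>e\<close> is a bijection between the permutations of the two index
  types that keeps the sign.\<close>

lemma det_reindex:
 fixes M :: "real^'n::finite^'n" and e :: "'n => 'w::finite"
 assumes e: "bij e"
 shows "det (\<chi> i j. M $ inv e i $ inv e j) = det M"
proof -
 have ie: "inv e (e x) = x" "e (inv e y) = y" for x y
  using e by (simp_all add: bij_is_inj bij_is_surj surj_f_inv_f)
 have bij: "bij_betw (\<lambda>p. e \<circ> p \<circ> inv e) {p. p permutes UNIV} {p. p permutes UNIV}"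
  using bij_betw_permutations[of e UNIV UNIV] e by (simp add: o_def)
 have "det (\<chi> i j. M $ inv e i $ inv e j) =
   (\<Sum>p | p permutes UNIV. of_int (sign p) * (\<Prod>i\<in>UNIV. M $ inv e i $ inv e (p i)))"
  by (simp add: det_def)
 also have "\<dots> = (\<Sum>p | p permutes UNIV. of_int (sign (e \<circ> p \<circ> inv e)) * (\<Prod>i\<in>UNIV. M $ inv e i $ inv e ((e \<circ> p \<circ> inv e) i)))"
  by (rule sum.reindex_bij_betw[OF bij, symmetric])
 also have "\<dots> = (\<Sum>p | p permutes UNIV. of_int (sign p) * (\<Prod>i\<in>UNIV. M $ i $ p i))"
 proof (rule sum.cong[OF refl])
  fix p assume "p \<in> {p. p permutes (UNIV :: 'n set)}"
  moreover have "(\<Prod>i\<in>UNIV. M $ inv e i $ p (inv e i)) = (\<Prod>i\<in>UNIV. M $ i $ p i)"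
   by (rule prod.reindex_bij_betw[of "inv e" UNIV UNIV]) (use e bij_imp_bij_inv in blast)
  ultimately show "of_int (sign (e \<circ> p \<circ> inv e)) * (\<Prod>i\<in>UNIV. M $ inv e i $ inv e ((e \<circ> p \<circ> inv e) i)) =
    of_int (sign p) * (\<Prod>i\<in>UNIV. M $ i $ p i)"
   by (simp add: sign_conjugate[OF e] ie)
 qed
 also have "\<dots> = det M" by (simp add: det_def)
 finally show ?thesis .
qed

definition reindex :: "('n => 'w) => real^'n => real^'w" where
 "reindex e x = (\<chi> j. x $ inv e j)"

lemma reindex_nth [simp]: "reindex e x $ j = x $ inv e j"
 by (simp add: reindex_def)

lemma reindex_inverse:
 assumes "bij e"
 shows "reindex (inv e) (reindex e x) = x" "reindex e (reindex (inv e) y) = y"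
 using assms by (simp_all add: vec_eq_iff inv_inv_eq bij_is_inj bij_is_surj surj_f_inv_f)

lemma linear_reindex: "bounded_linear (reindex e :: real^'n::finite => real^'w::finite)"
 by (simp add: linear_conv_bounded_linear[symmetric] linear_iff vec_eq_iff)

lemma reindex_measurable [measurable]: "(reindex e :: real^'n::finite => real^'w::finite) \<in> borel_measurable borel"
 by (intro borel_measurable_continuous_onI linear_continuous_on linear_reindex)

lemma prod_Basis_vec: "(\<Prod>b\<in>Basis. (x :: real^'n::finite) \<bullet> b) = (\<Prod>i\<in>UNIV. x $ i)"
proof -
 have basis: "(Basis :: (real^'n) set) = (\<lambda>i. axis i 1) ` UNIV" by (auto simp: Basis_vec_def)
 have inj: "inj (\<lambda>i::'n. axis i (1::real))" by (auto simp: inj_def axis_eq_axis)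
 show ?thesis unfolding basis prod.reindex[OF inj] by (simp add: inner_axis)
qed

lemma lborel_reindex:
 fixes e :: "'n::finite => 'w::finite"
 assumes e: "bij e"
 shows "distr lborel borel (reindex e) = lborel"
proof (rule lborel_eqI[symmetric])
 fix l u :: "real^'w" assume le: "\<And>b. b \<in> Basis ==> l \<bullet> b \<le> u \<bullet> b"
 have ie: "inv e (e x) = x" "e (inv e y) = y" for x y
  using e by (simp_all add: bij_is_inj bij_is_surj surj_f_inv_f)
 have le': "l $ i \<le> u $ i" for i using le[of "axis i 1"] by (simp add: inner_axis)
 have *: "reindex e -` box l u = box (reindex (inv e) l) (reindex (inv e) u)"
  using e by (auto simp: mem_box_cart inv_inv_eq) (metis ie)+
 have "emeasure (distr lborel borel (reindex e)) (box l u) = emeasure lborel (box (reindex (inv e) l) (reindex (inv e) u))"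
  by (simp add: emeasure_distr *)
 also have "\<dots> = (\<Prod>b\<in>Basis. (reindex (inv e) u - reindex (inv e) l) \<bullet> b)"
 proof (rule emeasure_lborel_box)
  fix b :: "real^'n" assume "b \<in> Basis"
  then obtain i where "b = axis i 1" by (auto simp: Basis_vec_def)
  then show "reindex (inv e) l \<bullet> b \<le> reindex (inv e) u \<bullet> b" using le' by (simp add: inner_axis)
 qed
 also have "(\<Prod>b\<in>Basis. (reindex (inv e) u - reindex (inv e) l) \<bullet> b) = (\<Prod>i\<in>UNIV. (u - l) $ e i)"
  using e by (simp add: prod_Basis_vec inv_inv_eq)
 also have "\<dots> = (\<Prod>b\<in>Basis. (u - l) \<bullet> b)"
  unfolding prod_Basis_vec using prod.reindex_bij_betw[OF e, of "\<lambda>i. (u - l) $ i"] by simp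
 finally show "emeasure (distr lborel borel (reindex e)) (box l u) = ennreal (\<Prod>b\<in>Basis. (u - l) \<bullet> b)" .
qed simp

text \<open>The equivalence \<open>has_measure_differentiable_image\<close> settles a finite
  integral. If the integral is infinite, so is the measure of the image, since a finite measure
  would make the Jacobian integrable with that value.\<close>

lemma emeasure_image_wellorder:
 fixes \<phi> :: "real^'w::{finite,wellorder} => real^'w::_"
 assumes S: "S \<in> sets borel" "\<phi> ` S \<in> sets borel"
  and der: "\<And>x. x \<in> S ==> (\<phi> has_derivative \<phi>' x) (at x within S)" and inj: "inj_on \<phi> S"
  and meas: "(\<lambda>x. indicator S x * \<bar>det (matrix (\<phi>' x))\<bar>) \<in> borel_measurable borel"
 shows "emeasure lborel (\<phi> ` S) = (\<integral>\<^sup>+x. ennreal (indicator S x * \<bar>det (matrix (\<phi>' x))\<bar>) \<partial>lborel)"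
proof -
 let ?f = "\<lambda>x. \<bar>det (matrix (\<phi>' x))\<bar>"
 have Sl: "S \<in> sets lebesgue" using S by simp
 have eq: "emeasure lborel (\<phi> ` S) = emeasure lebesgue (\<phi> ` S)" using S by simp
 note main = has_measure_differentiable_image[OF Sl der inj]
 have im: "\<phi> ` S \<in> lmeasurable \<and> emeasure lebesgue (\<phi> ` S) = ennreal r"
  if "0 \<le> r" "(?f has_integral r) S" for r
  using main[of r] that by (auto simp: emeasure_eq_measure2)
 show ?thesis
 proof (cases "(\<integral>\<^sup>+x. ennreal (indicator S x * ?f x) \<partial>lborel) = \<infinity>")
  case False
  then obtain r where r: "0 \<le> r" "(\<integral>\<^sup>+x. ennreal (indicator S x * ?f x) \<partial>lborel) = ennreal r"
   by (cases "\<integral>\<^sup>+x. ennreal (indicator S x * ?f x) \<partial>lborel" rule: ennreal_cases) auto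
  have "((\<lambda>x. indicator S x * ?f x) has_integral r) UNIV"
   by (rule nn_integral_has_integral[OF meas _ r(2,1)]) auto
  then have "((\<lambda>x. if x \<in> S then ?f x else 0) has_integral r) UNIV"
   by (rule has_integral_eq[rotated]) (auto simp: indicator_def)
  then have "(?f has_integral r) S" by (simp add: has_integral_restrict_UNIV)
  then show ?thesis using im r eq by auto
 next
  case True
  have "emeasure lborel (\<phi> ` S) = \<infinity>"
  proof (rule ccontr)
   assume fin: "emeasure lborel (\<phi> ` S) \<noteq> \<infinity>"
   have "emeasure lebesgue (\<phi> ` S) < \<infinity>" using fin unfolding eq by (simp add: less_top)
   moreover have "\<phi> ` S \<in> sets lebesgue" using S(2) by simp
   ultimately have "\<phi> ` S \<in> lmeasurable" by (rule fmeasurableI[rotated])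
   then have "(?f has_integral measure lebesgue (\<phi> ` S)) S"
    using main[of "measure lebesgue (\<phi> ` S)"] by simp
   then have "(\<integral>\<^sup>+x. ennreal (indicator S x * ?f x) \<partial>lborel) = ennreal (measure lebesgue (\<phi> ` S))"
    by (rule nn_integral_has_integral_lebesgue[rotated]) simp
   with True show False by simp
  qed
  then show ?thesis using True by simp
 qed
qed

text \<open>The map is conjugated by the relabelling \<open>R\<close> of coordinates, which
  preserves Lebesgue measure and, by \<open>det_reindex\<close>, the Jacobian.\<close>

lemma emeasure_image:
 fixes \<phi> :: "real^'n::finite => real^'n"
 assumes S: "S \<in> sets borel" "\<phi> ` S \<in> sets borel"
  and der: "\<And>x. x \<in> S ==> (\<phi> has_derivative \<phi>' x) (at x)" and inj: "inj_on \<phi> S"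
  and meas: "(\<lambda>x. indicator S x * \<bar>det (matrix (\<phi>' x))\<bar>) \<in> borel_measurable borel"
 shows "emeasure lborel (\<phi> ` S) = (\<integral>\<^sup>+x. ennreal (indicator S x * \<bar>det (matrix (\<phi>' x))\<bar>) \<partial>lborel)"
proof -
 obtain e :: "'n => 'n index" where e: "bij e" using ex_index_bij by blast
 define R where "R = (reindex e :: real^'n => real^'n index)"
 define R' where "R' = (reindex (inv e) :: real^'n index => real^'n)"
 have R: "R' (R x) = x" "R (R' y) = y" for x y
  using reindex_inverse[OF e] by (simp_all add: R_def R'_def)
 have lR: "bounded_linear R" "bounded_linear R'" by (simp_all add: R_def R'_def linear_reindex)
 have mR [measurable]: "R \<in> borel_measurable borel" "R' \<in> borel_measurable borel"
  by (simp_all add: R_def R'_def)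
 have img: "R ` X = R' -` X" for X using R by (auto simp: image_iff) metis
 have em: "emeasure lborel (R ` X) = emeasure lborel X" "R ` X \<in> sets borel" if X: "X \<in> sets borel" for X
 proof -
  show b: "R ` X \<in> sets borel" unfolding img using measurable_sets_borel[OF mR(2) X] by simp
  have "emeasure lborel (R ` X) = emeasure (distr lborel borel R) (R ` X)"
   using lborel_reindex[OF e] by (simp add: R_def)
  also have "\<dots> = emeasure lborel (R -` R ` X)" using b by (simp add: emeasure_distr)
  also have "R -` R ` X = X" using R by (auto simp: image_iff) metis
  finally show "emeasure lborel (R ` X) = emeasure lborel X" .
 qed
 define \<psi> where "\<psi> = (\<lambda>y. R (\<phi> (R' y)))"
 define \<psi>' where "\<psi>' = (\<lambda>y w. R (\<phi>' (R' y) (R' w)))"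
 have d\<psi>: "(\<psi> has_derivative \<psi>' y) (at y within R ` S)" if "y \<in> R ` S" for y
 proof -
  have "R' y \<in> S" using that R by auto
  from bounded_linear.has_derivative[OF lR(1) has_derivative_compose[OF
     bounded_linear.has_derivative[OF lR(2) has_derivative_ident] der[OF this]]]
  show ?thesis unfolding \<psi>_def \<psi>'_def by (rule has_derivative_at_withinI)
 qed
 have det: "det (matrix (\<psi>' (R x))) = det (matrix (\<phi>' x))" for x
 proof -
  have ax: "R' (axis j 1) = axis (inv e j) 1" for j
   unfolding R'_def using e by (auto simp: vec_eq_iff axis_def inv_inv_eq bij_is_surj surj_f_inv_f bij_is_inj)
  have "matrix (\<psi>' (R x)) = (\<chi> i j. matrix (\<phi>' x) $ inv e i $ inv e j)"
   by (simp add: matrix_def \<psi>'_def R ax) (simp add: R_def)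
  then show ?thesis using det_reindex[OF e] by simp
 qed
 have ims: "\<psi> ` R ` S = R ` \<phi> ` S" by (auto simp: \<psi>_def R image_iff)
 have ind: "indicator (R ` S) y = (indicator S (R' y) :: real)" for y
  by (auto simp: indicator_def img)
 have det': "det (matrix (\<psi>' y)) = det (matrix (\<phi>' (R' y)))" for y using det[of "R' y"] R by simp
 have "emeasure lborel (\<phi> ` S) = emeasure lborel (\<psi> ` R ` S)"
  unfolding ims using em S by simp
 also have "\<dots> = (\<integral>\<^sup>+y. ennreal (indicator (R ` S) y * \<bar>det (matrix (\<psi>' y))\<bar>) \<partial>lborel)"
 proof (rule emeasure_image_wellorder)
  show "R ` S \<in> sets borel" "\<psi> ` R ` S \<in> sets borel" unfolding ims using em S by auto
  show "inj_on \<psi> (R ` S)" unfolding \<psi>_def using inj R by (auto simp: inj_on_def) metis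
  show "(\<lambda>y. indicator (R ` S) y * \<bar>det (matrix (\<psi>' y))\<bar>) \<in> borel_measurable borel"
   unfolding ind det' using measurable_compose[OF mR(2) meas] by simp
 qed (rule d\<psi>)
 also have "\<dots> = (\<integral>\<^sup>+y. ennreal (indicator S (R' y) * \<bar>det (matrix (\<phi>' (R' y)))\<bar>) \<partial>distr lborel borel R)"
  unfolding ind det' using lborel_reindex[OF e] by (simp add: R_def)
 also have "\<dots> = (\<integral>\<^sup>+x. ennreal (indicator S x * \<bar>det (matrix (\<phi>' x))\<bar>) \<partial>lborel)"
  using measurable_compose[OF mR(2) meas] by (subst nn_integral_distr) (auto simp: R)
 finally show ?thesis .
qed

text \<open>Applied to the preimage of each Borel set, \<open>emeasure_image\<close> identifies the
  image of the measure with Jacobian density as Lebesgue measure on the image of \<open>S\<close>;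
  \<open>f\<close> is then integrated against both.\<close>

lemma nn_integral_image:
 fixes \<phi> :: "real^'n::finite => real^'n" and f :: "real^'n => ennreal"
 assumes S: "open S" "open (\<phi> ` S)"
  and der: "\<And>x. x \<in> S ==> (\<phi> has_derivative \<phi>' x) (at x)" and inj: "inj_on \<phi> S"
  and meas: "(\<lambda>x. indicator S x * \<bar>det (matrix (\<phi>' x))\<bar>) \<in> borel_measurable borel"
  and f: "f \<in> borel_measurable borel"
 shows "(\<integral>\<^sup>+y\<in>\<phi> ` S. f y \<partial>lborel) = (\<integral>\<^sup>+x. ennreal (indicator S x * \<bar>det (matrix (\<phi>' x))\<bar>) * f (\<phi> x) \<partial>lborel)"
proof -
 define J where "J = (\<lambda>x. ennreal (indicator S x * \<bar>det (matrix (\<phi>' x))\<bar>))"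
 have mJ [measurable]: "J \<in> borel_measurable borel" unfolding J_def using meas by measurable
 \<comment> \<open>\<open>\<phi>\<close> is controlled on \<open>S\<close> only. Its extension by 0
   is Borel measurable everywhere, and the density \<open>J\<close> ignores the points outside
   \<open>S\<close>.\<close>
 define \<phi>0 where "\<phi>0 = (\<lambda>x. if x \<in> S then \<phi> x else 0)"
 have cont: "continuous_on S \<phi>" using der has_derivative_continuous continuous_at_imp_continuous_on by blast
 have m0 [measurable]: "\<phi>0 \<in> borel_measurable borel"
  unfolding \<phi>0_def using S(1) cont by (intro borel_measurable_continuous_on_if) auto
 have "distr (density lborel J) borel \<phi>0 = density lborel (indicator (\<phi> ` S))"
 proof (rule measure_eqI)
  fix Y assume "Y \<in> sets (distr (density lborel J) borel \<phi>0)"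
  then have Y: "Y \<in> sets borel" by simp
  have im: "\<phi> ` (S \<inter> \<phi>0 -` Y) = \<phi> ` S \<inter> Y" by (auto simp: \<phi>0_def)
  have SY: "S \<inter> \<phi>0 -` Y \<in> sets borel" using S(1) measurable_sets_borel[OF m0 Y] by auto
  have "emeasure (distr (density lborel J) borel \<phi>0) Y = (\<integral>\<^sup>+x. J x * indicator (\<phi>0 -` Y) x \<partial>lborel)"
   using Y measurable_sets_borel[OF m0 Y] by (simp add: emeasure_distr emeasure_density)
  also have "\<dots> = (\<integral>\<^sup>+x. ennreal (indicator (S \<inter> \<phi>0 -` Y) x * \<bar>det (matrix (\<phi>' x))\<bar>) \<partial>lborel)"
   by (intro nn_integral_cong) (auto simp: J_def indicator_def)
  also have "\<dots> = emeasure lborel (\<phi> ` (S \<inter> \<phi>0 -` Y))"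
  proof (rule emeasure_image[symmetric])
   show "\<phi> ` (S \<inter> \<phi>0 -` Y) \<in> sets borel" unfolding im using S(2) Y by auto
   show "inj_on \<phi> (S \<inter> \<phi>0 -` Y)" using inj by (auto simp: inj_on_def)
   have "(\<lambda>x. indicator (\<phi>0 -` Y) x * (indicator S x * \<bar>det (matrix (\<phi>' x))\<bar>)) \<in> borel_measurable borel"
    using measurable_sets_borel[OF m0 Y] by (intro borel_measurable_times[OF borel_measurable_indicator meas]) auto
   then show "(\<lambda>x. indicator (S \<inter> \<phi>0 -` Y) x * \<bar>det (matrix (\<phi>' x))\<bar>) \<in> borel_measurable borel"
    by (simp add: indicator_inter_arith mult_ac)
  qed (use SY der in auto)
  also have "\<dots> = emeasure (density lborel (indicator (\<phi> ` S))) Y"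
   unfolding im using S(2) Y
   by (simp add: emeasure_density indicator_inter_arith[symmetric])
  finally show "emeasure (distr (density lborel J) borel \<phi>0) Y = emeasure (density lborel (indicator (\<phi> ` S))) Y" .
 qed simp
 then have "(\<integral>\<^sup>+y. f y \<partial>density lborel (indicator (\<phi> ` S))) = (\<integral>\<^sup>+y. f y \<partial>distr (density lborel J) borel \<phi>0)" by simp
 also have "\<dots> = (\<integral>\<^sup>+x. J x * f (\<phi>0 x) \<partial>lborel)"
  using f by (subst nn_integral_distr) (auto simp: nn_integral_density)
 also have "\<dots> = (\<integral>\<^sup>+x. J x * f (\<phi> x) \<partial>lborel)"
  by (intro nn_integral_cong) (auto simp: J_def \<phi>0_def indicator_def)
 finally show ?thesis
  using f S(2) by (simp add: nn_integral_density J_def mult.commute)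
qed

section \<open>Riemannian volume\<close>

definition volume_density ::
  "('m, 'n::finite) chart set => ('m, 'n) bilin_field => ('m, 'n) chart => real^'n => real" where
 "volume_density A g c x = sqrt \<bar>det (bilin_comp A c g x)\<bar>"

context manifold
begin

text \<open>\<open>chart_inv\<close> is uncontrolled outside the image of the chart; a constant
  value there makes it Borel measurable on the whole space.\<close>

definition chart_inv0 :: "('m, 'n) chart => real^'n => 'm" where
 "chart_inv0 c x = (if x \<in> snd c ` fst c then chart_inv c x else undefined)"

lemma chart_inv0_measurable [measurable]: "c \<in> A ==> chart_inv0 c \<in> borel_measurable borel"
 unfolding chart_inv0_def[abs_def] using open_chart(2) continuous_on_chart_inv
 by (intro borel_measurable_continuous_on_if) auto

lemma chart_image_borel:
 assumes "c \<in> A" "B \<in> sets borel"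
 shows "snd c ` (fst c \<inter> B) \<in> sets borel"
proof -
 have "snd c ` (fst c \<inter> B) = snd c ` fst c \<inter> chart_inv0 c -` B"
  using assms by (auto simp: chart_inv0_def)
 then show ?thesis
  using open_chart(2)[OF assms(1)] measurable_sets_borel[OF chart_inv0_measurable[OF assms(1)] assms(2)] by simp
qed

lemma inj_on_chart: "c \<in> A ==> inj_on (snd c) (fst c)"
 by (rule inj_on_inverseI[where g = "chart_inv c"]) simp

lemma chart_image_iff:
 assumes "c \<in> A" "p \<in> fst c"
 shows "snd c p \<in> snd c ` (fst c \<inter> B) \<longleftrightarrow> p \<in> B"
 using inj_on_image_mem_iff[OF inj_on_chart[OF assms(1)] assms(2), of "fst c \<inter> B"] assms(2) by simp

text \<open>Second countability enters here, through Lindelof's theorem; countably many charts allow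
  the volume to be built as a series.\<close>

lemma countable_charts:
 "\<exists>ch :: nat => ('m, 'n) chart. (\<forall>i. ch i \<in> A) \<and> (\<Union>i. fst (ch i)) = UNIV"
proof -
 obtain \<F> where F: "\<F> \<subseteq> fst ` A" "countable \<F>" "\<Union>\<F> = \<Union>(fst ` A)"
  by (rule Lindelof[of "fst ` A"]) (use open_chart in auto)
 have "\<Union>(fst ` A) = UNIV" using chart_at by blast
 then have U: "\<Union>\<F> = UNIV" using F by simp
 then have ne: "\<F> \<noteq> {}" by auto
 have r: "range (from_nat_into \<F>) = \<F>" by (rule range_from_nat_into[OF ne F(2)])
 have "\<exists>c. c \<in> A \<and> fst c = from_nat_into \<F> i" for i
 proof -
  have "from_nat_into \<F> i \<in> fst ` A" using F(1) from_nat_into[OF ne] by (rule subsetD)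
  then show ?thesis by (auto simp: image_iff Bex_def intro: sym)
 qed
 then obtain ch where ch: "\<And>i. ch i \<in> A \<and> fst (ch i) = from_nat_into \<F> i" by metis
 have "(\<Union>i. fst (ch i)) = \<Union>(range (from_nat_into \<F>))" using ch by auto
 then have "(\<Union>i. fst (ch i)) = UNIV" unfolding r U .
 with ch show ?thesis by (intro exI[of _ ch]) auto
qed

lemma metric_matrix_change:
 assumes g: "pseudo_riemannian_metric A g"
  and c: "c \<in> A" "p \<in> fst c" and d: "d \<in> A" "p \<in> fst d"
 defines "M \<equiv> matrix (transition_derivative c d p)"
 shows "bilin_comp A c g (snd c p) = transpose M ** bilin_comp A d g (snd d p) ** M"
proof -
 have tr: "transition_derivative c d p v = M *v v" for v
  unfolding M_def using matrix_works[of "transition_derivative c d p" v] linear_transition[OF c(1) d(1) c(2) d(2)]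
  by (simp add: linear_matrix_vector_mul_eq)
 have "u \<bullet> (bilin_comp A c g (snd c p) *v v) = u \<bullet> ((transpose M ** bilin_comp A d g (snd d p) ** M) *v v)" for u v
 proof -
  have "u \<bullet> (bilin_comp A c g (snd c p) *v v) = g p (of_coord A c p u) (of_coord A c p v)"
   using metric_chart[OF g c, of "of_coord A c p u" "of_coord A c p v"] c by simp
  also have "\<dots> = (M *v u) \<bullet> (bilin_comp A d g (snd d p) *v (M *v v))"
   using metric_chart[OF g d, of "of_coord A c p u" "of_coord A c p v"] to_coord_of_coord'[OF c(1) d(1) c(2) d(2)]
   by (simp add: tr)
  also have "\<dots> = u \<bullet> ((transpose M ** bilin_comp A d g (snd d p) ** M) *v v)"
   by (simp add: matrix_vector_mul_assoc[symmetric] dot_lmul_matrix[symmetric] vector_transpose_matrix)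
     (metis dot_lmul_matrix inner_commute transpose_matrix_vector)
  finally show ?thesis .
 qed
 then show ?thesis by (metis matrix_eq vector_eq_ldot)
qed

lemma volume_density_change:
 assumes "pseudo_riemannian_metric A g" "c \<in> A" "p \<in> fst c" "d \<in> A" "p \<in> fst d"
 shows "volume_density A g c (snd c p) =
   \<bar>det (matrix (transition_derivative c d p))\<bar> * volume_density A g d (snd d p)"
 unfolding volume_density_def metric_matrix_change[OF assms]
 by (simp add: det_mul abs_mult real_sqrt_mult)

context
 fixes g :: "('m, 'n) bilin_field"
 assumes g: "pseudo_riemannian_metric A g"
begin

lemma volume_density_pos: "c \<in> A ==> x \<in> snd c ` fst c ==> 0 < volume_density A g c x"
 using metric_matrix_det[OF metric_matrix_chart[OF g]] by (simp add: volume_density_def)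

lemma smooth_volume_density:
 assumes "c \<in> A" shows "smooth_on (volume_density A g c) (snd c ` fst c)"
 unfolding volume_density_def[abs_def] using metric_matrix_chart[OF g assms]
 by (intro smooth_on_sqrt smooth_on_abs smooth_on_det) (auto simp: metric_matrix_on_def)

lemma volume_density_measurable [measurable]:
 assumes "c \<in> A"
 shows "(\<lambda>x. indicator (snd c ` fst c) x * volume_density A g c x) \<in> borel_measurable borel"
proof -
 have "(\<lambda>x. if x \<in> snd c ` fst c then volume_density A g c x else 0) \<in> borel_measurable borel"
  using open_chart(2)[OF assms] smooth_on_continuous_on[OF smooth_volume_density[OF assms]]
  by (intro borel_measurable_continuous_on_if) auto
 then show ?thesis by (rule measurable_cong[THEN iffD1, rotated]) (auto simp: indicator_def)
qed

text \<open>The Riemannian volume of one chart domain, pushed forward to a Borel measure on the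
  whole manifold that is concentrated on this domain.\<close>

definition chart_measure :: "('m, 'n) chart => 'm measure" where
 "chart_measure c = distr (density lborel
   (\<lambda>x. ennreal (indicator (snd c ` fst c) x * volume_density A g c x))) borel (chart_inv0 c)"

lemma sets_chart_measure [simp]: "sets (chart_measure c) = sets borel"
 by (simp add: chart_measure_def)

lemma emeasure_chart_measure:
 assumes c: "c \<in> A" and B: "B \<in> sets borel"
 shows "emeasure (chart_measure c) B =
  (\<integral>\<^sup>+x\<in>snd c ` (fst c \<inter> B). ennreal (volume_density A g c x) \<partial>lborel)"
proof -
 note [measurable] = chart_inv0_measurable[OF c] volume_density_measurable[OF c]
 have V: "chart_inv0 c -` B \<in> sets borel" by (rule measurable_sets_borel[OF chart_inv0_measurable[OF c] B])
 have "emeasure (chart_measure c) B =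
   (\<integral>\<^sup>+x. ennreal (indicator (snd c ` fst c) x * volume_density A g c x) * indicator (chart_inv0 c -` B) x \<partial>lborel)"
  unfolding chart_measure_def using B V by (simp add: emeasure_distr emeasure_density)
 also have "\<dots> = (\<integral>\<^sup>+x\<in>snd c ` (fst c \<inter> B). ennreal (volume_density A g c x) \<partial>lborel)"
  by (intro nn_integral_cong) (use c in "auto simp: indicator_def chart_inv0_def")
 finally show ?thesis .
qed

text \<open>The Jacobian from the change of variables is the factor in the transformation law of
  \<open>volume_density\<close>.\<close>

lemma chart_measure_change:
 assumes c: "c \<in> A" and d: "d \<in> A" and B: "B \<in> sets borel" "B \<subseteq> fst c" "B \<subseteq> fst d"
 shows "emeasure (chart_measure c) B = emeasure (chart_measure d) B"
proof -
 define S where "S = snd c ` (fst c \<inter> fst d)"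
 define \<phi> where "\<phi> = snd d \<circ> chart_inv c"
 have im: "\<phi> ` S = snd d ` (fst d \<inter> fst c)" using c by (auto simp: \<phi>_def S_def image_iff)
 have S: "open S" "open (\<phi> ` S)"
  unfolding im using open_chart_image[OF c open_chart(1)[OF d]] open_chart_image[OF d open_chart(1)[OF c]]
  by (auto simp: S_def)
 have sm: "smooth_on \<phi> S" unfolding \<phi>_def S_def by (rule smooth_transition[OF c d])
 have M: "smooth_on (\<lambda>x. matrix (\<D> \<phi> (at x))) S"
  unfolding matrix_def using smooth_on_frechet[OF sm] by (intro smooth_intros S(1)) auto
 have "continuous_on S (\<lambda>x. \<bar>det (matrix (\<D> \<phi> (at x)))\<bar>)"
  using smooth_on_continuous_on[OF smooth_on_det[OF S(1) M]] by (rule continuous_on_rabs)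
 then have "(\<lambda>x. if x \<in> S then \<bar>det (matrix (\<D> \<phi> (at x)))\<bar> else 0) \<in> borel_measurable borel"
  using S(1) by (intro borel_measurable_continuous_on_if) auto
 then have meas: "(\<lambda>x. indicator S x * \<bar>det (matrix (\<D> \<phi> (at x)))\<bar>) \<in> borel_measurable borel"
  by (rule measurable_cong[THEN iffD1, rotated]) (auto simp: indicator_def)
 have Bd: "snd d ` B \<in> sets borel" using chart_image_borel[OF d B(1)] B(3) by (simp add: Int_absorb1)
 have Bc: "snd c ` B \<in> sets borel" using chart_image_borel[OF c B(1)] B(2) by (simp add: Int_absorb1)
 define f where "f = (\<lambda>y. ennreal (indicator (snd d ` fst d) y * volume_density A g d y) * indicator (snd d ` B) y)"
 have f: "f \<in> borel_measurable borel"
  unfolding f_def using volume_density_measurable[OF d] Bd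
  by (intro borel_measurable_times_ennreal measurable_compose[OF _ measurable_ennreal]) auto
 have inj: "inj_on \<phi> S"
 proof (rule inj_onI)
  fix x y assume "x \<in> S" "y \<in> S" "\<phi> x = \<phi> y"
  then obtain p q where pq: "p \<in> fst c" "p \<in> fst d" "x = snd c p" "q \<in> fst c" "q \<in> fst d" "y = snd c q"
   by (auto simp: S_def)
  then have "snd d p = snd d q" using \<open>\<phi> x = \<phi> y\<close> c by (simp add: \<phi>_def)
  then have "chart_inv d (snd d p) = chart_inv d (snd d q)" by simp
  then show "x = y" using pq d by simp
 qed
 have "emeasure (chart_measure d) B = (\<integral>\<^sup>+y\<in>\<phi> ` S. f y \<partial>lborel)"
  unfolding emeasure_chart_measure[OF d B(1)] im
  by (intro nn_integral_cong) (use B in "auto simp: f_def indicator_def")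
 also have "\<dots> = (\<integral>\<^sup>+x. ennreal (indicator S x * \<bar>det (matrix (\<D> \<phi> (at x)))\<bar>) * f (\<phi> x) \<partial>lborel)"
  by (rule nn_integral_image[OF S smooth_on_has_derivative[OF sm S(1)] inj meas f])
 also have "\<dots> = (\<integral>\<^sup>+x\<in>snd c ` (fst c \<inter> B). ennreal (volume_density A g c x) \<partial>lborel)"
 proof (intro nn_integral_cong)
  fix x
  show "ennreal (indicator S x * \<bar>det (matrix (\<D> \<phi> (at x)))\<bar>) * f (\<phi> x) =
    ennreal (volume_density A g c x) * indicator (snd c ` (fst c \<inter> B)) x"
  proof (cases "x \<in> S")
   case True
   then obtain p where p: "p \<in> fst c" "p \<in> fst d" "x = snd c p" by (auto simp: S_def)
   have fx: "\<phi> x = snd d p" using p c by (simp add: \<phi>_def)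
   have iff: "snd d p \<in> snd d ` B \<longleftrightarrow> p \<in> B" "x \<in> snd c ` (fst c \<inter> B) \<longleftrightarrow> p \<in> B"
    using chart_image_iff[OF d p(2), of B] chart_image_iff[OF c p(1), of B] B(3) p(3) by (simp_all add: Int_absorb1)
   have "volume_density A g c x = \<bar>det (matrix (\<D> \<phi> (at x)))\<bar> * volume_density A g d (snd d p)"
    using volume_density_change[OF g c p(1) d p(2)] by (simp add: \<phi>_def transition_derivative_def p(3))
   then show ?thesis
    using True iff p(2) by (simp add: f_def fx indicator_def ennreal_mult'' volume_density_def del: image_iff)
  next
   case False
   then have "x \<notin> snd c ` (fst c \<inter> B)" using B by (auto simp: S_def)
   then show ?thesis using False by simp
  qed
 qed
 finally show ?thesis unfolding emeasure_chart_measure[OF c B(1)] by simp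
qed

text \<open>The manifold is cut into countably many disjoint Borel pieces, each within one chart,
  and the chart measures of the pieces are added. The sum restricts correctly to every chart because
  chart measures agree on overlaps; additivity over the pieces also gives uniqueness.\<close>

lemma volume_measure_unique_existence:
 shows ex_volume_measure: "\<exists>V. sets V = sets borel \<and> (\<forall>c\<in>A. \<forall>B\<in>sets borel. B \<subseteq> fst c \<longrightarrow>
   emeasure V B = emeasure (chart_measure c) B)" (is ?ex)
  and volume_measure_unique: "\<And>V V'. sets V = sets borel ==> (\<forall>c\<in>A. \<forall>B\<in>sets borel. B \<subseteq> fst c \<longrightarrow>
   emeasure V B = emeasure (chart_measure c) B) ==> sets V' = sets borel ==> (\<forall>c\<in>A. \<forall>B\<in>sets borel. B \<subseteq> fst c \<longrightarrow>
   emeasure V' B = emeasure (chart_measure c) B) ==> V = V'"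
proof -
 obtain ch :: "nat => ('m, 'n) chart" where ch: "\<And>i. ch i \<in> A" "(\<Union>i. fst (ch i)) = UNIV"
  using countable_charts by blast
 define P where "P = disjointed (\<lambda>i. fst (ch i))"
 have P: "disjoint_family P" "(\<Union>i. P i) = UNIV" "P i \<subseteq> fst (ch i)" for i
  using disjoint_family_disjointed UN_disjointed_eq[of "\<lambda>i. fst (ch i)"] ch(2)
   disjointed_subset[of "\<lambda>i. fst (ch i)" i]
  by (simp_all add: P_def)
 have Pb: "P i \<in> sets borel" for i
  unfolding P_def disjointed_def using open_chart(1)[OF ch(1)] by (auto intro!: sets.Diff sets.finite_UN)
 have split: "(\<Sum>i. emeasure V (B \<inter> P i)) = emeasure V B" if "sets V = sets borel" "B \<in> sets borel" for V B
 proof -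
  have "(\<Sum>i. emeasure V (B \<inter> P i)) = emeasure V (\<Union>i. B \<inter> P i)"
   by (rule suminf_emeasure) (use P Pb that in "auto simp: disjoint_family_on_def")
  also have "(\<Union>i. B \<inter> P i) = B" using P(2) by blast
  finally show ?thesis .
 qed
 \<comment> \<open>The sum over the pieces is written as an integral over the counting measure, so
   that countable additivity becomes an exchange of integral and series.\<close>
 define \<mu> where "\<mu> = (\<lambda>B. \<integral>\<^sup>+i. emeasure (chart_measure (ch i)) (B \<inter> P i) \<partial>count_space UNIV)"
 define V where "V = measure_of UNIV (sets borel) \<mu>"
 have sV: "sets V = sets borel" by (simp add: V_def sets.sets_measure_of_eq[of borel, simplified])
 have eV: "emeasure V B = \<mu> B" if "B \<in> sets borel" for B
 proof (rule emeasure_measure_of[OF V_def])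
  show "positive (sets V) \<mu>" by (simp add: positive_def \<mu>_def)
  show "countably_additive (sets V) \<mu>"
   unfolding countably_additive_def
  proof (intro allI impI)
   fix F :: "nat => 'm set" assume F: "range F \<subseteq> sets V" "disjoint_family F"
   have "(\<Sum>j. \<mu> (F j)) = (\<integral>\<^sup>+i. (\<Sum>j. emeasure (chart_measure (ch i)) (F j \<inter> P i)) \<partial>count_space UNIV)"
    unfolding \<mu>_def by (rule nn_integral_suminf[symmetric]) simp
   also have "\<dots> = \<mu> (\<Union>j. F j)"
    unfolding \<mu>_def
   proof (rule nn_integral_cong)
    fix i
    have "(\<Sum>j. emeasure (chart_measure (ch i)) (F j \<inter> P i)) = emeasure (chart_measure (ch i)) (\<Union>j. F j \<inter> P i)"
     by (rule suminf_emeasure) (use F sV Pb in "auto simp: disjoint_family_on_def")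
    then show "(\<Sum>j. emeasure (chart_measure (ch i)) (F j \<inter> P i)) = emeasure (chart_measure (ch i)) ((\<Union>j. F j) \<inter> P i)"
     by (simp add: Int_UN_distrib2)
   qed
   finally show "(\<Sum>j. \<mu> (F j)) = \<mu> (\<Union>j. F j)" .
  qed
 qed (use that sV in auto)
 have "emeasure V B = emeasure (chart_measure c) B" if c: "c \<in> A" and B: "B \<in> sets borel" "B \<subseteq> fst c" for c B
 proof -
  have "emeasure V B = (\<Sum>i. emeasure (chart_measure (ch i)) (B \<inter> P i))"
   unfolding eV[OF B(1)] \<mu>_def by (rule nn_integral_count_space_nat)
  also have "\<dots> = (\<Sum>i. emeasure (chart_measure c) (B \<inter> P i))"
   by (intro suminf_cong chart_measure_change ch c) (use B Pb P(3) in auto)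
  also have "\<dots> = emeasure (chart_measure c) B" by (rule split) (use B in auto)
  finally show ?thesis .
 qed
 then show ?ex using sV by blast
 fix V V'
 assume V: "sets V = sets borel" "\<forall>c\<in>A. \<forall>B\<in>sets borel. B \<subseteq> fst c \<longrightarrow> emeasure V B = emeasure (chart_measure c) B"
  and V': "sets V' = sets borel" "\<forall>c\<in>A. \<forall>B\<in>sets borel. B \<subseteq> fst c \<longrightarrow> emeasure V' B = emeasure (chart_measure c) B"
 show "V = V'"
 proof (rule measure_eqI)
  fix B assume "B \<in> sets V"
  then have B: "B \<in> sets borel" using V by simp
  have "emeasure V (B \<inter> P i) = emeasure V' (B \<inter> P i)" for i
  proof -
   have s: "B \<inter> P i \<subseteq> fst (ch i)" using P(3)[of i] by blast
   have b: "B \<inter> P i \<in> sets borel" using B Pb by simp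
   show ?thesis using V(2)[rule_format, OF ch(1) b s] V'(2)[rule_format, OF ch(1) b s] by simp
  qed
  then show "emeasure V B = emeasure V' B" using split[OF V(1) B] split[OF V'(1) B] by simp
 qed (use V V' in simp)
qed

lemma volume_measure_eqI:
 assumes "sets V = sets borel"
  and "\<And>c B. c \<in> A ==> B \<in> sets borel ==> B \<subseteq> fst c ==> emeasure V B = emeasure (chart_measure c) B"
 shows "volume_measure A g = V"
proof -
 have *: "(\<integral>\<^sup>+x\<in>snd c ` B. ennreal (sqrt \<bar>det (bilin_comp A c g x)\<bar>) \<partial>lborel) = emeasure (chart_measure c) B"
  if "c \<in> A" "B \<in> sets borel" "B \<subseteq> fst c" for c B
  using emeasure_chart_measure[OF that(1,2)] that(3) by (simp add: volume_density_def Int_absorb1)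
 show ?thesis
  unfolding volume_measure_def
 proof (rule the_equality, intro conjI ballI impI)
  fix V'
  assume "sets V' = sets borel \<and> (\<forall>c\<in>A. \<forall>B\<in>sets borel. B \<subseteq> fst c \<longrightarrow>
   emeasure V' B = (\<integral>\<^sup>+x\<in>snd c ` B. ennreal (sqrt \<bar>det (bilin_comp A c g x)\<bar>) \<partial>lborel))"
  then show "V' = V" using volume_measure_unique[of V' V] assms * by auto
 qed (use assms * in auto)
qed

lemma volume_measure_props:
 shows sets_volume_measure: "sets (volume_measure A g) = sets borel"
  and emeasure_volume_chart: "\<And>c B. c \<in> A ==> B \<in> sets borel ==> B \<subseteq> fst c ==>
    emeasure (volume_measure A g) B = emeasure (chart_measure c) B"
proof -
 obtain V where V: "sets V = sets borel" "\<forall>c\<in>A. \<forall>B\<in>sets borel. B \<subseteq> fst c \<longrightarrow>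
   emeasure V B = emeasure (chart_measure c) B"
  using ex_volume_measure by blast
 then have "volume_measure A g = V" by (intro volume_measure_eqI) auto
 then show "sets (volume_measure A g) = sets borel" "\<And>c B. c \<in> A ==> B \<in> sets borel ==> B \<subseteq> fst c ==>
    emeasure (volume_measure A g) B = emeasure (chart_measure c) B"
  using V by auto
qed

lemma space_volume_measure: "space (volume_measure A g) = UNIV"
 using sets_eq_imp_space_eq[OF sets_volume_measure] by simp

lemma density_volume_chart:
 assumes c: "c \<in> A"
 shows "density (volume_measure A g) (indicator (fst c)) = chart_measure c"
proof (rule measure_eqI)
 fix B assume "B \<in> sets (density (volume_measure A g) (indicator (fst c)))"
 then have B: "B \<in> sets borel" using sets_volume_measure by simp
 have U: "fst c \<in> sets borel" using open_chart(1)[OF c] by auto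
 have "emeasure (density (volume_measure A g) (indicator (fst c))) B = emeasure (volume_measure A g) (fst c \<inter> B)"
  using B U sets_volume_measure by (simp add: emeasure_density indicator_inter_arith[symmetric])
 also have "\<dots> = emeasure (chart_measure c) (fst c \<inter> B)"
  using B U by (intro emeasure_volume_chart c) auto
 also have "\<dots> = emeasure (chart_measure c) B"
  using B U c by (simp add: emeasure_chart_measure[OF c] Int_assoc[symmetric])
 finally show "emeasure (density (volume_measure A g) (indicator (fst c))) B = emeasure (chart_measure c) B" .
qed (simp add: sets_volume_measure)

lemma integral_volume_chart:
 fixes f :: "'m => real"
 assumes c: "c \<in> A" and f: "f \<in> borel_measurable borel" and supp: "\<And>p. p \<notin> fst c ==> f p = 0"
 shows "integral\<^sup>L (volume_measure A g) f =
  integral\<^sup>L lborel (\<lambda>x. indicator (snd c ` fst c) x * (volume_density A g c x * f (chart_inv c x)))"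
proof -
 note [measurable] = chart_inv0_measurable[OF c] volume_density_measurable[OF c]
 have U: "fst c \<in> sets borel" using open_chart(1)[OF c] by auto
 have f': "f \<in> borel_measurable (volume_measure A g)"
  using f by (simp cong: measurable_cong_sets add: sets_volume_measure)
 have "f p = indicator (fst c) p *\<^sub>R f p" for p using supp[of p] by (auto simp: indicator_def)
 then have "integral\<^sup>L (volume_measure A g) f = integral\<^sup>L (volume_measure A g) (\<lambda>p. indicator (fst c) p *\<^sub>R f p)"
  by presburger
 also have "\<dots> = integral\<^sup>L (density (volume_measure A g) (\<lambda>p. ennreal (indicator (fst c) p))) f"
  using f' U by (intro integral_density[symmetric] borel_measurable_indicator) (auto simp: sets_volume_measure)
 also have "density (volume_measure A g) (\<lambda>p. ennreal (indicator (fst c) p)) = chart_measure c"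
  using density_volume_chart[OF c] by (simp add: ennreal_indicator)
 also have "integral\<^sup>L (chart_measure c) f = integral\<^sup>L (density lborel
   (\<lambda>x. ennreal (indicator (snd c ` fst c) x * volume_density A g c x))) (\<lambda>x. f (chart_inv0 c x))"
  unfolding chart_measure_def using f by (intro integral_distr) auto
 also have "\<dots> = integral\<^sup>L lborel (\<lambda>x. (indicator (snd c ` fst c) x * volume_density A g c x) *\<^sub>R f (chart_inv0 c x))"
 proof (rule integral_density)
  show "(\<lambda>x. f (chart_inv0 c x)) \<in> borel_measurable lborel"
   using measurable_compose[OF chart_inv0_measurable[OF c] f] by simp
  show "AE x in lborel. 0 \<le> indicator (snd c ` fst c) x * volume_density A g c x"
   by (auto simp: volume_density_def)
 qed (use volume_density_measurable[OF c] in simp)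
 also have "\<dots> = integral\<^sup>L lborel (\<lambda>x. indicator (snd c ` fst c) x * (volume_density A g c x * f (chart_inv c x)))"
  by (intro Bochner_Integration.integral_cong) (auto simp: indicator_def chart_inv0_def)
 finally show ?thesis .
qed

text \<open>The density is positive and nonempty open sets are not negligible. This turns vanishing
  integrals of nonnegative continuous functions into pointwise vanishing.\<close>

lemma volume_open_pos:
 assumes "open W" "p \<in> W"
 shows "emeasure (volume_measure A g) W \<noteq> 0"
proof
 assume z: "emeasure (volume_measure A g) W = 0"
 obtain c where c: "c \<in> A" "p \<in> fst c" by (rule ex_chart)
 define B where "B = fst c \<inter> W"
 have B: "B \<in> sets borel" "B \<subseteq> fst c" using open_chart(1)[OF c(1)] assms by (auto simp: B_def)
 have "emeasure (volume_measure A g) B \<le> emeasure (volume_measure A g) W"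
  by (rule emeasure_mono) (use assms in "auto simp: B_def sets_volume_measure")
 then have "emeasure (chart_measure c) B = 0" using z emeasure_volume_chart[OF c(1) B] by simp
 then have "(\<integral>\<^sup>+x. ennreal (indicator (snd c ` fst c) x * volume_density A g c x) * indicator (snd c ` B) x \<partial>lborel) = 0"
  unfolding emeasure_chart_measure[OF c(1) B(1)]
  by (subst nn_integral_cong) (auto simp: indicator_def B_def)
 moreover have o: "open (snd c ` B)" using open_chart_image[OF c(1) assms(1)] by (simp add: B_def)
 ultimately have "AE x in lborel. ennreal (indicator (snd c ` fst c) x * volume_density A g c x) * indicator (snd c ` B) x = 0"
  using volume_density_measurable[OF c(1)] by (subst (asm) nn_integral_0_iff_AE) auto
 then have "AE x in lborel. x \<notin> snd c ` B"
 proof (rule eventually_mono)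
  fix x assume "ennreal (indicator (snd c ` fst c) x * volume_density A g c x) * indicator (snd c ` B) x = 0"
  then show "x \<notin> snd c ` B"
   using volume_density_pos[OF c(1), of x] by (auto simp: B_def indicator_def split: if_splits)
 qed
 then have "emeasure lborel (snd c ` B) = 0"
  using o by (subst (asm) AE_iff_measurable[OF _ refl]) auto
 moreover have "snd c ` B \<noteq> {}" using c assms by (auto simp: B_def)
 ultimately show False using o open_not_negligible[of "snd c ` B"]
  by (simp add: negligible_iff_emeasure0 emeasure_completion)
qed

text \<open>The density is bounded on closed coordinate balls, so the volume is locally finite, and
  finitely many such neighbourhoods cover a compact set.\<close>

lemma volume_compact_finite:
 assumes "compact K"
 shows "emeasure (volume_measure A g) K < \<infinity>"
proof -
 have "\<exists>N. open N \<and> p \<in> N \<and> emeasure (volume_measure A g) N < \<infinity>" for p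
 proof -
  obtain c where c: "c \<in> A" "p \<in> fst c" by (rule ex_chart)
  obtain r where r: "r > 0" "cball (snd c p) r \<subseteq> snd c ` fst c"
   using open_chart(2)[OF c(1)] c(2) open_contains_cball by (metis image_eqI)
  obtain C where C: "\<And>x. x \<in> cball (snd c p) r ==> \<bar>volume_density A g c x\<bar> \<le> C"
   using compact_continuous_bounded[OF compact_cball continuous_on_subset[OF
     smooth_on_continuous_on[OF smooth_volume_density[OF c(1)]] r(2)]] by blast
  define N where "N = {q \<in> fst c. snd c q \<in> ball (snd c p) r}"
  have N: "open N" "p \<in> N" "N \<subseteq> fst c"
   using open_chart_preimage[OF c(1), of "ball (snd c p) r"] r c by (auto simp: N_def)
  have Nb: "N \<in> sets borel" using N(1) by auto
  have "emeasure (volume_measure A g) N = (\<integral>\<^sup>+x\<in>snd c ` (fst c \<inter> N). ennreal (volume_density A g c x) \<partial>lborel)"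
   using emeasure_volume_chart[OF c(1) Nb N(3)] emeasure_chart_measure[OF c(1) Nb] by simp
  also have "\<dots> \<le> (\<integral>\<^sup>+x. ennreal C * indicator (cball (snd c p) r) x \<partial>lborel)"
  proof (rule nn_integral_mono)
   fix x
   show "ennreal (volume_density A g c x) * indicator (snd c ` (fst c \<inter> N)) x \<le> ennreal C * indicator (cball (snd c p) r) x"
   proof (cases "x \<in> snd c ` (fst c \<inter> N)")
    case True
    then have "x \<in> cball (snd c p) r" by (auto simp: N_def)
    then show ?thesis using C[of x] True by (auto intro!: ennreal_leI)
   qed simp
  qed
  also have "\<dots> = ennreal C * emeasure lborel (cball (snd c p) r)"
   by (simp add: nn_integral_cmult_indicator)
  also have "\<dots> < \<infinity>"
   using emeasure_lborel_cball_finite[of "snd c p" r] by (simp add: ennreal_mult_less_top)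
  finally show ?thesis using N by blast
 qed
 then obtain N where N: "\<And>p. open (N p) \<and> p \<in> N p \<and> emeasure (volume_measure A g) (N p) < \<infinity>" by metis
 obtain F where F: "finite F" "K \<subseteq> (\<Union>p\<in>F. N p)"
  using compactE_image[OF assms, of UNIV N] N by (metis UNIV_I UN_iff subsetI)
 have "emeasure (volume_measure A g) K \<le> emeasure (volume_measure A g) (\<Union>p\<in>F. N p)"
  by (rule emeasure_mono[OF F(2)]) (use N F in "auto simp: sets_volume_measure")
 also have "\<dots> \<le> (\<Sum>p\<in>F. emeasure (volume_measure A g) (N p))"
  using N F by (intro emeasure_subadditive_finite) (auto simp: sets_volume_measure)
 also have "\<dots> < \<infinity>" using N F by simp
 finally show ?thesis .
qed

end

section \<open>Comparison of the volumes of two metrics\<close>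

definition volume_ratio :: "('m, 'n) bilin_field => ('m, 'n) bilin_field => 'm => real" where
 "volume_ratio g g' p = volume_density A g' (chart_at A p) (snd (chart_at A p) p) /
   volume_density A g (chart_at A p) (snd (chart_at A p) p)"

context
 fixes g g' :: "('m, 'n) bilin_field"
 assumes g: "pseudo_riemannian_metric A g" and g': "pseudo_riemannian_metric A g'"
begin

text \<open>Under a change of chart both densities are multiplied by the same Jacobian, which drops
  out of the quotient.\<close>

lemma volume_ratio_chart:
 assumes c: "c \<in> A" "p \<in> fst c"
 shows "volume_ratio g g' p = volume_density A g' c (snd c p) / volume_density A g c (snd c p)"
proof -
 let ?d = "chart_at A p"
 have "volume_density A g ?d (snd ?d p) \<noteq> 0"
  using volume_density_pos[OF g chart_at(1), of "snd ?d p"] chart_at(2) by force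
 then have "det (matrix (transition_derivative ?d c p)) \<noteq> 0"
  using volume_density_change[OF g chart_at c] by auto
 then show ?thesis
  unfolding volume_ratio_def volume_density_change[OF g chart_at c] volume_density_change[OF g' chart_at c]
  by simp
qed

lemma volume_ratio_pos: "0 < volume_ratio g g' p"
 unfolding volume_ratio_def using volume_density_pos[OF g chart_at(1)] volume_density_pos[OF g' chart_at(1)] chart_at(2)
 by (intro divide_pos_pos) auto

lemma continuous_volume_ratio: "continuous_on UNIV (volume_ratio g g')"
proof -
 have "isCont (volume_ratio g g') p" for p
 proof -
  obtain c where c: "c \<in> A" "p \<in> fst c" by (rule ex_chart)
  have "continuous_on (fst c) (\<lambda>p. volume_density A g' c (snd c p) / volume_density A g c (snd c p))"
   by (intro continuous_on_divide ballI
     continuous_on_compose2[OF smooth_on_continuous_on[OF smooth_volume_density[OF g' c(1)]] continuous_on_chart[OF c(1)]]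
     continuous_on_compose2[OF smooth_on_continuous_on[OF smooth_volume_density[OF g c(1)]] continuous_on_chart[OF c(1)]])
     (use volume_density_pos[OF g c(1)] in force)+
  then have "continuous_on (fst c) (volume_ratio g g')"
   by (rule continuous_on_cong[THEN iffD1, rotated 2]) (use volume_ratio_chart[OF c(1)] in auto)
  then show ?thesis using open_chart(1)[OF c(1)] c(2) by (simp add: continuous_on_eq_continuous_at)
 qed
 then show ?thesis by (simp add: continuous_at_imp_continuous_on)
qed

text \<open>All metrics of a variation thereby share one fixed measure, and only the integrand
  depends on the parameter.\<close>

lemma volume_measure_density:
 "volume_measure A g' = density (volume_measure A g) (\<lambda>p. ennreal (volume_ratio g g' p))"
proof (rule volume_measure_eqI[OF g'])
 show "sets (density (volume_measure A g) (\<lambda>p. ennreal (volume_ratio g g' p))) = sets borel"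
  by (simp add: sets_volume_measure[OF g])
 have mr: "volume_ratio g g' \<in> borel_measurable borel"
  using continuous_volume_ratio by (rule borel_measurable_continuous_onI)
 fix c B assume c: "c \<in> A" and B: "B \<in> sets borel" "B \<subseteq> fst c"
 note [measurable] = chart_inv0_measurable[OF c] volume_density_measurable[OF g c] mr
 have mr': "(\<lambda>p. ennreal (volume_ratio g g' p)) \<in> borel_measurable (volume_measure A g)"
  using mr by (simp cong: measurable_cong_sets add: sets_volume_measure[OF g])
 have "emeasure (density (volume_measure A g) (\<lambda>p. ennreal (volume_ratio g g' p))) B =
   (\<integral>\<^sup>+p. ennreal (volume_ratio g g' p) * indicator B p \<partial>volume_measure A g)"
  using B mr' by (intro emeasure_density) (auto simp: sets_volume_measure[OF g])
 also have "\<dots> = (\<integral>\<^sup>+p. indicator (fst c) p * (ennreal (volume_ratio g g' p) * indicator B p) \<partial>volume_measure A g)"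
  by (intro nn_integral_cong) (use B in "auto simp: indicator_def")
 also have "\<dots> = (\<integral>\<^sup>+p. ennreal (volume_ratio g g' p) * indicator B p \<partial>density (volume_measure A g) (indicator (fst c)))"
  using B open_chart(1)[OF c]
  by (intro nn_integral_density[symmetric] borel_measurable_indicator borel_measurable_times_ennreal mr')
    (auto simp: sets_volume_measure[OF g])
 also have "\<dots> = (\<integral>\<^sup>+p. ennreal (volume_ratio g g' p) * indicator B p \<partial>chart_measure g c)"
  by (simp add: density_volume_chart[OF g c])
 also have "\<dots> = (\<integral>\<^sup>+x. ennreal (indicator (snd c ` fst c) x * volume_density A g c x) *
   (ennreal (volume_ratio g g' (chart_inv0 c x)) * indicator B (chart_inv0 c x)) \<partial>lborel)"
  unfolding chart_measure_def[OF g] using B by (simp add: nn_integral_distr nn_integral_density)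
 also have "\<dots> = (\<integral>\<^sup>+x\<in>snd c ` (fst c \<inter> B). ennreal (volume_density A g' c x) \<partial>lborel)"
 proof (intro nn_integral_cong)
  fix x
  show "ennreal (indicator (snd c ` fst c) x * volume_density A g c x) *
   (ennreal (volume_ratio g g' (chart_inv0 c x)) * indicator B (chart_inv0 c x)) =
   ennreal (volume_density A g' c x) * indicator (snd c ` (fst c \<inter> B)) x"
  proof (cases "x \<in> snd c ` fst c")
   case True
   then obtain p where p: "p \<in> fst c" "x = snd c p" by auto
   have v: "0 < volume_density A g c x" "0 < volume_density A g' c x"
    using volume_density_pos[OF g c True] volume_density_pos[OF g' c True] by auto
   have iff: "x \<in> snd c ` (fst c \<inter> B) \<longleftrightarrow> p \<in> B"
    using chart_image_iff[OF c p(1), of B] p(2) by simp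
   have inv: "chart_inv0 c x = p" using p c by (auto simp: chart_inv0_def)
   have "volume_density A g c x * volume_ratio g g' p = volume_density A g' c x"
    using volume_ratio_chart[OF c p(1)] v(1) by (simp add: p(2))
   then have "ennreal (volume_density A g c x) * ennreal (volume_ratio g g' p) = ennreal (volume_density A g' c x)"
    using v volume_ratio_pos[of p] by (simp add: ennreal_mult[symmetric])
   then show ?thesis using True by (simp add: inv iff mult.assoc[symmetric] indicator_def)
  next
   case False
   then have "x \<notin> snd c ` (fst c \<inter> B)" by auto
   then show ?thesis using False by simp
  qed
 qed
 also have "\<dots> = emeasure (chart_measure g' c) B" using emeasure_chart_measure[OF g' c B(1)] by simp
 finally show "emeasure (density (volume_measure A g) (\<lambda>p. ennreal (volume_ratio g g' p))) B = emeasure (chart_measure g' c) B" .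
qed

end

end

section \<open>The Palatini identity\<close>

text \<open>The derivative of \<open>curvature_rep\<close> at the coefficients \<open>C\<close> in
  direction \<open>H\<close>.\<close>

definition curvature_variation ::
  "'n::finite coefficients => 'n::finite coefficients =>
   real^'n => real^'n => real^'n => real^'n => real^'n" where
 "curvature_variation C H x u w v =
   \<D> (\<lambda>y. H y u v) (at x) w - \<D> (\<lambda>y. H y w v) (at x) u
   + (H x w (C x u v) + C x w (H x u v) - H x u (C x w v) - C x u (H x w v))"

definition ricci_variation ::
  "'n::finite coefficients => 'n::finite coefficients =>
   real^'n => real^'n => real^'n => real" where
 "ricci_variation C H x u v = (\<Sum>*j. curvature_variation C H x u (axis j 1) v $ j)"

text \<open>Here the inverse metric is held fixed; its own derivative is accounted for in
  \<open>scalar_rep_family_derivative\<close>.\<close>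

definition scalar_variation ::
  "(real^'n => real^'n^'n) => 'n::finite coefficients =>
   'n::finite coefficients => real^'n => real" where
 "scalar_variation G C H x =
   (\<Sum>*i m. matrix_inv (G x) $ i $ m * ricci_variation C H x (axis i 1) (axis m 1))"

text \<open>The vector \<open>g^{im} H_{im}^k - g^{km} H_{jm}^j\<close> times the volume density.
  With this factor the plain coordinate divergence is the density times the metric divergence, and
  no covariant derivative of \<open>H\<close> has to be defined.\<close>

definition palatini_field ::
  "(real^'n => real^'n^'n) => 'n::finite coefficients => real^'n => real^'n" where
 "palatini_field G H x = sqrt \<bar>det (G x)\<bar> *\<^sub>R (\<chi> k.
   (\<Sum>*i m. matrix_inv (G x) $ i $ m * H x (axis i 1) (axis m 1) $ k) -
   (\<Sum>*m j. matrix_inv (G x) $ k $ m * H x (axis j 1) (axis m 1) $ j))"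

lemma has_real_derivative_along:
 fixes f :: "'a::real_normed_vector => 'b::real_normed_vector"
 assumes "(f has_derivative f') (at x)"
 shows "((\<lambda>t. f (x + t *\<^sub>R e)) has_vector_derivative f' e) (at 0)"
proof -
 have "((\<lambda>t. x + t *\<^sub>R e) has_derivative (\<lambda>t. t *\<^sub>R e)) (at 0)"
  by (auto intro!: derivative_eq_intros)
 from has_derivative_compose[OF this] assms
 have "((\<lambda>t. f (x + t *\<^sub>R e)) has_derivative (\<lambda>t. f' (t *\<^sub>R e))) (at 0)" by simp
 then show ?thesis
  using linear_scale[OF has_derivative_linear[OF assms]] by (simp add: has_vector_derivative_def)
qed

lemma has_real_derivative_sqrt_det:
 fixes M :: "real => real^'n^'n"
 assumes M: "(M has_vector_derivative M') (at t)" and nz: "det (M t) \<noteq> 0"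
 shows "((\<lambda>t. sqrt \<bar>det (M t)\<bar>) has_real_derivative
   sqrt \<bar>det (M t)\<bar> * (trace (matrix_inv (M t) ** M') / 2)) (at t)"
proof -
 let ?D = "det (M t) * trace (matrix_inv (M t) ** M')"
 have "((\<lambda>t. (det (M t))\<^sup>2) has_real_derivative 2 * det (M t) * ?D) (at t)"
  using DERIV_power[OF has_real_derivative_det[OF M nz], of 2] by (simp add: mult_ac)
 \<comment> \<open>The absolute value is differentiated as the square root of the square.\<close>
 then have 1: "((\<lambda>t. sqrt ((det (M t))\<^sup>2)) has_real_derivative
   (inverse (sqrt ((det (M t))\<^sup>2)) / 2) * (2 * det (M t) * ?D)) (at t)"
  using nz by (intro DERIV_chain2[OF DERIV_real_sqrt]) auto
 have "0 < \<bar>det (M t)\<bar>" using nz by simp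
 from DERIV_chain2[OF DERIV_real_sqrt[OF this] 1[unfolded real_sqrt_abs]]
 have "((\<lambda>t. sqrt \<bar>det (M t)\<bar>) has_real_derivative
   (inverse (sqrt \<bar>det (M t)\<bar>) / 2) * ((inverse \<bar>det (M t)\<bar> / 2) * (2 * det (M t) * ?D))) (at t)" .
 also have "(inverse \<bar>det (M t)\<bar> / 2) * (2 * det (M t) * ?D) = \<bar>det (M t)\<bar> * trace (matrix_inv (M t) ** M')"
  using nz by (simp add: field_simps abs_mult_self_eq power2_eq_square[symmetric])
 also have "(inverse (sqrt \<bar>det (M t)\<bar>) / 2) * (\<bar>det (M t)\<bar> * trace (matrix_inv (M t) ** M')) =
   sqrt \<bar>det (M t)\<bar> * (trace (matrix_inv (M t) ** M') / 2)"
  using nz by (simp add: field_simps)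
 finally show ?thesis .
qed

lemma matrix_mult_add_left: "(M + N) ** P = M ** P + N ** P"
 for M N :: "real^'n^'m" and P :: "real^'l^'n"
 by (simp add: vec_eq_iff matrix_matrix_mult_def sum.distrib algebra_simps)

lemma trace_matrix_mult: "trace (M ** N) = (\<Sum>*i j. M $ i $ j * N $ j $ i)"
 for M N :: "real^'n^'n"
 by (simp add: trace_def matrix_matrix_mult_def)

lemma trace_transpose: "trace (transpose M) = trace (M :: real^'n^'n)"
 by (simp add: trace_def transpose_def)

lemma matrix_inv_symmetric:
 fixes M :: "real^'n^'n"
 assumes "det M \<noteq> 0" "transpose M = M"
 shows "transpose (matrix_inv M) = matrix_inv M"
proof -
 have "transpose (matrix_inv M) ** M = mat 1"
  using matrix_inv_right[OF assms(1)] assms(2) by (metis matrix_transpose_mul transpose_mat)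
 then have "transpose (matrix_inv M) ** M ** matrix_inv M = matrix_inv M" by simp
 then show ?thesis using matrix_inv_right[OF assms(1)] by (simp add: matrix_mul_assoc[symmetric])
qed

context
 fixes G :: "real^'n => real^'n^'n" and S x
 assumes G: "metric_matrix_on G S" and x: "x \<in> S"
begin

definition connection_matrix :: "real^'n => real^'n^'n" where
 "connection_matrix u = matrix (christoffel G x u)"

lemma connection_matrix_mult: "connection_matrix u *v w = christoffel G x u w"
 using bilinear_christoffel[OF G x] unfolding connection_matrix_def
 by (simp add: bilinear_def matrix_works linear_matrix_vector_mul_eq)

text \<open>Metric compatibility as a matrix equation; the derivatives of the volume density and of
  the inverse metric follow from it by matrix algebra.\<close>

lemma metric_derivative_matrix:
 "\<D> G (at x) u = G x ** connection_matrix u + transpose (connection_matrix u) ** G x"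
proof -
 have "v \<bullet> (\<D> G (at x) u *v w) =
   v \<bullet> ((G x ** connection_matrix u + transpose (connection_matrix u) ** G x) *v w)" for v w
 proof -
  have "v \<bullet> (\<D> G (at x) u *v w) =
    christoffel G x u v \<bullet> (G x *v w) + christoffel G x u w \<bullet> (G x *v v)"
   by (rule christoffel_metric[OF G x])
  also have "christoffel G x u w \<bullet> (G x *v v) = v \<bullet> (G x *v (connection_matrix u *v w))"
   unfolding connection_matrix_mult by (rule metric_matrix_inner[OF G x])
  also have "christoffel G x u v \<bullet> (G x *v w) = v \<bullet> (transpose (connection_matrix u) *v (G x *v w))"
   unfolding connection_matrix_mult[symmetric] by (metis dot_lmul_matrix transpose_matrix_vector inner_commute)
  finally show ?thesis
   by (simp add: matrix_vector_mult_add_rdistrib matrix_vector_mul_assoc inner_add_right)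
 qed
 then show ?thesis by (metis matrix_eq vector_eq_ldot)
qed

text \<open>The logarithmic derivative of the density is half the trace of the inverse metric times
  the derivative of the metric. Both summands of \<open>metric_derivative_matrix\<close> contribute
  the same trace, the contracted Christoffel symbol.\<close>

lemma sqrt_det_derivative:
 "((\<lambda>t. sqrt \<bar>det (G (x + t *\<^sub>R u))\<bar>) has_real_derivative
   sqrt \<bar>det (G x)\<bar> * (\<Sum>*l. christoffel G x u (axis l 1) $ l)) (at 0)"
proof -
 have i: "matrix_inv (G x) ** G x = mat 1" "G x ** matrix_inv (G x) = mat 1"
  using matrix_inv_left matrix_inv_right metric_matrix_det[OF G x] by blast+
 let ?N = "connection_matrix u"
 have "trace (matrix_inv (G x) ** (transpose ?N ** G x)) = trace ((transpose ?N ** G x) ** matrix_inv (G x))"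
  by (rule trace_mul_sym)
 also have "(transpose ?N ** G x) ** matrix_inv (G x) = transpose ?N"
  by (simp add: matrix_mul_assoc[symmetric] i)
 finally have 1: "trace (matrix_inv (G x) ** (transpose ?N ** G x)) = trace ?N" by (simp add: trace_transpose)
 have 2: "matrix_inv (G x) ** (G x ** ?N) = ?N" by (simp add: matrix_mul_assoc i)
 have "trace (matrix_inv (G x) ** \<D> G (at x) u) = 2 * trace ?N"
  unfolding metric_derivative_matrix matrix_add_ldistrib trace_add 1 2 by simp
 moreover have "trace (connection_matrix u) = (\<Sum>*l. christoffel G x u (axis l 1) $ l)"
  by (simp add: trace_def connection_matrix_def matrix_def)
 ultimately show ?thesis
  using has_real_derivative_sqrt_det[OF has_real_derivative_along[OF metric_matrix_derivative[OF G x], of u]]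
   metric_matrix_det[OF G x] by simp
qed

lemma matrix_inv_metric_derivative:
 "((\<lambda>t. matrix_inv (G (x + t *\<^sub>R u)) $ i $ m) has_real_derivative
   - ((\<Sum>*l. matrix_inv (G x) $ l $ m * christoffel G x u (axis l 1) $ i) +
    (\<Sum>*l. matrix_inv (G x) $ i $ l * christoffel G x u (axis l 1) $ m))) (at 0)"
proof -
 have S: "open S" "smooth_on G S" and nz: "\<And>y. y \<in> S ==> det (G y) \<noteq> 0"
  using G by (auto simp: metric_matrix_on_def)
 have i: "matrix_inv (G x) ** G x = mat 1" "G x ** matrix_inv (G x) = mat 1"
  using matrix_inv_left matrix_inv_right metric_matrix_det[OF G x] by blast+
 have sm: "smooth_on (\<lambda>y. matrix_inv (G y)) S" by (rule smooth_on_matrix_inv[OF S nz])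
 define H where "H = \<D> (\<lambda>y. matrix_inv (G y)) (at x) u"
 have d: "((\<lambda>t. matrix_inv (G (x + t *\<^sub>R u))) has_vector_derivative H) (at 0)"
  unfolding H_def by (rule has_real_derivative_along[OF smooth_on_has_derivative[OF sm S(1) x]])
 define T where "T = (\<lambda>t. x + t *\<^sub>R u) -` S"
 have T: "open T" unfolding T_def by (intro continuous_open_vimage S(1) continuous_intros)
 have "H = - (matrix_inv (G (x + 0 *\<^sub>R u)) ** \<D> G (at x) u ** matrix_inv (G (x + 0 *\<^sub>R u)))"
  by (rule has_vector_derivative_matrix_inv[OF has_real_derivative_along[OF metric_matrix_derivative[OF G x]] d T])
    (use x nz in "auto simp: T_def")
 also have "\<dots> = - (connection_matrix u ** matrix_inv (G x) + matrix_inv (G x) ** transpose (connection_matrix u))"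
 proof -
  have "matrix_inv (G x) ** (G x ** N) ** matrix_inv (G x) = N ** matrix_inv (G x)" for N
   by (simp only: matrix_mul_assoc i matrix_mul_lid)
  moreover have "matrix_inv (G x) ** (N ** G x) ** matrix_inv (G x) = matrix_inv (G x) ** N" for N
   by (simp only: matrix_mul_assoc[symmetric] i matrix_mul_rid)
  ultimately show ?thesis
   unfolding metric_derivative_matrix by (simp only: matrix_add_ldistrib matrix_mult_add_left scaleR_zero_left add_0_right)
 qed
 finally have "H $ i $ m = - ((\<Sum>*l. matrix_inv (G x) $ l $ m * christoffel G x u (axis l 1) $ i) +
    (\<Sum>*l. matrix_inv (G x) $ i $ l * christoffel G x u (axis l 1) $ m))"
  by (simp add: matrix_matrix_mult_def transpose_def connection_matrix_def matrix_def mult.commute)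
 then show ?thesis
  using bounded_linear.has_vector_derivative[OF bounded_linear_compose[OF bounded_linear_vec_nth[of m] bounded_linear_vec_nth[of i]] d]
  by (simp add: has_real_derivative_iff_has_vector_derivative)
qed

end

text \<open>The index computation behind the Palatini identity: \<open>a\<close> is the inverse metric, \<open>\<Gamma> i j k\<close> and
 \<open>c i j k\<close> are the \<open>k\<close>-th components of the connection and of its variation on the basis vectors
 \<open>i\<close> and \<open>j\<close>, and \<open>d l i j k\<close> is the derivative of \<open>c i j k\<close> in direction \<open>l\<close>.\<close>

lemma palatini_index_identity:
 fixes a :: "'n::finite => 'n => real" and \<Gamma> c :: "'n => 'n => 'n => real" and d :: "'n => 'n => 'n => 'n => real"
 assumes sa: "\<And>i j. a i j = a j i" and s\<Gamma>: "\<And>i j k. \<Gamma> i j k = \<Gamma> j i k"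
 shows "(\<Sum>*i m. a i m * (\<Sum>*j. d j i m j - d i j m j +
    ((\<Sum>*l. \<Gamma> i m l * c j l j) + (\<Sum>*l. c i m l * \<Gamma> j l j)
     - (\<Sum>*l. \<Gamma> j m l * c i l j) - (\<Sum>*l. c j m l * \<Gamma> i l j)))) =
  (\<Sum>*k. (\<Sum>*l. \<Gamma> k l l) * ((\<Sum>*i m. a i m * c i m k) - (\<Sum>*m j. a k m * c j m j))
   + ((\<Sum>*i m. - ((\<Sum>*l. a l m * \<Gamma> k l i) + (\<Sum>*l. a i l * \<Gamma> k l m)) * c i m k + a i m * d k i m k)
     - (\<Sum>*m j. - ((\<Sum>*l. a l m * \<Gamma> k l k) + (\<Sum>*l. a k l * \<Gamma> k l m)) * c j m j + a k m * d k j m j)))" (is "?lhs = ?rhs")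
proof -
 let ?S = "\<lambda>f. \<Sum>*i m j l. (f i m j l :: real)"
 let ?T = "\<lambda>f. \<Sum>*i m j. (f i m j :: real)"
 have T12: "?T f = ?T (\<lambda>i m j. f m i j)" for f by (rule sum.swap)
 have T23: "?T f = ?T (\<lambda>i m j. f i j m)" for f by (intro sum.cong refl sum.swap)
 have S12: "?S f = ?S (\<lambda>i m j l. f m i j l)" for f by (rule sum.swap)
 have S23: "?S f = ?S (\<lambda>i m j l. f i j m l)" for f by (intro sum.cong refl sum.swap)
 have S34: "?S f = ?S (\<lambda>i m j l. f i m l j)" for f by (intro sum.cong refl sum.swap)
 have L: "?lhs =
   ?T (\<lambda>i m j. a i m * d j i m j) - ?T (\<lambda>i m j. a i m * d i j m j) +
   (?S (\<lambda>i m j l. a i m * \<Gamma> i m l * c j l j) + ?S (\<lambda>i m j l. a i m * c i m l * \<Gamma> j l j)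
   - ?S (\<lambda>i m j l. a i m * \<Gamma> j m l * c i l j) - ?S (\<lambda>i m j l. a i m * c j m l * \<Gamma> i l j))"
  by (simp add: sum_distrib_left sum.distrib sum_subtractf algebra_simps)
 have R: "?rhs =
  (?S (\<lambda>k i m l. \<Gamma> k l l * (a i m * c i m k)) - ?S (\<lambda>k m j l. \<Gamma> k l l * (a k m * c j m j)))
  + (?T (\<lambda>k i m. a i m * d k i m k) - ?S (\<lambda>k i m l. a l m * \<Gamma> k l i * c i m k) - ?S (\<lambda>k i m l. a i l * \<Gamma> k l m * c i m k))
  - (?T (\<lambda>k m j. a k m * d k j m j) - ?S (\<lambda>k m j l. a l m * \<Gamma> k l k * c j m j) - ?S (\<lambda>k m j l. a k l * \<Gamma> k l m * c j m j))"
  by (simp add: sum_distrib_left sum_distrib_right sum_product sum.distrib sum_subtractf sum_negf algebra_simps)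
 \<comment> \<open>Both sides are now sums of monomials, matched by adjacent transpositions of the
   summation indices. Equality 5 makes two terms of the right side cancel; the term with
   \<open>d i j m j\<close> is the same on both sides up to names of bound indices.\<close>
 have 1: "?T (\<lambda>i m j. a i m * d j i m j) = ?T (\<lambda>k i m. a i m * d k i m k)"
  by (subst T23, subst T12) (rule refl)
 have 3: "?S (\<lambda>i m j l. a i m * \<Gamma> i m l * c j l j) = ?S (\<lambda>k m j l. a k l * \<Gamma> k l m * c j m j)"
  by (rule trans[OF S23 trans[OF S34 S23]])
 have 4: "?S (\<lambda>i m j l. a i m * c i m l * \<Gamma> j l j) = ?S (\<lambda>k i m l. \<Gamma> k l l * (a i m * c i m k))"
  by (rule trans[OF S34 trans[OF S23 trans[OF S12]]]) (use s\<Gamma> in "simp only: mult_ac")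
 have 5: "?S (\<lambda>k m j l. \<Gamma> k l l * (a k m * c j m j)) = ?S (\<lambda>k m j l. a l m * \<Gamma> k l k * c j m j)"
  by (rule trans[OF S12 trans[OF S23 trans[OF S34 trans[OF S23 trans[OF S12]]]]]) (use s\<Gamma> in "simp only: mult_ac")
 have 6: "?S (\<lambda>i m j l. a i m * c j m l * \<Gamma> i l j) = ?S (\<lambda>k i m l. a l m * \<Gamma> k l i * c i m k)"
  by (rule trans[OF _ trans[OF S23 trans[OF S34 trans[OF S23 trans[OF S12 trans[OF S23 S34]]]]]]) (simp only: s\<Gamma> mult_ac)
 have 7: "?S (\<lambda>i m j l. a i m * \<Gamma> j m l * c i l j) = ?S (\<lambda>k i m l. a i l * \<Gamma> k l m * c i m k)"
  by (rule trans[OF S23 trans[OF S12 S34]])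
 show ?thesis unfolding L R using 1 3 4 5 6 7 by linarith
qed

lemma bilinear_apply_nth:
 assumes "bilinear (H :: real^'n => real^'n => real^'n)"
 shows "H u w $ j = (\<Sum>*l. w $ l * H u (axis l 1) $ j)"
proof -
 have lin: "linear (H u)" using assms by (simp add: bilinear_def)
 have "H u w = H u (\<Sum>*l. w $ l *\<^sub>R axis l 1)" using vec_eq_sum_axis[of w] by simp
 then show ?thesis by (simp add: linear_sum[OF lin] linear_scale[OF lin])
qed

lemma smooth_palatini_field:
 assumes G: "metric_matrix_on G S" and H: "coefficients_on H S"
 shows "smooth_on (palatini_field G H) S"
proof -
 have S: "open S" "smooth_on G S" and nz: "\<And>y. y \<in> S ==> det (G y) \<noteq> 0"
  using G by (auto simp: metric_matrix_on_def)
 have Hs: "smooth_on (\<lambda>x. H x u v) S" for u v using H by (simp add: coefficients_on_def)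
 show ?thesis
  unfolding palatini_field_def[abs_def]
  by (intro smooth_on_scaleR smooth_on_sqrt smooth_on_abs smooth_on_det smooth_on_vec_lambda smooth_on_diff
    smooth_on_sum smooth_on_mult smooth_on_nth smooth_on_matrix_inv Hs S) (auto simp: nz)
qed

text \<open>The product rule produces derivatives of the density, of the inverse metric and of
  \<open>H\<close>. The first two are Christoffel terms, and the index identity matches them with
  the algebraic terms of \<open>curvature_variation\<close>.\<close>

theorem palatini_divergence:
 assumes G: "metric_matrix_on G S" and H: "coefficients_on H S" and x: "x \<in> S"
 shows "sqrt \<bar>det (G x)\<bar> * scalar_variation G (christoffel G) H x =
  (\<Sum>*k. \<D> (palatini_field G H) (at x) (axis k 1) $ k)"
proof -
 define a where "a = (\<lambda>i m. matrix_inv (G x) $ i $ m)"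
 define \<Gamma> where "\<Gamma> = (\<lambda>i j k. christoffel G x (axis i 1) (axis j 1) $ k)"
 define c where "c = (\<lambda>i j k. H x (axis i 1) (axis j 1) $ k)"
 define d where "d = (\<lambda>l i j k. \<D> (\<lambda>y. H y (axis i 1) (axis j 1)) (at x) (axis l 1) $ k)"
 define \<rho> where "\<rho> = sqrt \<bar>det (G x)\<bar>"
 have S: "open S" using G by (simp add: metric_matrix_on_def)
 note bG = bilinear_christoffel[OF G x] and bH = coefficients_bilinear[OF H x]
 have sa: "a i j = a j i" for i j
 proof -
  have "a i j = transpose (matrix_inv (G x)) $ j $ i" by (simp add: a_def transpose_def)
  then show ?thesis
   unfolding matrix_inv_symmetric[OF metric_matrix_det[OF G x] metric_matrix_symmetric[OF G x]] a_def .
 qed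
 have s\<Gamma>: "\<Gamma> i j k = \<Gamma> j i k" for i j k
  using christoffel_symmetric[OF G x, of "axis i 1" "axis j 1"] by (simp add: \<Gamma>_def)
 have "ricci_variation (christoffel G) H x (axis i 1) (axis m 1) = (\<Sum>*j. d j i m j - d i j m j +
    ((\<Sum>*l. \<Gamma> i m l * c j l j) + (\<Sum>*l. c i m l * \<Gamma> j l j)
     - (\<Sum>*l. \<Gamma> j m l * c i l j) - (\<Sum>*l. c j m l * \<Gamma> i l j)))" (is "_ = ?V i m") for i m
  unfolding ricci_variation_def curvature_variation_def d_def \<Gamma>_def c_def
  by (simp add: bilinear_apply_nth[OF bH, of _ "christoffel G x _ _"] bilinear_apply_nth[OF bG, of _ "H x _ _"])
 then have "scalar_variation G (christoffel G) H x = (\<Sum>*i m. a i m * ?V i m)"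
  by (simp add: scalar_variation_def a_def)
 also have "\<dots> = (\<Sum>*k. (\<Sum>*l. \<Gamma> k l l) * ((\<Sum>*i m. a i m * c i m k) - (\<Sum>*m j. a k m * c j m j))
   + ((\<Sum>*i m. - ((\<Sum>*l. a l m * \<Gamma> k l i) + (\<Sum>*l. a i l * \<Gamma> k l m)) * c i m k + a i m * d k i m k)
     - (\<Sum>*m j. - ((\<Sum>*l. a l m * \<Gamma> k l k) + (\<Sum>*l. a k l * \<Gamma> k l m)) * c j m j + a k m * d k j m j)))"
  (is "_ = (\<Sum>*k. ?R k)")
  by (rule palatini_index_identity[OF sa s\<Gamma>])
 finally have 1: "scalar_variation G (christoffel G) H x = (\<Sum>*k. ?R k)" .
 have 2: "\<rho> * (\<Sum>*k. ?R k) = (\<Sum>*k. \<D> (palatini_field G H) (at x) (axis k 1) $ k)"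
  unfolding sum_distrib_left
 proof (rule sum.cong[OF refl])
  fix k
  let ?y = "\<lambda>t. x + t *\<^sub>R axis k 1"
  have Hd: "((\<lambda>t. H (?y t) (axis i 1) (axis j 1) $ l) has_real_derivative d k i j l) (at 0)" for i j l
   using bounded_linear.has_vector_derivative[OF bounded_linear_vec_nth[of l]
     has_real_derivative_along[OF coefficients_derivative[OF H x], of "axis k 1" "axis i 1" "axis j 1"]]
   by (simp add: has_real_derivative_iff_has_vector_derivative d_def)
  have ad: "((\<lambda>t. matrix_inv (G (?y t)) $ i $ m) has_real_derivative
    - ((\<Sum>*l. a l m * \<Gamma> k l i) + (\<Sum>*l. a i l * \<Gamma> k l m))) (at 0)" for i m
   using matrix_inv_metric_derivative[OF G x, of "axis k 1" i m] by (simp add: a_def \<Gamma>_def)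
  have \<rho>d: "((\<lambda>t. sqrt \<bar>det (G (?y t))\<bar>) has_real_derivative \<rho> * (\<Sum>*l. \<Gamma> k l l)) (at 0)"
   using sqrt_det_derivative[OF G x, of "axis k 1"] by (simp add: \<rho>_def \<Gamma>_def)
  have prod: "((\<lambda>t. matrix_inv (G (?y t)) $ i $ m * H (?y t) (axis i' 1) (axis j' 1) $ l) has_real_derivative
    - ((\<Sum>*l. a l m * \<Gamma> k l i) + (\<Sum>*l. a i l * \<Gamma> k l m)) * c i' j' l + a i m * d k i' j' l) (at 0)" for i m i' j' l
   using DERIV_mult[OF ad[of i m] Hd[of i' j' l]] by (simp add: a_def c_def mult.commute)
  have at0: "matrix_inv (G (?y 0)) $ i $ m = a i m" "H (?y 0) (axis i 1) (axis j 1) $ l = c i j l"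
   "sqrt \<bar>det (G (?y 0))\<bar> = \<rho>" for i m j l by (simp_all add: a_def c_def \<rho>_def)
  have alg: "r * A * B + C * r = r * (A * B + C)" for r A B C :: real by (simp add: algebra_simps)
  have 1: "((\<lambda>t. palatini_field G H (?y t) $ k) has_real_derivative \<rho> * ?R k) (at 0)"
   unfolding palatini_field_def vector_scaleR_component vec_lambda_beta real_scaleR_def
   by (rule DERIV_cong[OF DERIV_mult[OF \<rho>d DERIV_diff[OF DERIV_sum[OF DERIV_sum[OF prod]] DERIV_sum[OF DERIV_sum[OF prod]]]]])
     (unfold at0, rule alg)
  have 2: "((\<lambda>t. palatini_field G H (?y t) $ k) has_real_derivative
    \<D> (palatini_field G H) (at x) (axis k 1) $ k) (at 0)"
   using bounded_linear.has_vector_derivative[OF bounded_linear_vec_nth[of k]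
     has_real_derivative_along[OF smooth_on_has_derivative[OF smooth_palatini_field[OF G H] S x], of "axis k 1"]]
   by (simp add: has_real_derivative_iff_has_vector_derivative)
  show "\<rho> * ?R k = \<D> (palatini_field G H) (at x) (axis k 1) $ k"
   by (rule DERIV_unique[OF 1 2])
 qed
 show ?thesis unfolding 1 \<rho>_def[symmetric] by (rule 2)
qed

lemma integral_palatini_eq_0:
 assumes G: "metric_matrix_on G S" and H: "coefficients_on H S"
  and K: "compact K" "K \<subseteq> S" "\<And>x u v. x \<in> S - K ==> H x u v = 0"
 shows "integral\<^sup>L lborel (\<lambda>x. indicator S x * (sqrt \<bar>det (G x)\<bar> * scalar_variation G (christoffel G) H x)) = 0"
proof -
 have S: "open S" using G by (simp add: metric_matrix_on_def)
 have oK: "open (- K)" using K(1) compact_imp_closed by blast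
 define V where "V = palatini_field G H"
 have V: "smooth_on V S" unfolding V_def by (rule smooth_palatini_field[OF G H])
 have V0: "V x = 0" if "x \<in> S - K" for x
  using K(3)[OF that] by (simp add: V_def palatini_field_def vec_eq_iff)
 \<comment> \<open>The components of the field are extended by 0; as they vanish on
   \<open>S - K\<close>, the extension is differentiable everywhere with continuous
   derivative.\<close>
 define F where "F = (\<lambda>k x. if x \<in> S then V x $ k else 0)"
 define F' where "F' = (\<lambda>k x v. if x \<in> S then \<D> V (at x) v $ k else 0)"
 have F0: "F k x = 0" if "x \<notin> K" for k x using V0 that by (auto simp: F_def)
 have dF: "(F k has_derivative F' k x) (at x)" for k x
 proof (cases "x \<in> S")
  case True
  have "((\<lambda>x. V x $ k) has_derivative (\<lambda>v. \<D> V (at x) v $ k)) (at x)"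
   by (rule bounded_linear.has_derivative[OF bounded_linear_vec_nth smooth_on_has_derivative[OF V S True]])
  then have "(F k has_derivative (\<lambda>v. \<D> V (at x) v $ k)) (at x)"
   by (rule has_derivative_cong_open[OF _ S True]) (simp add: F_def)
  then show ?thesis using True by (simp add: F'_def)
 next
  case False
  have "(F k has_derivative (\<lambda>v. 0)) (at x)"
   by (rule has_derivative_cong_open[OF has_derivative_const oK]) (use False K F0 in auto)
  then show ?thesis using False by (simp add: F'_def)
 qed
 have F'0: "F' k x = (\<lambda>v. 0)" if "x \<notin> K" for k x
 proof -
  have "(F k has_derivative (\<lambda>v. 0)) (at x)"
   by (rule has_derivative_cong_open[OF has_derivative_const oK]) (use that F0 in auto)
  then show ?thesis using dF has_derivative_unique by blast
 qed
 have cF: "continuous_on UNIV (\<lambda>x. F' k x v)" for k v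
 proof -
  have "continuous_on S (\<lambda>x. \<D> V (at x) v $ k)"
   by (intro smooth_on_continuous_on smooth_on_nth S smooth_on_frechet V)
  then have "continuous_on S (\<lambda>x. F' k x v)"
   by (rule continuous_on_cong[THEN iffD1, rotated 2]) (auto simp: F'_def)
  moreover have "continuous_on (- K) (\<lambda>x. F' k x v)"
   by (rule continuous_on_cong[THEN iffD1, OF refl _ continuous_on_const[of _ 0]]) (simp add: F'0)
  ultimately have "continuous_on (S \<union> - K) (\<lambda>x. F' k x v)"
   by (rule continuous_on_open_Un[OF S oK])
  moreover have "S \<union> - K = UNIV" using K(2) by blast
  ultimately show ?thesis by simp
 qed
 have int: "integrable lborel (\<lambda>x. F' k x v)" for k v
 proof -
  have "integrable lborel (\<lambda>x. indicator K x *\<^sub>R F' k x v)"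
   by (rule borel_integrable_compact[OF K(1) continuous_on_subset[OF cF]]) simp
  moreover have "indicator K x *\<^sub>R F' k x v = F' k x v" for x
   by (cases "x \<in> K") (simp_all add: F'0)
  ultimately show ?thesis by (simp only:)
 qed
 have "indicator S x * (sqrt \<bar>det (G x)\<bar> * scalar_variation G (christoffel G) H x) = (\<Sum>*k. F' k x (axis k 1))" for x
  using palatini_divergence[OF G H, of x] by (cases "x \<in> S") (simp_all add: F'_def V_def)
 then have "integral\<^sup>L lborel (\<lambda>x. indicator S x * (sqrt \<bar>det (G x)\<bar> * scalar_variation G (christoffel G) H x)) =
   integral\<^sup>L lborel (\<lambda>x. \<Sum>*k. F' k x (axis k 1))" by (simp only:)
 also have "\<dots> = (\<Sum>*k. integral\<^sup>L lborel (\<lambda>x. F' k x (axis k 1)))"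
  by (rule Bochner_Integration.integral_sum) (rule int)
 also have "\<dots> = 0"
  using integral_directional_derivative_eq_0[OF dF cF K(1) F0] by (intro sum.neutral) blast
 finally show ?thesis .
qed

subsection \<open>Variation of the scalar curvature\<close>

lemma curvature_rep_add:
 assumes C: "coefficients_on C S" and H: "coefficients_on H S" and x: "x \<in> S"
 shows "curvature_rep (\<lambda>x u v. C x u v + H x u v) x u w v =
  curvature_rep C x u w v + curvature_variation C H x u w v + (H x w (H x u v) - H x u (H x w v))"
proof -
 have D: "\<D> (\<lambda>y. C y u v + H y u v) (at x) =
   (\<lambda>w. \<D> (\<lambda>y. C y u v) (at x) w + \<D> (\<lambda>y. H y u v) (at x) w)" for u v
  by (rule frechet_derivativeI[OF has_derivative_add[OF coefficients_derivative[OF C x] coefficients_derivative[OF H x]]])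
 show ?thesis
  unfolding curvature_rep_def curvature_variation_def D
  by (simp add: bilinear_radd[OF coefficients_bilinear[OF C x]] bilinear_radd[OF coefficients_bilinear[OF H x]])
qed

lemma curvature_variation_add:
 assumes H: "coefficients_on H S" and H': "coefficients_on H' S" and C: "bilinear (C x)" and x: "x \<in> S"
 shows "curvature_variation C (\<lambda>x u v. H x u v + H' x u v) x u w v =
  curvature_variation C H x u w v + curvature_variation C H' x u w v"
proof -
 have D: "\<D> (\<lambda>y. H y u v + H' y u v) (at x) =
   (\<lambda>w. \<D> (\<lambda>y. H y u v) (at x) w + \<D> (\<lambda>y. H' y u v) (at x) w)" for u v
  by (rule frechet_derivativeI[OF has_derivative_add[OF coefficients_derivative[OF H x] coefficients_derivative[OF H' x]]])
 show ?thesis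
  unfolding curvature_variation_def D by (simp add: bilinear_radd[OF C])
qed

lemma curvature_variation_minus:
 assumes H: "coefficients_on H S" and C: "bilinear (C x)" and x: "x \<in> S"
 shows "curvature_variation C (\<lambda>x u v. - H x u v) x u w v = - curvature_variation C H x u w v"
proof -
 have D: "\<D> (\<lambda>y. - H y u v) (at x) = (\<lambda>w. - \<D> (\<lambda>y. H y u v) (at x) w)" for u v
  by (rule frechet_derivativeI[OF has_derivative_minus[OF coefficients_derivative[OF H x]]])
 show ?thesis
  unfolding curvature_variation_def D by (simp add: bilinear_rneg[OF C])
qed

lemma scalar_variation_add:
 assumes "coefficients_on H S" "coefficients_on H' S" "bilinear (C x)" "x \<in> S"
 shows "scalar_variation G C (\<lambda>x u v. H x u v + H' x u v) x = scalar_variation G C H x + scalar_variation G C H' x"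
 unfolding scalar_variation_def ricci_variation_def curvature_variation_add[where C = C and x = x, OF assms]
 by (simp add: sum.distrib distrib_left)

text \<open>The terms quadratic in \<open>H\<close> are even, so the difference of the values at
  \<open>C + H\<close> and \<open>C - H\<close> is twice the linear part, exactly and without a
  limit.\<close>

lemma scalar_rep_odd_part:
 assumes C: "coefficients_on C S" and H: "coefficients_on H S" and x: "x \<in> S"
 shows "scalar_rep G (\<lambda>x u v. C x u v + H x u v) x - scalar_rep G (\<lambda>x u v. C x u v + - H x u v) x =
  2 * scalar_variation G C H x"
proof -
 have nH: "coefficients_on (\<lambda>x u v. - H x u v) S"
  using H unfolding coefficients_on_def bilinear_def
  by (auto intro!: smooth_on_minus linear_compose_neg)
 have key: "curvature_rep (\<lambda>x u v. C x u v + H x u v) x u w v - curvature_rep (\<lambda>x u v. C x u v + - H x u v) x u w v =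
   2 *\<^sub>R curvature_variation C H x u w v" for u w v
  unfolding curvature_rep_add[OF C H x] curvature_rep_add[OF C nH x]
   curvature_variation_minus[where C = C and x = x, OF H coefficients_bilinear[OF C x] x]
  by (simp add: bilinear_rneg[OF coefficients_bilinear[OF H x]] scaleR_2)
 have "ricci_rep (\<lambda>x u v. C x u v + H x u v) x u v - ricci_rep (\<lambda>x u v. C x u v + - H x u v) x u v =
   2 * ricci_variation C H x u v" for u v
  unfolding ricci_rep_def ricci_variation_def sum_subtractf[symmetric] sum_distrib_left
 proof (rule sum.cong[OF refl])
  fix j
  show "curvature_rep (\<lambda>x u v. C x u v + H x u v) x u (axis j 1) v $ j -
    curvature_rep (\<lambda>x u v. C x u v + - H x u v) x u (axis j 1) v $ j =
    2 * curvature_variation C H x u (axis j 1) v $ j"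
   unfolding vector_minus_component[symmetric] key by simp
 qed
 then show ?thesis
  unfolding scalar_rep_def scalar_variation_def sum_subtractf[symmetric] sum_distrib_left right_diff_distrib[symmetric]
  by (simp only: mult.left_commute)
qed

lemma smooth_family_scalar_rep:
 fixes G :: "real => real^'n => real^'n^'n" and C :: "real => 'n::finite coefficients"
 assumes I: "open I" "open U" and G: "smooth_on (\<lambda>(t, x). G t x) (I \<times> U)"
  and det: "\<And>t x. t \<in> I ==> x \<in> U ==> det (G t x) \<noteq> 0"
  and C: "\<And>u v. smooth_on (\<lambda>(t, x). C t x u v) (I \<times> U)"
  and bil: "\<And>t x. t \<in> I ==> x \<in> U ==> bilinear (C t x)"
 shows "smooth_on (\<lambda>(t, x). ricci_rep (C t) x u v) (I \<times> U)"
  and "smooth_on (\<lambda>(t, x). scalar_rep (G t) (C t) x) (I \<times> U)"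
proof -
 have op: "open (I \<times> U)" using I by (simp add: open_Times)
 have D: "smooth_on (\<lambda>z. \<D> (\<lambda>y. C (fst z) y u v) (at (snd z)) w) (I \<times> U)" for u v w
  using smooth_family_frechet[OF C I] by (simp add: case_prod_beta')
 have Cs: "smooth_on (\<lambda>z. C (fst z) (snd z) u v) (I \<times> U)" for u v using C by (simp add: case_prod_beta')
 have CC: "smooth_on (\<lambda>z. C (fst z) (snd z) u (C (fst z) (snd z) w v)) (I \<times> U)" for u w v
  by (rule smooth_on_bilinear_field[OF op, of "\<lambda>z. C (fst z) (snd z)", OF _ Cs smooth_on_const[OF op] Cs])
    (use bil in auto)
 have R: "smooth_on (\<lambda>z. ricci_rep (C (fst z)) (snd z) u v) (I \<times> U)" for u v
  unfolding ricci_rep_def curvature_rep_def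
  by (intro smooth_on_sum op smooth_on_nth smooth_on_diff smooth_on_add D CC)
 show "smooth_on (\<lambda>(t, x). ricci_rep (C t) x u v) (I \<times> U)" using R by (simp add: case_prod_beta')
 have Gs: "smooth_on (\<lambda>z. G (fst z) (snd z)) (I \<times> U)" using G by (simp add: case_prod_beta')
 show "smooth_on (\<lambda>(t, x). scalar_rep (G t) (C t) x) (I \<times> U)"
  unfolding scalar_rep_def case_prod_beta'
  by (intro smooth_on_sum op smooth_on_mult smooth_on_nth smooth_on_matrix_inv Gs R) (use det in auto)
qed

lemma ricci_rep_cong:
 assumes "open S" "x \<in> S" "\<And>y. y \<in> S ==> C y = C' y"
 shows "curvature_rep C x u w v = curvature_rep C' x u w v" "ricci_rep C x u v = ricci_rep C' x u v"
  "scalar_rep G C x = scalar_rep G C' x"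
proof -
 have D: "\<D> (\<lambda>y. C y u v) (at x) = \<D> (\<lambda>y. C' y u v) (at x)" for u v
  by (rule frechet_derivative_cong_open[OF assms(1,2)]) (simp add: assms(3))
 have R: "curvature_rep C x u w v = curvature_rep C' x u w v" for u w v
  by (simp add: curvature_rep_def D assms(2,3))
 then show "curvature_rep C x u w v = curvature_rep C' x u w v" .
 show "ricci_rep C x u v = ricci_rep C' x u v" by (simp add: ricci_rep_def R)
 show "scalar_rep G C x = scalar_rep G C' x" by (simp add: scalar_rep_def ricci_rep_def R)
qed

lemma scalar_variation_cong:
 assumes "open S" "x \<in> S" "\<And>y. y \<in> S ==> H y = H' y"
 shows "scalar_variation G C H x = scalar_variation G C H' x"
proof -
 have D: "\<D> (\<lambda>y. H y u v) (at x) = \<D> (\<lambda>y. H' y u v) (at x)" for u v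
  by (rule frechet_derivative_cong_open[OF assms(1,2)]) (simp add: assms(3))
 show ?thesis by (simp add: scalar_variation_def ricci_variation_def curvature_variation_def D assms(2,3))
qed

section \<open>Cut-off functions and tensor fields\<close>

context manifold
begin

lemma smooth_fun_continuous: "smooth_fun_on A UNIV f ==> continuous_on UNIV f"
proof -
 assume f: "smooth_fun_on A UNIV f"
 have "isCont f p" for p
 proof -
  obtain c where c: "c \<in> A" "p \<in> fst c" by (rule ex_chart)
  have "continuous_on (fst c) (\<lambda>q. (f \<circ> chart_inv c) (snd c q))"
   by (rule continuous_on_compose2[OF smooth_on_continuous_on[OF smooth_fun_rep[OF f c(1)]] continuous_on_chart[OF c(1)]]) auto
  then have "continuous_on (fst c) f"
   by (rule continuous_on_cong[THEN iffD1, rotated 2]) (use c in auto)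
  then show ?thesis using open_chart(1)[OF c(1)] c(2) by (simp add: continuous_on_eq_continuous_at)
 qed
 then show "continuous_on UNIV f" by (simp add: continuous_at_imp_continuous_on)
qed

text \<open>In the chosen chart the bump is \<open>flat_exp 0\<close> of \<open>r\<^sup>2\<close>
  minus the squared distance from the centre. That \<open>K\<close> lies in this chart domain is
  recorded because localised tensors are later integrated in a single chart.\<close>

lemma smooth_bump:
 assumes O: "open W" "p \<in> W"
 obtains \<phi> K where "smooth_fun_on A UNIV \<phi>" "\<And>q. 0 \<le> \<phi> q" "0 < \<phi> p" "compact K" "K \<subseteq> W" "K \<subseteq> fst (chart_at A p)"
  "\<And>q. q \<notin> K ==> \<phi> q = 0"
proof -
 define c where "c = chart_at A p"
 have c: "c \<in> A" "p \<in> fst c" using chart_at by (auto simp: c_def)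
 define x0 where "x0 = snd c p"
 have "x0 \<in> snd c ` (fst c \<inter> W)" using c O by (auto simp: x0_def)
 then obtain r where r: "r > 0" "cball x0 r \<subseteq> snd c ` (fst c \<inter> W)"
  using open_chart_image[OF c(1) O(1)] open_contains_cball by blast
 define K where "K = chart_inv c ` cball x0 r"
 have cont: "continuous_on (cball x0 r) (chart_inv c)"
  by (rule continuous_on_subset[OF continuous_on_chart_inv[OF c(1)]]) (use r in auto)
 have K: "compact K" unfolding K_def by (rule compact_continuous_image[OF cont compact_cball])
 have KW: "K \<subseteq> fst c \<inter> W" unfolding K_def using r(2) c by auto
 define \<phi> where "\<phi> = (\<lambda>q. if q \<in> fst c then flat_exp 0 (r\<^sup>2 - (snd c q - x0) \<bullet> (snd c q - x0)) else 0)"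
 have zero: "\<phi> q = 0" if "q \<notin> K" for q
 proof (cases "q \<in> fst c")
  case True
  have "snd c q \<notin> cball x0 r"
  proof
   assume "snd c q \<in> cball x0 r"
   then have "chart_inv c (snd c q) \<in> K" unfolding K_def by blast
   then show False using that True c by simp
  qed
  then have "r < norm (snd c q - x0)" by (simp add: dist_norm norm_minus_commute)
  then have "r\<^sup>2 < (norm (snd c q - x0))\<^sup>2" using r(1) by (intro power_strict_mono) auto
  then show ?thesis by (simp add: \<phi>_def flat_exp_def power2_norm_eq_inner)
 qed (simp add: \<phi>_def)
 have "smooth_fun_on A UNIV \<phi>"
  unfolding smooth_fun_on_def
 proof (intro ballI smooth_on_local)
  fix d y assume d: "d \<in> A" and y: "y \<in> snd d ` (fst d \<inter> UNIV)"
  then obtain q where q: "q \<in> fst d" "y = snd d q" by auto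
  show "\<exists>U. open U \<and> y \<in> U \<and> smooth_on (\<phi> \<circ> chart_inv d) U"
  proof (cases "q \<in> fst c")
   case True
   let ?U = "snd d ` (fst d \<inter> fst c)"
   have U: "open ?U" "y \<in> ?U" using open_chart_image[OF d open_chart(1)[OF c(1)]] q True by auto
   note \<tau> = smooth_transition[OF d c(1)]
   have "smooth_on (\<lambda>x. r\<^sup>2 - ((snd c \<circ> chart_inv d) x - x0) \<bullet> ((snd c \<circ> chart_inv d) x - x0)) ?U"
    by (intro smooth_on_diff smooth_on_inner smooth_on_const U \<tau>)
   then have "smooth_on (\<lambda>x. flat_exp 0 (r\<^sup>2 - ((snd c \<circ> chart_inv d) x - x0) \<bullet> ((snd c \<circ> chart_inv d) x - x0))) ?U"
    by (rule smooth_on_compose[OF smooth_on_flat_exp]) (use U in auto)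
   then have "smooth_on (\<phi> \<circ> chart_inv d) ?U"
    by (rule smooth_on_transform[OF _ U(1)]) (use d in "auto simp: \<phi>_def")
   then show ?thesis using U by blast
  next
   case False
   let ?U = "snd d ` (fst d \<inter> - K)"
   \<comment> \<open>Compact sets are closed in a Hausdorff space; this is where a function cut off
     in one chart becomes smooth on the whole manifold.\<close>
   have "open (- K)" using K compact_imp_closed by blast
   then have U: "open ?U" "y \<in> ?U" using open_chart_image[OF d] q False KW by auto
   have "smooth_on (\<phi> \<circ> chart_inv d) ?U"
    by (rule smooth_on_transform[OF smooth_on_const[of _ 0] U(1)]) (use U d zero in auto)
   then show ?thesis using U by blast
  qed
 qed
 moreover have "0 \<le> \<phi> q" for q by (simp add: \<phi>_def flat_exp_def)
 moreover have "0 < \<phi> p" using c r(1) by (simp add: \<phi>_def flat_exp_def x0_def)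
 ultimately show thesis using that[of \<phi> K] K KW zero by (simp add: c_def)
qed

lemma continuous_compact_bounded:
 fixes f :: "'m => real"
 assumes "continuous_on UNIV f" "compact K" "\<And>q. q \<notin> K ==> f q = 0"
 obtains C where "C \<ge> 0" "\<And>q. \<bar>f q\<bar> \<le> C"
proof -
 obtain C where C: "\<And>q. q \<in> K ==> \<bar>f q\<bar> \<le> C"
  using compact_continuous_bounded[OF assms(2) continuous_on_subset[OF assms(1) subset_UNIV]] by blast
 have "\<bar>f q\<bar> \<le> max C 0" for q
  using C[of q] assms(3)[of q] by (cases "q \<in> K") auto
 then show thesis using that[of "max C 0"] by simp
qed

lemma finite_volume_restrict:
 assumes g: "pseudo_riemannian_metric A g" and O: "\<Omega> \<in> sets borel" "\<Omega> \<subseteq> K" "compact K"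
 shows "finite_measure (restrict_space (volume_measure A g) \<Omega>)"
proof
 have Ks: "K \<in> sets (volume_measure A g)"
  using compact_imp_closed[OF O(3)] by (simp add: sets_volume_measure[OF g])
 have Os: "\<Omega> \<in> sets (volume_measure A g)" using O(1) by (simp add: sets_volume_measure[OF g])
 have "emeasure (volume_measure A g) \<Omega> \<le> emeasure (volume_measure A g) K"
  by (rule emeasure_mono[OF O(2) Ks])
 also have "\<dots> < \<infinity>" using volume_compact_finite[OF g O(3)] by (simp add: less_top)
 finally show "emeasure (restrict_space (volume_measure A g) \<Omega>) (space (restrict_space (volume_measure A g) \<Omega>)) \<noteq> \<infinity>"
  using Os by (simp add: emeasure_restrict_space space_restrict_space space_volume_measure[OF g])
qed

lemma integrable_continuous_on_domain:
 fixes f :: "'m => real"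
 assumes g: "pseudo_riemannian_metric A g" and O: "\<Omega> \<in> sets borel" "\<Omega> \<subseteq> K" "compact K" and f: "continuous_on UNIV f"
 shows "set_integrable (volume_measure A g) \<Omega> f"
proof -
 let ?M = "restrict_space (volume_measure A g) \<Omega>"
 interpret finite_measure ?M by (rule finite_volume_restrict[OF g O])
 obtain C where C: "\<And>x. x \<in> K ==> \<bar>f x\<bar> \<le> C"
  using compact_continuous_bounded[OF O(3) continuous_on_subset[OF f subset_UNIV]] by blast
 have "f \<in> borel_measurable (volume_measure A g)"
  using borel_measurable_continuous_onI[OF f] by (simp cong: measurable_cong_sets add: sets_volume_measure[OF g])
 then have "integrable ?M f"
  using C O(2) by (intro integrable_const_bound[of _ C]) (auto intro!: measurable_restrict_space1 AE_I2 simp: space_restrict_space)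
 then show ?thesis
  using O(1) by (simp add: set_integrable_def integrable_restrict_space sets_volume_measure[OF g] space_volume_measure[OF g])
qed

lemma integrable_continuous_compact:
 fixes f :: "'m => real"
 assumes g: "pseudo_riemannian_metric A g" and f: "continuous_on UNIV f" and K: "compact K" "\<And>q. q \<notin> K ==> f q = 0"
 shows "integrable (volume_measure A g) f"
proof -
 have "set_integrable (volume_measure A g) K f"
  by (rule integrable_continuous_on_domain[OF g borel_compact[OF K(1)] order_refl K(1) f])
 moreover have "(\<lambda>q. indicator K q *\<^sub>R f q) = f" using K(2) by (auto simp: fun_eq_iff indicator_def)
 ultimately show ?thesis by (simp add: set_integrable_def)
qed

text \<open>Smoothness is local, and the open sets \<open>W\<close> and \<open>- K\<close> cover the
  manifold.\<close>

lemma smooth_tensor12_extend: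
 assumes S: "\<And>p. bilinear (S p)" "\<And>c i j. c \<in> A ==> smooth_on (\<lambda>x. tensor12_comp A c S x i j) (snd c ` (fst c \<inter> W))"
  and W: "open W" and K: "closed K" "K \<subseteq> W" and zero: "\<And>p u v. p \<notin> K ==> S p u v = 0"
 shows "smooth_tensor12 A S"
 unfolding smooth_tensor12_def
proof (intro conjI allI ballI S(1) smooth_on_local)
 fix c i j x assume c: "c \<in> A" and "x \<in> snd c ` fst c"
 then obtain p where p: "p \<in> fst c" "x = snd c p" by auto
 show "\<exists>U. open U \<and> x \<in> U \<and> smooth_on (\<lambda>x. tensor12_comp A c S x i j) U"
 proof (cases "p \<in> W")
  case True
  then show ?thesis using S(2)[OF c] open_chart_image[OF c W] p by blast
 next
  case False
  let ?U = "snd c ` (fst c \<inter> - K)"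
  have U: "open ?U" "x \<in> ?U" using open_chart_image[OF c, of "- K"] K p False by auto
  have "smooth_on (\<lambda>x. tensor12_comp A c S x i j) ?U"
   by (rule smooth_on_transform[OF smooth_on_const[of _ 0] U(1)])
     (use U c zero in "auto simp: tensor12_comp_def Let_def linear_0[OF linear_to_coord]")
  then show ?thesis using U by blast
 qed
qed

lemma smooth_tensor12_scaleR:
 assumes S: "smooth_tensor12 A S" and W: "open W" "smooth_fun_on A W f" and K: "closed K" "K \<subseteq> W"
  and zero: "\<And>p u v. p \<notin> K ==> S p u v = 0"
 shows "smooth_tensor12 A (\<lambda>p u v. f p *\<^sub>R S p u v)"
proof (rule smooth_tensor12_extend[OF _ _ W(1) K])
 show "bilinear (\<lambda>u v. f p *\<^sub>R S p u v)" for p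
  using S by (auto simp: smooth_tensor12_def bilinear_def intro!: linear_compose_scale_right)
 fix c i j assume c: "c \<in> A"
 let ?U = "snd c ` (fst c \<inter> W)"
 have U: "open ?U" by (rule open_chart_image[OF c W(1)])
 have "smooth_on (\<lambda>x. tensor12_comp A c S x i j) ?U"
  by (rule smooth_on_subset[of _ "snd c ` fst c"]) (use S c in "auto simp: smooth_tensor12_def")
 from smooth_on_scaleR[OF U smooth_fun_rep[OF W(2) c] this]
 show "smooth_on (\<lambda>x. tensor12_comp A c (\<lambda>p u v. f p *\<^sub>R S p u v) x i j) ?U"
  by (rule smooth_on_transform[OF _ U]) (use c in "auto simp: tensor12_comp_def Let_def linear_scale[OF linear_to_coord]")
qed (simp add: zero)

lemma smooth_tensor12_add:
 assumes S: "smooth_tensor12 A S" and S': "smooth_tensor12 A S'"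
 shows "smooth_tensor12 A (\<lambda>p u v. S p u v + S' p u v)"
 unfolding smooth_tensor12_def
proof (intro conjI allI ballI)
 show "bilinear (\<lambda>u v. S p u v + S' p u v)" for p
  using S S' by (auto simp: smooth_tensor12_def bilinear_def intro!: linear_compose_add)
 fix c i j assume c: "c \<in> A"
 show "smooth_on (\<lambda>x. tensor12_comp A c (\<lambda>p u v. S p u v + S' p u v) x i j) (snd c ` fst c)"
 proof (rule smooth_on_transform)
  show "smooth_on (\<lambda>x. tensor12_comp A c S x i j + tensor12_comp A c S' x i j) (snd c ` fst c)"
   using S S' c open_chart(2)[OF c] by (intro smooth_on_add) (auto simp: smooth_tensor12_def)
 qed (use c open_chart(2)[OF c] in "auto simp: tensor12_comp_def Let_def linear_add[OF linear_to_coord]")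
qed

lemma smooth_tensor12_zero: "smooth_tensor12 A (\<lambda>p u v. 0)"
 unfolding smooth_tensor12_def
proof (intro conjI allI ballI)
 show "bilinear (\<lambda>u v :: real^'n. 0 :: real^'n)" by (simp add: bilinear_def linear_zero)
 fix c i j assume c: "c \<in> A"
 show "smooth_on (\<lambda>x. tensor12_comp A c (\<lambda>p u v. 0) x i j) (snd c ` fst c)"
  by (rule smooth_on_transform[OF smooth_on_const[of _ 0]])
    (use c open_chart(2)[OF c] in "auto simp: tensor12_comp_def Let_def linear_0[OF linear_to_coord]")
qed

lemma smooth_tensor12_minus:
 assumes S: "smooth_tensor12 A S"
 shows "smooth_tensor12 A (\<lambda>p u v. - S p u v)"
proof -
 have "smooth_fun_on A UNIV (\<lambda>_. - 1)"
  unfolding smooth_fun_on_def o_def using open_chart(2) by (auto intro!: smooth_on_const)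
 from smooth_tensor12_scaleR[OF S open_UNIV this closed_UNIV] show ?thesis by simp
qed

lemma contorted_rep_minus:
 "c \<in> A ==> x \<in> snd c ` fst c ==>
  contorted_rep A c g (\<lambda>p u v. - S p u v) x = (\<lambda>u v. christoffel (bilin_comp A c g) x u v + - tensor12_rep A c S x u v)"
 by (auto simp: fun_eq_iff contorted_rep_def tensor12_rep_def Let_def linear_neg[OF linear_to_coord])

end

section \<open>The part of the mixed scalar curvature that is linear in the contorsion\<close>

context line_product
begin

context
 fixes g :: "('m, 'n) bilin_field"
 assumes adapted: "adapted_metric A k D g"
begin

text \<open>Taking the odd part isolates the linear term without reference to a chart. Since the
  mixed scalar curvature is half of \<open>scalar_rep\<close>, the difference, without further
  factor, is the linear part of \<open>scalar_rep\<close>.\<close>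

definition mixed_linear :: "('m, 'n) tensor12_field => 'm => real" where
 "mixed_linear S p = mixed_scalar_curvature A k D g S p - mixed_scalar_curvature A k D g (\<lambda>p u v. - S p u v) p"

lemma mixed_linear_chart:
 assumes S: "smooth_tensor12 A S" and c: "c \<in> A" "p \<in> fst c"
 shows "mixed_linear S p = scalar_variation (bilin_comp A c g) (christoffel (bilin_comp A c g)) (tensor12_rep A c S) (snd c p)"
proof -
 have x: "snd c p \<in> snd c ` fst c" using c by auto
 note H = coefficients_tensor12_rep[OF S c(1)] and C = coefficients_christoffel[OF metricD[OF adapted] c(1)]
 have "scalar_rep (bilin_comp A c g) (contorted_rep A c g (\<lambda>p u v. - S p u v)) (snd c p) =
   scalar_rep (bilin_comp A c g) (\<lambda>x u v. christoffel (bilin_comp A c g) x u v + - tensor12_rep A c S x u v) (snd c p)"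
  by (rule ricci_rep_cong(3)[OF open_chart(2)[OF c(1)] x]) (rule contorted_rep_minus[OF c(1)])
 moreover have "contorted_rep A c g S = (\<lambda>x u v. christoffel (bilin_comp A c g) x u v + tensor12_rep A c S x u v)"
  by (intro ext) (simp add: contorted_rep_def)
 ultimately show ?thesis
  unfolding mixed_linear_def mixed_scalar_chart[OF adapted S c] mixed_scalar_chart[OF adapted smooth_tensor12_minus[OF S] c]
  using scalar_rep_odd_part[OF C H x, of "bilin_comp A c g"] by (simp add: diff_divide_distrib[symmetric])
qed

lemma mixed_linear_add:
 assumes S: "smooth_tensor12 A S" and S': "smooth_tensor12 A S'"
 shows "mixed_linear (\<lambda>p u v. S p u v + S' p u v) p = mixed_linear S p + mixed_linear S' p"
proof -
 obtain c where c: "c \<in> A" "p \<in> fst c" by (rule ex_chart)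
 have x: "snd c p \<in> snd c ` fst c" using c by auto
 have "scalar_variation (bilin_comp A c g) (christoffel (bilin_comp A c g)) (tensor12_rep A c (\<lambda>p u v. S p u v + S' p u v)) (snd c p) =
   scalar_variation (bilin_comp A c g) (christoffel (bilin_comp A c g)) (\<lambda>x u v. tensor12_rep A c S x u v + tensor12_rep A c S' x u v) (snd c p)"
  by (rule scalar_variation_cong[OF open_chart(2)[OF c(1)] x])
    (use c in "auto simp: fun_eq_iff tensor12_rep_def Let_def linear_add[OF linear_to_coord]")
 also have "\<dots> = scalar_variation (bilin_comp A c g) (christoffel (bilin_comp A c g)) (tensor12_rep A c S) (snd c p) +
   scalar_variation (bilin_comp A c g) (christoffel (bilin_comp A c g)) (tensor12_rep A c S') (snd c p)"
  by (rule scalar_variation_add[where C = "christoffel (bilin_comp A c g)" and x = "snd c p",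
     OF coefficients_tensor12_rep[OF S c(1)] coefficients_tensor12_rep[OF S' c(1)]
     coefficients_bilinear[OF coefficients_christoffel[OF metricD[OF adapted] c(1)] x] x])
 finally show ?thesis
  unfolding mixed_linear_chart[OF smooth_tensor12_add[OF S S'] c] mixed_linear_chart[OF S c] mixed_linear_chart[OF S' c] .
qed

lemma mixed_linear_zero: "mixed_linear (\<lambda>p u v. 0) p = 0"
 by (simp add: mixed_linear_def)

lemma mixed_linear_local:
 assumes S: "smooth_tensor12 A S" and K: "closed K" "\<And>p u v. p \<notin> K ==> S p u v = 0" and p: "p \<notin> K"
 shows "mixed_linear S p = 0"
proof -
 obtain c where c: "c \<in> A" "p \<in> fst c" by (rule ex_chart)
 let ?U = "snd c ` (fst c \<inter> - K)"
 have U: "open ?U" "snd c p \<in> ?U" using open_chart_image[OF c(1), of "- K"] K c p by auto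
 have "scalar_variation (bilin_comp A c g) (christoffel (bilin_comp A c g)) (tensor12_rep A c S) (snd c p) =
   scalar_variation (bilin_comp A c g) (christoffel (bilin_comp A c g)) (tensor12_rep A c (\<lambda>p u v. 0)) (snd c p)"
  by (rule scalar_variation_cong[OF U]) (use c K in "auto simp: fun_eq_iff tensor12_rep_def Let_def")
 then show ?thesis
  unfolding mixed_linear_chart[OF S c] mixed_linear_chart[OF smooth_tensor12_zero c, symmetric] mixed_linear_zero .
qed

text \<open>The statement on families, applied to a family that is constant in the
  parameter.\<close>

lemma smooth_curvature_rep:
 assumes c: "c \<in> A" and C: "coefficients_on C (snd c ` fst c)"
 shows smooth_ricci_rep: "smooth_on (\<lambda>x. ricci_rep C x u v) (snd c ` fst c)"
  and smooth_scalar_rep: "smooth_on (scalar_rep (bilin_comp A c g) C) (snd c ` fst c)"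
proof -
 let ?G = "bilin_comp A c g" and ?S = "snd c ` fst c"
 have op: "open ?S" by (rule open_chart(2)[OF c])
 note G = metric_matrix_chart[OF metricD[OF adapted] c]
 have 1: "smooth_on (\<lambda>(t::real, x). ?G x) (UNIV \<times> ?S)"
  using G op by (intro smooth_on_times_snd) (simp_all add: metric_matrix_on_def)
 have 2: "smooth_on (\<lambda>(t::real, x). C x u v) (UNIV \<times> ?S)" for u v
  using C op by (intro smooth_on_times_snd) (simp_all add: coefficients_on_def)
 note family = smooth_family_scalar_rep[where G = "\<lambda>_. ?G" and C = "\<lambda>_. C", OF open_UNIV op 1 metric_matrix_det[OF G] 2 coefficients_bilinear[OF C]]
 show "smooth_on (\<lambda>x. ricci_rep C x u v) ?S" "smooth_on (scalar_rep ?G C) ?S"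
  by (rule smooth_family_at[OF family(1) open_UNIV op UNIV_I], assumption+)
    (rule smooth_family_at[OF family(2) open_UNIV op UNIV_I])
qed

lemma smooth_mixed_linear:
 assumes S: "smooth_tensor12 A S"
 shows "smooth_fun_on A UNIV (mixed_linear S)"
 unfolding smooth_fun_on_def
proof
 fix c assume c: "c \<in> A"
 let ?G = "bilin_comp A c g" and ?S = "snd c ` fst c"
 have op: "open ?S" by (rule open_chart(2)[OF c])
 have C1: "coefficients_on (contorted_rep A c g S) ?S"
  using represents_contorted[OF metricD[OF adapted] S c] by (simp add: represents_def)
 have C2: "coefficients_on (contorted_rep A c g (\<lambda>p u v. - S p u v)) ?S"
  using represents_contorted[OF metricD[OF adapted] smooth_tensor12_minus[OF S] c] by (simp add: represents_def)
 have "smooth_on (\<lambda>x. scalar_rep ?G (contorted_rep A c g S) x / 2 -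
   scalar_rep ?G (contorted_rep A c g (\<lambda>p u v. - S p u v)) x / 2) ?S"
  using op by (intro smooth_on_diff smooth_on_divide smooth_on_const smooth_scalar_rep[OF c C1] smooth_scalar_rep[OF c C2]) auto
 then have "smooth_on (mixed_linear S \<circ> chart_inv c) ?S"
 proof (rule smooth_on_transform[OF _ op])
  fix x assume x: "x \<in> ?S"
  then have p: "chart_inv c x \<in> fst c" "snd c (chart_inv c x) = x" using c by auto
  show "(mixed_linear S \<circ> chart_inv c) x = scalar_rep ?G (contorted_rep A c g S) x / 2 -
   scalar_rep ?G (contorted_rep A c g (\<lambda>p u v. - S p u v)) x / 2"
   unfolding mixed_linear_def o_def mixed_scalar_chart[OF adapted S c p(1)]
    mixed_scalar_chart[OF adapted smooth_tensor12_minus[OF S] c p(1)] p(2) ..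
 qed
 then show "smooth_on (mixed_linear S \<circ> chart_inv c) (snd c ` (fst c \<inter> UNIV))" by simp
qed

lemmas continuous_mixed_linear = smooth_fun_continuous[OF smooth_mixed_linear]

lemma integral_mixed_linear_chart:
 assumes S: "smooth_tensor12 A S" and c: "c \<in> A" and K: "compact K" "K \<subseteq> fst c" "\<And>p u v. p \<notin> K ==> S p u v = 0"
 shows "integral\<^sup>L (volume_measure A g) (mixed_linear S) = 0"
proof -
 let ?G = "bilin_comp A c g" and ?S = "snd c ` fst c"
 have z: "mixed_linear S p = 0" if "p \<notin> fst c" for p
  by (rule mixed_linear_local[OF S compact_imp_closed[OF K(1)] K(3)]) (use that K in auto)
 have "integral\<^sup>L (volume_measure A g) (mixed_linear S) =
  integral\<^sup>L lborel (\<lambda>x. indicator ?S x * (volume_density A g c x * mixed_linear S (chart_inv c x)))"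
  by (rule integral_volume_chart[OF metricD[OF adapted] c borel_measurable_continuous_onI[OF continuous_mixed_linear[OF S]] z])
 also have "\<dots> = integral\<^sup>L lborel (\<lambda>x. indicator ?S x * (sqrt \<bar>det (?G x)\<bar> * scalar_variation ?G (christoffel ?G) (tensor12_rep A c S) x))"
  by (intro Bochner_Integration.integral_cong refl)
    (use c in "auto simp: indicator_def volume_density_def mixed_linear_chart[OF S c]")
 also have "\<dots> = 0"
 proof (rule integral_palatini_eq_0[OF metric_matrix_chart[OF metricD[OF adapted] c] coefficients_tensor12_rep[OF S c]])
  show "compact (snd c ` K)"
   by (rule compact_continuous_image[OF continuous_on_subset[OF continuous_on_chart[OF c] K(2)] K(1)])
  show "snd c ` K \<subseteq> ?S" using K(2) by auto
  fix x u v assume x: "x \<in> ?S - snd c ` K"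
  then have "chart_inv c x \<notin> K" using c by auto
  then show "tensor12_rep A c S x u v = 0"
   using x c K(3) by (auto simp: tensor12_rep_def Let_def linear_0[OF linear_to_coord])
 qed
 finally show ?thesis .
qed

text \<open>\<open>S\<close> is split by the bumps \<open>\<phi> p\<close> divided by their sum
  \<open>\<Psi>\<close>, which is positive near \<open>K\<close>. Each piece is supported in one
  chart, where the linear term is a divergence.\<close>

theorem integral_mixed_linear:
 assumes S: "smooth_tensor12 A S" and K: "compact K" "\<And>p u v. p \<notin> K ==> S p u v = 0"
 shows "integral\<^sup>L (volume_measure A g) (mixed_linear S) = 0"
proof -
 have Kc: "closed K" using K compact_imp_closed by blast
 have "\<exists>\<phi> L. smooth_fun_on A UNIV \<phi> \<and> (\<forall>q. 0 \<le> \<phi> q) \<and> 0 < \<phi> p \<and> compact L \<and> L \<subseteq> fst (chart_at A p) \<and>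
   (\<forall>q. q \<notin> L \<longrightarrow> \<phi> q = 0)" for p
  using smooth_bump[OF open_UNIV UNIV_I[of p]] by metis
 then obtain \<phi> L where \<phi>: "\<And>p. smooth_fun_on A UNIV (\<phi> p)" "\<And>p q. 0 \<le> \<phi> p q" "\<And>p. 0 < \<phi> p p"
  and L: "\<And>p. compact (L p)" "\<And>p. L p \<subseteq> fst (chart_at A p)" "\<And>p q. q \<notin> L p ==> \<phi> p q = 0"
  by metis
 have op: "open {q. 0 < \<phi> p q}" for p
  by (rule open_Collect_less[OF continuous_on_const smooth_fun_continuous[OF \<phi>(1)]])
 have cover: "\<exists>F. finite F \<and> K \<subseteq> (\<Union>p\<in>F. {q. 0 < \<phi> p q})"
 proof (rule compactE_image[OF K(1), of UNIV "\<lambda>p. {q. 0 < \<phi> p q}"])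
  show "K \<subseteq> (\<Union>p\<in>UNIV. {q. 0 < \<phi> p q})" using \<phi>(3) by auto
  fix F assume "finite F" "K \<subseteq> (\<Union>p\<in>F. {q. 0 < \<phi> p q})"
  then show ?thesis by (intro exI[of _ F] conjI)
 qed (rule op)
 then obtain F where F: "finite F" "K \<subseteq> (\<Union>p\<in>F. {q. 0 < \<phi> p q})" by blast
 define \<Psi> where "\<Psi> = (\<lambda>q. \<Sum>p\<in>F. \<phi> p q)"
 define W where "W = {q. 0 < \<Psi> q}"
 have \<Psi>s: "smooth_on (\<Psi> \<circ> chart_inv c) (snd c ` fst c)" if "c \<in> A" for c
  unfolding \<Psi>_def o_def using smooth_fun_rep[OF \<phi>(1) that] open_chart(2)[OF that]
  by (intro smooth_on_sum) (simp_all add: o_def)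
 then have "smooth_fun_on A UNIV \<Psi>" by (simp add: smooth_fun_on_def)
 from open_Collect_less[OF continuous_on_const smooth_fun_continuous[OF this]]
 have W: "open W" unfolding W_def .
 have KW: "K \<subseteq> W"
 proof
  fix q assume "q \<in> K"
  then obtain p where p: "p \<in> F" "0 < \<phi> p q" using F by auto
  then have "0 < (\<Sum>p\<in>F. \<phi> p q)" using F(1) \<phi>(2) by (intro sum_pos2[of F p]) auto
  then show "q \<in> W" by (simp add: W_def \<Psi>_def)
 qed
 \<comment> \<open>The quotient is smooth only where \<open>\<Psi>\<close> is positive, which is
   enough because \<open>S\<close> vanishes outside \<open>K\<close>.\<close>
 define S' where "S' = (\<lambda>p q u v. (\<phi> p q / \<Psi> q) *\<^sub>R S q u v)"
 have S's: "smooth_tensor12 A (S' p)" for p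
  unfolding S'_def
 proof (rule smooth_tensor12_scaleR[OF S W _ Kc KW K(2)])
  show "smooth_fun_on A W (\<lambda>q. \<phi> p q / \<Psi> q)"
   unfolding smooth_fun_on_def
  proof
   fix c assume c: "c \<in> A"
   show "smooth_on ((\<lambda>q. \<phi> p q / \<Psi> q) \<circ> chart_inv c) (snd c ` (fst c \<inter> W))"
    unfolding o_def
   proof (rule smooth_on_divide[OF open_chart_image[OF c W]])
    show "smooth_on (\<lambda>x. \<phi> p (chart_inv c x)) (snd c ` (fst c \<inter> W))"
     by (rule smooth_on_subset[OF smooth_fun_rep[OF \<phi>(1) c, unfolded o_def]]) auto
    show "smooth_on (\<lambda>x. \<Psi> (chart_inv c x)) (snd c ` (fst c \<inter> W))"
     by (rule smooth_on_subset[OF \<Psi>s[OF c, unfolded o_def]]) auto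
   qed (use c in "auto simp: W_def")
  qed
 qed
 have sum: "smooth_tensor12 A (\<lambda>q u v. \<Sum>p\<in>F'. S' p q u v) \<and>
   mixed_linear (\<lambda>q u v. \<Sum>p\<in>F'. S' p q u v) = (\<lambda>q. \<Sum>p\<in>F'. mixed_linear (S' p) q)" if "finite F'" for F'
  using that
 proof induction
  case empty
  then show ?case by (simp add: smooth_tensor12_zero mixed_linear_zero)
 next
  case (insert p F')
  then show ?case
   using smooth_tensor12_add[OF S's[of p]] mixed_linear_add[OF S's[of p]] by (simp add: fun_eq_iff)
 qed
 have "(\<Sum>p\<in>F. S' p q u v) = S q u v" for q u v
 proof (cases "q \<in> K")
  case True
  then have "0 < \<Psi> q" using KW by (auto simp: W_def)
  then have "(\<Sum>p\<in>F. \<phi> p q / \<Psi> q) = 1" by (simp add: sum_divide_distrib[symmetric] \<Psi>_def)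
  then show ?thesis by (simp add: S'_def scaleR_left.sum[symmetric])
 qed (simp add: S'_def K(2))
 then have "mixed_linear S = (\<lambda>q. \<Sum>p\<in>F. mixed_linear (S' p) q)"
  using sum[OF F(1)] by (simp add: fun_eq_iff)
 then have "integral\<^sup>L (volume_measure A g) (mixed_linear S) =
   integral\<^sup>L (volume_measure A g) (\<lambda>q. \<Sum>p\<in>F. mixed_linear (S' p) q)" by simp
 also have "\<dots> = (\<Sum>p\<in>F. integral\<^sup>L (volume_measure A g) (mixed_linear (S' p)))"
 proof (rule Bochner_Integration.integral_sum)
  fix p
  show "integrable (volume_measure A g) (mixed_linear (S' p))"
   by (rule integrable_continuous_compact[OF metricD[OF adapted] continuous_mixed_linear[OF S's] K(1)],
     rule mixed_linear_local[OF S's Kc]) (simp_all add: S'_def K(2))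
 qed
 also have "\<dots> = 0"
 proof (rule sum.neutral, rule ballI)
  fix p
  show "integral\<^sup>L (volume_measure A g) (mixed_linear (S' p)) = 0"
   by (rule integral_mixed_linear_chart[OF S's chart_at(1) L(1)[of p] L(2)[of p]]) (simp add: S'_def L(3))
 qed
 finally show ?thesis .
qed

end

end

section \<open>Differentiation under the volume integral\<close>

context manifold
begin

definition smooth_fun_family :: "real set => (real => 'm => real) => bool" where
 "smooth_fun_family I f \<longleftrightarrow> (\<forall>c\<in>A. smooth_on (\<lambda>(t, x). f t (chart_inv c x)) (I \<times> snd c ` fst c))"

lemma smooth_fun_familyD:
 "smooth_fun_family I f ==> c \<in> A ==> smooth_on (\<lambda>(t, x). f t (chart_inv c x)) (I \<times> snd c ` fst c)"
 by (simp add: smooth_fun_family_def)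

lemma smooth_fun_family_derivative:
 assumes f: "smooth_fun_family I f" "open I"
 shows "t \<in> I ==> ((\<lambda>s. f s p) has_real_derivative deriv (\<lambda>s. f s p) t) (at t)"
  and "smooth_fun_family I (\<lambda>t p. deriv (\<lambda>s. f s p) t)"
proof -
 have der: "((\<lambda>s. f s p) has_real_derivative vector_derivative (\<lambda>s. f s p) (at t)) (at t)" if "t \<in> I" for t p
 proof -
  obtain c where c: "c \<in> A" "p \<in> fst c" by (rule ex_chart)
  note sm = smooth_fun_familyD[OF f(1) c(1)]
  have x: "snd c p \<in> snd c ` fst c" using c by auto
  show ?thesis
   using family_derivative_time[OF sm f(2) open_chart(2)[OF c(1)] that x] c
   by (simp add: has_real_derivative_iff_has_vector_derivative vector_derivative_at)
 qed
 have eq: "deriv (\<lambda>s. f s p) t = vector_derivative (\<lambda>s. f s p) (at t)" if "t \<in> I" for t p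
  by (rule DERIV_imp_deriv[OF der[OF that]])
 show "t \<in> I ==> ((\<lambda>s. f s p) has_real_derivative deriv (\<lambda>s. f s p) t) (at t)"
  using der eq by simp
 show "smooth_fun_family I (\<lambda>t p. deriv (\<lambda>s. f s p) t)"
  unfolding smooth_fun_family_def
 proof
  fix c assume c: "c \<in> A"
  have op: "open (snd c ` fst c)" by (rule open_chart(2)[OF c])
  note sm = smooth_fun_familyD[OF f(1) c]
  show "smooth_on (\<lambda>(t, x). deriv (\<lambda>s. f s (chart_inv c x)) t) (I \<times> snd c ` fst c)"
   by (rule smooth_on_transform[OF smooth_family_vector_derivative[OF sm f(2) op]])
     (use f(2) op eq in "auto simp: open_Times")
 qed
qed

lemma smooth_fun_family_continuous:
 assumes f: "smooth_fun_family I f" "open I"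
 shows "continuous_on (I \<times> UNIV) (\<lambda>(t, p). f t p)"
proof -
 have "isCont (\<lambda>(t, p). f t p) (t, p)" if t: "t \<in> I" for t p
 proof -
  obtain c where c: "c \<in> A" "p \<in> fst c" by (rule ex_chart)
  note sm = smooth_fun_familyD[OF f(1) c(1)]
  have "continuous_on (I \<times> fst c) (\<lambda>z. (\<lambda>(t, x). f t (chart_inv c x)) (fst z, snd c (snd z)))"
  proof (rule continuous_on_compose2[OF smooth_on_continuous_on[OF sm]])
   show "continuous_on (I \<times> fst c) (\<lambda>z. (fst z, snd c (snd z)))"
    by (intro continuous_on_Pair continuous_on_fst continuous_on_id
      continuous_on_compose2[OF continuous_on_chart[OF c(1)] continuous_on_snd[OF continuous_on_id]]) auto
  qed auto
  then have "continuous_on (I \<times> fst c) (\<lambda>(t, p). f t p)"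
   by (rule continuous_on_cong[THEN iffD1, rotated 2]) (use c in auto)
  then show ?thesis
   using open_Times[OF f(2) open_chart(1)[OF c(1)]] c(2) t by (auto simp: continuous_on_eq_continuous_at)
 qed
 then show ?thesis by (auto intro!: continuous_at_imp_continuous_on)
qed

lemma smooth_fun_family_at:
 assumes f: "smooth_fun_family I f" "open I" "t \<in> I"
 shows "smooth_fun_on A UNIV (f t)"
 unfolding smooth_fun_on_def
proof
 fix c assume c: "c \<in> A"
 note sm = smooth_fun_familyD[OF f(1) c]
 show "smooth_on (f t \<circ> chart_inv c) (snd c ` (fst c \<inter> UNIV))"
  using smooth_family_at[OF sm f(2) open_chart(2)[OF c] f(3)] by (simp add: o_def)
qed

lemma set_integral_restrict:
 fixes f :: "'m => real"
 assumes g: "pseudo_riemannian_metric A g" and O: "\<Omega> \<in> sets borel"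
 shows "(LINT p:\<Omega>|volume_measure A g. f p) = integral\<^sup>L (restrict_space (volume_measure A g) \<Omega>) f"
 using O by (simp add: set_lebesgue_integral_def integral_restrict_space sets_volume_measure[OF g] space_volume_measure[OF g])

theorem has_real_derivative_volume_integral:
 assumes g: "pseudo_riemannian_metric A g" and O: "\<Omega> \<in> sets borel" "\<Omega> \<subseteq> K" "compact K"
  and f: "smooth_fun_family {-\<delta><..<\<delta>} f" and \<delta>: "0 < \<delta>"
 shows "((\<lambda>t. LINT p:\<Omega>|volume_measure A g. f t p) has_real_derivative
   (LINT p:\<Omega>|volume_measure A g. deriv (\<lambda>s. f s p) 0)) (at 0)"
proof -
 let ?M = "restrict_space (volume_measure A g) \<Omega>" and ?I = "{-\<delta><..<\<delta>}"
 \<comment> \<open>On the closed half interval times \<open>K\<close> the integrand and its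
   derivative are bounded by compactness; on the whole open interval they need not be.\<close>
 let ?J = "{-(\<delta>/2)..\<delta>/2}"
 have J: "?J \<subseteq> ?I" using \<delta> by auto
 have cpt: "compact (?J \<times> K)" by (intro compact_Times compact_Icc O(3))
 have c: "continuous_on (?J \<times> K) (\<lambda>(t, p). f t p)"
  by (rule continuous_on_subset[OF smooth_fun_family_continuous[OF f open_greaterThanLessThan]]) (use J in auto)
 have c': "continuous_on (?J \<times> K) (\<lambda>(t, p). deriv (\<lambda>s. f s p) t)"
  by (rule continuous_on_subset[OF smooth_fun_family_continuous[OF smooth_fun_family_derivative(2)[OF f open_greaterThanLessThan]
      open_greaterThanLessThan]]) (use J in auto)
 obtain C where C: "\<And>z. z \<in> ?J \<times> K ==> \<bar>(\<lambda>(t, p). deriv (\<lambda>s. f s p) t) z\<bar> \<le> C"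
  using compact_continuous_bounded[OF cpt c'] by blast
 obtain C0 where C0: "\<And>z. z \<in> ?J \<times> K ==> \<bar>(\<lambda>(t, p). f t p) z\<bar> \<le> C0"
  using compact_continuous_bounded[OF cpt c] by blast
 have sp: "space ?M = \<Omega>" by (simp add: space_restrict_space space_volume_measure[OF g])
 show ?thesis
  unfolding set_integral_restrict[OF g O(1)]
 proof (rule has_real_derivative_integral[where \<delta> = "\<delta>/2" and C = C and C0 = C0 and f' = "\<lambda>t p. deriv (\<lambda>s. f s p) t"])
  show "finite_measure ?M" by (rule finite_volume_restrict[OF g O])
  show "0 < \<delta> / 2" using \<delta> by simp
  fix t :: real assume t: "\<bar>t\<bar> < \<delta> / 2"
  then have tI: "t \<in> ?I" "t \<in> ?J" by auto
  have "f t \<in> borel_measurable (volume_measure A g)"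
   using borel_measurable_continuous_onI[OF smooth_fun_continuous[OF smooth_fun_family_at[OF f open_greaterThanLessThan tI(1)]]]
   by (simp cong: measurable_cong_sets add: sets_volume_measure[OF g])
  then show "f t \<in> borel_measurable ?M" by (rule measurable_restrict_space1)
  fix p assume p: "p \<in> space ?M"
  show "((\<lambda>s. f s p) has_real_derivative deriv (\<lambda>s. f s p) t) (at t)"
   by (rule smooth_fun_family_derivative(1)[OF f open_greaterThanLessThan tI(1)])
  have "(t, p) \<in> ?J \<times> K" using tI p O(2) unfolding sp by auto
  from C[OF this] show "\<bar>deriv (\<lambda>s. f s p) t\<bar> \<le> C" by simp
 next
  fix p assume p: "p \<in> space ?M"
  have "(0, p) \<in> ?J \<times> K" using \<delta> p O(2) unfolding sp by auto
  from C0[OF this] show "\<bar>f 0 p\<bar> \<le> C0" by simp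
 qed
qed

lemma set_integral_volume_ratio:
 fixes f :: "'m => real"
 assumes g: "pseudo_riemannian_metric A g" and g': "pseudo_riemannian_metric A g'" and O: "\<Omega> \<in> sets borel"
  and f: "continuous_on UNIV f"
 shows "(LINT p:\<Omega>|volume_measure A g'. f p) = (LINT p:\<Omega>|volume_measure A g. volume_ratio g g' p * f p)"
proof -
 have [measurable]: "volume_ratio g g' \<in> borel_measurable (volume_measure A g)" "f \<in> borel_measurable (volume_measure A g)"
  using borel_measurable_continuous_onI[OF f] borel_measurable_continuous_onI[OF continuous_volume_ratio[OF g g']]
  by (simp_all cong: measurable_cong_sets add: sets_volume_measure[OF g])
 have [measurable]: "\<Omega> \<in> sets (volume_measure A g)" using O by (simp add: sets_volume_measure[OF g])
 show ?thesis
  unfolding set_lebesgue_integral_def volume_measure_density[OF g g']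
  by (subst integral_density) (auto simp: less_imp_le[OF volume_ratio_pos[OF g g']] mult_ac)
qed

text \<open>Lets the condition of preserved volume be differentiated as a real integral over a fixed
  measure.\<close>

lemma emeasure_volume_ratio:
 assumes g: "pseudo_riemannian_metric A g" and g': "pseudo_riemannian_metric A g'"
  and O: "\<Omega> \<in> sets borel" "\<Omega> \<subseteq> K" "compact K"
 shows "emeasure (volume_measure A g') \<Omega> = ennreal (LINT p:\<Omega>|volume_measure A g. volume_ratio g g' p)"
proof -
 interpret finite_measure "restrict_space (volume_measure A g') \<Omega>" by (rule finite_volume_restrict[OF g' O])
 have Os: "\<Omega> \<in> sets (volume_measure A g')" using O by (simp add: sets_volume_measure[OF g'])
 have "emeasure (volume_measure A g') \<Omega> < \<infinity>"
  using emeasure_finite[of \<Omega>] Os by (simp add: emeasure_restrict_space less_top)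
 then have "emeasure (volume_measure A g') \<Omega> = ennreal (LINT p:\<Omega>|volume_measure A g'. 1)"
  using Os by (simp add: set_lebesgue_integral_def emeasure_eq_ennreal_measure less_top space_volume_measure[OF g'])
 also have "(LINT p:\<Omega>|volume_measure A g'. 1) = (LINT p:\<Omega>|volume_measure A g. volume_ratio g g' p * 1)"
  by (rule set_integral_volume_ratio[OF g g' O(1) continuous_on_const])
 finally show ?thesis by simp
qed

end

section \<open>First variation of the curvature\<close>

lemma has_vector_derivative_bilinear_family:
 fixes B :: "real => real^'n => real^'n => real^'n"
 assumes B: "\<And>u v. ((\<lambda>s. B s u v) has_vector_derivative B' u v) (at t)" and bil: "\<And>s. s \<in> I ==> bilinear (B s)"
  and bil': "bilinear B'" and I: "open I" "t \<in> I" and Z: "(Z has_vector_derivative Z') (at t)"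
 shows "((\<lambda>s. B s w (Z s)) has_vector_derivative B' w (Z t) + B t w Z') (at t)"
proof -
 have expand: "b w z = (\<Sum>*l. z $ l *\<^sub>R b w (axis l 1))" if "bilinear b" for b :: "real^'n => real^'n => real^'n" and w z
 proof -
  have lin: "linear (b w)" using that by (simp add: bilinear_def)
  have "b w z = b w (\<Sum>*l. z $ l *\<^sub>R axis l 1)" using vec_eq_sum_axis[of z] by simp
  then show ?thesis by (simp add: linear_sum[OF lin] linear_scale[OF lin])
 qed
 have zl: "((\<lambda>s. Z s $ l) has_vector_derivative Z' $ l) (at t)" for l
  by (rule bounded_linear.has_vector_derivative[OF bounded_linear_vec_nth Z])
 have "((\<lambda>s. \<Sum>*l. Z s $ l *\<^sub>R B s w (axis l 1)) has_vector_derivative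
   (\<Sum>*l. Z t $ l *\<^sub>R B' w (axis l 1) + Z' $ l *\<^sub>R B t w (axis l 1))) (at t)"
  by (rule has_vector_derivative_sum)
    (rule bounded_bilinear.has_vector_derivative[OF bounded_bilinear_scaleR zl B])
 moreover have "(\<Sum>*l. Z t $ l *\<^sub>R B' w (axis l 1) + Z' $ l *\<^sub>R B t w (axis l 1)) = B' w (Z t) + B t w Z'"
  unfolding sum.distrib expand[OF bil', symmetric] expand[OF bil[OF I(2)], symmetric] ..
 ultimately show ?thesis
  using has_vector_derivative_transform_within_open[OF _ I, of "\<lambda>s. \<Sum>*l. Z s $ l *\<^sub>R B s w (axis l 1)" _ "\<lambda>s. B s w (Z s)"]
   expand[OF bil, symmetric] by simp
qed

context
 fixes C :: "real => 'n::finite coefficients" and C' I U t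
 assumes I: "open I" "open U" "t \<in> I"
  and C: "\<And>u v. smooth_on (\<lambda>(t, x). C t x u v) (I \<times> U)"
  and bil: "\<And>t x. t \<in> I ==> x \<in> U ==> bilinear (C t x)"
 defines "C' \<equiv> \<lambda>x u v. vector_derivative (\<lambda>s. C s x u v) (at t)"
begin

lemma family_coefficients_derivative:
 assumes "x \<in> U" shows "((\<lambda>s. C s x u v) has_vector_derivative C' x u v) (at t)"
proof -
 have d: "((\<lambda>s. C s x u v) has_vector_derivative \<D> (\<lambda>(t, x). C t x u v) (at (t, x)) (1, 0)) (at t)"
  by (rule family_derivative_time[OF C I assms])
 show ?thesis unfolding C'_def vector_derivative_at[OF d] by (rule d)
qed

lemma coefficients_family_derivative: "coefficients_on C' U"
 unfolding coefficients_on_def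
proof (intro conjI ballI allI I(2))
 show "smooth_on (\<lambda>x. C' x u v) U" for u v
  unfolding C'_def by (rule smooth_family_at[OF smooth_family_vector_derivative[OF C I(1,2)] I])
 fix x assume x: "x \<in> U"
 note D = family_coefficients_derivative[OF x]
 have eq: "C' x u v = z" if "(f has_vector_derivative z) (at t)" "\<And>s. s \<in> I ==> f s = C s x u v" for f z u v
  using vector_derivative_unique_at[OF D has_vector_derivative_transform_within_open[OF that(1) I(1,3) that(2)]] .
 show "bilinear (C' x)"
  unfolding bilinear_def
 proof (intro conjI allI linearI)
  fix u v w :: "real^'n" and r :: real
  show "C' x u (v + w) = C' x u v + C' x u w"
   by (rule eq[OF has_vector_derivative_add[OF D D]]) (simp add: bilinear_radd[OF bil[OF _ x]])
  show "C' x (v + w) u = C' x v u + C' x w u"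
   by (rule eq[OF has_vector_derivative_add[OF D D]]) (simp add: bilinear_ladd[OF bil[OF _ x]])
  show "C' x u (r *\<^sub>R v) = r *\<^sub>R C' x u v"
   by (rule eq[OF bounded_linear.has_vector_derivative[OF bounded_linear_scaleR_right D]])
     (simp add: bilinear_rmul[OF bil[OF _ x]])
  show "C' x (r *\<^sub>R v) u = r *\<^sub>R C' x v u"
   by (rule eq[OF bounded_linear.has_vector_derivative[OF bounded_linear_scaleR_right D]])
     (simp add: bilinear_lmul[OF bil[OF _ x]])
 qed
qed

lemma curvature_rep_variation:
 assumes x: "x \<in> U"
 shows "((\<lambda>s. curvature_rep (C s) x u w v) has_vector_derivative curvature_variation (C t) C' x u w v) (at t)"
proof -
 note D = family_coefficients_derivative[OF x]
 have F: "((\<lambda>s. \<D> (\<lambda>y. C s y u v) (at x) w) has_vector_derivative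
   \<D> (\<lambda>y. C' y u v) (at x) w) (at t)" for u v w
  unfolding C'_def by (rule family_derivative_commute[OF C I x])
 have B: "((\<lambda>s. C s x w (C s x u v)) has_vector_derivative C' x w (C t x u v) + C t x w (C' x u v)) (at t)" for u v w
  by (rule has_vector_derivative_bilinear_family[OF D bil[OF _ x] coefficients_bilinear[OF coefficients_family_derivative x] I(1,3) D])
 have "((\<lambda>s. curvature_rep (C s) x u w v) has_vector_derivative
   \<D> (\<lambda>y. C' y u v) (at x) w - \<D> (\<lambda>y. C' y w v) (at x) u
   + (C' x w (C t x u v) + C t x w (C' x u v)) - (C' x u (C t x w v) + C t x u (C' x w v))) (at t)"
  unfolding curvature_rep_def
  by (intro has_vector_derivative_add has_vector_derivative_diff F B)
 then show ?thesis by (simp add: curvature_variation_def algebra_simps)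
qed

lemma ricci_rep_variation:
 assumes x: "x \<in> U"
 shows "((\<lambda>s. ricci_rep (C s) x u v) has_real_derivative ricci_variation (C t) C' x u v) (at t)"
 unfolding ricci_rep_def ricci_variation_def has_real_derivative_iff_has_vector_derivative
 by (intro has_vector_derivative_sum bounded_linear.has_vector_derivative[OF bounded_linear_vec_nth] curvature_rep_variation[OF x])

lemma scalar_rep_variation:
 assumes x: "x \<in> U"
 shows "((\<lambda>s. scalar_rep G (C s) x) has_real_derivative scalar_variation G (C t) C' x) (at t)"
 unfolding scalar_rep_def scalar_variation_def
 by (intro DERIV_sum DERIV_cmult ricci_rep_variation[OF x])

end

text \<open>Twice the polarisation, in the arguments \<open>T\<close> and \<open>H\<close>, of the
  quadratic contorsion term of the contracted curvature. It contains no derivatives.\<close>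

definition quadratic_part ::
  "(real^'n => real^'n^'n) => 'n::finite coefficients =>
   'n::finite coefficients => real^'n => real" where
 "quadratic_part G T H x = (\<Sum>*i m. matrix_inv (G x) $ i $ m *
   (\<Sum>*j. (H x (axis j 1) (T x (axis i 1) (axis m 1)) + T x (axis j 1) (H x (axis i 1) (axis m 1))
    - H x (axis i 1) (T x (axis j 1) (axis m 1)) - T x (axis i 1) (H x (axis j 1) (axis m 1))) $ j))"

lemma scalar_variation_shift:
 assumes "bilinear (H x)"
 shows "scalar_variation G (\<lambda>x u v. C x u v + T x u v) H x = scalar_variation G C H x + quadratic_part G T H x"
proof -
 have "curvature_variation (\<lambda>x u v. C x u v + T x u v) H x u w v = curvature_variation C H x u w v
   + (H x w (T x u v) + T x w (H x u v) - H x u (T x w v) - T x u (H x w v))" for u w v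
  by (simp add: curvature_variation_def bilinear_radd[OF assms])
 then show ?thesis
  by (simp add: scalar_variation_def ricci_variation_def quadratic_part_def sum.distrib distrib_left del: vector_minus_component)
qed

section \<open>Variations of the contorsion tensor\<close>

lemma action_domainD:
 assumes "action_domain \<Omega>" "connected (UNIV :: 'a set)"
 shows "open \<Omega>" "compact (closure \<Omega>)" "connected \<Omega>" "\<Omega> \<in> sets borel" "\<Omega> \<subseteq> closure (\<Omega> :: 'a::topological_space set)"
 using assms closure_subset[of \<Omega>] by (auto simp: action_domain_def split: if_splits)

context manifold
begin

lemma tensor12_comp_rep: "tensor12_comp A c S x i j = tensor12_rep A c S x (axis i 1) (axis j 1)"
 by (simp add: tensor12_comp_def tensor12_rep_def coord_field_def)

lemma smooth_tensor12_of_rep: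
 assumes R: "\<And>c. c \<in> A ==> coefficients_on (R c) (snd c ` fst c)"
  and S: "\<And>c p u v. c \<in> A ==> p \<in> fst c ==>
   to_coord A c p (S p u v) = R c (snd c p) (to_coord A c p u) (to_coord A c p v)"
 shows "smooth_tensor12 A S"
  and "\<And>c x u v. c \<in> A ==> x \<in> snd c ` fst c ==> tensor12_rep A c S x u v = R c x u v"
proof -
 show rep: "tensor12_rep A c S x u v = R c x u v" if cx: "c \<in> A" "x \<in> snd c ` fst c" for c x u v
 proof -
  obtain p where p: "p \<in> fst c" "x = snd c p" using cx by blast
  show ?thesis using S[OF cx(1) p(1)] cx(1) p by (simp add: tensor12_rep_def Let_def)
 qed
 show "smooth_tensor12 A S"
  unfolding smooth_tensor12_def
 proof (intro conjI allI ballI)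
  fix p
  obtain c where c: "c \<in> A" "p \<in> fst c" by (rule ex_chart)
  have bil: "bilinear (R c (snd c p))" using coefficients_bilinear[OF R[OF c(1)]] c(2) by blast
  have S_eq: "S p u v = of_coord A c p (R c (snd c p) (to_coord A c p u) (to_coord A c p v))" for u v
   using S[OF c, of u v, symmetric] c by simp
  show "bilinear (S p)"
   unfolding bilinear_def
   by (intro conjI allI linearI)
     (simp_all add: S_eq linear_add[OF linear_to_coord[OF c]] linear_scale[OF linear_to_coord[OF c]]
      linear_add[OF linear_of_coord[OF c]] linear_scale[OF linear_of_coord[OF c]]
      bilinear_radd[OF bil] bilinear_ladd[OF bil] bilinear_rmul[OF bil] bilinear_lmul[OF bil])
 next
  fix c i j assume c: "c \<in> A"
  show "smooth_on (\<lambda>x. tensor12_comp A c S x i j) (snd c ` fst c)"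
  proof (rule smooth_on_transform[OF _ open_chart(2)[OF c]])
   show "smooth_on (\<lambda>x. R c x (axis i 1) (axis j 1)) (snd c ` fst c)"
    using R[OF c] by (simp add: coefficients_on_def)
   show "tensor12_comp A c S x i j = R c x (axis i 1) (axis j 1)" if "x \<in> snd c ` fst c" for x
    unfolding tensor12_comp_rep by (rule rep[OF c that])
  qed
 qed
qed

lemma tensor12_rep_comp:
 assumes "smooth_tensor12 A S" "c \<in> A" "x \<in> snd c ` fst c"
 shows "tensor12_rep A c S x u v = (\<Sum>*i j. (u $ i * v $ j) *\<^sub>R tensor12_comp A c S x i j)"
proof -
 obtain p where p: "p \<in> fst c" "x = snd c p" using assms by blast
 have "bilinear (S p)" using assms by (simp add: smooth_tensor12_def)
 from tensor12_rep_expand[where T = S, OF this assms(2) p(1)] show ?thesis unfolding p(2) .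
qed

text \<open>The inhomogeneous part \<open>K\<close> of the transformation law does not depend on the parameter, so that
 the derivative of a family of coefficients is a tensor.\<close>

lemma family_velocity:
 fixes C :: "('m, 'n) chart => real => 'n::finite coefficients" and V :: "real => ('m, 'n) tensor12_field"
 assumes I: "open I" "0 \<in> I"
  and C: "\<And>c u v. c \<in> A ==> smooth_on (\<lambda>(t, x). C c t x u v) (I \<times> snd c ` fst c)"
   "\<And>c t x. c \<in> A ==> t \<in> I ==> x \<in> snd c ` fst c ==> bilinear (C c t x)"
  and V: "\<And>c p u v. c \<in> A ==> p \<in> fst c ==>
   \<exists>K. \<forall>s\<in>I. C c s (snd c p) (to_coord A c p u) (to_coord A c p v) = to_coord A c p (V s p u v) + K"
 shows "smooth_tensor12 A (\<lambda>p u v. vector_derivative (\<lambda>s. V s p u v) (at 0))"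
  and "\<And>c x u v. c \<in> A ==> x \<in> snd c ` fst c ==>
   tensor12_rep A c (\<lambda>p u v. vector_derivative (\<lambda>s. V s p u v) (at 0)) x u v = vector_derivative (\<lambda>s. C c s x u v) (at 0)"
proof -
 let ?R = "\<lambda>c x u v. vector_derivative (\<lambda>s. C c s x u v) (at 0)"
 have R: "coefficients_on (?R c) (snd c ` fst c)" if c: "c \<in> A" for c
  by (rule coefficients_family_derivative[where C = "C c" and U = "snd c ` fst c", OF I(1) open_chart(2)[OF c] I(2) C(1)[OF c] C(2)[OF c]])
 have D: "((\<lambda>s. C c s (snd c p) a b) has_vector_derivative ?R c (snd c p) a b) (at 0)" if c: "c \<in> A" "p \<in> fst c" for c p a b
  by (rule family_coefficients_derivative[where C = "C c" and U = "snd c ` fst c", OF I(1) open_chart(2)[OF c(1)] I(2) C(1)[OF c(1)] C(2)[OF c(1)]])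
    (use c in auto)
 have S: "to_coord A c p (vector_derivative (\<lambda>s. V s p u v) (at 0)) = ?R c (snd c p) (to_coord A c p u) (to_coord A c p v)"
  if c: "c \<in> A" "p \<in> fst c" for c p u v
 proof -
  define d where "d = chart_at A p"
  have d: "d \<in> A" "p \<in> fst d" using chart_at by (auto simp: d_def)
  obtain K where K: "\<forall>s\<in>I. C d s (snd d p) u v = V s p u v + K" using V[OF d, of u v] by (auto simp: d_def)
  obtain L where L: "\<forall>s\<in>I. C c s (snd c p) (to_coord A c p u) (to_coord A c p v) = to_coord A c p (V s p u v) + L" using V[OF c] by blast
  have "((\<lambda>s. V s p u v) has_vector_derivative ?R d (snd d p) u v - 0) (at 0)"
   by (rule has_vector_derivative_transform_within_open[OF has_vector_derivative_diff[OF D[OF d] has_vector_derivative_const[of K]] I])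
     (simp add: K)
  then have "((\<lambda>s. V s p u v) has_vector_derivative vector_derivative (\<lambda>s. V s p u v) (at 0)) (at 0)"
   using vector_derivative_at by fastforce
  from has_vector_derivative_add[OF bounded_linear.has_vector_derivative[OF linear_conv_bounded_linear[THEN iffD1, OF linear_to_coord[OF c]] this]
    has_vector_derivative_const[of L]]
  have "((\<lambda>s. C c s (snd c p) (to_coord A c p u) (to_coord A c p v)) has_vector_derivative
    to_coord A c p (vector_derivative (\<lambda>s. V s p u v) (at 0)) + 0) (at 0)"
   by (rule has_vector_derivative_transform_within_open[OF _ I]) (simp add: L)
  from vector_derivative_at[OF this] show ?thesis by simp
 qed
 show "smooth_tensor12 A (\<lambda>p u v. vector_derivative (\<lambda>s. V s p u v) (at 0))"
  by (rule smooth_tensor12_of_rep(1)[where R = ?R]) (rule R, assumption, rule S)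
 show "tensor12_rep A c (\<lambda>p u v. vector_derivative (\<lambda>s. V s p u v) (at 0)) x u v = ?R c x u v" if "c \<in> A" "x \<in> snd c ` fst c" for c x u v
  by (rule smooth_tensor12_of_rep(2)[where R = ?R, OF _ _ that]) (rule R, assumption, rule S)
qed

context
 fixes H :: "real => ('m, 'n) tensor12_field" and T \<delta> \<Omega>
 assumes H: "contorsion_variation A \<Omega> T \<delta> H"
begin

definition contorsion_velocity :: "('m, 'n) tensor12_field" where
 "contorsion_velocity p u v = vector_derivative (\<lambda>s. H s p u v) (at 0)"

lemma smooth_family_contorsion:
 assumes c: "c \<in> A"
 shows "smooth_on (\<lambda>(t, x). tensor12_rep A c (H t) x u v) ({-\<delta><..<\<delta>} \<times> snd c ` fst c)"
proof (rule smooth_on_transform)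
 let ?S = "snd c ` fst c"
 show op: "open ({-\<delta><..<\<delta>} \<times> ?S)" using open_chart(2)[OF c] by (intro open_Times) auto
 have "smooth_on (\<lambda>z. tensor12_comp A c (H (fst z)) (snd z) i j) ({-\<delta><..<\<delta>} \<times> ?S)" for i j
  using H c by (simp add: contorsion_variation_def case_prod_beta')
 then show "smooth_on (\<lambda>z. \<Sum>*i j. (u $ i * v $ j) *\<^sub>R tensor12_comp A c (H (fst z)) (snd z) i j)
   ({-\<delta><..<\<delta>} \<times> ?S)"
  by (intro smooth_on_sum smooth_on_scaleR smooth_on_const op)
 fix z assume z: "z \<in> {-\<delta><..<\<delta>} \<times> ?S"
 then have "smooth_tensor12 A (H (fst z))" "snd z \<in> ?S" using H by (auto simp: contorsion_variation_def)
 then show "(case z of (t, x) => tensor12_rep A c (H t) x u v) =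
   (\<Sum>*i j. (u $ i * v $ j) *\<^sub>R tensor12_comp A c (H (fst z)) (snd z) i j)"
  using tensor12_rep_comp[OF _ c] by (simp add: case_prod_beta')
qed

lemma bilinear_contorsion:
 assumes c: "c \<in> A" and "t \<in> {-\<delta><..<\<delta>}" "x \<in> snd c ` fst c"
 shows "bilinear (tensor12_rep A c (H t) x)"
proof -
 have "smooth_tensor12 A (H t)" using H assms by (auto simp: contorsion_variation_def)
 from coefficients_bilinear[OF coefficients_tensor12_rep[OF this c] assms(3)] show ?thesis .
qed

lemma contorsion_velocity:
 shows smooth_contorsion_velocity: "smooth_tensor12 A contorsion_velocity"
  and contorsion_velocity_rep: "\<And>c x u v. c \<in> A ==> x \<in> snd c ` fst c ==>
   tensor12_rep A c contorsion_velocity x u v = vector_derivative (\<lambda>s. tensor12_rep A c (H s) x u v) (at 0)"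
proof -
 have d: "0 \<in> {-\<delta><..<\<delta>}" using H by (auto simp: contorsion_variation_def)
 have "\<exists>K. \<forall>s\<in>{-\<delta><..<\<delta>}. tensor12_rep A c (H s) (snd c p) (to_coord A c p u) (to_coord A c p v) = to_coord A c p (H s p u v) + K"
  if "c \<in> A" "p \<in> fst c" for c p u v
  using tensor12_rep_chart[OF that, symmetric] by (intro exI[of _ 0]) simp
 note vel = family_velocity[where C = "\<lambda>c s. tensor12_rep A c (H s)" and V = H, OF open_greaterThanLessThan d
   smooth_family_contorsion bilinear_contorsion this]
 have eq: "contorsion_velocity = (\<lambda>p u v. vector_derivative (\<lambda>s. H s p u v) (at 0))"
  by (intro ext) (rule contorsion_velocity_def)
 show "smooth_tensor12 A contorsion_velocity" unfolding eq by (rule vel(1))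
 show "tensor12_rep A c contorsion_velocity x u v = vector_derivative (\<lambda>s. tensor12_rep A c (H s) x u v) (at 0)"
  if "c \<in> A" "x \<in> snd c ` fst c" for c x u v
  unfolding eq by (rule vel(2)) (simp_all add: that)
qed

end

end

context line_product
begin

context
 fixes g :: "('m, 'n) bilin_field"
 assumes adapted: "adapted_metric A k D g"
begin

definition mixed_quadratic :: "('m, 'n) tensor12_field => ('m, 'n) tensor12_field => 'm => real" where
 "mixed_quadratic T S p = (let c = chart_at A p in
   quadratic_part (bilin_comp A c g) (tensor12_rep A c T) (tensor12_rep A c S) (snd c p))"

context
 fixes H :: "real => ('m, 'n) tensor12_field" and T \<delta> \<Omega>
 assumes H: "contorsion_variation A \<Omega> T \<delta> H"
begin

lemma smooth_family_contorted:
 assumes c: "c \<in> A"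
 shows "smooth_on (\<lambda>(t, x). contorted_rep A c g (H t) x u v) ({-\<delta><..<\<delta>} \<times> snd c ` fst c)"
proof -
 let ?S = "snd c ` fst c" and ?I = "{-\<delta><..<\<delta>}"
 have op: "open (?I \<times> ?S)" using open_chart(2)[OF c] by (intro open_Times) auto
 have "smooth_on (\<lambda>(t, x). christoffel (bilin_comp A c g) x u v) (?I \<times> ?S)"
  using coefficients_christoffel[OF metricD[OF adapted] c] open_chart(2)[OF c] by (intro smooth_on_times_snd) (simp_all add: coefficients_on_def)
 from smooth_on_add[OF op this smooth_family_contorsion[OF H c, of u v]]
 show ?thesis by (simp add: contorted_rep_def case_prod_beta')
qed

lemma bilinear_contorted:
 assumes c: "c \<in> A" and "t \<in> {-\<delta><..<\<delta>}" "x \<in> snd c ` fst c"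
 shows "bilinear (contorted_rep A c g (H t) x)"
proof -
 have "smooth_tensor12 A (H t)" using H assms by (auto simp: contorsion_variation_def)
 then have "coefficients_on (contorted_rep A c g (H t)) (snd c ` fst c)"
  using represents_contorted[OF metricD[OF adapted] _ c] by (simp add: represents_def)
 from coefficients_bilinear[OF this assms(3)] show ?thesis .
qed

lemma smooth_family_mixed_scalar:
 "smooth_fun_family {-\<delta><..<\<delta>} (\<lambda>t. mixed_scalar_curvature A k D g (H t))"
 unfolding smooth_fun_family_def
proof
 fix c assume c: "c \<in> A"
 let ?S = "snd c ` fst c" and ?I = "{-\<delta><..<\<delta>}" and ?G = "bilin_comp A c g"
 have op: "open ?S" "open (?I \<times> ?S)" using open_chart(2)[OF c] by (auto intro!: open_Times)
 note G = metric_matrix_chart[OF metricD[OF adapted] c]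
 have "smooth_on (\<lambda>(t, x). scalar_rep ?G (contorted_rep A c g (H t)) x) (?I \<times> ?S)"
 proof (rule smooth_family_scalar_rep(2)[where G = "\<lambda>_. ?G" and C = "\<lambda>t. contorted_rep A c g (H t)" and I = ?I and U = ?S])
  show "smooth_on (\<lambda>(t::real, x). ?G x) (?I \<times> ?S)"
   using G op by (intro smooth_on_times_snd) (simp_all add: metric_matrix_on_def)
  show "det (?G x) \<noteq> 0" if "x \<in> ?S" for x using metric_matrix_det[OF G that] .
 qed (simp_all add: op smooth_family_contorted[OF c] bilinear_contorted[OF c] del: split_paired_All)
 then have "smooth_on (\<lambda>z. (\<lambda>(t, x). scalar_rep ?G (contorted_rep A c g (H t)) x) z / 2) (?I \<times> ?S)"
  by (intro smooth_on_divide smooth_on_const op) auto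
 then show "smooth_on (\<lambda>(t, x). mixed_scalar_curvature A k D g (H t) (chart_inv c x)) (?I \<times> ?S)"
 proof (rule smooth_on_transform[OF _ op(2)])
  fix z assume z: "z \<in> ?I \<times> ?S"
  then have T: "smooth_tensor12 A (H (fst z))" using H by (auto simp: contorsion_variation_def)
  have p: "chart_inv c (snd z) \<in> fst c" "snd c (chart_inv c (snd z)) = snd z" using z c by auto
  show "(case z of (t, x) => mixed_scalar_curvature A k D g (H t) (chart_inv c x)) =
    (\<lambda>(t, x). scalar_rep ?G (contorted_rep A c g (H t)) x) z / 2"
   using mixed_scalar_chart[OF adapted T c p(1)] p(2) by (simp add: case_prod_beta')
 qed
qed

text \<open>The parameter enters through the coefficients only, so the derivative is the linear part
  at the Christoffel symbols plus the polarised quadratic term; the factor 1/2 comes from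
  \<open>mixed_scalar_chart\<close>.\<close>

lemma mixed_scalar_velocity:
 "deriv (\<lambda>s. mixed_scalar_curvature A k D g (H s) p) 0 =
   (mixed_linear g (contorsion_velocity H) p + mixed_quadratic T (contorsion_velocity H) p) / 2"
proof -
 define c where "c = chart_at A p"
 have c: "c \<in> A" "p \<in> fst c" using chart_at by (auto simp: c_def)
 let ?S = "snd c ` fst c" and ?I = "{-\<delta><..<\<delta>}" and ?G = "bilin_comp A c g" and ?V = "contorsion_velocity H"
 have x: "snd c p \<in> ?S" using c by auto
 have d: "0 \<in> ?I" and T: "smooth_tensor12 A T" and H0: "H 0 = T" using H by (auto simp: contorsion_variation_def)
 note V = smooth_contorsion_velocity[OF H]
 have C': "vector_derivative (\<lambda>s. contorted_rep A c g (H s) y u v) (at 0) = tensor12_rep A c ?V y u v" if y: "y \<in> ?S" for y u v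
 proof -
  have "((\<lambda>s. tensor12_rep A c (H s) y u v) has_vector_derivative tensor12_rep A c ?V y u v) (at 0)"
   unfolding contorsion_velocity_rep[OF H c(1) y]
   by (rule family_coefficients_derivative[where C = "\<lambda>t. tensor12_rep A c (H t)" and U = "?S", OF open_greaterThanLessThan
      open_chart(2)[OF c(1)] d smooth_family_contorsion[OF H c(1)] bilinear_contorsion[OF H c(1)] y])
  from vector_derivative_at[OF has_vector_derivative_add[OF has_vector_derivative_const[of "christoffel ?G y u v"] this]]
  show ?thesis by (simp add: contorted_rep_def)
 qed
 have "((\<lambda>s. scalar_rep ?G (contorted_rep A c g (H s)) (snd c p)) has_real_derivative
   scalar_variation ?G (contorted_rep A c g (H 0)) (\<lambda>x u v. vector_derivative (\<lambda>s. contorted_rep A c g (H s) x u v) (at 0)) (snd c p)) (at 0)"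
  by (rule scalar_rep_variation[where C = "\<lambda>t. contorted_rep A c g (H t)" and U = "?S", OF open_greaterThanLessThan
      open_chart(2)[OF c(1)] d smooth_family_contorted[OF c(1)] bilinear_contorted[OF c(1)] x])
 also have "scalar_variation ?G (contorted_rep A c g (H 0)) (\<lambda>x u v. vector_derivative (\<lambda>s. contorted_rep A c g (H s) x u v) (at 0)) (snd c p) =
   scalar_variation ?G (contorted_rep A c g (H 0)) (tensor12_rep A c ?V) (snd c p)"
  by (rule scalar_variation_cong[OF open_chart(2)[OF c(1)] x]) (simp add: fun_eq_iff C')
 also have "contorted_rep A c g (H 0) = (\<lambda>x u v. christoffel ?G x u v + tensor12_rep A c T x u v)"
  by (intro ext) (simp add: contorted_rep_def H0)
 also have "scalar_variation ?G (\<lambda>x u v. christoffel ?G x u v + tensor12_rep A c T x u v) (tensor12_rep A c ?V) (snd c p) =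
   mixed_linear g ?V p + mixed_quadratic T ?V p"
  unfolding mixed_linear_chart[OF adapted V c] mixed_quadratic_def Let_def c_def[symmetric]
  by (rule scalar_variation_shift[where H = "tensor12_rep A c ?V" and x = "snd c p", OF coefficients_bilinear[OF coefficients_tensor12_rep[OF V c(1)] x]])
 finally have D: "((\<lambda>s. scalar_rep ?G (contorted_rep A c g (H s)) (snd c p) / 2) has_real_derivative
   (mixed_linear g ?V p + mixed_quadratic T ?V p) / 2) (at 0)" by (rule DERIV_cdivide)
 have "((\<lambda>s. mixed_scalar_curvature A k D g (H s) p) has_real_derivative
   (mixed_linear g ?V p + mixed_quadratic T ?V p) / 2) (at 0)"
 proof (rule has_field_derivative_transform_within_open[OF D open_greaterThanLessThan d])
  fix s assume "s \<in> ?I"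
  then have "smooth_tensor12 A (H s)" using H by (auto simp: contorsion_variation_def)
  from mixed_scalar_chart[OF adapted this c]
  show "scalar_rep ?G (contorted_rep A c g (H s)) (snd c p) / 2 = mixed_scalar_curvature A k D g (H s) p" by simp
 qed
 then show ?thesis by (rule DERIV_imp_deriv)
qed

text \<open>Read off from \<open>mixed_scalar_velocity\<close>: the definition, in the chosen chart
  of each point, does not show how the value depends on the point.\<close>

lemma smooth_mixed_quadratic: "smooth_fun_on A UNIV (mixed_quadratic T (contorsion_velocity H))"
proof -
 let ?V = "contorsion_velocity H" and ?I = "{-\<delta><..<\<delta>}"
 have d: "0 \<in> ?I" using H by (auto simp: contorsion_variation_def)
 have eq: "mixed_quadratic T ?V = (\<lambda>p. 2 * deriv (\<lambda>s. mixed_scalar_curvature A k D g (H s) p) 0 - mixed_linear g ?V p)"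
  by (simp add: mixed_scalar_velocity fun_eq_iff field_simps)
 have s1: "smooth_fun_on A UNIV (\<lambda>p. deriv (\<lambda>s. mixed_scalar_curvature A k D g (H s) p) 0)"
  by (rule smooth_fun_family_at[OF smooth_fun_family_derivative(2)[OF smooth_family_mixed_scalar open_greaterThanLessThan]
     open_greaterThanLessThan d])
 have s2: "smooth_fun_on A UNIV (mixed_linear g ?V)"
  by (rule smooth_mixed_linear[OF adapted smooth_contorsion_velocity[OF H]])
 show ?thesis
  unfolding smooth_fun_on_def eq
 proof
  fix c assume c: "c \<in> A"
  show "smooth_on ((\<lambda>p. 2 * deriv (\<lambda>s. mixed_scalar_curvature A k D g (H s) p) 0 - mixed_linear g ?V p) \<circ> chart_inv c)
    (snd c ` (fst c \<inter> UNIV))"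
   using smooth_fun_rep[OF s1 c] smooth_fun_rep[OF s2 c] open_chart(2)[OF c] unfolding o_def
   by (auto intro!: smooth_on_diff smooth_on_mult smooth_on_const)
 qed
qed

theorem action_contorsion_derivative:
 assumes O: "\<Omega> \<in> sets borel" "\<Omega> \<subseteq> K" "compact K"
  and K': "compact K'" "K' \<subseteq> \<Omega>" "\<And>p u v. p \<notin> K' ==> contorsion_velocity H p u v = 0"
 shows "((\<lambda>t. action A k D \<Omega> g (H t)) has_real_derivative
   (LINT p:\<Omega>|volume_measure A g. mixed_quadratic T (contorsion_velocity H) p) / 2) (at 0)"
proof -
 let ?V = "contorsion_velocity H" and ?M = "volume_measure A g"
 have d: "0 < \<delta>" using H by (auto simp: contorsion_variation_def)
 note V = smooth_contorsion_velocity[OF H]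
 have i1: "set_integrable ?M \<Omega> (mixed_linear g ?V)"
  by (rule integrable_continuous_on_domain[OF metricD[OF adapted] O continuous_mixed_linear[OF adapted V]])
 have i2: "set_integrable ?M \<Omega> (mixed_quadratic T ?V)"
  by (rule integrable_continuous_on_domain[OF metricD[OF adapted] O smooth_fun_continuous[OF smooth_mixed_quadratic]])
 have z: "mixed_linear g ?V p = 0" if "p \<notin> \<Omega>" for p
  by (rule mixed_linear_local[OF adapted V compact_imp_closed[OF K'(1)] K'(3)]) (use that K' in auto)
 have "(LINT p:\<Omega>|?M. mixed_linear g ?V p) = integral\<^sup>L ?M (mixed_linear g ?V)"
  unfolding set_lebesgue_integral_def by (intro Bochner_Integration.integral_cong refl) (auto simp: indicator_def z)
 also have "\<dots> = 0" by (rule integral_mixed_linear[OF adapted V K'(1,3)])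
 finally have "(LINT p:\<Omega>|?M. mixed_linear g ?V p) = 0" .
 then have "(LINT p:\<Omega>|?M. deriv (\<lambda>s. mixed_scalar_curvature A k D g (H s) p) 0) = (LINT p:\<Omega>|?M. mixed_quadratic T ?V p) / 2"
  unfolding mixed_scalar_velocity using set_integral_add(2)[OF i1 i2] by simp
 from has_real_derivative_volume_integral[OF metricD[OF adapted] O smooth_family_mixed_scalar d, unfolded this]
 show ?thesis unfolding action_def .
qed

end

end

end

section \<open>Vanishing of the contorsion tensor\<close>

lemma frame_functional:
 assumes E: "orthogonal_frame b I E" and F: "linear (F :: real^'n => real)"
 shows "(\<Sum>\<mu>\<in>I. b v (E \<mu>) * F (E \<mu>) / b (E \<mu>) (E \<mu>)) = F v"
proof -
 have "F v = F (\<Sum>\<mu>\<in>I. (b v (E \<mu>) / b (E \<mu>) (E \<mu>)) *\<^sub>R E \<mu>)" using frame_expansion[OF E, of v] by simp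
 then show ?thesis by (simp add: linear_sum[OF F] linear_scale[OF F])
qed

text \<open>\<open>quadratic_part\<close> with both contractions carried out in a frame, so that no
  coordinates remain.\<close>

definition frame_quadratic ::
  "(real^'n => real^'n => real) => 'i set => ('i => real^'n) =>
   (real^'n => real^'n => real^'n) => (real^'n => real^'n => real^'n) => real" where
 "frame_quadratic b I E T S = (\<Sum>\<nu>\<in>I. \<Sum>\<mu>\<in>I.
   b (S (E \<mu>) (T (E \<nu>) (E \<nu>)) + T (E \<mu>) (S (E \<nu>) (E \<nu>))
    - S (E \<nu>) (T (E \<mu>) (E \<nu>)) - T (E \<nu>) (S (E \<mu>) (E \<nu>))) (E \<mu>) / (b (E \<nu>) (E \<nu>) * b (E \<mu>) (E \<mu>)))"

lemma quadratic_part_frame: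
 fixes G :: "real^'n => real^'n^'n" and I :: "'i set"
 assumes E: "orthogonal_frame (\<lambda>u v. u \<bullet> (G x *v v)) I E" and G: "det (G x) \<noteq> 0" "transpose (G x) = G x"
  and T: "bilinear (T x)" and H: "bilinear (H x)"
 shows "quadratic_part G T H x = frame_quadratic (\<lambda>u v. u \<bullet> (G x *v v)) I E (T x) (H x)"
proof -
 define L where "L = (\<lambda>u v z. H x z (T x u v) + T x z (H x u v) - H x u (T x z v) - T x u (H x z v))"
 note bil = bilinear_ladd[OF T] bilinear_radd[OF T] bilinear_lmul[OF T] bilinear_rmul[OF T]
  bilinear_ladd[OF H] bilinear_radd[OF H] bilinear_lmul[OF H] bilinear_rmul[OF H]
 have lin: "linear (L u v)" for u v by (rule linearI) (simp_all add: L_def bil algebra_simps)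
 define B where "B = (\<lambda>u v. \<Sum>*j. L u v (axis j 1) $ j)"
 have B: "bilinear B"
  unfolding bilinear_def
  by (intro conjI allI linearI; simp add: B_def L_def bil sum.distrib[symmetric] sum_distrib_left algebra_simps)
 have "quadratic_part G T H x = (\<Sum>*i m. matrix_inv (G x) $ i $ m * B (axis i 1) (axis m 1))"
  by (simp add: quadratic_part_def B_def L_def)
 also have "\<dots> = (\<Sum>\<nu>\<in>I. B (E \<nu>) (E \<nu>) / (E \<nu> \<bullet> (G x *v E \<nu>)))"
  by (rule contraction_frame[OF E refl G B])
 also have "\<dots> = (\<Sum>\<nu>\<in>I. (\<Sum>\<mu>\<in>I. L (E \<nu>) (E \<nu>) (E \<mu>) \<bullet> (G x *v E \<mu>) / (E \<mu> \<bullet> (G x *v E \<mu>))) / (E \<nu> \<bullet> (G x *v E \<nu>)))"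
  unfolding B_def trace_frame[OF E lin] ..
 finally show ?thesis
  by (simp add: frame_quadratic_def L_def sum_divide_distrib mult.commute)
qed

text \<open>A velocity of rank one lets \<open>frame_functional\<close> evaluate the sums over the
  frame. Total symmetry of \<open>T\<close> makes the positive terms traces of \<open>T\<close> and
  identifies the two negative ones.\<close>

lemma frame_quadratic_rank_one:
 fixes b :: "real^'n => real^'n => real" and I :: "'i set"
 assumes E: "orthogonal_frame b I E" and sym: "\<And>u v. b u v = b v u" and T: "bilinear T"
  and stat: "\<And>x y z. b (T x y) z = b (T y x) z" "\<And>x y z. b (T x y) z = b (T x z) y"
  and S: "\<And>u v. S u v = (b a u * b c v) *\<^sub>R w"
 shows "frame_quadratic b I E T S =
  b a w * (\<Sum>\<nu>\<in>I. b (T (E \<nu>) (E \<nu>)) c / b (E \<nu>) (E \<nu>)) +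
  b a c * (\<Sum>\<nu>\<in>I. b (T (E \<nu>) (E \<nu>)) w / b (E \<nu>) (E \<nu>)) - 2 * b (T w a) c"
proof -
 have bil: "bilinear b" using E by (simp add: orthogonal_frame_def)
 have lin: "linear (\<lambda>z. b w z)" for w using bil by (simp add: bilinear_def)
 have linT: "linear (\<lambda>z. b (T u z) v)" "linear (\<lambda>z. b v (T z u))" "linear (\<lambda>z. b v (T u z))" for u v
  by (auto intro!: linearI simp: bilinear_radd[OF T] bilinear_rmul[OF T] bilinear_ladd[OF T] bilinear_lmul[OF T]
    bilinear_ladd[OF bil] bilinear_lmul[OF bil] bilinear_radd[OF bil] bilinear_rmul[OF bil])
 note F = frame_functional[OF E]
 let ?e = "\<lambda>\<mu>. b (E \<mu>) (E \<mu>)"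
 have 1: "(\<Sum>\<nu>\<in>I. \<Sum>\<mu>\<in>I. b (S (E \<mu>) (T (E \<nu>) (E \<nu>))) (E \<mu>) / (?e \<nu> * ?e \<mu>)) =
   b a w * (\<Sum>\<nu>\<in>I. b (T (E \<nu>) (E \<nu>)) c / ?e \<nu>)"
 proof -
  have "(\<Sum>\<mu>\<in>I. b (S (E \<mu>) (T (E \<nu>) (E \<nu>))) (E \<mu>) / (?e \<nu> * ?e \<mu>)) =
    b c (T (E \<nu>) (E \<nu>)) / ?e \<nu> * (\<Sum>\<mu>\<in>I. b a (E \<mu>) * b w (E \<mu>) / ?e \<mu>)" for \<nu>
   unfolding sum_distrib_left by (intro sum.cong refl) (simp add: S bilinear_lmul[OF bil])
  then show ?thesis using F[OF lin, of a w] sym[of w a] sym[of c] by (simp add: sum_distrib_left mult_ac)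
 qed
 have 2: "(\<Sum>\<nu>\<in>I. \<Sum>\<mu>\<in>I. b (T (E \<mu>) (S (E \<nu>) (E \<nu>))) (E \<mu>) / (?e \<nu> * ?e \<mu>)) =
   b a c * (\<Sum>\<nu>\<in>I. b (T (E \<nu>) (E \<nu>)) w / ?e \<nu>)"
 proof -
  have "(\<Sum>\<nu>\<in>I. \<Sum>\<mu>\<in>I. b (T (E \<mu>) (S (E \<nu>) (E \<nu>))) (E \<mu>) / (?e \<nu> * ?e \<mu>)) =
    (\<Sum>\<nu>\<in>I. b a (E \<nu>) * b c (E \<nu>) / ?e \<nu>) * (\<Sum>\<mu>\<in>I. b (T (E \<mu>) w) (E \<mu>) / ?e \<mu>)"
   unfolding sum_product by (intro sum.cong refl) (simp add: S bilinear_lmul[OF bil] bilinear_rmul[OF T])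
  moreover have "b (T (E \<mu>) w) (E \<mu>) = b (T (E \<mu>) (E \<mu>)) w" for \<mu> by (rule stat(2))
  ultimately show ?thesis using F[OF lin, of a c] sym[of c a] by simp
 qed
 have 3: "(\<Sum>\<nu>\<in>I. \<Sum>\<mu>\<in>I. b (S (E \<nu>) (T (E \<mu>) (E \<nu>))) (E \<mu>) / (?e \<nu> * ?e \<mu>)) = b (T w a) c"
 proof -
  have "(\<Sum>\<mu>\<in>I. b (S (E \<nu>) (T (E \<mu>) (E \<nu>))) (E \<mu>) / (?e \<nu> * ?e \<mu>)) =
    b a (E \<nu>) / ?e \<nu> * (\<Sum>\<mu>\<in>I. b w (E \<mu>) * b c (T (E \<mu>) (E \<nu>)) / ?e \<mu>)" for \<nu>
   unfolding sum_distrib_left by (intro sum.cong refl) (simp add: S bilinear_lmul[OF bil])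
  then have "(\<Sum>\<mu>\<in>I. b (S (E \<nu>) (T (E \<mu>) (E \<nu>))) (E \<mu>) / (?e \<nu> * ?e \<mu>)) =
    b a (E \<nu>) * b c (T w (E \<nu>)) / ?e \<nu>" for \<nu> using F[OF linT(2), of w c] by simp
  then show ?thesis using F[OF linT(3), of a c w] sym[of c] by simp
 qed
 have 4: "(\<Sum>\<nu>\<in>I. \<Sum>\<mu>\<in>I. b (T (E \<nu>) (S (E \<mu>) (E \<nu>))) (E \<mu>) / (?e \<nu> * ?e \<mu>)) = b (T w a) c"
 proof -
  have "(\<Sum>\<mu>\<in>I. b (T (E \<nu>) (S (E \<mu>) (E \<nu>))) (E \<mu>) / (?e \<nu> * ?e \<mu>)) =
    b c (E \<nu>) / ?e \<nu> * (\<Sum>\<mu>\<in>I. b a (E \<mu>) * b (T (E \<nu>) w) (E \<mu>) / ?e \<mu>)" for \<nu>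
   unfolding sum_distrib_left
   by (intro sum.cong refl) (simp add: S bilinear_lmul[OF bil] bilinear_rmul[OF T])
  then have "(\<Sum>\<mu>\<in>I. b (T (E \<nu>) (S (E \<mu>) (E \<nu>))) (E \<mu>) / (?e \<nu> * ?e \<mu>)) =
    b c (E \<nu>) * b a (T w (E \<nu>)) / ?e \<nu>" for \<nu>
   using F[OF lin, of a "T (E \<nu>) w"] stat(1)[of "E \<nu>" w a] sym[of a] by simp
  then show ?thesis using F[OF linT(3), of c a w] sym[of a] stat(2)[of w a c] by simp
 qed
 have "frame_quadratic b I E T S = (\<Sum>\<nu>\<in>I. \<Sum>\<mu>\<in>I. b (S (E \<mu>) (T (E \<nu>) (E \<nu>))) (E \<mu>) / (?e \<nu> * ?e \<mu>)) +
   (\<Sum>\<nu>\<in>I. \<Sum>\<mu>\<in>I. b (T (E \<mu>) (S (E \<nu>) (E \<nu>))) (E \<mu>) / (?e \<nu> * ?e \<mu>)) -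
   (\<Sum>\<nu>\<in>I. \<Sum>\<mu>\<in>I. b (S (E \<nu>) (T (E \<mu>) (E \<nu>))) (E \<mu>) / (?e \<nu> * ?e \<mu>)) -
   (\<Sum>\<nu>\<in>I. \<Sum>\<mu>\<in>I. b (T (E \<nu>) (S (E \<mu>) (E \<nu>))) (E \<mu>) / (?e \<nu> * ?e \<mu>))"
  unfolding frame_quadratic_def
  by (simp add: sum.distrib[symmetric] sum_subtractf[symmetric] bilinear_ladd[OF bil] bilinear_lsub[OF bil]
    add_divide_distrib diff_divide_distrib)
 then show ?thesis unfolding 1 2 3 4 by simp
qed

text \<open>The tests of rank one express the components of \<open>T\<close> in the frame by its
  trace \<open>t\<close>. A second line makes \<open>t\<close> vanish, and then all components
  do.\<close>

lemma totally_symmetric_eq_0: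
 fixes b :: "real^'n => real^'n => real" and I :: "'i set"
 assumes E: "orthogonal_frame b I E" and sym: "\<And>u v. b u v = b v u" and T: "bilinear T"
  and stat: "\<And>x y z. b (T x y) z = b (T y x) z" "\<And>x y z. b (T x y) z = b (T x z) y"
  and I: "\<And>\<beta>. \<beta> \<in> I ==> \<exists>\<alpha>\<in>I. \<alpha> \<noteq> \<beta>"
  and zero: "\<And>\<alpha> \<beta> \<gamma> S. \<alpha> \<in> I ==> \<beta> \<in> I ==> \<gamma> \<in> I ==>
   (\<And>u v. S u v = (b (E \<alpha>) u * b (E \<beta>) v) *\<^sub>R E \<gamma>) ==> frame_quadratic b I E T S = 0"
 shows "T u v = 0"
proof -
 define t where "t = (\<lambda>z. \<Sum>\<nu>\<in>I. b (T (E \<nu>) (E \<nu>)) z / b (E \<nu>) (E \<nu>))"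
 have q: "b (E \<alpha>) (E \<gamma>) * t (E \<beta>) + b (E \<alpha>) (E \<beta>) * t (E \<gamma>) - 2 * b (T (E \<gamma>) (E \<alpha>)) (E \<beta>) = 0"
  if "\<alpha> \<in> I" "\<beta> \<in> I" "\<gamma> \<in> I" for \<alpha> \<beta> \<gamma>
  using frame_quadratic_rank_one[OF E sym T stat, of "\<lambda>u v. (b (E \<alpha>) u * b (E \<beta>) v) *\<^sub>R E \<gamma>" "E \<alpha>" "E \<beta>" "E \<gamma>"]
   zero[OF that, of "\<lambda>u v. (b (E \<alpha>) u * b (E \<beta>) v) *\<^sub>R E \<gamma>"] unfolding t_def by simp
 have orth: "b (E \<mu>) (E \<nu>) = 0" if "\<mu> \<in> I" "\<nu> \<in> I" "\<mu> \<noteq> \<nu>" for \<mu> \<nu>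
  using E that unfolding orthogonal_frame_def by blast
 have nz: "b (E \<mu>) (E \<mu>) \<noteq> 0" if "\<mu> \<in> I" for \<mu>
  using E that unfolding orthogonal_frame_def by blast
 have t: "t (E \<beta>) = 0" if \<beta>: "\<beta> \<in> I" for \<beta>
 proof -
  obtain \<alpha> where \<alpha>: "\<alpha> \<in> I" "\<alpha> \<noteq> \<beta>" using I[OF \<beta>] by blast
  \<comment> \<open>The equation for \<open>\<alpha>, \<alpha>, \<beta>\<close> expresses
    \<open>t (E \<beta>)\<close> by the component of \<open>T\<close> with indices
    \<open>\<beta>, \<alpha>, \<alpha>\<close>; the equation for
    \<open>\<beta>, \<alpha>, \<alpha>\<close> makes that component vanish by orthogonality.\<close>
  have "b (T (E \<beta>) (E \<alpha>)) (E \<alpha>) = b (T (E \<alpha>) (E \<beta>)) (E \<alpha>)" by (rule stat(1))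
  then have "b (E \<alpha>) (E \<alpha>) * t (E \<beta>) = 0"
   using q[OF \<alpha>(1) \<alpha>(1) \<beta>] q[OF \<beta> \<alpha>(1) \<alpha>(1)] orth[OF \<alpha>(1) \<beta> \<alpha>(2)] orth[OF \<beta> \<alpha>(1)] \<alpha>(2) by simp
  then show ?thesis using nz[OF \<alpha>(1)] by simp
 qed
 have z: "b (T (E \<gamma>) (E \<alpha>)) (E \<beta>) = 0" if "\<alpha> \<in> I" "\<beta> \<in> I" "\<gamma> \<in> I" for \<alpha> \<beta> \<gamma>
  using q[OF that] t[OF that(2)] t[OF that(3)] by simp
 have bil: "bilinear b" using E by (simp add: orthogonal_frame_def)
 have TE: "T (E \<gamma>) (E \<alpha>) = 0" if "\<alpha> \<in> I" "\<gamma> \<in> I" for \<alpha> \<gamma>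
  using frame_expansion[OF E, of "T (E \<gamma>) (E \<alpha>)"] z that by simp
 have "T u v = T (\<Sum>\<mu>\<in>I. (b u (E \<mu>) / b (E \<mu>) (E \<mu>)) *\<^sub>R E \<mu>) (\<Sum>\<mu>\<in>I. (b v (E \<mu>) / b (E \<mu>) (E \<mu>)) *\<^sub>R E \<mu>)"
  using frame_expansion[OF E, of u] frame_expansion[OF E, of v] by simp
 also have "\<dots> = (\<Sum>(i, j)\<in>I \<times> I. T ((b u (E i) / b (E i) (E i)) *\<^sub>R E i) ((b v (E j) / b (E j) (E j)) *\<^sub>R E j))"
  by (rule bilinear_sum[OF T])
 also have "\<dots> = 0"
  by (rule sum.neutral) (auto simp: bilinear_lmul[OF T] bilinear_rmul[OF T] TE)
 finally show ?thesis .
qed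

section \<open>Test domains and test tensors\<close>

context manifold
begin

text \<open>In the non-compact case a coordinate ball around the point is admissible, since its
  closure lies in the compact preimage of the closed ball. Criticality can thus be exploited near
  every point.\<close>

lemma ex_action_domain:
 fixes p :: 'm
 obtains \<Omega> where "action_domain \<Omega>" "p \<in> \<Omega>"
proof (cases "compact (UNIV :: 'm set)")
 case True
 then show thesis using that[of UNIV] by (simp add: action_domain_def)
next
 case False
 obtain c where c: "c \<in> A" "p \<in> fst c" by (rule ex_chart)
 obtain r where r: "r > 0" "cball (snd c p) r \<subseteq> snd c ` fst c"
  using open_chart(2)[OF c(1)] c(2) open_contains_cball by blast
 let ?B = "ball (snd c p) r"
 define \<Omega> where "\<Omega> = chart_inv c ` ?B"
 have sub: "?B \<subseteq> snd c ` fst c" using r(2) ball_subset_cball by blast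
 have eq: "\<Omega> = {q \<in> fst c. snd c q \<in> ?B}"
 proof -
  have "q \<in> \<Omega>" if "q \<in> fst c" "snd c q \<in> ?B" for q
   unfolding \<Omega>_def using that c by (intro image_eqI[of _ _ "snd c q"]) auto
  then show ?thesis unfolding \<Omega>_def using sub c by auto
 qed
 have "open \<Omega>" unfolding eq by (rule open_chart_preimage[OF c(1) open_ball])
 moreover have "connected \<Omega>" unfolding \<Omega>_def
  by (rule connected_continuous_image[OF continuous_on_subset[OF continuous_on_chart_inv[OF c(1)] sub] connected_ball])
 moreover have "compact (closure \<Omega>)"
 proof -
  have K: "compact (chart_inv c ` cball (snd c p) r)"
   by (rule compact_continuous_image[OF continuous_on_subset[OF continuous_on_chart_inv[OF c(1)] r(2)] compact_cball])
  have "\<Omega> \<subseteq> chart_inv c ` cball (snd c p) r" unfolding \<Omega>_def by auto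
  then have "closure \<Omega> \<subseteq> chart_inv c ` cball (snd c p) r" by (rule closure_minimal[OF _ compact_imp_closed[OF K]])
  then show ?thesis using compact_Int_closed[OF K closed_closure[of \<Omega>]] by (simp add: Int_absorb1)
 qed
 moreover have "p \<in> \<Omega>" unfolding eq using c r by simp
 ultimately show thesis using that[of \<Omega>] False by (simp add: action_domain_def)
qed

lemma continuous_integral_eq_0:
 fixes f :: "'m => real"
 assumes g: "pseudo_riemannian_metric A g" and O: "open \<Omega>" "\<Omega> \<subseteq> K" "compact K"
  and f: "continuous_on UNIV f" "\<And>p. 0 \<le> f p" and int: "(LINT p:\<Omega>|volume_measure A g. f p) = 0" and p: "p \<in> \<Omega>"
 shows "f p = 0"
proof (rule ccontr)
 assume nz: "f p \<noteq> 0"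
 let ?M = "volume_measure A g"
 have Ob: "\<Omega> \<in> sets borel" using O(1) by simp
 have i: "integrable ?M (\<lambda>p. indicator \<Omega> p *\<^sub>R f p)"
  using integrable_continuous_on_domain[OF g Ob O(2,3) f(1)] by (simp add: set_integrable_def)
 have AE: "AE p in ?M. indicator \<Omega> p *\<^sub>R f p = 0"
  using int integral_nonneg_eq_0_iff_AE[OF i] f(2) by (simp add: set_lebesgue_integral_def)
 have W: "open {q. 0 < f q}" by (rule open_Collect_less[OF continuous_on_const f(1)])
 have Ws: "\<Omega> \<inter> {q. 0 < f q} \<in> sets ?M" using O(1) W by (simp add: sets_volume_measure[OF g] open_Int)
 have "{q \<in> space ?M. \<not> indicator \<Omega> q *\<^sub>R f q = 0} = \<Omega> \<inter> {q. 0 < f q}"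
  using f(2) by (auto simp: space_volume_measure[OF g] indicator_def less_le)
 from AE_iff_measurable[OF Ws this] AE have "emeasure ?M (\<Omega> \<inter> {q. 0 < f q}) = 0" by simp
 moreover have "p \<in> \<Omega> \<inter> {q. 0 < f q}" using nz f(2)[of p] p by simp
 ultimately show False using volume_open_pos[OF g open_Int[OF O(1) W]] by blast
qed

lemma smooth_coord_field: "c \<in> A ==> smooth_vf_on A (fst c) (coord_field A c i)"
 using smooth_of_coord[of c "axis i 1"] by (simp add: coord_field_def[abs_def])

lemma smooth_rank_one_tensor:
 assumes g: "pseudo_riemannian_metric A g" and W: "open W" and X: "smooth_vf_on A W X" and Y: "smooth_vf_on A W Y" and Z: "smooth_vf_on A W Z"
  and \<phi>: "smooth_fun_on A UNIV \<phi>" and K: "closed K" "K \<subseteq> W" "\<And>p. p \<notin> K ==> \<phi> p = 0"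
 shows "smooth_tensor12 A (\<lambda>p u v. (\<phi> p * (g p (X p) u * g p (Y p) v)) *\<^sub>R Z p)"
proof (rule smooth_tensor12_extend[where W = W, OF _ _ W K(1,2)])
 show "bilinear (\<lambda>u v. (\<phi> p * (g p (X p) u * g p (Y p) v)) *\<^sub>R Z p)" for p
  unfolding bilinear_def by (intro conjI allI linearI) (simp_all add: metric_simps[OF g] algebra_simps)
 fix c i j assume c: "c \<in> A"
 let ?U = "snd c ` (fst c \<inter> W)"
 have U: "open ?U" by (rule open_chart_image[OF c W])
 have cW: "open (fst c \<inter> W)" using open_chart(1)[OF c] W by blast
 note co = smooth_vf_on_subset[OF smooth_coord_field[OF c], of "fst c \<inter> W"]
 have 1: "smooth_fun_on A (fst c \<inter> W) (\<lambda>q. g q (X q) (coord_field A c i q))"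
  by (rule smooth_metric_apply[OF g cW smooth_vf_on_subset[OF X] co]) (use cW W open_chart(1)[OF c] in auto)
 have 2: "smooth_fun_on A (fst c \<inter> W) (\<lambda>q. g q (Y q) (coord_field A c j q))"
  by (rule smooth_metric_apply[OF g cW smooth_vf_on_subset[OF Y] co]) (use cW W open_chart(1)[OF c] in auto)
 have s1: "smooth_on (\<lambda>x. g (chart_inv c x) (X (chart_inv c x)) (coord_field A c i (chart_inv c x))) ?U"
  using smooth_fun_rep[OF 1 c] by (simp add: o_def inf_left_idem)
 have s2: "smooth_on (\<lambda>x. g (chart_inv c x) (Y (chart_inv c x)) (coord_field A c j (chart_inv c x))) ?U"
  using smooth_fun_rep[OF 2 c] by (simp add: o_def inf_left_idem)
 have s3: "smooth_on (\<lambda>x. \<phi> (chart_inv c x)) ?U"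
  by (rule smooth_on_subset[OF smooth_fun_rep[OF \<phi> c, unfolded o_def]]) (use U in auto)
 have s4: "smooth_on (vf_rep A c Z) ?U" by (rule smooth_vf_rep[OF Z c])
 from smooth_on_scaleR[OF U smooth_on_mult[OF U s3 smooth_on_mult[OF U s1 s2]] s4]
 show "smooth_on (\<lambda>x. tensor12_comp A c (\<lambda>p u v. (\<phi> p * (g p (X p) u * g p (Y p) v)) *\<^sub>R Z p) x i j) ?U"
  by (rule smooth_on_transform[OF _ U])
    (use c in "auto simp: tensor12_comp_def Let_def vf_rep_def linear_scale[OF linear_to_coord]")
qed (simp add: K(3))

text \<open>The interval radius 1 is arbitrary: unlike metrics, contorsion tensors satisfy no
  nondegeneracy condition that could fail along the way.\<close>

lemma contorsion_variation_affine:
 assumes T: "smooth_tensor12 A T" and S: "smooth_tensor12 A S" and K: "closed K" "K \<subseteq> \<Omega>" "\<And>p u v. p \<notin> K ==> S p u v = 0"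
 shows "contorsion_variation A \<Omega> T 1 (\<lambda>t p u v. T p u v + t *\<^sub>R S p u v)"
  and "contorsion_velocity (\<lambda>t p u v. T p u v + t *\<^sub>R S p u v) = S"
proof -
 let ?H = "\<lambda>t p u v. T p u v + t *\<^sub>R S p u v"
 have D: "vector_derivative (\<lambda>s. ?H s p u v) (at t) = S p u v" for t p u v
 proof (rule vector_derivative_at)
  show "((\<lambda>s. ?H s p u v) has_vector_derivative S p u v) (at t)"
   by (auto intro!: derivative_eq_intros)
 qed
 have st: "smooth_tensor12 A (\<lambda>p u v. t *\<^sub>R S p u v)" for t
 proof -
  have "smooth_fun_on A UNIV (\<lambda>_. t)"
   unfolding smooth_fun_on_def o_def using open_chart(2) by (auto intro!: smooth_on_const)
  from smooth_tensor12_scaleR[OF S open_UNIV this closed_UNIV] show ?thesis by simp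
 qed
 show "contorsion_variation A \<Omega> T 1 ?H"
  unfolding contorsion_variation_def
 proof (intro conjI ballI allI)
  show "smooth_tensor12 A (?H t)" for t by (rule smooth_tensor12_add[OF T st])
  show "closure {p. \<exists>u v. vector_derivative (\<lambda>s. ?H s p u v) (at t) \<noteq> 0} \<subseteq> \<Omega>" for t
  proof -
   have "{p. \<exists>u v. vector_derivative (\<lambda>s. ?H s p u v) (at t) \<noteq> 0} \<subseteq> K" unfolding D using K(3) by blast
   from closure_minimal[OF this K(1)] show ?thesis using K(2) by blast
  qed
  fix c i j assume c: "c \<in> A"
  let ?S = "snd c ` fst c" and ?I = "{- 1<..<1} :: real set"
  have op: "open ?S" "open (?I \<times> ?S)" using open_chart(2)[OF c] by (auto intro!: open_Times)
  have TS: "smooth_on (\<lambda>(t::real, x). tensor12_comp A c T x i j) (?I \<times> ?S)" "smooth_on (\<lambda>(t::real, x). tensor12_comp A c S x i j) (?I \<times> ?S)"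
   using T S c op by (auto intro!: smooth_on_times_snd simp: smooth_tensor12_def)
  have "smooth_on (\<lambda>z. tensor12_comp A c T (snd z) i j + fst z *\<^sub>R tensor12_comp A c S (snd z) i j) (?I \<times> ?S)"
   by (rule smooth_on_add[OF op(2) TS(1)[unfolded case_prod_beta'] smooth_on_scaleR[OF op(2)
     smooth_on_linear[OF bounded_linear_fst] TS(2)[unfolded case_prod_beta']]]) (rule op(2))
  then show "smooth_on (\<lambda>(t, x). tensor12_comp A c (?H t) x i j) (?I \<times> ?S)"
   by (rule smooth_on_transform[OF _ op(2)])
     (use c in "auto simp: tensor12_comp_def Let_def linear_add[OF linear_to_coord] linear_scale[OF linear_to_coord]")
 qed simp_all
 then show "contorsion_velocity ?H = S"
  by (simp add: contorsion_velocity_def D fun_eq_iff)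
qed

end

context line_product
begin

context
 fixes g :: "('m, 'n) bilin_field" and T
 assumes adapted: "adapted_metric A k D g" and T: "smooth_tensor12 A T"
begin

lemma mixed_quadratic_frame:
 assumes S: "smooth_tensor12 A S" and E: "orthogonal_frame (g p) I E"
 shows "mixed_quadratic g T S p = frame_quadratic (g p) I E (T p) (S p)"
proof -
 define c where "c = chart_at A p"
 have c: "c \<in> A" "p \<in> fst c" using chart_at by (auto simp: c_def)
 have x: "snd c p \<in> snd c ` fst c" using c by auto
 note G = metric_matrix_chart[OF metricD[OF adapted] c(1)]
 have "mixed_quadratic g T S p = frame_quadratic (\<lambda>u v. u \<bullet> (bilin_comp A c g (snd c p) *v v)) I (\<lambda>\<mu>. to_coord A c p (E \<mu>))
   (tensor12_rep A c T (snd c p)) (tensor12_rep A c S (snd c p))"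
  unfolding mixed_quadratic_def[OF adapted] Let_def c_def[symmetric]
  by (rule quadratic_part_frame[where G = "bilin_comp A c g" and x = "snd c p" and T = "tensor12_rep A c T" and H = "tensor12_rep A c S",
     OF frame_to_coord[OF adapted E c] metric_matrix_det[OF G x] metric_matrix_symmetric[OF G x]
     coefficients_bilinear[OF coefficients_tensor12_rep[OF T c(1)] x] coefficients_bilinear[OF coefficients_tensor12_rep[OF S c(1)] x]])
 then show ?thesis
  unfolding frame_quadratic_def tensor12_rep_chart[OF c, symmetric] linear_add[OF linear_to_coord[OF c], symmetric]
   linear_diff[OF linear_to_coord[OF c], symmetric] metric_chart[OF metricD[OF adapted] c, symmetric] .
qed

text \<open>The tensors are compared at the point \<open>p\<close> only, so \<open>r\<close> may be
  the value of a function: the quadratic term is tensorial in the velocity.\<close>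

lemma mixed_quadratic_scaleR:
 assumes S: "smooth_tensor12 A S" and S': "smooth_tensor12 A S'" and eq: "\<And>u v. S' p u v = r *\<^sub>R S p u v"
 shows "mixed_quadratic g T S' p = r * mixed_quadratic g T S p"
proof -
 obtain E where E: "orthogonal_frame (g p) {1..k} E" by (rule ex_line_frame[OF adapted])
 have "bilinear (T p)" using T by (simp add: smooth_tensor12_def)
 note bil = bilinear_rmul[OF this]
 show ?thesis
  unfolding mixed_quadratic_frame[OF S E] mixed_quadratic_frame[OF S' E] frame_quadratic_def eq bil
   scaleR_add_right[symmetric] scaleR_diff_right[symmetric] metric_simps[OF metricD[OF adapted]]
  by (simp add: sum_distrib_left)
qed

context
 fixes \<Omega>
 assumes crit: "\<And>\<delta> H. contorsion_variation A \<Omega> T \<delta> H ==> ((\<lambda>t. action A k D \<Omega> g (H t)) has_real_derivative 0) (at 0)"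
  and O: "open \<Omega>" "compact (closure \<Omega>)"
begin

lemma critical_mixed_quadratic:
 assumes S: "smooth_tensor12 A S" and K: "compact K" "K \<subseteq> \<Omega>" "\<And>p u v. p \<notin> K ==> S p u v = 0" and p: "p \<in> \<Omega>"
 shows "mixed_quadratic g T S p = 0"
proof -
 have Kc: "closed K" using K(1) by (rule compact_imp_closed)
 have Ob: "\<Omega> \<in> sets borel" using O by simp
 let ?H = "\<lambda>S t p u v. T p u v + t *\<^sub>R S p u v"
 have zero: "(LINT p:\<Omega>|volume_measure A g. mixed_quadratic g T S' p) = 0"
  if S': "smooth_tensor12 A S'" and K': "\<And>p u v. p \<notin> K ==> S' p u v = 0" for S'
 proof -
  have H: "contorsion_variation A \<Omega> T 1 (?H S')"
   by (rule contorsion_variation_affine(1)[OF T S' Kc K(2)]) (rule K')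
  have V: "contorsion_velocity (?H S') = S'"
   by (rule contorsion_variation_affine(2)[OF T S' Kc K(2)]) (rule K')
  have "((\<lambda>t. action A k D \<Omega> g (?H S' t)) has_real_derivative (LINT p:\<Omega>|volume_measure A g. mixed_quadratic g T S' p) / 2) (at 0)"
   by (rule action_contorsion_derivative[OF adapted H Ob closure_subset O(2) K(1,2), unfolded V]) (rule K')
  from DERIV_unique[OF this crit[OF H]] show ?thesis by simp
 qed
 have H: "contorsion_variation A \<Omega> T 1 (?H S)"
  by (rule contorsion_variation_affine(1)[OF T S Kc K(2)]) (rule K(3))
 have V: "contorsion_velocity (?H S) = S"
  by (rule contorsion_variation_affine(2)[OF T S Kc K(2)]) (rule K(3))
 have f: "smooth_fun_on A UNIV (mixed_quadratic g T S)"
  using smooth_mixed_quadratic[OF adapted H] unfolding V .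
 \<comment> \<open>The velocity is weighted with its own \<open>mixed_quadratic\<close>; the
   integrand then becomes a square, which has to vanish pointwise.\<close>
 let ?S' = "\<lambda>p u v. mixed_quadratic g T S p *\<^sub>R S p u v"
 have S': "smooth_tensor12 A ?S'"
  by (rule smooth_tensor12_scaleR[OF S open_UNIV f closed_UNIV]) auto
 have "(LINT p:\<Omega>|volume_measure A g. mixed_quadratic g T ?S' p) = 0" by (rule zero[OF S']) (simp add: K(3))
 then have "(LINT p:\<Omega>|volume_measure A g. (mixed_quadratic g T S p)\<^sup>2) = 0"
  unfolding mixed_quadratic_scaleR[OF S S' refl] by (simp add: power2_eq_square)
 from continuous_integral_eq_0[OF metricD[OF adapted] O(1) closure_subset O(2) _ _ this p]
 have "(mixed_quadratic g T S p)\<^sup>2 = 0" using smooth_fun_continuous[OF f] by (simp add: continuous_on_power)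
 then show ?thesis by simp
qed

lemma critical_contorsion_eq_0:
 assumes k: "k > 1" and stat: "statistical g T" and p: "p \<in> \<Omega>"
 shows "T p u v = 0"
proof -
 have "\<exists>W X. open W \<and> p \<in> W \<and> smooth_vf_on A W X \<and> (\<forall>q\<in>W. X q \<noteq> 0 \<and> D \<mu> q = span {X q})" if "\<mu> \<in> {1..k}" for \<mu>
  using local_section[OF that, of p] by metis
 then obtain W X where WX: "\<And>\<mu>. \<mu> \<in> {1..k} ==> open (W \<mu>) \<and> p \<in> W \<mu> \<and> smooth_vf_on A (W \<mu>) (X \<mu>) \<and>
   (\<forall>q\<in>W \<mu>. X \<mu> q \<noteq> 0 \<and> D \<mu> q = span {X \<mu> q})" by metis
 have E: "orthogonal_frame (g p) {1..k} (\<lambda>\<mu>. X \<mu> p)"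
  by (rule frame_lines[OF adapted]) (use WX in "auto intro: span_base")
 have Tb: "bilinear (T p)" using T by (simp add: smooth_tensor12_def)
 show ?thesis
 proof (rule totally_symmetric_eq_0[OF E _ Tb])
  show "g p u v = g p v u" for u v using metricD[OF adapted] by (simp add: pseudo_riemannian_metric_def)
  show "g p (T p x y) z = g p (T p y x) z" "g p (T p x y) z = g p (T p x z) y" for x y z
   using stat unfolding statistical_def by blast+
  show "\<exists>\<alpha>\<in>{1..k}. \<alpha> \<noteq> \<beta>" for \<beta> using k by (intro bexI[of _ "if \<beta> = 1 then 2 else 1"]) auto
  fix \<alpha> \<beta> \<gamma> S assume i: "\<alpha> \<in> {1..k}" "\<beta> \<in> {1..k}" "\<gamma> \<in> {1..k}"
   and S: "\<And>u v. S u v = (g p (X \<alpha> p) u * g p (X \<beta> p) v) *\<^sub>R X \<gamma> p"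
  define V where "V = W \<alpha> \<inter> W \<beta> \<inter> W \<gamma>"
  have V: "open V" "p \<in> V" unfolding V_def using WX i by auto
  have sub: "V \<subseteq> W \<alpha>" "V \<subseteq> W \<beta>" "V \<subseteq> W \<gamma>" by (auto simp: V_def)
  have sm: "smooth_vf_on A (W \<mu>) (X \<mu>)" if "\<mu> \<in> {1..k}" for \<mu> using WX[OF that] by (elim conjE)
  note Xs = smooth_vf_on_subset[OF sm[OF i(1)] sub(1)] smooth_vf_on_subset[OF sm[OF i(2)] sub(2)]
   smooth_vf_on_subset[OF sm[OF i(3)] sub(3)]
  have OV: "open (V \<inter> \<Omega>)" "p \<in> V \<inter> \<Omega>" using V O p by auto
  obtain \<phi> K where \<phi>: "smooth_fun_on A UNIV \<phi>" "0 < \<phi> p" and K: "compact K" "K \<subseteq> V \<inter> \<Omega>" "\<And>q. q \<notin> K ==> \<phi> q = 0"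
   using smooth_bump[OF OV] by metis
  \<comment> \<open>A global tensor, built from local sections of the lines, whose value at
    \<open>p\<close> is \<open>\<phi> p\<close> times the given tensor of rank one.\<close>
  let ?S = "\<lambda>q u v. (\<phi> q * (g q (X \<alpha> q) u * g q (X \<beta> q) v)) *\<^sub>R X \<gamma> q"
  have s: "smooth_tensor12 A ?S"
   by (rule smooth_rank_one_tensor[OF metricD[OF adapted] V(1) Xs \<phi>(1) compact_imp_closed[OF K(1)] _ K(3)]) (use K(2) in auto)
  have "mixed_quadratic g T ?S p = 0"
   by (rule critical_mixed_quadratic[OF s K(1) _ _ p]) (use K(2,3) in auto)
  then have "frame_quadratic (g p) {1..k} (\<lambda>\<mu>. X \<mu> p) (T p) (?S p) = 0"
   unfolding mixed_quadratic_frame[OF s E] .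
  moreover have "?S p = (\<lambda>u v. \<phi> p *\<^sub>R S u v)" by (intro ext) (simp add: S)
  ultimately have "\<phi> p * frame_quadratic (g p) {1..k} (\<lambda>\<mu>. X \<mu> p) (T p) S = 0"
   by (simp add: frame_quadratic_def bilinear_rmul[OF Tb] scaleR_add_right[symmetric] scaleR_diff_right[symmetric]
     metric_simps[OF metricD[OF adapted]] sum_distrib_left del: scaleR_add_right scaleR_diff_right)
  then show "frame_quadratic (g p) {1..k} (\<lambda>\<mu>. X \<mu> p) (T p) S = 0" using \<phi>(2) by simp
 qed
qed

end

end

end

section \<open>Variations of the metric\<close>

context
 fixes G :: "real => real^'n => real^'n^'n" and I U t and G' :: "real^'n => real^'n^'n"
 assumes I: "open I" "open U" "t \<in> I" and G: "smooth_on (\<lambda>(t, x). G t x) (I \<times> U)"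
  and metric: "\<And>t. t \<in> I ==> metric_matrix_on (G t) U"
 defines "G' \<equiv> \<lambda>x. vector_derivative (\<lambda>s. G s x) (at t)"
begin

lemma metric_family_derivative:
 assumes x: "x \<in> U" shows "((\<lambda>s. G s x) has_vector_derivative G' x) (at t)"
proof -
 have d: "((\<lambda>s. G s x) has_vector_derivative \<D> (\<lambda>(t, x). G t x) (at (t, x)) (1, 0)) (at t)"
  by (rule family_derivative_time[OF G I x])
 show ?thesis unfolding G'_def vector_derivative_at[OF d] by (rule d)
qed

lemma metric_family_det: "s \<in> I ==> x \<in> U ==> det (G s x) \<noteq> 0"
 by (rule metric_matrix_det[OF metric])

lemma metric_family_christoffel:
 "smooth_on (\<lambda>(t, x). christoffel (G t) x u v) (I \<times> U)" "s \<in> I ==> x \<in> U ==> bilinear (christoffel (G s) x)"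
 by (rule smooth_family_christoffel[OF G I(1,2) metric_family_det], assumption+)
   (rule bilinear_christoffel[OF metric], assumption+)

text \<open>When the Koszul formula is differentiated in the parameter, only the pairing of the
  wanted derivative with the metric survives, as the metric and its first derivatives are stationary
  at \<open>x\<close>. This controls the support of the velocity of the connection.\<close>

lemma christoffel_family_stationary:
 assumes W: "open W" "x \<in> W" "W \<subseteq> U" and zero: "\<And>y. y \<in> W ==> G' y = 0"
 shows "vector_derivative (\<lambda>s. christoffel (G s) x u v) (at t) = 0"
proof -
 have x: "x \<in> U" using W by blast
 let ?\<Gamma>' = "vector_derivative (\<lambda>s. christoffel (G s) x u v) (at t)"
 have D\<Gamma>: "((\<lambda>s. christoffel (G s) x u v) has_vector_derivative ?\<Gamma>') (at t)"
  by (rule family_coefficients_derivative[where C = "\<lambda>t. christoffel (G t)" and I = I and U = U,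
     OF I metric_family_christoffel x])
 have mv: "bounded_linear (\<lambda>M :: real^'n^'n. M *v w)" for w
  by (rule linear_conv_bounded_linear[THEN iffD1], rule linearI)
    (simp_all add: matrix_vector_mult_add_rdistrib scaleR_matrix_vector_assoc)
 have "((\<lambda>s. G s x *v w) has_vector_derivative G' x *v w) (at t)" for w
  by (rule bounded_linear.has_vector_derivative[OF mv metric_family_derivative[OF x]])
 then have DG: "((\<lambda>s. G s x *v w) has_vector_derivative 0) (at t)" for w using zero[OF W(2)] by simp
 have "\<D> G' (at x) = \<D> (\<lambda>y. 0) (at x)"
  by (rule frechet_derivative_cong_open[OF W(1,2)]) (rule zero)
 also have "\<dots> = (\<lambda>v. 0)" by (rule frechet_derivativeI[OF has_derivative_const])
 finally have F0: "\<D> G' (at x) a = 0" for a by simp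
 have "((\<lambda>s. \<D> (G s) (at x) a) has_vector_derivative \<D> G' (at x) a) (at t)" for a
  unfolding G'_def by (rule family_derivative_commute[OF G I x])
 from bounded_linear.has_vector_derivative[OF mv this]
 have DF: "((\<lambda>s. \<D> (G s) (at x) a *v w) has_vector_derivative 0) (at t)" for a w
  by (simp add: F0)
 have DI: "((\<lambda>s. a \<bullet> Z s) has_vector_derivative 0) (at t)" if "(Z has_vector_derivative 0) (at t)" for a and Z :: "real => real^'n"
  using bounded_linear.has_vector_derivative[OF bounded_linear_inner_right that, of a] by simp
 have "?\<Gamma>' \<bullet> (G t x *v w) = 0" for w
 proof -
  have 1: "((\<lambda>s. 2 * (christoffel (G s) x u v \<bullet> (G s x *v w))) has_vector_derivative
    2 * (christoffel (G t) x u v \<bullet> 0 + ?\<Gamma>' \<bullet> (G t x *v w))) (at t)"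
   by (rule bounded_linear.has_vector_derivative[OF bounded_linear_mult_right
      bounded_bilinear.has_vector_derivative[OF bounded_bilinear_inner D\<Gamma> DG]])
  have 2: "((\<lambda>s. v \<bullet> (\<D> (G s) (at x) u *v w) + u \<bullet> (\<D> (G s) (at x) v *v w)
    - u \<bullet> (\<D> (G s) (at x) w *v v)) has_vector_derivative 0 + 0 - 0) (at t)"
   by (intro has_vector_derivative_add has_vector_derivative_diff DI DF)
  have "((\<lambda>s. 2 * (christoffel (G s) x u v \<bullet> (G s x *v w))) has_vector_derivative 0 + 0 - 0) (at t)"
   by (rule has_vector_derivative_transform_within_open[OF 2 I(1,3)]) (rule christoffel_inner[OF metric x, symmetric])
  from vector_derivative_unique_at[OF 1 this] show ?thesis by simp
 qed
 from this[of "matrix_inv (G t x) *v ?\<Gamma>'"] have "?\<Gamma>' \<bullet> ?\<Gamma>' = 0"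
  by (simp add: matrix_vector_mul_assoc matrix_inv_right[OF metric_family_det[OF I(3) x]])
 then show ?thesis by simp
qed

lemma sqrt_det_family_derivative:
 assumes x: "x \<in> U"
 shows "((\<lambda>s. sqrt \<bar>det (G s x)\<bar>) has_real_derivative
   sqrt \<bar>det (G t x)\<bar> * (trace (matrix_inv (G t x) ** G' x) / 2)) (at t)"
 by (rule has_real_derivative_sqrt_det[OF metric_family_derivative[OF x] metric_family_det[OF I(3) x]])

text \<open>The product rule for inverse metric times Ricci; the subtracted term comes from the
  derivative of the inverse metric.\<close>

lemma scalar_rep_family_derivative:
 assumes x: "x \<in> U"
 shows "((\<lambda>s. scalar_rep (G s) (christoffel (G s)) x) has_real_derivative
   scalar_variation (G t) (christoffel (G t)) (\<lambda>x u v. vector_derivative (\<lambda>s. christoffel (G s) x u v) (at t)) x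
   - (\<Sum>*i m. (matrix_inv (G t x) ** G' x ** matrix_inv (G t x)) $ i $ m *
     ricci_rep (christoffel (G t)) x (axis i 1) (axis m 1))) (at t)"
proof -
 let ?C' = "\<lambda>x u v. vector_derivative (\<lambda>s. christoffel (G s) x u v) (at t)"
 let ?gi = "\<lambda>s. matrix_inv (G s x)"
 have op: "open (I \<times> U)" using I by (simp add: open_Times)
 have "smooth_on (\<lambda>(t, x). matrix_inv (G t x)) (I \<times> U)"
  using smooth_on_matrix_inv[OF op G] metric_family_det by (auto simp: case_prod_beta')
 from family_derivative_time[OF this I x] obtain M' where M': "(?gi has_vector_derivative M') (at t)" by blast
 have M'_eq: "M' = - (?gi t ** G' x ** ?gi t)"
  by (rule has_vector_derivative_matrix_inv[OF metric_family_derivative[OF x] M' I(1,3)]) (rule metric_family_det[OF _ x])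
 have gi: "((\<lambda>s. ?gi s $ i $ m) has_real_derivative - (?gi t ** G' x ** ?gi t) $ i $ m) (at t)" for i m
  using bounded_linear.has_vector_derivative[OF bounded_linear_compose[OF bounded_linear_vec_nth bounded_linear_vec_nth] M', of i m]
  unfolding M'_eq by (simp add: has_real_derivative_iff_has_vector_derivative)
 have R: "((\<lambda>s. ricci_rep (christoffel (G s)) x u v) has_real_derivative ricci_variation (christoffel (G t)) ?C' x u v) (at t)" for u v
  by (rule ricci_rep_variation[where C = "\<lambda>t. christoffel (G t)" and I = I and U = U, OF I metric_family_christoffel x])
 have "((\<lambda>s. scalar_rep (G s) (christoffel (G s)) x) has_real_derivative
   (\<Sum>*i m. - (?gi t ** G' x ** ?gi t) $ i $ m * ricci_rep (christoffel (G t)) x (axis i 1) (axis m 1) +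
    ricci_variation (christoffel (G t)) ?C' x (axis i 1) (axis m 1) * ?gi t $ i $ m)) (at t)"
  unfolding scalar_rep_def by (intro DERIV_sum DERIV_mult gi R)
 then show ?thesis
  by (simp add: scalar_variation_def sum.distrib sum_negf sum_subtractf algebra_simps)
qed

end

text \<open>\<open>h\<close> is diagonal in the frame, as the velocity of an adapted family is on
  the lines; both contractions then collapse to a sum over single lines.\<close>

lemma contraction_frame_two:
 fixes G :: "real^'n^'n" and I :: "'i set"
 assumes E: "orthogonal_frame (\<lambda>u v. u \<bullet> (G *v v)) I E" and G: "det G \<noteq> 0" "transpose G = G"
  and B: "bilinear (B :: real^'n => real^'n => real)"
  and h: "\<And>\<mu> \<nu>. \<mu> \<in> I ==> \<nu> \<in> I ==> \<mu> \<noteq> \<nu> ==> E \<mu> \<bullet> (h *v E \<nu>) = 0"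
 shows "(\<Sum>*i m. (matrix_inv G ** h ** matrix_inv G) $ i $ m * B (axis i 1) (axis m 1)) =
   (\<Sum>\<mu>\<in>I. (E \<mu> \<bullet> (h *v E \<mu>)) * B (E \<mu>) (E \<mu>) / (E \<mu> \<bullet> (G *v E \<mu>))\<^sup>2)" (is "?lhs = ?rhs")
  and "trace (matrix_inv G ** h) = (\<Sum>\<mu>\<in>I. (E \<mu> \<bullet> (h *v E \<mu>)) / (E \<mu> \<bullet> (G *v E \<mu>)))"
proof -
 let ?gi = "matrix_inv G" and ?e = "\<lambda>\<mu>. E \<mu> \<bullet> (G *v E \<mu>)"
 have fin: "finite I" using E by (simp add: orthogonal_frame_def)
 note con = contraction_frame[OF E refl G]
 note bil = bilinear_ladd[OF B] bilinear_radd[OF B] bilinear_lmul[OF B] bilinear_rmul[OF B]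
  inner_add_left inner_add_right matrix_vector_right_distrib matrix_vector_mult_scaleR
 have 1: "(\<Sum>*b m. ?gi $ b $ m * ((u \<bullet> (h *v axis b 1)) * B w (axis m 1))) =
   (\<Sum>\<nu>\<in>I. (u \<bullet> (h *v E \<nu>)) * B w (E \<nu>) / ?e \<nu>)" for u w
  by (rule con[of "\<lambda>v v'. (u \<bullet> (h *v v)) * B w v'"]) (simp add: bilinear_def linear_iff bil algebra_simps)
 have 2: "bilinear (\<lambda>w u. \<Sum>\<nu>\<in>I. (u \<bullet> (h *v E \<nu>)) * B w (E \<nu>) / ?e \<nu>)"
  by (auto simp: bilinear_def bil sum.distrib[symmetric] sum_distrib_left add_divide_distrib algebra_simps intro!: linearI)
 have swap: "(\<Sum>*m b a. F m b a) = (\<Sum>*a b m. F m b a)" for F :: "'n => 'n => 'n => real"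
  by (rule trans[OF sum.swap trans[OF sum.cong[OF refl sum.swap] sum.swap]])
 have "(\<Sum>*m. (?gi ** h ** ?gi) $ i $ m * B (axis i 1) (axis m 1)) =
   (\<Sum>*a. ?gi $ i $ a * (\<Sum>*b m. ?gi $ b $ m * ((axis a 1 \<bullet> (h *v axis b 1)) * B (axis i 1) (axis m 1))))" for i
 proof -
  have "(\<Sum>*m. (?gi ** h ** ?gi) $ i $ m * B (axis i 1) (axis m 1)) =
    (\<Sum>*m b a. ?gi $ i $ a * (?gi $ b $ m * (h $ a $ b * B (axis i 1) (axis m 1))))"
   by (simp add: matrix_matrix_mult_def sum_distrib_left sum_distrib_right mult_ac)
  also note swap
  finally show ?thesis
   by (simp add: sum_distrib_left inner_axis' matrix_vector_mult_basis column_def)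
 qed
 then have "?lhs =
   (\<Sum>\<mu>\<in>I. (\<Sum>\<nu>\<in>I. (E \<mu> \<bullet> (h *v E \<nu>)) * B (E \<mu>) (E \<nu>) / ?e \<nu>) / ?e \<mu>)"
  unfolding 1 by (simp only: con[OF 2])
 also have "\<dots> = ?rhs"
 proof (rule sum.cong[OF refl])
  fix \<mu> assume \<mu>: "\<mu> \<in> I"
  have "(\<Sum>\<nu>\<in>I. (E \<mu> \<bullet> (h *v E \<nu>)) * B (E \<mu>) (E \<nu>) / ?e \<nu>) =
    (\<Sum>\<nu>\<in>I. if \<nu> = \<mu> then (E \<mu> \<bullet> (h *v E \<mu>)) * B (E \<mu>) (E \<mu>) / ?e \<mu> else 0)"
   by (rule sum.cong[OF refl]) (use h[OF \<mu>] in auto)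
  then show "(\<Sum>\<nu>\<in>I. (E \<mu> \<bullet> (h *v E \<nu>)) * B (E \<mu>) (E \<nu>) / ?e \<nu>) / ?e \<mu> =
    (E \<mu> \<bullet> (h *v E \<mu>)) * B (E \<mu>) (E \<mu>) / (?e \<mu>)\<^sup>2"
   using \<mu> fin by (simp add: power2_eq_square)
 qed
 finally show "?lhs = ?rhs" .
 have 3: "bilinear (\<lambda>u v. v \<bullet> (h *v u))"
  by (auto simp: bilinear_def linear_iff inner_add_left matrix_vector_right_distrib inner_add_right
    matrix_vector_mult_scaleR)
 have "trace (?gi ** h) = (\<Sum>*i m. ?gi $ i $ m * (axis m 1 \<bullet> (h *v axis i 1)))"
  by (simp add: trace_matrix_mult inner_axis' matrix_vector_mult_basis column_def)
 also have "\<dots> = (\<Sum>\<mu>\<in>I. (E \<mu> \<bullet> (h *v E \<mu>)) / ?e \<mu>)"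
  by (rule con[OF 3])
 finally show "trace (?gi ** h) = (\<Sum>\<mu>\<in>I. (E \<mu> \<bullet> (h *v E \<mu>)) / ?e \<mu>)" .
qed

section \<open>First variation of volume and action along adapted metrics\<close>

context line_product
begin

text \<open>On a non-null line every bilinear form is a multiple of \<open>g\<close>, and the factor
  does not depend on the chosen vector. For the velocity of the metric it is the relative velocity,
  for \<open>ricci\<close> the Ricci curvature of the line.\<close>

definition line_ratio :: "('m, 'n) bilin_field => ('m, 'n) bilin_field => nat => 'm => real" where
 "line_ratio b g \<mu> p = (let u = SOME u. u \<in> D \<mu> p \<and> u \<noteq> 0 in b p u u / g p u u)"

lemma line_ratio_eq:
 assumes "\<mu> \<in> {1..k}" "u \<in> D \<mu> p" "u \<noteq> 0" "bilinear (b p)" "bilinear (g p)"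
 shows "line_ratio b g \<mu> p = b p u u / g p u u"
proof -
 define w where "w = (SOME u. u \<in> D \<mu> p \<and> u \<noteq> 0)"
 have w: "w \<in> D \<mu> p" "w \<noteq> 0" using someI[of "\<lambda>u. u \<in> D \<mu> p \<and> u \<noteq> 0" u] assms(2,3) by (auto simp: w_def)
 obtain r where r: "w = r *\<^sub>R u" using line_multiple[OF assms(1-3) w(1)] .
 then have "r \<noteq> 0" using w(2) by auto
 then show ?thesis
  unfolding line_ratio_def Let_def w_def[symmetric] r
  by (simp add: bilinear_lmul[OF assms(4)] bilinear_rmul[OF assms(4)] bilinear_lmul[OF assms(5)] bilinear_rmul[OF assms(5)])
qed

text \<open>The negative of the Einstein tensor on the line \<open>\<mu>\<close>, relative to
  \<open>g\<close>; with this coefficient the line enters the first variation of the action.\<close>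

definition einstein_defect :: "('m, 'n) bilin_field => nat => 'm => real" where
 "einstein_defect g \<mu> p = (\<Sum>\<nu>\<in>{1..k}. line_ratio (ricci A g) g \<nu> p) / 2 - line_ratio (ricci A g) g \<mu> p"

lemma mixed_scalar_zero:
 assumes adapted: "adapted_metric A k D g" and c: "c \<in> A" "p \<in> fst c"
 shows "mixed_scalar_curvature A k D g (\<lambda>p u v. 0) p = scalar_rep (bilin_comp A c g) (christoffel (bilin_comp A c g)) (snd c p) / 2"
proof -
 have x: "snd c p \<in> snd c ` fst c" using c by auto
 have "scalar_rep (bilin_comp A c g) (contorted_rep A c g (\<lambda>p u v. 0)) (snd c p) =
   scalar_rep (bilin_comp A c g) (christoffel (bilin_comp A c g)) (snd c p)"
  by (rule ricci_rep_cong(3)[OF open_chart(2)[OF c(1)] x])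
    (use c in "auto simp: fun_eq_iff contorted_rep_def tensor12_rep_def Let_def linear_0[OF linear_to_coord]")
 then show ?thesis unfolding mixed_scalar_chart[OF adapted smooth_tensor12_zero c] by simp
qed

context
 fixes \<Omega> and g :: "('m, 'n) bilin_field" and \<delta> and G :: "real => ('m, 'n) bilin_field" and I
 assumes var: "adapted_variation A k D \<Omega> g \<delta> G"
 defines "I \<equiv> {-\<delta><..<\<delta>}"
begin

lemma variation_interval: "open I" "0 \<in> I" "0 < \<delta>"
 using var by (auto simp: adapted_variation_def I_def)

lemma variation_0: "G 0 = g"
 using var by (simp add: adapted_variation_def)

lemma variation_adapted: "t \<in> I ==> adapted_metric A k D (G t)" and base_adapted: "adapted_metric A k D g"
 using var by (auto simp: adapted_variation_def I_def)

lemmas variation_metric = metricD[OF variation_adapted]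
lemmas base_metric = metricD[OF base_adapted]

lemma variation_smooth: "c \<in> A ==> smooth_on (\<lambda>(t, x). bilin_comp A c (G t) x) (I \<times> snd c ` fst c)"
 using var unfolding adapted_variation_def I_def by blast

lemma variation_matrix: "c \<in> A ==> t \<in> I ==> metric_matrix_on (bilin_comp A c (G t)) (snd c ` fst c)"
 by (rule metric_matrix_chart[OF variation_metric])

definition metric_velocity :: "real => ('m, 'n) bilin_field" where
 "metric_velocity t p u v = deriv (\<lambda>s. G s p u v) t"

lemma metric_velocity_chart:
 assumes t: "t \<in> I" and c: "c \<in> A" "p \<in> fst c"
 shows "metric_velocity t p u v =
   to_coord A c p u \<bullet> (vector_derivative (\<lambda>s. bilin_comp A c (G s) (snd c p)) (at t) *v to_coord A c p v)"
proof -
 have x: "snd c p \<in> snd c ` fst c" using c by auto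
 let ?a = "to_coord A c p u" and ?b = "to_coord A c p v"
 note D = metric_family_derivative[where G = "\<lambda>s. bilin_comp A c (G s)" and I = I and U = "snd c ` fst c",
   OF variation_interval(1) open_chart(2)[OF c(1)] t variation_smooth[OF c(1)] variation_matrix[OF c(1)] x]
 have lin: "bounded_linear (\<lambda>M :: real^'n^'n. ?a \<bullet> (M *v ?b))"
  by (rule linear_conv_bounded_linear[THEN iffD1], rule linearI)
    (simp_all add: matrix_vector_mult_add_rdistrib inner_add_right scaleR_matrix_vector_assoc[symmetric])
 have "((\<lambda>s. ?a \<bullet> (bilin_comp A c (G s) (snd c p) *v ?b)) has_real_derivative
   ?a \<bullet> (vector_derivative (\<lambda>s. bilin_comp A c (G s) (snd c p)) (at t) *v ?b)) (at t)"
  using bounded_linear.has_vector_derivative[OF lin D] variation_matrix[OF c(1)]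
  by (simp add: has_real_derivative_iff_has_vector_derivative)
 from has_field_derivative_transform_within_open[OF this variation_interval(1) t, of "\<lambda>s. G s p u v"]
 show ?thesis unfolding metric_velocity_def using metric_chart[OF variation_metric c] by (auto intro: DERIV_imp_deriv)
qed

lemma bilinear_metric_velocity: "t \<in> I ==> bilinear (metric_velocity t p)"
 by (simp add: bilinear_def linear_iff metric_velocity_chart[OF _ chart_at] inner_add_left inner_add_right
   matrix_vector_right_distrib matrix_vector_mult_scaleR)

lemma metric_velocity_orthogonal:
 assumes t: "t \<in> I" and "\<mu> \<in> {1..k}" "\<nu> \<in> {1..k}" "\<mu> \<noteq> \<nu>" "u \<in> D \<mu> p" "v \<in> D \<nu> p"
 shows "metric_velocity t p u v = 0"
proof -
 have "((\<lambda>s. G s p u v) has_real_derivative 0) (at t)"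
 proof (rule has_field_derivative_transform_within_open[OF DERIV_const variation_interval(1) t])
  show "0 = G s p u v" if "s \<in> I" for s
   using variation_adapted[OF that] assms(2-) unfolding adapted_metric_def by metis
 qed
 then show ?thesis unfolding metric_velocity_def by (rule DERIV_imp_deriv)
qed

definition connection_velocity :: "('m, 'n) tensor12_field" where
 "connection_velocity p u v = (let c = chart_at A p in
   vector_derivative (\<lambda>s. christoffel (bilin_comp A c (G s)) (snd c p) u v) (at 0))"

lemma variation_christoffel:
 assumes c: "c \<in> A"
 shows "\<And>u v. smooth_on (\<lambda>(t, x). christoffel (bilin_comp A c (G t)) x u v) (I \<times> snd c ` fst c)"
  and "\<And>t x. t \<in> I ==> x \<in> snd c ` fst c ==> bilinear (christoffel (bilin_comp A c (G t)) x)"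
 by (rule smooth_family_christoffel[OF variation_smooth[OF c] variation_interval(1) open_chart(2)[OF c]
    metric_matrix_det[OF variation_matrix[OF c]]]; assumption)
   (rule bilinear_christoffel[OF variation_matrix[OF c]]; assumption)

text \<open>Christoffel symbols are not tensors, but their derivative in the parameter is one,
  because the inhomogeneous term of the transformation law is constant.\<close>

lemma connection_velocity:
 shows smooth_connection_velocity: "smooth_tensor12 A connection_velocity"
  and connection_velocity_rep: "\<And>c x u v. c \<in> A ==> x \<in> snd c ` fst c ==>
   tensor12_rep A c connection_velocity x u v = vector_derivative (\<lambda>s. christoffel (bilin_comp A c (G s)) x u v) (at 0)"
proof -
 let ?C = "\<lambda>c s. christoffel (bilin_comp A c (G s))"
 let ?V = "\<lambda>s p. ?C (chart_at A p) s (snd (chart_at A p) p)"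
 have "\<exists>K. \<forall>s\<in>I. ?C c s (snd c p) (to_coord A c p u) (to_coord A c p v) = to_coord A c p (?V s p u v) + K"
  if c: "c \<in> A" "p \<in> fst c" for c p u v
 proof -
  define d where "d = chart_at A p"
  have d: "d \<in> A" "p \<in> fst d" using chart_at by (auto simp: d_def)
  let ?X = "\<lambda>q. of_coord A d q u" and ?Y = "\<lambda>q. of_coord A d q v"
  note XY = open_chart(1)[OF d(1)] d(2) smooth_of_coord[OF d(1), of u] smooth_of_coord[OF d(1), of v]
  have id: "to_coord A d p w = w" "of_coord A d p w = w" for w by (simp_all add: d_def)
  \<comment> \<open>Both charts compute the same covariant derivative of \<open>?Y\<close>. The
    symbols therefore differ by derivatives of the coordinates of \<open>?Y\<close>, which do not
    depend on the metric.\<close>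
  have "?C c s (snd c p) (to_coord A c p u) (to_coord A c p v) = to_coord A c p (?C d s (snd d p) u v) +
    (to_coord A c p (\<D> (vf_rep A d ?Y) (at (snd d p)) u) -
     \<D> (vf_rep A c ?Y) (at (snd c p)) (to_coord A c p u))" if s: "s \<in> I" for s
   using levi_civita_chart[OF variation_metric[OF s] XY c] levi_civita_chart[OF variation_metric[OF s] XY d]
   unfolding id by (simp add: linear_add[OF linear_to_coord[OF c]] algebra_simps)
  then show ?thesis unfolding d_def by blast
 qed
 note vel = family_velocity[where C = ?C and V = ?V, OF variation_interval(1,2) variation_christoffel this]
 have eq: "connection_velocity = (\<lambda>p u v. vector_derivative (\<lambda>s. ?V s p u v) (at 0))"
  by (intro ext) (simp add: connection_velocity_def Let_def)
 show "smooth_tensor12 A connection_velocity" unfolding eq by (rule vel(1))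
 show "tensor12_rep A c connection_velocity x u v = vector_derivative (\<lambda>s. ?C c s x u v) (at 0)"
  if "c \<in> A" "x \<in> snd c ` fst c" for c x u v
  unfolding eq by (rule vel(2)) (simp_all add: that)
qed

text \<open>Keeps the support of the velocity of the connection within that of the variation, so
  that its divergence integrates to 0.\<close>

lemma connection_velocity_local:
 assumes N: "open N" "p \<in> N" and zero: "\<And>q u v. q \<in> N ==> metric_velocity 0 q u v = 0"
 shows "connection_velocity p u v = 0"
proof -
 define c where "c = chart_at A p"
 have c: "c \<in> A" "p \<in> fst c" using chart_at by (auto simp: c_def)
 let ?W = "snd c ` (fst c \<inter> N)"
 have W: "open ?W" "snd c p \<in> ?W" "?W \<subseteq> snd c ` fst c" using open_chart_image[OF c(1) N(1)] c N by auto
 have z: "vector_derivative (\<lambda>s. bilin_comp A c (G s) y) (at 0) = 0" if y: "y \<in> ?W" for y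
 proof -
  obtain q where q: "q \<in> fst c" "q \<in> N" "y = snd c q" using y by blast
  let ?M = "vector_derivative (\<lambda>s. bilin_comp A c (G s) y) (at 0)"
  have "a \<bullet> (?M *v b) = 0" for a b
   using metric_velocity_chart[OF variation_interval(2) c(1) q(1), of "of_coord A c q a" "of_coord A c q b"]
    zero[OF q(2)] c(1) q by simp
  then have "(?M *v b) \<bullet> (?M *v b) = 0" for b .
  then have "?M *v b = 0" for b by (simp only: inner_eq_zero_iff)
  then show ?thesis by (simp add: matrix_eq)
 qed
 show ?thesis
  unfolding connection_velocity_def c_def[symmetric] Let_def
  by (rule christoffel_family_stationary[where G = "\<lambda>s. bilin_comp A c (G s)" and I = I and U = "snd c ` fst c",
     OF variation_interval(1) open_chart(2)[OF c(1)] variation_interval(2) variation_smooth[OF c(1)] variation_matrix[OF c(1)] W z])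
qed

lemma smooth_family_volume_ratio: "smooth_fun_family I (\<lambda>t. volume_ratio g (G t))"
 unfolding smooth_fun_family_def
proof
 fix c assume c: "c \<in> A"
 let ?S = "snd c ` fst c"
 have op: "open (I \<times> ?S)" using variation_interval(1) open_chart(2)[OF c] by (intro open_Times)
 have den: "smooth_on (\<lambda>(t::real, x). volume_density A g c x) (I \<times> ?S)"
  by (rule smooth_on_times_snd[OF smooth_volume_density[OF base_metric c] variation_interval(1) open_chart(2)[OF c]])
 have num: "smooth_on (\<lambda>(t, x). sqrt \<bar>det (bilin_comp A c (G t) x)\<bar>) (I \<times> ?S)"
  unfolding case_prod_beta'
  by (intro smooth_on_sqrt smooth_on_abs smooth_on_det op variation_smooth[OF c, unfolded case_prod_beta'])
    (auto simp: metric_matrix_det[OF variation_matrix[OF c]])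
 have "smooth_on (\<lambda>z. sqrt \<bar>det (bilin_comp A c (G (fst z)) (snd z))\<bar> / volume_density A g c (snd z)) (I \<times> ?S)"
  by (rule smooth_on_divide[OF op num[unfolded case_prod_beta'] den[unfolded case_prod_beta']])
    (use volume_density_pos[OF base_metric c] in fastforce)
 then show "smooth_on (\<lambda>(t, x). volume_ratio g (G t) (chart_inv c x)) (I \<times> ?S)"
 proof (rule smooth_on_transform[OF _ op])
  fix z assume "z \<in> I \<times> ?S"
  then have t: "fst z \<in> I" and q: "chart_inv c (snd z) \<in> fst c" "snd c (chart_inv c (snd z)) = snd z" using c by auto
  show "(case z of (t, x) => volume_ratio g (G t) (chart_inv c x)) =
    sqrt \<bar>det (bilin_comp A c (G (fst z)) (snd z))\<bar> / volume_density A g c (snd z)"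
   unfolding case_prod_beta' volume_ratio_chart[OF base_metric variation_metric[OF t] c q(1)] q(2)
   by (simp add: volume_density_def)
 qed
qed

lemma smooth_family_variation_scalar:
 "smooth_fun_family I (\<lambda>t. mixed_scalar_curvature A k D (G t) (\<lambda>p u v. 0))"
 unfolding smooth_fun_family_def
proof
 fix c assume c: "c \<in> A"
 let ?S = "snd c ` fst c" and ?G = "\<lambda>t. bilin_comp A c (G t)"
 have op: "open (I \<times> ?S)" using variation_interval(1) open_chart(2)[OF c] by (intro open_Times)
 have det: "det (?G t x) \<noteq> 0" if "t \<in> I" "x \<in> ?S" for t x by (rule metric_matrix_det[OF variation_matrix[OF c that(1)] that(2)])
 have "smooth_on (\<lambda>(t, x). scalar_rep (?G t) (christoffel (?G t)) x) (I \<times> ?S)"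
  by (rule smooth_family_scalar_rep(2)[where G = ?G and C = "\<lambda>t. christoffel (?G t)" and I = I and U = ?S,
     OF variation_interval(1) open_chart(2)[OF c] variation_smooth[OF c] det
     variation_christoffel[OF c]]; assumption)
 then have "smooth_on (\<lambda>z. (\<lambda>(t, x). scalar_rep (?G t) (christoffel (?G t)) x) z / 2) (I \<times> ?S)"
  by (intro smooth_on_divide smooth_on_const op) auto
 then show "smooth_on (\<lambda>(t, x). mixed_scalar_curvature A k D (G t) (\<lambda>p u v. 0) (chart_inv c x)) (I \<times> ?S)"
 proof (rule smooth_on_transform[OF _ op])
  fix z assume "z \<in> I \<times> ?S"
  then have t: "fst z \<in> I" and q: "chart_inv c (snd z) \<in> fst c" "snd c (chart_inv c (snd z)) = snd z" using c by auto
  show "(case z of (t, x) => mixed_scalar_curvature A k D (G t) (\<lambda>p u v. 0) (chart_inv c x)) =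
    (\<lambda>(t, x). scalar_rep (?G t) (christoffel (?G t)) x) z / 2"
   unfolding case_prod_beta' mixed_scalar_zero[OF variation_adapted[OF t] c q(1)] q(2) ..
 qed
qed

text \<open>Jacobi's formula for the density, with the trace taken in a frame of the lines. It is
  stated at every parameter because the exact volume of the rescaled metrics is obtained from
  it.\<close>

lemma volume_ratio_derivative:
 assumes t: "t \<in> I"
 shows "((\<lambda>s. volume_ratio g (G s) p) has_real_derivative
   volume_ratio g (G t) p * ((\<Sum>\<mu>\<in>{1..k}. line_ratio (metric_velocity t) (G t) \<mu> p) / 2)) (at t)"
proof -
 obtain c where c: "c \<in> A" "p \<in> fst c" by (rule ex_chart)
 have x: "snd c p \<in> snd c ` fst c" using c by auto
 let ?G = "\<lambda>s. bilin_comp A c (G s)" and ?h = "vector_derivative (\<lambda>s. bilin_comp A c (G s) (snd c p)) (at t)"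
 let ?d = "sqrt \<bar>det (?G t (snd c p))\<bar> * (trace (matrix_inv (?G t (snd c p)) ** ?h) / 2) / volume_density A g c (snd c p)"
 note fam = variation_interval(1) open_chart(2)[OF c(1)] t variation_smooth[OF c(1)] variation_matrix[OF c(1)]
 obtain E where E: "\<And>\<mu>. \<mu> \<in> {1..k} ==> E \<mu> \<in> D \<mu> p \<and> E \<mu> \<noteq> 0" using ex_line_vector[of p] by blast
 have fr: "orthogonal_frame (G t p) {1..k} E" by (rule frame_lines[OF variation_adapted[OF t] E])
 note mc = metric_chart[OF variation_metric[OF t] c]
 have "trace (matrix_inv (?G t (snd c p)) ** ?h) =
   (\<Sum>\<mu>\<in>{1..k}. (to_coord A c p (E \<mu>) \<bullet> (?h *v to_coord A c p (E \<mu>))) / (to_coord A c p (E \<mu>) \<bullet> (?G t (snd c p) *v to_coord A c p (E \<mu>))))"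
 proof (rule contraction_frame_two(2)[OF frame_to_coord[OF variation_adapted[OF t] fr c]
    metric_matrix_det[OF variation_matrix[OF c(1) t] x] metric_matrix_symmetric[OF variation_matrix[OF c(1) t] x], of "\<lambda>u v. 0"])
  show "bilinear (\<lambda>u v :: real^'n. 0 :: real)" by (simp add: bilinear_def linear_zero)
  show "to_coord A c p (E \<mu>) \<bullet> (?h *v to_coord A c p (E \<nu>)) = 0" if "\<mu> \<in> {1..k}" "\<nu> \<in> {1..k}" "\<mu> \<noteq> \<nu>" for \<mu> \<nu>
   using metric_velocity_orthogonal[OF t that] E that metric_velocity_chart[OF t c] by metis
 qed
 also have "\<dots> = (\<Sum>\<mu>\<in>{1..k}. line_ratio (metric_velocity t) (G t) \<mu> p)"
 proof (rule sum.cong[OF refl])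
  fix \<mu> assume \<mu>: "\<mu> \<in> {1..k}"
  show "to_coord A c p (E \<mu>) \<bullet> (?h *v to_coord A c p (E \<mu>)) / (to_coord A c p (E \<mu>) \<bullet> (?G t (snd c p) *v to_coord A c p (E \<mu>))) =
    line_ratio (metric_velocity t) (G t) \<mu> p"
   unfolding line_ratio_eq[OF \<mu> conjunct1[OF E[OF \<mu>]] conjunct2[OF E[OF \<mu>]] bilinear_metric_velocity[OF t]
     bilinear_metric[OF variation_metric[OF t]]] metric_velocity_chart[OF t c] mc ..
 qed
 finally have tr: "trace (matrix_inv (?G t (snd c p)) ** ?h) = (\<Sum>\<mu>\<in>{1..k}. line_ratio (metric_velocity t) (G t) \<mu> p)" .
 have D: "((\<lambda>s. sqrt \<bar>det (?G s (snd c p))\<bar> / volume_density A g c (snd c p)) has_real_derivative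
   ?d) (at t)"
  by (rule DERIV_cdivide[OF sqrt_det_family_derivative[where G = ?G and I = I and U = "snd c ` fst c", OF fam x]])
 have vr: "volume_ratio g (G s) p = sqrt \<bar>det (?G s (snd c p))\<bar> / volume_density A g c (snd c p)" if "s \<in> I" for s
  unfolding volume_ratio_chart[OF base_metric variation_metric[OF that] c] by (simp add: volume_density_def)
 have "((\<lambda>s. volume_ratio g (G s) p) has_real_derivative
   ?d) (at t)"
  by (rule has_field_derivative_transform_within_open[OF D variation_interval(1) t]) (rule vr[symmetric])
 then show ?thesis unfolding tr vr[OF t] by (simp add: mult.commute)
qed

lemma volume_ratio_0: "volume_ratio g g p = 1"
proof -
 have "0 < volume_density A g (chart_at A p) (snd (chart_at A p) p)"
  using volume_density_pos[OF base_metric chart_at(1)] chart_at(2) by blast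
 then show ?thesis by (simp add: volume_ratio_def)
qed

text \<open>The volume contributes half of the sum of the relative velocities times
  \<open>Scal / 2\<close>, the inverse metric subtracts half of their sum weighted with the Ricci
  curvatures, and the velocity of the connection adds half of a divergence. Collecting the factors
  of each relative velocity gives \<open>einstein_defect\<close>.\<close>

lemma variation_scalar_derivative:
 "((\<lambda>s. volume_ratio g (G s) p * mixed_scalar_curvature A k D (G s) (\<lambda>p u v. 0) p) has_real_derivative
   (mixed_linear g connection_velocity p + (\<Sum>\<mu>\<in>{1..k}. line_ratio (metric_velocity 0) g \<mu> p * einstein_defect g \<mu> p)) / 2) (at 0)"
proof -
 obtain c where c: "c \<in> A" "p \<in> fst c" by (rule ex_chart)
 have x: "snd c p \<in> snd c ` fst c" using c by auto
 define h where "h = vector_derivative (\<lambda>s. bilin_comp A c (G s) (snd c p)) (at 0)"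
 let ?G = "\<lambda>s. bilin_comp A c (G s)"
 note t = variation_interval(2)
 note fam = variation_interval(1) open_chart(2)[OF c(1)] t variation_smooth[OF c(1)] variation_matrix[OF c(1)]
 obtain E where E: "\<And>\<mu>. \<mu> \<in> {1..k} ==> E \<mu> \<in> D \<mu> p \<and> E \<mu> \<noteq> 0" using ex_line_vector[of p] by blast
 have fr: "orthogonal_frame (g p) {1..k} E" by (rule frame_lines[OF base_adapted E])
 note frc = frame_to_coord[OF base_adapted fr c]
 note G0 = variation_matrix[OF c(1) t, unfolded variation_0]
 let ?e = "\<lambda>\<mu>. to_coord A c p (E \<mu>)"
 let ?m = "(mixed_linear g connection_velocity p - (\<Sum>\<mu>\<in>{1..k}. line_ratio (metric_velocity 0) g \<mu> p * line_ratio (ricci A g) g \<mu> p)) / 2"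
 let ?Ric = "ricci_rep (christoffel (bilin_comp A c g)) (snd c p)"
 have Ric: "bilinear ?Ric" by (rule ricci_rep_bilinear[OF coefficients_christoffel[OF base_metric c(1)] x])
 have orth: "?e \<mu> \<bullet> (h *v ?e \<nu>) = 0" if "\<mu> \<in> {1..k}" "\<nu> \<in> {1..k}" "\<mu> \<noteq> \<nu>" for \<mu> \<nu>
  using metric_velocity_orthogonal[OF t that] E that metric_velocity_chart[OF t c] unfolding h_def by metis
 have ric: "line_ratio (ricci A g) g \<mu> p = ?Ric (?e \<mu>) (?e \<mu>) / g p (E \<mu>) (E \<mu>)" if "\<mu> \<in> {1..k}" for \<mu>
  unfolding line_ratio_eq[OF that conjunct1[OF E[OF that]] conjunct2[OF E[OF that]] bilinear_ricci[OF base_adapted]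
    bilinear_metric[OF base_metric]] ricci_chart[OF base_adapted c] ..
 have eta: "line_ratio (metric_velocity 0) g \<mu> p = (?e \<mu> \<bullet> (h *v ?e \<mu>)) / g p (E \<mu>) (E \<mu>)" if "\<mu> \<in> {1..k}" for \<mu>
  unfolding line_ratio_eq[OF that conjunct1[OF E[OF that]] conjunct2[OF E[OF that]] bilinear_metric_velocity[OF t]
    bilinear_metric[OF base_metric]] metric_velocity_chart[OF t c] h_def ..
 have S: "scalar_rep (bilin_comp A c g) (christoffel (bilin_comp A c g)) (snd c p) = (\<Sum>\<nu>\<in>{1..k}. line_ratio (ricci A g) g \<nu> p)"
  unfolding scalar_rep_def contraction_frame[OF frc refl metric_matrix_det[OF G0 x] metric_matrix_symmetric[OF G0 x] Ric]
  by (intro sum.cong refl) (simp add: ric metric_chart[OF base_metric c])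
 have H: "(\<Sum>*i m. (matrix_inv (bilin_comp A c g (snd c p)) ** h ** matrix_inv (bilin_comp A c g (snd c p))) $ i $ m *
   ?Ric (axis i 1) (axis m 1)) = (\<Sum>\<mu>\<in>{1..k}. line_ratio (metric_velocity 0) g \<mu> p * line_ratio (ricci A g) g \<mu> p)"
  by (subst contraction_frame_two(1)[OF frc metric_matrix_det[OF G0 x] metric_matrix_symmetric[OF G0 x] Ric orth], assumption+,
    intro sum.cong refl) (simp add: ric eta power2_eq_square metric_chart[OF base_metric c])
 have V: "scalar_variation (bilin_comp A c g) (christoffel (bilin_comp A c g)) (\<lambda>x u v. vector_derivative (\<lambda>s. christoffel (?G s) x u v) (at 0)) (snd c p) =
   mixed_linear g connection_velocity p"
  unfolding mixed_linear_chart[OF base_adapted smooth_connection_velocity c]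
  by (rule scalar_variation_cong[OF open_chart(2)[OF c(1)] x]) (simp add: fun_eq_iff connection_velocity_rep[OF c(1)])
 have "((\<lambda>s. scalar_rep (?G s) (christoffel (?G s)) (snd c p) / 2) has_real_derivative
   ?m) (at 0)"
  using DERIV_cdivide[OF scalar_rep_family_derivative[where G = ?G and I = I and U = "snd c ` fst c", OF fam x], of 2]
  unfolding h_def[symmetric] variation_0 V H .
 then have DS: "((\<lambda>s. mixed_scalar_curvature A k D (G s) (\<lambda>p u v. 0) p) has_real_derivative
   ?m) (at 0)"
  by (rule has_field_derivative_transform_within_open[OF _ variation_interval(1) t])
    (rule mixed_scalar_zero[OF variation_adapted c, symmetric])
 have S0: "mixed_scalar_curvature A k D g (\<lambda>p u v. 0) p = (\<Sum>\<nu>\<in>{1..k}. line_ratio (ricci A g) g \<nu> p) / 2"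
  unfolding mixed_scalar_zero[OF base_adapted c] S ..
 from DERIV_mult[OF volume_ratio_derivative[OF t] DS]
 have P: "((\<lambda>s. volume_ratio g (G s) p * mixed_scalar_curvature A k D (G s) (\<lambda>p u v. 0) p) has_real_derivative
   (\<Sum>\<mu>\<in>{1..k}. line_ratio (metric_velocity 0) g \<mu> p) / 2 * ((\<Sum>\<nu>\<in>{1..k}. line_ratio (ricci A g) g \<nu> p) / 2) +
   ?m) (at 0)"
  by (simp add: variation_0 volume_ratio_0 S0)
 have W: "(\<Sum>\<mu>\<in>{1..k}. line_ratio (metric_velocity 0) g \<mu> p * einstein_defect g \<mu> p) =
   (\<Sum>\<mu>\<in>{1..k}. line_ratio (metric_velocity 0) g \<mu> p) * ((\<Sum>\<nu>\<in>{1..k}. line_ratio (ricci A g) g \<nu> p) / 2)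
   - (\<Sum>\<mu>\<in>{1..k}. line_ratio (metric_velocity 0) g \<mu> p * line_ratio (ricci A g) g \<mu> p)"
  by (simp add: einstein_defect_def right_diff_distrib sum_subtractf sum_distrib_right)
 show ?thesis unfolding W by (rule DERIV_cong[OF P]) (simp add: field_simps)
qed

lemma smooth_family_action_density:
 "smooth_fun_family I (\<lambda>t p. volume_ratio g (G t) p * mixed_scalar_curvature A k D (G t) (\<lambda>p u v. 0) p)"
 unfolding smooth_fun_family_def case_prod_beta'
proof
 fix c assume c: "c \<in> A"
 have op: "open (I \<times> snd c ` fst c)" using variation_interval(1) open_chart(2)[OF c] by (intro open_Times)
 show "smooth_on (\<lambda>z. volume_ratio g (G (fst z)) (chart_inv c (snd z)) *
   mixed_scalar_curvature A k D (G (fst z)) (\<lambda>p u v. 0) (chart_inv c (snd z))) (I \<times> snd c ` fst c)"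
  using smooth_family_volume_ratio smooth_family_variation_scalar c unfolding smooth_fun_family_def case_prod_beta'
  by (intro smooth_on_mult[OF op]) blast+
qed

context
 fixes K assumes O: "\<Omega> \<in> sets borel" "\<Omega> \<subseteq> K" "compact K"
begin

lemma volume_derivative:
 "((\<lambda>t. LINT p:\<Omega>|volume_measure A g. volume_ratio g (G t) p) has_real_derivative
   (LINT p:\<Omega>|volume_measure A g. \<Sum>\<mu>\<in>{1..k}. line_ratio (metric_velocity 0) g \<mu> p) / 2) (at 0)"
proof -
 have "deriv (\<lambda>s. volume_ratio g (G s) p) 0 = (\<Sum>\<mu>\<in>{1..k}. line_ratio (metric_velocity 0) g \<mu> p) / 2" for p
  using DERIV_imp_deriv[OF volume_ratio_derivative[OF variation_interval(2)]] by (simp add: variation_0 volume_ratio_0)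
 from has_real_derivative_volume_integral[OF base_metric O smooth_family_volume_ratio[unfolded I_def] variation_interval(3), unfolded this]
 show ?thesis by simp
qed

text \<open>By \<open>volume_ratio\<close> the action becomes an integral over the fixed volume of
  \<open>g\<close>, so that differentiation passes under the integral sign; the divergence then
  drops out.\<close>

theorem action_metric_derivative:
 "((\<lambda>t. action A k D \<Omega> (G t) (\<lambda>p u v. 0)) has_real_derivative
   (LINT p:\<Omega>|volume_measure A g. \<Sum>\<mu>\<in>{1..k}. line_ratio (metric_velocity 0) g \<mu> p * einstein_defect g \<mu> p) / 2) (at 0)"
proof -
 let ?M = "volume_measure A g" and ?V = connection_velocity
 let ?w = "\<lambda>p. \<Sum>\<mu>\<in>{1..k}. line_ratio (metric_velocity 0) g \<mu> p * einstein_defect g \<mu> p"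
 let ?f = "\<lambda>t p. volume_ratio g (G t) p * mixed_scalar_curvature A k D (G t) (\<lambda>p u v. 0) p"
 have der: "deriv (\<lambda>s. ?f s p) 0 = (mixed_linear g ?V p + ?w p) / 2" for p
  by (rule DERIV_imp_deriv[OF variation_scalar_derivative])
 define L where "L = closure {p. \<exists>u v. deriv (\<lambda>s. G s p u v) 0 \<noteq> 0}"
 have L: "L \<subseteq> \<Omega>" using var variation_interval(3) unfolding adapted_variation_def L_def by force
 have Lc: "compact L"
  using compact_Int_closed[OF O(3), of L] L O(2) by (simp add: L_def Int_absorb1)
 have V0: "?V p u v = 0" if "p \<notin> L" for p u v
 proof (rule connection_velocity_local)
  show "open (- L)" by (simp add: L_def open_Compl)
  show "metric_velocity 0 q u v = 0" if "q \<in> - L" for q u v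
   using that closure_subset[of "{p. \<exists>u v. deriv (\<lambda>s. G s p u v) 0 \<noteq> 0}"] unfolding L_def metric_velocity_def by blast
 qed (use that in simp)
 note V = smooth_connection_velocity
 have cd: "continuous_on UNIV (\<lambda>p. deriv (\<lambda>s. ?f s p) 0)"
  by (rule smooth_fun_continuous[OF smooth_fun_family_at[OF smooth_fun_family_derivative(2)[OF smooth_family_action_density
      variation_interval(1)] variation_interval(1,2)]])
 have cV: "continuous_on UNIV (mixed_linear g ?V)" by (rule continuous_mixed_linear[OF base_adapted V])
 \<comment> \<open>Continuity of the weighted sum is inferred from the other terms of the
   derivative, since its factors are defined by a choice of vectors at each point.\<close>
 have "continuous_on UNIV (\<lambda>p. 2 * deriv (\<lambda>s. ?f s p) 0 - mixed_linear g ?V p)"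
  by (intro continuous_on_diff continuous_on_mult continuous_on_const cd cV)
 then have cw: "continuous_on UNIV ?w" unfolding der by (simp add: add_divide_distrib distrib_left)
 note int = integrable_continuous_on_domain[OF base_metric O]
 have z: "mixed_linear g ?V p = 0" if "p \<notin> \<Omega>" for p
  by (rule mixed_linear_local[OF base_adapted V compact_imp_closed[OF Lc] V0]) (use that L in auto)
 have "(LINT p:\<Omega>|?M. mixed_linear g ?V p) = integral\<^sup>L ?M (mixed_linear g ?V)"
  unfolding set_lebesgue_integral_def by (intro Bochner_Integration.integral_cong refl) (auto simp: indicator_def z)
 also have "\<dots> = 0" by (rule integral_mixed_linear[OF base_adapted V Lc V0])
 finally have "(LINT p:\<Omega>|?M. deriv (\<lambda>s. ?f s p) 0) = (LINT p:\<Omega>|?M. ?w p) / 2"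
  unfolding der using set_integral_add(2)[OF int[OF cV] int[OF cw]] by simp
 from has_real_derivative_volume_integral[OF base_metric O smooth_family_action_density[unfolded I_def] variation_interval(3), unfolded this]
 have D: "((\<lambda>t. LINT p:\<Omega>|?M. ?f t p) has_real_derivative (LINT p:\<Omega>|?M. ?w p) / 2) (at 0)" .
 show ?thesis
 proof (rule has_field_derivative_transform_within_open[OF D variation_interval(1,2)])
  fix t assume t: "t \<in> I"
  have "continuous_on UNIV (mixed_scalar_curvature A k D (G t) (\<lambda>p u v. 0))"
   by (rule smooth_fun_continuous[OF smooth_fun_family_at[OF smooth_family_variation_scalar variation_interval(1) t]])
  from set_integral_volume_ratio[OF base_metric variation_metric[OF t] O(1) this]
  show "(LINT p:\<Omega>|?M. ?f t p) = action A k D \<Omega> (G t) (\<lambda>p u v. 0)" by (simp add: action_def)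
 qed
qed

lemma volume_preserving_derivative:
 assumes "volume_preserving A \<Omega> \<delta> G"
 shows "(LINT p:\<Omega>|volume_measure A g. \<Sum>\<mu>\<in>{1..k}. line_ratio (metric_velocity 0) g \<mu> p) = 0"
proof -
 let ?v = "\<lambda>t. LINT p:\<Omega>|volume_measure A g. volume_ratio g (G t) p"
 have nn: "0 \<le> ?v t" if "t \<in> I" for t
  unfolding set_lebesgue_integral_def
  by (rule Bochner_Integration.integral_nonneg)
    (simp add: less_imp_le[OF volume_ratio_pos[OF base_metric variation_metric[OF that]]])
 have "?v t = ?v 0" if t: "t \<in> I" for t
 proof -
  have "ennreal (?v t) = ennreal (?v 0)"
   using assms t variation_interval(2) emeasure_volume_ratio[OF base_metric variation_metric O]
   unfolding volume_preserving_def I_def[symmetric] by metis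
  then show ?thesis using nn[OF t] nn[OF variation_interval(2)] by simp
 qed
 then have "(?v has_real_derivative 0) (at 0)"
  by (intro has_field_derivative_transform_within_open[OF DERIV_const variation_interval(1,2)]) auto
 from DERIV_unique[OF this volume_derivative] show ?thesis by simp
qed

end

end

end

section \<open>Rescaling the metric along the lines\<close>

context line_product
begin

text \<open>The metric composed with the orthogonal projection to the line \<open>\<mu>\<close>. The
  metric is the sum of these parts, and independent nonzero smooth factors on them keep it
  adapted.\<close>

definition line_part :: "('m, 'n) bilin_field => nat => ('m, 'n) bilin_field" where
 "line_part g \<mu> p u v = (let e = SOME u. u \<in> D \<mu> p \<and> u \<noteq> 0 in g p u e * g p e v / g p e e)"

definition rescaled :: "('m, 'n) bilin_field => (nat => 'm => real) => ('m, 'n) bilin_field" where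
 "rescaled g w p u v = (\<Sum>\<mu>\<in>{1..k}. w \<mu> p * line_part g \<mu> p u v)"

context
 fixes g :: "('m, 'n) bilin_field"
 assumes adapted: "adapted_metric A k D g"
begin

lemma line_part_eq:
 assumes "\<mu> \<in> {1..k}" "e \<in> D \<mu> p" "e \<noteq> 0"
 shows "line_part g \<mu> p u v = g p u e * g p e v / g p e e"
proof -
 define w where "w = (SOME u. u \<in> D \<mu> p \<and> u \<noteq> 0)"
 have w: "w \<in> D \<mu> p" "w \<noteq> 0" using someI[of "\<lambda>u. u \<in> D \<mu> p \<and> u \<noteq> 0" e] assms(2,3) by (auto simp: w_def)
 obtain r where r: "w = r *\<^sub>R e" using line_multiple[OF assms w(1)] .
 then have "r \<noteq> 0" using w(2) by auto
 then show ?thesis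
  unfolding line_part_def Let_def w_def[symmetric] r by (simp add: metric_simps[OF metricD[OF adapted]])
qed

lemma line_part_line:
 assumes "\<mu> \<in> {1..k}" "\<nu> \<in> {1..k}" "v \<in> D \<nu> p"
 shows "line_part g \<mu> p u v = (if \<mu> = \<nu> then g p u v else 0)"
proof (cases "v = 0")
 case True
 then show ?thesis by (simp add: line_part_def Let_def metric_simps[OF metricD[OF adapted]])
next
 case False
 obtain E where E: "\<forall>\<mu>\<in>{1..k}. E \<mu> \<in> D \<mu> p \<and> E \<mu> \<noteq> 0" using ex_line_vector by blast
 show ?thesis
 proof (cases "\<mu> = \<nu>")
  case True
  then show ?thesis
   using line_part_eq[OF assms(2,3) False] line_nonnull[OF adapted assms(2,3) False] by simp
 next
  case ne: False
  have "g p (E \<mu>) v = 0" using adapted assms ne E unfolding adapted_metric_def by blast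
  then show ?thesis using line_part_eq[of \<mu> "E \<mu>" p u v] assms(1) E ne by simp
 qed
qed

lemma line_part_bilinear: "bilinear (line_part g \<mu> p)" and line_part_symmetric: "line_part g \<mu> p u v = line_part g \<mu> p v u"
proof -
 show "bilinear (line_part g \<mu> p)"
  by (simp add: bilinear_def linear_iff line_part_def Let_def metric_simps[OF metricD[OF adapted]] algebra_simps add_divide_distrib)
 show "line_part g \<mu> p u v = line_part g \<mu> p v u"
  by (simp add: line_part_def Let_def metric_symmetric[OF metricD[OF adapted]] mult.commute)
qed

lemma smooth_line_part:
 assumes \<mu>: "\<mu> \<in> {1..k}" and c: "c \<in> A"
 shows "smooth_on (bilin_comp A c (line_part g \<mu>)) (snd c ` fst c)"
proof (rule smooth_on_local)
 fix x assume "x \<in> snd c ` fst c"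
 then obtain p where p: "p \<in> fst c" "x = snd c p" by auto
 obtain W X where W: "open W" "p \<in> W" and X: "smooth_vf_on A W X" "\<And>q. q \<in> W ==> X q \<noteq> 0 \<and> D \<mu> q = span {X q}"
  using local_section[OF \<mu>, of p] by metis
 let ?V = "fst c \<inter> W" and ?U = "snd c ` (fst c \<inter> W)"
 have V: "open ?V" using open_chart(1)[OF c] W(1) by blast
 have U: "open ?U" "x \<in> ?U" using open_chart_image[OF c W(1)] p W(2) by auto
 have Xl: "X q \<in> D \<mu> q" "X q \<noteq> 0" if "q \<in> W" for q using X(2)[OF that] by (auto intro: span_base)
 have X': "smooth_vf_on A ?V X" by (rule smooth_vf_on_subset[OF X(1)]) auto
 have co: "smooth_vf_on A ?V (coord_field A c i)" for i
  by (rule smooth_vf_on_subset[OF smooth_coord_field[OF c]]) auto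
 have rep: "smooth_on (\<lambda>y. f (chart_inv c y)) ?U" if "smooth_fun_on A ?V f" for f
  using smooth_fun_rep[OF that c] by (simp add: o_def inf_left_idem)
 have inv: "chart_inv c y \<in> W" if "y \<in> ?U" for y using that c by auto
 have "smooth_on (\<lambda>y. \<chi> i j. g (chart_inv c y) (coord_field A c i (chart_inv c y)) (X (chart_inv c y)) *
   g (chart_inv c y) (X (chart_inv c y)) (coord_field A c j (chart_inv c y)) /
   g (chart_inv c y) (X (chart_inv c y)) (X (chart_inv c y))) ?U"
  by (rule smooth_on_vec_lambda[OF U(1)], rule smooth_on_vec_lambda[OF U(1)],
    rule smooth_on_divide[OF U(1) smooth_on_mult[OF U(1) rep[OF smooth_metric_apply[OF metricD[OF adapted] V co X']]
      rep[OF smooth_metric_apply[OF metricD[OF adapted] V X' co]]] rep[OF smooth_metric_apply[OF metricD[OF adapted] V X' X']]])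
    (rule line_nonnull[OF adapted \<mu> Xl[OF inv]])
 then have "smooth_on (bilin_comp A c (line_part g \<mu>)) ?U"
  by (rule smooth_on_transform[OF _ U(1)])
    (simp add: bilin_comp_def Let_def line_part_eq[OF \<mu> Xl[OF inv]])
 then show "\<exists>U. open U \<and> x \<in> U \<and> smooth_on (bilin_comp A c (line_part g \<mu>)) U" using U by blast
qed

lemma metric_line_parts: "g p u v = (\<Sum>\<mu>\<in>{1..k}. line_part g \<mu> p u v)"
proof -
 obtain E where E: "\<And>\<mu>. \<mu> \<in> {1..k} ==> E \<mu> \<in> D \<mu> p \<and> E \<mu> \<noteq> 0" using ex_line_vector[of p] by blast
 have fr: "orthogonal_frame (g p) {1..k} E" by (rule frame_lines[OF adapted E])
 have lin: "linear (g p u)" using bilinear_metric[OF metricD[OF adapted], of p] by (simp add: bilinear_def)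
 have "g p u v = (\<Sum>\<mu>\<in>{1..k}. g p v (E \<mu>) * g p u (E \<mu>) / g p (E \<mu>) (E \<mu>))"
  by (rule frame_functional[OF fr lin, symmetric])
 also have "\<dots> = (\<Sum>\<mu>\<in>{1..k}. line_part g \<mu> p u v)"
  by (rule sum.cong[OF refl]) (use E in "simp add: line_part_eq[OF _ conjunct1[OF E] conjunct2[OF E]] metric_symmetric[OF metricD[OF adapted], of p v] mult.commute")
 finally show ?thesis .
qed

lemma rescaled_one: "(\<And>\<mu>. w \<mu> p = 1) ==> rescaled g w p u v = g p u v"
 by (simp add: rescaled_def metric_line_parts)

lemma rescaled_line:
 assumes "\<nu> \<in> {1..k}" "v \<in> D \<nu> p"
 shows "rescaled g w p u v = w \<nu> p * g p u v"
proof -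
 have "rescaled g w p u v = (\<Sum>\<mu>\<in>{1..k}. if \<mu> = \<nu> then w \<nu> p * g p u v else 0)"
  unfolding rescaled_def by (intro sum.cong refl) (simp add: line_part_line[OF _ assms])
 then show ?thesis using assms(1) by simp
qed

lemma rescaled_bilinear: "bilinear (rescaled g w p)"
 by (auto simp: bilinear_def rescaled_def bilinear_ladd[OF line_part_bilinear] bilinear_radd[OF line_part_bilinear]
   bilinear_lmul[OF line_part_bilinear] bilinear_rmul[OF line_part_bilinear] sum.distrib sum_distrib_left algebra_simps intro!: linearI)

lemma smooth_family_rescaled:
 assumes I: "open I" and w: "\<And>\<mu>. smooth_fun_family I (w \<mu>)" and c: "c \<in> A"
 shows "smooth_on (\<lambda>(t, x). bilin_comp A c (rescaled g (\<lambda>\<mu>. w \<mu> t)) x) (I \<times> snd c ` fst c)"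
proof -
 let ?S = "snd c ` fst c"
 have op: "open (I \<times> ?S)" using I open_chart(2)[OF c] by (intro open_Times)
 have "smooth_on (\<lambda>z. \<Sum>\<mu>\<in>{1..k}. w \<mu> (fst z) (chart_inv c (snd z)) *\<^sub>R bilin_comp A c (line_part g \<mu>) (snd z)) (I \<times> ?S)"
 proof (intro smooth_on_sum smooth_on_scaleR op)
  fix \<mu> assume \<mu>: "\<mu> \<in> {1..k}"
  show "smooth_on (\<lambda>z. w \<mu> (fst z) (chart_inv c (snd z))) (I \<times> ?S)"
   using w[of \<mu>] c by (simp add: smooth_fun_family_def case_prod_beta')
  show "smooth_on (\<lambda>z. bilin_comp A c (line_part g \<mu>) (snd z)) (I \<times> ?S)"
   using smooth_on_times_snd[OF smooth_line_part[OF \<mu> c] I open_chart(2)[OF c]] by (simp add: case_prod_beta')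
 qed
 then show ?thesis
  by (rule smooth_on_transform[OF _ op])
    (simp add: case_prod_beta' bilin_comp_def Let_def rescaled_def vec_eq_iff)
qed

lemma rescaled_adapted:
 assumes w: "\<And>\<mu> p. w \<mu> p \<noteq> 0" and s: "\<And>c. c \<in> A ==> smooth_on (bilin_comp A c (rescaled g w)) (snd c ` fst c)"
 shows "adapted_metric A k D (rescaled g w)"
 unfolding adapted_metric_def pseudo_riemannian_metric_def
proof (intro conjI allI ballI impI rescaled_bilinear s)
 show "rescaled g w p u v = rescaled g w p v u" for p u v
  by (simp add: rescaled_def line_part_symmetric[of _ p u v])
 show "u = 0" if z: "\<forall>v. rescaled g w p u v = 0" for p u
 proof -
  obtain E where E: "\<And>\<mu>. \<mu> \<in> {1..k} ==> E \<mu> \<in> D \<mu> p \<and> E \<mu> \<noteq> 0" using ex_line_vector[of p] by blast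
  have "g p u (E \<mu>) = 0" if "\<mu> \<in> {1..k}" for \<mu>
   using rescaled_line[OF that conjunct1[OF E[OF that]], of w u] z w by simp
  then show ?thesis using frame_expansion[OF frame_lines[OF adapted E], of u] by simp
 qed
 show "u = 0" if "\<mu> \<in> {1..k}" "u \<in> D \<mu> p" "\<forall>v\<in>D \<mu> p. rescaled g w p u v = 0" for p \<mu> u
 proof -
  have "w \<mu> p * g p u u = 0" using that(3) rescaled_line[OF that(1,2), of w u] that(2) by simp
  then show ?thesis using w line_nonnull[OF adapted that(1,2)] by auto
 qed
 show "rescaled g w p u v = 0" if "\<mu> \<in> {1..k}" "\<nu> \<in> {1..k}" "\<mu> \<noteq> \<nu>" "u \<in> D \<mu> p" "v \<in> D \<nu> p" for p \<mu> \<nu> u v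
 proof -
  have "g p u v = 0" using adapted that unfolding adapted_metric_def by blast
  then show ?thesis using rescaled_line[OF that(2,5), of w u] by simp
 qed
qed

context
 fixes w :: "nat => real => 'm => real" and \<delta> I K \<Omega>
 assumes \<delta>: "0 < \<delta>" and w: "\<And>\<mu>. smooth_fun_family I (w \<mu>)" and nz: "\<And>\<mu> t p. t \<in> I ==> w \<mu> t p \<noteq> 0"
  and w0: "\<And>\<mu> p. w \<mu> 0 p = 1" and K: "closed K" "K \<subseteq> \<Omega>" "\<And>\<mu> t p. p \<notin> K ==> w \<mu> t p = 1"
  and I_def: "I = {-\<delta><..<\<delta>}"
begin

lemma rescaled_variation: "adapted_variation A k D \<Omega> g \<delta> (\<lambda>t. rescaled g (\<lambda>\<mu>. w \<mu> t))"
 unfolding adapted_variation_def I_def[symmetric]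
proof (intro conjI ballI \<delta>)
 have I: "open I" by (simp add: I_def)
 show "rescaled g (\<lambda>\<mu>. w \<mu> 0) = g" by (intro ext rescaled_one w0)
 note s = smooth_family_rescaled[OF I w]
 show "smooth_on (\<lambda>(t, x). bilin_comp A c (rescaled g (\<lambda>\<mu>. w \<mu> t)) x) (I \<times> snd c ` fst c)" if "c \<in> A" for c
  by (rule s[OF that])
 fix t assume t: "t \<in> I"
 show "adapted_metric A k D (rescaled g (\<lambda>\<mu>. w \<mu> t))"
  by (rule rescaled_adapted[OF nz[OF t] smooth_family_at[OF s I open_chart(2) t]])
 have "{p. \<exists>u v. deriv (\<lambda>s. rescaled g (\<lambda>\<mu>. w \<mu> s) p u v) t \<noteq> 0} \<subseteq> K"
 proof safe
  fix p u v assume d: "deriv (\<lambda>s. rescaled g (\<lambda>\<mu>. w \<mu> s) p u v) t \<noteq> 0"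
  show "p \<in> K"
  proof (rule ccontr)
   assume "p \<notin> K"
   then have "(\<lambda>s. rescaled g (\<lambda>\<mu>. w \<mu> s) p u v) = (\<lambda>s. g p u v)" using K(3) rescaled_one by auto
   then show False using d by simp
  qed
 qed
 from closure_minimal[OF this K(1)] K(2)
 show "closure {p. \<exists>u v. deriv (\<lambda>s. rescaled g (\<lambda>\<mu>. w \<mu> s) p u v) t \<noteq> 0} \<subseteq> \<Omega>" by blast
qed

lemma rescaled_velocity:
 assumes t: "t \<in> I" and \<mu>: "\<mu> \<in> {1..k}"
 shows "line_ratio (metric_velocity (\<lambda>t. rescaled g (\<lambda>\<mu>. w \<mu> t)) t) (rescaled g (\<lambda>\<mu>. w \<mu> t)) \<mu> p =
  deriv (\<lambda>s. w \<mu> s p) t / w \<mu> t p"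
proof -
 have I: "open I" by (simp add: I_def)
 obtain E where E: "E \<in> D \<mu> p" "E \<noteq> 0" using ex_line_vector[of p] \<mu> by blast
 note var = rescaled_variation
 have G: "rescaled g (\<lambda>\<mu>. w \<mu> s) p E E = w \<mu> s p * g p E E" for s
  by (rule rescaled_line[OF \<mu> E(1)])
 have "((\<lambda>s. w \<mu> s p * g p E E) has_real_derivative deriv (\<lambda>s. w \<mu> s p) t * g p E E) (at t)"
  by (rule DERIV_cmult_right[OF smooth_fun_family_derivative(1)[OF w I t]])
 then have "metric_velocity (\<lambda>t. rescaled g (\<lambda>\<mu>. w \<mu> t)) t p E E = deriv (\<lambda>s. w \<mu> s p) t * g p E E"
  unfolding metric_velocity_def[OF var] G by (rule DERIV_imp_deriv)
 then show ?thesis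
  using line_ratio_eq[OF \<mu> E bilinear_metric_velocity[OF var t[unfolded I_def]] rescaled_bilinear] G
   line_nonnull[OF adapted \<mu> E] nz[OF t] by simp
qed

text \<open>Both sides solve the same linear differential equation in "t".\<close>

lemma rescaled_volume_ratio:
 assumes r: "\<And>t p. t \<in> I ==> ((\<lambda>s. r s p) has_real_derivative r t p * ((\<Sum>\<mu>\<in>{1..k}. deriv (\<lambda>s. w \<mu> s p) t / w \<mu> t p) / 2)) (at t)"
  and r0: "\<And>p. r 0 p = 1" and pos: "\<And>t p. t \<in> I ==> r t p \<noteq> 0" and t: "t \<in> I"
 shows "volume_ratio g (rescaled g (\<lambda>\<mu>. w \<mu> t)) p = r t p"
proof -
 note var = rescaled_variation
 let ?v = "\<lambda>t. volume_ratio g (rescaled g (\<lambda>\<mu>. w \<mu> t)) p"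
 let ?e = "\<lambda>t. (\<Sum>\<mu>\<in>{1..k}. deriv (\<lambda>s. w \<mu> s p) t / w \<mu> t p) / 2"
 have v: "(?v has_real_derivative ?v t * ?e t) (at t)" if t: "t \<in> I" for t
 proof -
  have "(\<Sum>\<mu>\<in>{1..k}. line_ratio (metric_velocity (\<lambda>t. rescaled g (\<lambda>\<mu>. w \<mu> t)) t) (rescaled g (\<lambda>\<mu>. w \<mu> t)) \<mu> p) =
    (\<Sum>\<mu>\<in>{1..k}. deriv (\<lambda>s. w \<mu> s p) t / w \<mu> t p)"
   by (rule sum.cong[OF refl]) (rule rescaled_velocity[OF t])
  then show ?thesis using volume_ratio_derivative[OF var t[unfolded I_def], of p] by simp
 qed
 have q: "((\<lambda>s. ?v s / r s p) has_real_derivative 0) (at t within I)" if t: "t \<in> I" for t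
  by (rule has_field_derivative_at_within, rule DERIV_cong[OF DERIV_divide[OF v[OF t] r[OF t] pos[OF t]]]) simp
 have "convex I" by (simp add: I_def)
 from has_field_derivative_zero_constant[OF this q] obtain a where a: "\<And>s. s \<in> I ==> ?v s / r s p = a" by blast
 have "0 \<in> I" using \<delta> by (simp add: I_def)
 moreover have "?v 0 = 1" using volume_ratio_0[OF var] variation_0[OF var] by simp
 ultimately have "a = 1" using a[of 0] r0 by simp
 then show ?thesis using a[OF t] pos[OF t] by (simp add: divide_eq_eq)
qed

end

end

end

section \<open>Critical metrics\<close>

context manifold
begin

lemma smooth_fun_const: "smooth_fun_on A UNIV (\<lambda>_. r)"
 unfolding smooth_fun_on_def o_def using open_chart(2) by (auto intro!: smooth_on_const)

lemma smooth_fun_arith: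
 assumes f: "smooth_fun_on A UNIV f" and h: "smooth_fun_on A UNIV h"
 shows "smooth_fun_on A UNIV (\<lambda>p. f p + h p)" "smooth_fun_on A UNIV (\<lambda>p. f p - h p)" "smooth_fun_on A UNIV (\<lambda>p. f p * h p)"
proof -
 have *: "smooth_on (\<lambda>x. f (chart_inv c x)) (snd c ` fst c)" "smooth_on (\<lambda>x. h (chart_inv c x)) (snd c ` fst c)"
  "open (snd c ` fst c)" if "c \<in> A" for c
  using smooth_fun_rep[OF f that] smooth_fun_rep[OF h that] open_chart(2)[OF that] by (simp_all add: o_def)
 show "smooth_fun_on A UNIV (\<lambda>p. f p + h p)" "smooth_fun_on A UNIV (\<lambda>p. f p - h p)" "smooth_fun_on A UNIV (\<lambda>p. f p * h p)"
  unfolding smooth_fun_on_def o_def Int_UNIV_right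
  by (intro ballI smooth_on_add smooth_on_diff smooth_on_mult *; assumption)+
qed

end

context line_product
begin

context
 fixes g :: "('m, 'n) bilin_field"
 assumes adapted: "adapted_metric A k D g"
begin

lemma smooth_line_ratio_ricci:
 assumes \<mu>: "\<mu> \<in> {1..k}"
 shows "smooth_fun_on A UNIV (line_ratio (ricci A g) g \<mu>)"
 unfolding smooth_fun_on_def Int_UNIV_right
proof (intro ballI smooth_on_local)
 fix c x assume c: "c \<in> A" and "x \<in> snd c ` fst c"
 then obtain p where p: "p \<in> fst c" "x = snd c p" by auto
 obtain W X where W: "open W" "p \<in> W" and X: "smooth_vf_on A W X" "\<And>q. q \<in> W ==> X q \<noteq> 0 \<and> D \<mu> q = span {X q}"
  using local_section[OF \<mu>, of p] by metis
 let ?S = "snd c ` fst c" and ?U = "snd c ` (fst c \<inter> W)" and ?G = "bilin_comp A c g"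
 have S: "open ?S" by (rule open_chart(2)[OF c])
 have U: "open ?U" "x \<in> ?U" using open_chart_image[OF c W(1)] p W(2) by auto
 have Xl: "X q \<in> D \<mu> q" "X q \<noteq> 0" if "q \<in> W" for q using X(2)[OF that] by (auto intro: span_base)
 note G = metric_matrix_chart[OF metricD[OF adapted] c]
 note \<Gamma> = coefficients_christoffel[OF metricD[OF adapted] c]
 have R: "smooth_on (\<lambda>x. ricci_rep (christoffel ?G) x u v) ?U" for u v
  by (rule smooth_on_subset[OF smooth_ricci_rep[OF adapted c \<Gamma>]]) auto
 have V: "smooth_on (vf_rep A c X) ?U" by (rule smooth_vf_rep[OF X(1) c])
 have num: "smooth_on (\<lambda>y. ricci_rep (christoffel ?G) y (vf_rep A c X y) (vf_rep A c X y)) ?U"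
  by (rule smooth_on_bilinear_field[OF U(1) _ R V V], rule ricci_rep_bilinear[OF \<Gamma>]) auto
 have den: "smooth_on (\<lambda>y. g (chart_inv c y) (X (chart_inv c y)) (X (chart_inv c y))) ?U"
  using smooth_fun_rep[OF smooth_metric_apply[OF metricD[OF adapted] W(1) X(1) X(1)] c] by (simp add: o_def)
 have inv: "chart_inv c y \<in> W" "chart_inv c y \<in> fst c" "snd c (chart_inv c y) = y" if "y \<in> ?U" for y using that c by auto
 have "smooth_on (\<lambda>y. ricci_rep (christoffel ?G) y (vf_rep A c X y) (vf_rep A c X y) /
   g (chart_inv c y) (X (chart_inv c y)) (X (chart_inv c y))) ?U"
  by (rule smooth_on_divide[OF U(1) num den]) (rule line_nonnull[OF adapted \<mu> Xl[OF inv(1)]])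
 then have "smooth_on (line_ratio (ricci A g) g \<mu> \<circ> chart_inv c) ?U"
 proof (rule smooth_on_transform[OF _ U(1)])
  fix y assume y: "y \<in> ?U"
  show "(line_ratio (ricci A g) g \<mu> \<circ> chart_inv c) y = ricci_rep (christoffel ?G) y (vf_rep A c X y) (vf_rep A c X y) /
   g (chart_inv c y) (X (chart_inv c y)) (X (chart_inv c y))"
   unfolding o_def line_ratio_eq[OF \<mu> Xl[OF inv(1)[OF y]] bilinear_ricci[OF adapted] bilinear_metric[OF metricD[OF adapted]]]
    ricci_chart[OF adapted c inv(2)[OF y]] inv(3)[OF y] by (simp add: vf_rep_def)
 qed
 then show "\<exists>U. open U \<and> x \<in> U \<and> smooth_on (line_ratio (ricci A g) g \<mu> \<circ> chart_inv c) U" using U by blast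
qed

lemma smooth_einstein_defect:
 assumes "\<mu> \<in> {1..k}"
 shows "smooth_fun_on A UNIV (einstein_defect g \<mu>)"
proof -
 have "smooth_fun_on A UNIV (\<lambda>p. \<Sum>\<nu>\<in>J. line_ratio (ricci A g) g \<nu> p)" if "finite J" "J \<subseteq> {1..k}" for J
  using that
 proof (induction J)
  case (insert \<nu> J)
  then show ?case using smooth_fun_arith(1)[OF smooth_line_ratio_ricci[of \<nu>]] by simp
 qed (simp add: smooth_fun_const)
 then have "smooth_fun_on A UNIV (\<lambda>p. \<Sum>\<nu>\<in>{1..k}. line_ratio (ricci A g) g \<nu> p)" by simp
 from smooth_fun_arith(2)[OF smooth_fun_arith(3)[OF this smooth_fun_const[of "1/2"]] smooth_line_ratio_ricci[OF assms]]
 show ?thesis by (simp add: einstein_defect_def[abs_def])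
qed

text \<open>
 The metric is scaled by \<open>(1 + t \<phi>)\<^sup>2\<close> along the line \<open>\<alpha>\<close> and by \<open>((1 + t h) / (1 + t \<phi>))\<^sup>2\<close>
 along the line \<open>\<beta>\<close>, so that the volume form is scaled by exactly \<open>1 + t h\<close>.
\<close>

lemma metric_test:
 assumes crit: "\<And>\<delta> G. adapted_variation A k D \<Omega> g \<delta> G ==> volume_preserving A \<Omega> \<delta> G ==>
   ((\<lambda>t. action A k D \<Omega> (G t) (\<lambda>p u v. 0)) has_real_derivative 0) (at 0)"
  and O: "open \<Omega>" "compact (closure \<Omega>)"
  and \<alpha>\<beta>: "\<alpha> \<in> {1..k}" "\<beta> \<in> {1..k}" "\<alpha> \<noteq> \<beta>"
  and \<phi>: "smooth_fun_on A UNIV \<phi>" and h: "smooth_fun_on A UNIV h"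
  and K: "compact K" "K \<subseteq> \<Omega>" "\<And>p. p \<notin> K ==> \<phi> p = 0" "\<And>p. p \<notin> K ==> h p = 0"
  and vol: "(LINT p:\<Omega>|volume_measure A g. h p) = 0"
 shows "(LINT p:\<Omega>|volume_measure A g. \<phi> p * einstein_defect g \<alpha> p + (h p - \<phi> p) * einstein_defect g \<beta> p) = 0"
proof -
 have Ob: "\<Omega> \<in> sets borel" using O(1) by simp
 note dom = Ob closure_subset O(2)
 obtain C1 where C1: "C1 \<ge> 0" "\<And>p. \<bar>\<phi> p\<bar> \<le> C1"
  using continuous_compact_bounded[OF smooth_fun_continuous[OF \<phi>] K(1,3)] by blast
 obtain C2 where C2: "C2 \<ge> 0" "\<And>p. \<bar>h p\<bar> \<le> C2"
  using continuous_compact_bounded[OF smooth_fun_continuous[OF h] K(1,4)] by blast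
 define C where "C = C1 + C2"
 have C: "C \<ge> 0" "\<bar>\<phi> p\<bar> \<le> C" "\<bar>h p\<bar> \<le> C" for p
  using C1(1) C1(2)[of p] C2(1) C2(2)[of p] by (auto simp: C_def)
 \<comment> \<open>For \<open>t\<close> in this interval, \<open>t\<close> times a value of
   \<open>\<phi>\<close> or \<open>h\<close> is less than 1 in absolute value, so that the scaling
   factors stay nonzero; the summand 1 covers \<open>C = 0\<close>.\<close>
 define \<delta> where "\<delta> = 1 / (C + 1)"
 define I where "I = {-\<delta><..<\<delta>}"
 have \<delta>: "0 < \<delta>" using C(1) by (simp add: \<delta>_def)
 have I: "open I" "0 \<in> I" using \<delta> by (auto simp: I_def)
 have pos: "0 < 1 + t * f" if "t \<in> I" "\<bar>f\<bar> \<le> C" for t f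
 proof -
  have "\<bar>t\<bar> < 1 / (C + 1)" using that(1) by (auto simp: I_def \<delta>_def)
  then have "\<bar>t\<bar> * (C + 1) < 1" using C(1) by (simp add: pos_less_divide_eq)
  moreover have "\<bar>t * f\<bar> \<le> \<bar>t\<bar> * (C + 1)" unfolding abs_mult by (rule mult_left_mono) (use that(2) in auto)
  ultimately show ?thesis by linarith
 qed
 note p\<phi> = pos[OF _ C(2)] and ph = pos[OF _ C(3)]
 define w where "w = (\<lambda>\<mu> t p. if \<mu> = \<alpha> then (1 + t * \<phi> p)\<^sup>2 else if \<mu> = \<beta> then ((1 + t * h p) / (1 + t * \<phi> p))\<^sup>2 else 1)"
 have ws: "smooth_fun_family I (w \<mu>)" for \<mu>
  unfolding smooth_fun_family_def
 proof
  fix c assume c: "c \<in> A"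
  let ?S = "snd c ` fst c"
  have op: "open ?S" "open (I \<times> ?S)" using I open_chart(2)[OF c] by (auto intro!: open_Times)
  have aff: "smooth_on (\<lambda>z. 1 + fst z * f (chart_inv c (snd z))) (I \<times> ?S)" if f: "smooth_fun_on A UNIV f" for f
  proof -
   have "smooth_on (\<lambda>(t::real, x). f (chart_inv c x)) (I \<times> ?S)"
    using smooth_on_times_snd[OF smooth_fun_rep[OF f c, unfolded o_def Int_UNIV_right] I(1) op(1)] .
   from smooth_on_add[OF op(2) smooth_on_const[OF op(2)] smooth_on_mult[OF op(2) smooth_on_linear[OF bounded_linear_fst op(2)] this[unfolded case_prod_beta']]]
   show ?thesis .
  qed
  show "smooth_on (\<lambda>(t, x). w \<mu> t (chart_inv c x)) (I \<times> ?S)"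
  proof -
   have nz: "1 + fst z * \<phi> (chart_inv c (snd z)) \<noteq> 0" if "z \<in> I \<times> ?S" for z
    using p\<phi>[of "fst z" "chart_inv c (snd z)"] that by auto
   note q = smooth_on_power[OF op(2) smooth_on_divide[OF op(2) aff[OF h] aff[OF \<phi>] nz], where n = 2]
   show ?thesis
    unfolding case_prod_beta' w_def
    using smooth_on_power[OF op(2) aff[OF \<phi>], of 2] q smooth_on_const[OF op(2)]
    by (cases "\<mu> = \<alpha>"; cases "\<mu> = \<beta>") simp_all
  qed
 qed
 have wnz: "w \<mu> t p \<noteq> 0" if "t \<in> I" for \<mu> t p
  using p\<phi>[OF that, of p] ph[OF that, of p] by (simp add: w_def)
 have w0: "w \<mu> 0 p = 1" for \<mu> p by (simp add: w_def)
 have wK: "w \<mu> t p = 1" if "p \<notin> K" for \<mu> t p using K(3,4)[OF that] by (simp add: w_def)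
 let ?G = "\<lambda>t. rescaled g (\<lambda>\<mu>. w \<mu> t)"
 note R = \<delta> ws wnz w0 compact_imp_closed[OF K(1)] K(2) wK I_def
 have var: "adapted_variation A k D \<Omega> g \<delta> ?G"
  by (rule rescaled_variation[OF adapted, where w = w, OF R])
 \<comment> \<open>The squares turn relative velocities into twice logarithmic derivatives. The
   contributions of \<open>\<phi>\<close> along the two lines are opposite, so only \<open>h\<close>
   remains in the sum and hence in the volume.\<close>
 have log: "deriv (\<lambda>s. w \<mu> s p) t / w \<mu> t p = (if \<mu> = \<alpha> then 2 * \<phi> p / (1 + t * \<phi> p) else 0) +
   (if \<mu> = \<beta> then 2 * h p / (1 + t * h p) - 2 * \<phi> p / (1 + t * \<phi> p) else 0)" if t: "t \<in> I" for \<mu> t p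
 proof -
  have nz: "1 + t * \<phi> p \<noteq> 0" "1 + t * h p \<noteq> 0" using p\<phi>[OF t, of p] ph[OF t, of p] by auto
  have sq: "deriv (\<lambda>s. (f s)\<^sup>2) t / (f t)\<^sup>2 = 2 * f' / f t" if "(f has_real_derivative f') (at t)" "f t \<noteq> 0" for f f'
  proof -
   have "((\<lambda>s. (f s)\<^sup>2) has_real_derivative 2 * f t * f') (at t)"
    using DERIV_power[OF that(1), of 2] by (simp add: mult_ac)
   from DERIV_imp_deriv[OF this] show ?thesis using that(2) by (simp add: power2_eq_square)
  qed
  have a: "((\<lambda>s. 1 + s * f) has_real_derivative f) (at t)" for f by (auto intro!: derivative_eq_intros)
  have 1: "deriv (\<lambda>s. (1 + s * \<phi> p)\<^sup>2) t / (1 + t * \<phi> p)\<^sup>2 = 2 * \<phi> p / (1 + t * \<phi> p)" by (rule sq[OF a nz(1)])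
  have 2: "deriv (\<lambda>s. ((1 + s * h p) / (1 + s * \<phi> p))\<^sup>2) t / ((1 + t * h p) / (1 + t * \<phi> p))\<^sup>2 =
    2 * h p / (1 + t * h p) - 2 * \<phi> p / (1 + t * \<phi> p)"
  proof -
   have "(1 + t * h p) / (1 + t * \<phi> p) \<noteq> 0" using nz by simp
   note sq[OF DERIV_divide[OF a[of "h p"] a[of "\<phi> p"] nz(1)] this]
   also have "2 * ((h p * (1 + t * \<phi> p) - (1 + t * h p) * \<phi> p) / ((1 + t * \<phi> p) * (1 + t * \<phi> p))) / ((1 + t * h p) / (1 + t * \<phi> p)) =
     2 * h p / (1 + t * h p) - 2 * \<phi> p / (1 + t * \<phi> p)"
   proof -
    have "2 * ((y * x - z * w) / (x * x)) / (z / x) = 2 * y / z - 2 * w / x" if "x \<noteq> 0" "z \<noteq> 0" for x y z w :: real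
     using that by (simp add: field_simps)
    from this[OF nz] show ?thesis .
   qed
   finally show ?thesis .
  qed
  show ?thesis
   using \<alpha>\<beta>(3) 1 2 by (cases "\<mu> = \<alpha>"; cases "\<mu> = \<beta>") (simp_all add: w_def)
 qed
 have sum2: "(\<Sum>\<mu>\<in>{1..k}. (if \<mu> = \<alpha> then x else 0) * F \<mu> + (if \<mu> = \<beta> then y else 0) * F \<mu>) = x * F \<alpha> + y * F \<beta>" for x y and F :: "nat => real"
  using \<alpha>\<beta> by (simp add: sum.distrib if_distrib[of "\<lambda>x. x * _"] cong: if_cong)
 have vr: "volume_ratio g (?G t) p = 1 + t * h p" if t: "t \<in> I" for t p
 proof (rule rescaled_volume_ratio[OF adapted, where w = w and r = "\<lambda>t p. 1 + t * h p", OF R])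
  show "1 + t * h p \<noteq> 0" if "t \<in> I" for t p using ph[OF that, of p] by simp
  fix t p assume t: "t \<in> I"
  have "(\<Sum>\<mu>\<in>{1..k}. deriv (\<lambda>s. w \<mu> s p) t / w \<mu> t p) = 2 * h p / (1 + t * h p)"
   unfolding log[OF t] using sum2[of _ "\<lambda>_. 1"] by simp
  then have "(1 + t * h p) * ((\<Sum>\<mu>\<in>{1..k}. deriv (\<lambda>s. w \<mu> s p) t / w \<mu> t p) / 2) = h p"
   using ph[OF t, of p] by (simp add: field_simps)
  then show "((\<lambda>t. 1 + t * h p) has_real_derivative (1 + t * h p) * ((\<Sum>\<mu>\<in>{1..k}. deriv (\<lambda>s. w \<mu> s p) t / w \<mu> t p) / 2)) (at t)"
   by (auto intro!: derivative_eq_intros)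
 qed (use t in simp_all)
 have int: "set_integrable (volume_measure A g) \<Omega> (\<lambda>p. t * h p)" for t
  by (rule integrable_continuous_on_domain[OF metricD[OF adapted] dom])
    (intro continuous_on_mult continuous_on_const smooth_fun_continuous[OF h])
 have int1: "set_integrable (volume_measure A g) \<Omega> (\<lambda>p. 1 :: real)"
  by (rule integrable_continuous_on_domain[OF metricD[OF adapted] dom continuous_on_const])
 have em: "emeasure (volume_measure A (?G t)) \<Omega> = ennreal (LINT p:\<Omega>|volume_measure A g. 1)" if t: "t \<in> I" for t
  unfolding emeasure_volume_ratio[OF metricD[OF adapted] variation_metric[OF var t[unfolded I_def]] dom] vr[OF t]
  using set_integral_add(2)[OF int1 int] vol by simp
 have "volume_preserving A \<Omega> \<delta> ?G"
  unfolding volume_preserving_def I_def[symmetric] using em I(2) by simp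
 from DERIV_unique[OF action_metric_derivative[OF var dom] crit[OF var this]]
 have z: "(LINT p:\<Omega>|volume_measure A g. \<Sum>\<mu>\<in>{1..k}. line_ratio (metric_velocity ?G 0) g \<mu> p * einstein_defect g \<mu> p) = 0" by simp
 have "line_ratio (metric_velocity ?G 0) g \<mu> p = (if \<mu> = \<alpha> then 2 * \<phi> p else 0) + (if \<mu> = \<beta> then 2 * (h p - \<phi> p) else 0)"
  if "\<mu> \<in> {1..k}" for \<mu> p
  using rescaled_velocity[OF adapted, where w = w, OF R I(2) that, of p] log[OF I(2), of \<mu> p] variation_0[OF var] by (simp add: w0)
 then have "(\<Sum>\<mu>\<in>{1..k}. line_ratio (metric_velocity ?G 0) g \<mu> p * einstein_defect g \<mu> p) =
   (\<Sum>\<mu>\<in>{1..k}. (if \<mu> = \<alpha> then 2 * \<phi> p else 0) * einstein_defect g \<mu> p + (if \<mu> = \<beta> then 2 * (h p - \<phi> p) else 0) * einstein_defect g \<mu> p)" for p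
  by (intro sum.cong refl) (simp add: distrib_right)
 from z[unfolded this sum2]
 have "(LINT p:\<Omega>|volume_measure A g. 2 * (\<phi> p * einstein_defect g \<alpha> p + (h p - \<phi> p) * einstein_defect g \<beta> p)) = 0"
  by (simp add: algebra_simps)
 then show ?thesis by (subst (asm) set_integral_mult_right) simp
qed

end

end

context line_product
begin

context
 fixes g :: "('m, 'n) bilin_field"
 assumes adapted: "adapted_metric A k D g"
begin

context
 fixes \<Omega>
 assumes crit: "\<And>\<delta> G. adapted_variation A k D \<Omega> g \<delta> G ==> volume_preserving A \<Omega> \<delta> G ==>
   ((\<lambda>t. action A k D \<Omega> (G t) (\<lambda>p u v. 0)) has_real_derivative 0) (at 0)"
  and O: "open \<Omega>" "compact (closure \<Omega>)"
begin

lemma einstein_defect_equal: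
 assumes \<alpha>\<beta>: "\<alpha> \<in> {1..k}" "\<beta> \<in> {1..k}" "\<alpha> \<noteq> \<beta>" and p: "p \<in> \<Omega>"
 shows "einstein_defect g \<alpha> p = einstein_defect g \<beta> p"
proof -
 obtain \<psi> K where \<psi>: "smooth_fun_on A UNIV \<psi>" "\<And>q. 0 \<le> \<psi> q" "0 < \<psi> p"
  and K: "compact K" "K \<subseteq> \<Omega>" "\<And>q. q \<notin> K ==> \<psi> q = 0"
  using smooth_bump[OF O(1) p] by metis
 let ?d = "\<lambda>q. einstein_defect g \<alpha> q - einstein_defect g \<beta> q"
 \<comment> \<open>The test function is the difference of the two defects, cut off near
   \<open>p\<close>. With \<open>h = 0\<close> the volume form is unchanged, and the integrand is
   \<open>\<psi>\<close> times a square.\<close>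
 let ?\<phi> = "\<lambda>q. \<psi> q * ?d q"
 have d: "smooth_fun_on A UNIV ?d"
  by (rule smooth_fun_arith(2)[OF smooth_einstein_defect[OF adapted \<alpha>\<beta>(1)] smooth_einstein_defect[OF adapted \<alpha>\<beta>(2)]])
 note \<phi> = smooth_fun_arith(3)[OF \<psi>(1) d]
 have "(LINT q:\<Omega>|volume_measure A g. ?\<phi> q * einstein_defect g \<alpha> q + (0 - ?\<phi> q) * einstein_defect g \<beta> q) = 0"
  by (rule metric_test[OF adapted crit O \<alpha>\<beta> \<phi> smooth_fun_const K(1,2)]) (simp_all add: K(3))
 moreover have "?\<phi> q * einstein_defect g \<alpha> q + (0 - ?\<phi> q) * einstein_defect g \<beta> q = \<psi> q * (?d q)\<^sup>2" for q
  by (simp add: power2_eq_square algebra_simps)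
 ultimately have z: "(LINT q:\<Omega>|volume_measure A g. \<psi> q * (?d q)\<^sup>2) = 0" by simp
 have "\<psi> p * (?d p)\<^sup>2 = 0"
  by (rule continuous_integral_eq_0[OF metricD[OF adapted] O(1) closure_subset O(2) _ _ z p])
    (simp_all add: continuous_on_mult continuous_on_power smooth_fun_continuous[OF \<psi>(1)] smooth_fun_continuous[OF d] \<psi>(2))
 then show ?thesis using \<psi>(3) by simp
qed

text \<open>Here \<open>\<phi> = 0\<close>, so only the line \<open>\<beta>\<close> is scaled: the
  volume form changes pointwise but keeps its integral.\<close>

lemma einstein_defect_locally_constant:
 assumes \<alpha>\<beta>: "\<alpha> \<in> {1..k}" "\<beta> \<in> {1..k}" "\<alpha> \<noteq> \<beta>" and p: "p \<in> \<Omega>"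
 obtains U where "open U" "p \<in> U" "\<And>q. q \<in> U ==> einstein_defect g \<beta> q = einstein_defect g \<beta> p"
proof -
 have Ob: "\<Omega> \<in> sets borel" using O(1) by simp
 obtain \<psi> K where \<psi>: "smooth_fun_on A UNIV \<psi>" "\<And>q. 0 \<le> \<psi> q" "0 < \<psi> p"
  and K: "compact K" "K \<subseteq> \<Omega>" "\<And>q. q \<notin> K ==> \<psi> q = 0"
  using smooth_bump[OF O(1) p] by metis
 let ?F = "einstein_defect g \<beta>" and ?M = "volume_measure A g"
 note F = smooth_einstein_defect[OF adapted \<alpha>\<beta>(2)]
 have nz: "(LINT q:\<Omega>|?M. \<psi> q) \<noteq> 0"
 proof
  assume "(LINT q:\<Omega>|?M. \<psi> q) = 0"
  from continuous_integral_eq_0[OF metricD[OF adapted] O(1) closure_subset O(2) smooth_fun_continuous[OF \<psi>(1)] \<psi>(2) this p]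
  show False using \<psi>(3) by simp
 qed
 \<comment> \<open>The mean of the defect weighted by \<open>\<psi>\<close>, chosen so that
   \<open>?h\<close> has integral 0, as \<open>metric_test\<close> demands. Subtracting
   \<open>m\<close> times this vanishing integral completes the square.\<close>
 define m where "m = (LINT q:\<Omega>|?M. \<psi> q * ?F q) / (LINT q:\<Omega>|?M. \<psi> q)"
 let ?h = "\<lambda>q. \<psi> q * (?F q - m)"
 have d: "smooth_fun_on A UNIV (\<lambda>q. ?F q - m)" by (rule smooth_fun_arith(2)[OF F smooth_fun_const])
 note h = smooth_fun_arith(3)[OF \<psi>(1) d]
 note int = integrable_continuous_on_domain[OF metricD[OF adapted] Ob closure_subset O(2)]
 have i1: "set_integrable ?M \<Omega> (\<lambda>q. \<psi> q * ?F q)" by (rule int[OF smooth_fun_continuous[OF smooth_fun_arith(3)[OF \<psi>(1) F]]])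
 have i2: "set_integrable ?M \<Omega> (\<lambda>q. m * \<psi> q)" by (rule int[OF smooth_fun_continuous[OF smooth_fun_arith(3)[OF smooth_fun_const \<psi>(1)]]])
 have i3: "set_integrable ?M \<Omega> (\<lambda>q. ?h q * ?F q)" by (rule int[OF smooth_fun_continuous[OF smooth_fun_arith(3)[OF h F]]])
 have i4: "set_integrable ?M \<Omega> (\<lambda>q. m * ?h q)" by (rule int[OF smooth_fun_continuous[OF smooth_fun_arith(3)[OF smooth_fun_const h]]])
 have "(LINT q:\<Omega>|?M. ?h q) = (LINT q:\<Omega>|?M. \<psi> q * ?F q - m * \<psi> q)" by (simp add: algebra_simps)
 also have "\<dots> = 0" unfolding set_integral_diff(2)[OF i1 i2] using nz by (simp add: m_def)
 finally have h0: "(LINT q:\<Omega>|?M. ?h q) = 0" .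
 have "(LINT q:\<Omega>|?M. 0 * einstein_defect g \<alpha> q + (?h q - 0) * ?F q) = 0"
  by (rule metric_test[OF adapted crit O \<alpha>\<beta> smooth_fun_const h K(1,2) _ _ h0]) (simp_all add: K(3))
 then have "(LINT q:\<Omega>|?M. ?h q * ?F q - m * ?h q) = 0"
  unfolding set_integral_diff(2)[OF i3 i4] using h0 by simp
 moreover have "?h q * ?F q - m * ?h q = \<psi> q * (?F q - m)\<^sup>2" for q
  by (simp add: power2_eq_square algebra_simps)
 ultimately have z: "(LINT q:\<Omega>|?M. \<psi> q * (?F q - m)\<^sup>2) = 0" by simp
 have eq: "?F q = m" if q: "q \<in> \<Omega> \<inter> {q. 0 < \<psi> q}" for q
 proof -
  have "\<psi> q * (?F q - m)\<^sup>2 = 0"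
   by (rule continuous_integral_eq_0[OF metricD[OF adapted] O(1) closure_subset O(2) _ _ z])
     (use q in "simp_all add: continuous_on_mult continuous_on_power smooth_fun_continuous[OF \<psi>(1)] smooth_fun_continuous[OF d] \<psi>(2)")
  then show ?thesis using q by simp
 qed
 have "open (\<Omega> \<inter> {q. 0 < \<psi> q})"
  by (rule open_Int[OF O(1) open_Collect_less[OF continuous_on_const smooth_fun_continuous[OF \<psi>(1)]]])
 moreover have "p \<in> \<Omega> \<inter> {q. 0 < \<psi> q}" using p \<psi>(3) by simp
 ultimately show thesis using that[of "\<Omega> \<inter> {q. 0 < \<psi> q}"] eq by simp
qed

end

lemma ricci_line:
 assumes "\<mu> \<in> {1..k}" "u \<in> D \<mu> p" "v \<in> D \<mu> p"
 shows "ricci A g p u v = line_ratio (ricci A g) g \<mu> p * g p u v"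
proof (cases "u = 0")
 case True
 then show ?thesis using bilinear_lzero[OF bilinear_ricci[OF adapted]] by (simp add: metric_simps[OF metricD[OF adapted]])
next
 case False
 obtain r where r: "v = r *\<^sub>R u" using line_multiple[OF assms(1,2) False assms(3)] .
 show ?thesis
  unfolding r line_ratio_eq[OF assms(1,2) False bilinear_ricci[OF adapted] bilinear_metric[OF metricD[OF adapted]]]
  using line_nonnull[OF adapted assms(1,2) False]
  by (simp add: bilinear_rmul[OF bilinear_ricci[OF adapted]] metric_simps[OF metricD[OF adapted]])
qed

theorem critical_metric_iff:
 assumes con: "connected (UNIV :: 'm set)" and k: "k > 2"
 shows "(\<forall>\<Omega>. action_domain \<Omega> \<longrightarrow> (\<forall>\<delta> G. adapted_variation A k D \<Omega> g \<delta> G \<and> volume_preserving A \<Omega> \<delta> G \<longrightarrow>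
      ((\<lambda>t. action A k D \<Omega> (G t) (\<lambda>p u v. 0)) has_real_derivative 0) (at 0))) \<longleftrightarrow>
  (\<exists>l::real. \<forall>\<mu>\<in>{1..k}. \<forall>p. \<forall>u\<in>D \<mu> p. \<forall>v\<in>D \<mu> p. ricci A g p u v = - (2 * l / (real k - 2)) * g p u v)"
  (is "?crit \<longleftrightarrow> ?einstein")
proof
 assume C: ?crit
 have crit: "((\<lambda>t. action A k D \<Omega> (G t) (\<lambda>p u v. 0)) has_real_derivative 0) (at 0)"
  if "action_domain \<Omega>" "adapted_variation A k D \<Omega> g \<delta> G" "volume_preserving A \<Omega> \<delta> G" for \<Omega> \<delta> G
  using C that by blast
 have one: "1 \<in> {1..k}" and two: "2 \<in> {1..k}" using k by auto
 let ?F = "einstein_defect g 1"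
 have eq: "einstein_defect g \<mu> p = ?F p" if \<mu>: "\<mu> \<in> {1..k}" for \<mu> p
 proof (cases "\<mu> = 1")
  case False
  obtain \<Omega> where \<Omega>: "action_domain \<Omega>" "p \<in> \<Omega>" using ex_action_domain[of p] by blast
  show ?thesis
   by (rule einstein_defect_equal[OF crit[OF \<Omega>(1)] action_domainD(1,2)[OF \<Omega>(1) con] \<mu> one False \<Omega>(2)])
 qed simp
 have loc: "\<exists>U. openin (top_of_set UNIV) U \<and> p \<in> U \<and> (\<forall>q\<in>U. ?F q = ?F p)" for p
 proof -
  obtain \<Omega> where \<Omega>: "action_domain \<Omega>" "p \<in> \<Omega>" using ex_action_domain[of p] by blast
  have ne: "2 \<noteq> (1::nat)" by simp
  show ?thesis
  proof (rule einstein_defect_locally_constant[OF crit[OF \<Omega>(1)] action_domainD(1,2)[OF \<Omega>(1) con] two one ne \<Omega>(2)])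
   fix U assume U: "open U" "p \<in> U" and F: "\<And>q. q \<in> U ==> ?F q = ?F p"
   show "\<exists>U. openin (top_of_set UNIV) U \<and> p \<in> U \<and> (\<forall>q\<in>U. ?F q = ?F p)"
    by (intro exI[of _ U] conjI ballI F) (use U in simp_all)
  qed
 qed
 obtain F0 where F0: "\<And>p. ?F p = F0"
  using locally_constant_imp_constant[OF con loc] unfolding constant_on_def by blast
 have ratio: "line_ratio (ricci A g) g \<mu> p = 2 * F0 / (real k - 2)" if \<mu>: "\<mu> \<in> {1..k}" for \<mu> p
 proof -
  define s where "s = (\<Sum>\<nu>\<in>{1..k}. line_ratio (ricci A g) g \<nu> p)"
  have r: "line_ratio (ricci A g) g \<nu> p = s / 2 - F0" if "\<nu> \<in> {1..k}" for \<nu>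
   using eq[OF that, of p] F0[of p] by (simp add: einstein_defect_def s_def)
  have "(\<Sum>\<nu>\<in>{1..k}. line_ratio (ricci A g) g \<nu> p) = (\<Sum>\<nu>\<in>{1..k}. s / 2 - F0)"
   by (rule sum.cong[OF refl]) (rule r)
  then have "s = real k * (s / 2 - F0)" unfolding s_def[symmetric] by simp
  then have "s * (real k - 2) = 2 * real k * F0" by (simp add: field_simps)
  then have s: "s = 2 * real k * F0 / (real k - 2)" using k by (simp add: field_simps)
  show ?thesis unfolding r[OF \<mu>] s using k by (simp add: field_simps)
 qed
 \<comment> \<open>With common defect \<open>F0\<close> every line has Ricci curvature
   \<open>2 * F0 / (real k - 2)\<close>; in the sign convention of the statement the multiplier is
   therefore \<open>- F0\<close>.\<close>
 show ?einstein
  by (rule exI[of _ "- F0"]) (use ricci_line ratio in simp)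
next
 assume ?einstein
 then obtain l where l: "\<And>\<mu> p u v. \<mu> \<in> {1..k} ==> u \<in> D \<mu> p ==> v \<in> D \<mu> p ==>
   ricci A g p u v = - (2 * l / (real k - 2)) * g p u v" by blast
 define a where "a = - (2 * l / (real k - 2))"
 have r: "line_ratio (ricci A g) g \<mu> p = a" if \<mu>: "\<mu> \<in> {1..k}" for \<mu> p
 proof -
  obtain E where E: "E \<in> D \<mu> p" "E \<noteq> 0" using ex_line_vector[of p] \<mu> by blast
  show ?thesis
   unfolding line_ratio_eq[OF \<mu> E bilinear_ricci[OF adapted] bilinear_metric[OF metricD[OF adapted]]] l[OF \<mu> E(1) E(1)] a_def[symmetric]
   using line_nonnull[OF adapted \<mu> E] by simp
 qed
 \<comment> \<open>All defects equal this constant, so the derivative of the action is a constant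
   times the integral that vanishes along volume preserving variations.\<close>
 define b where "b = real k * a / 2 - a"
 have F: "einstein_defect g \<mu> p = b" if "\<mu> \<in> {1..k}" for \<mu> p
  using r that by (simp add: einstein_defect_def b_def)
 show ?crit
 proof (intro allI impI, elim conjE)
  fix \<Omega> \<delta> G
  assume \<Omega>: "action_domain \<Omega>" and var: "adapted_variation A k D \<Omega> g \<delta> G" and vol: "volume_preserving A \<Omega> \<delta> G"
  note dom = action_domainD(4,5,2)[OF \<Omega> con]
  have "(\<Sum>\<mu>\<in>{1..k}. line_ratio (metric_velocity G 0) g \<mu> p * einstein_defect g \<mu> p) =
    (\<Sum>\<mu>\<in>{1..k}. line_ratio (metric_velocity G 0) g \<mu> p) * b" for p
   unfolding sum_distrib_right by (intro sum.cong refl) (simp add: F)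
  then have "(LINT p:\<Omega>|volume_measure A g. \<Sum>\<mu>\<in>{1..k}. line_ratio (metric_velocity G 0) g \<mu> p * einstein_defect g \<mu> p) = 0"
   using volume_preserving_derivative[OF var dom vol] by simp
  then show "((\<lambda>t. action A k D \<Omega> (G t) (\<lambda>p u v. 0)) has_real_derivative 0) (at 0)"
   using action_metric_derivative[OF var dom] by simp
 qed
qed

text \<open>At \<open>T = 0\<close> the quadratic term has no first order part, and the linear one
  is a divergence.\<close>

lemma critical_zero_contorsion:
 assumes O: "open \<Omega>" "compact (closure \<Omega>)" and H: "contorsion_variation A \<Omega> (\<lambda>p u v. 0) \<delta> H"
 shows "((\<lambda>t. action A k D \<Omega> g (H t)) has_real_derivative 0) (at 0)"
proof -
 have Ob: "\<Omega> \<in> sets borel" using O(1) by simp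
 define L where "L = closure {p. \<exists>u v. vector_derivative (\<lambda>s. H s p u v) (at 0) \<noteq> 0}"
 have L: "L \<subseteq> \<Omega>" using H unfolding contorsion_variation_def L_def by force
 have "compact L" using compact_Int_closed[OF O(2), of L] L closure_subset[of \<Omega>] by (simp add: L_def Int_absorb1)
 moreover have "contorsion_velocity H p u v = 0" if "p \<notin> L" for p u v
  using that closure_subset[of "{p. \<exists>u v. vector_derivative (\<lambda>s. H s p u v) (at 0) \<noteq> 0}"]
  unfolding L_def contorsion_velocity_def[OF H] by blast
 ultimately have D: "((\<lambda>t. action A k D \<Omega> g (H t)) has_real_derivative
   (LINT p:\<Omega>|volume_measure A g. mixed_quadratic g (\<lambda>p u v. 0) (contorsion_velocity H) p) / 2) (at 0)"
  by (rule action_contorsion_derivative[OF adapted H Ob closure_subset O(2) _ L])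
 have "mixed_quadratic g (\<lambda>p u v. 0) (contorsion_velocity H) p = 0" for p
 proof -
  obtain E where E: "orthogonal_frame (g p) {1..k} E" by (rule ex_line_frame[OF adapted])
  have V: "smooth_tensor12 A (contorsion_velocity H)" by (rule smooth_contorsion_velocity[OF H])
  then have "bilinear (contorsion_velocity H p)" by (simp add: smooth_tensor12_def)
  from bilinear_rzero[OF this] show ?thesis
   unfolding mixed_quadratic_frame[OF adapted smooth_tensor12_zero V E] by (simp add: frame_quadratic_def metric_simps[OF metricD[OF adapted]])
 qed
 then show ?thesis using D by simp
qed

end

end

theorem corollary6:
  fixes A :: "('m::{t2_space,second_countable_topology}, 'n::finite) chart set"
    and k :: nat
    and D :: "nat \<Rightarrow> ('m, 'n) distrib"
    and g :: "('m, 'n) bilin_field"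
    and T :: "('m, 'n) tensor12_field"
  assumes "connected_smooth_manifold A"
    and "k > 2"
    and "almost_product A k D"
    and "adapted_metric A k D g"
    and "\<forall>\<mu>\<in>{1..k}. \<forall>p. dim (D \<mu> p) = 1"
    and "\<forall>\<mu>\<in>{1..k}. \<forall>\<nu>\<in>{1..k}. \<mu> \<noteq> \<nu> \<longrightarrow> mixed_totally_geodesic A g (D \<mu>) (D \<nu>)"
    and "\<forall>\<mu>\<in>{1..k}. \<forall>\<nu>\<in>{1..k}. \<mu> \<noteq> \<nu> \<longrightarrow> mixed_integrable A g (D \<mu>) (D \<nu>)"
    and "smooth_tensor12 A T"
    and "statistical g T"
  shows "critical_pair A k D g T \<longleftrightarrow>
    (\<forall>p u v. T p u v = 0) \<and>
    (\<exists>l::real. \<forall>\<mu>\<in>{1..k}. \<forall>p. \<forall>u\<in>D \<mu> p. \<forall>v\<in>D \<mu> p.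
       ricci A g p u v = - (2 * l / (real k - 2)) * g p u v)"
proof -
 have con: "connected (UNIV :: 'm set)" and "smooth_atlas A"
  using assms(1) by (simp_all add: connected_smooth_manifold_def)
 interpret line_product A k D
  by unfold_locales (fact \<open>smooth_atlas A\<close>, fact assms(3), fact assms(5))
 note adapted = assms(4)
 \<comment> \<open>Each point lies in some admissible domain, where the variations of the contorsion
   alone force \<open>T\<close> to vanish.\<close>
 have T: "T = (\<lambda>p u v. 0)" if crit: "critical_pair A k D g T"
 proof (intro ext)
  fix p :: 'm and u v
  obtain \<Omega> where \<Omega>: "action_domain \<Omega>" "p \<in> \<Omega>" using ex_action_domain[of p] by blast
  have c: "((\<lambda>t. action A k D \<Omega> g (H t)) has_real_derivative 0) (at 0)" if "contorsion_variation A \<Omega> T \<delta> H" for \<delta> H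
   using crit \<Omega>(1) that unfolding critical_pair_def by blast
  have "k > 1" using assms(2) by simp
  from critical_contorsion_eq_0[OF adapted assms(8) c action_domainD(1,2)[OF \<Omega>(1) con] this assms(9) \<Omega>(2)]
  show "T p u v = 0" .
 qed
 \<comment> \<open>Once \<open>T\<close> vanishes, the action along metric variations is that of the
   Levi-Civita connections, and variations of the contorsion impose no further condition.\<close>
 have "critical_pair A k D g T \<longleftrightarrow> T = (\<lambda>p u v. 0) \<and>
   (\<forall>\<Omega>. action_domain \<Omega> \<longrightarrow> (\<forall>\<delta> G. adapted_variation A k D \<Omega> g \<delta> G \<and> volume_preserving A \<Omega> \<delta> G \<longrightarrow>
      ((\<lambda>t. action A k D \<Omega> (G t) (\<lambda>p u v. 0)) has_real_derivative 0) (at 0)))" (is "_ \<longleftrightarrow> _ \<and> ?metric")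
 proof
  assume crit: "critical_pair A k D g T"
  then have ?metric unfolding T[OF crit] critical_pair_def by blast
  then show "T = (\<lambda>p u v. 0) \<and> ?metric" using T[OF crit] by simp
 next
  assume *: "T = (\<lambda>p u v. 0) \<and> ?metric"
  then have T0: "T = (\<lambda>p u v. 0)" and metric: ?metric by simp_all
  show "critical_pair A k D g T"
   unfolding critical_pair_def T0
   using metric critical_zero_contorsion[OF adapted action_domainD(1,2)[OF _ con]] by simp
 qed
 then show ?thesis unfolding critical_metric_iff[OF adapted con assms(2)] by (simp add: fun_eq_iff)
qed

end
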